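(* Let $(M,\omega,F=(L,H))$ be a simple semitoric system, let $m$ be one of its focus-focus points, and let $(\Delta,b,\varepsilon)$ be a representative of its semitoric polygon with associated generalized toric momentum map $\mu_\Delta=(L,\mu_2^\Delta)$, normalized (by translation) so that $L(m)=0$ and $\mu_\Delta(m)=0$. Let $\kappa^\Delta\in\mathbb{Z}$ be the twisting index of $m$ relative to $(\Delta,b,\varepsilon)$. Then $\kappa^\Delta$ can equivalently be described in each of the following ways; that is, for an integer $k$ each of the following statements is equivalent to $k=\kappa^\Delta$: 1. (difference of momentum maps, the original definition) $\mu_\Delta=T^{k}\circ\nu$ on a neighborhood $W$ of the fiber $F^{-1}(F(m))$, where $\nu=(L,\Xi)$ is the privileged (preferred) momentum map at $m$; 2. (difference of actions) $k\,\mathrm{Re}(z)=I_\Delta(z)-\xi(z)$ for $z\in\Phi(\tilde W)$; 3. (difference of Taylor series) $k\cdot 2\pi l=(S^\Delta)^\infty-(S^{\mathrm{pref}})^\infty$ as power series in $l,j$; 4. (difference of cycles) $k\,\gamma_L^z=\gamma_\Delta^z-\gamma_{\mathrm{pref}}^z$ in $H_1(\Lambda_z)$ for $z\in\Phi(\tilde W)$.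
   Context: Conventions. On a symplectic manifold $(M,\omega)$ the Hamiltonian vector field of $f$ is defined by $\omega(\mathcal X_f,\cdot)=-df$. $\mathbb{S}^1=\mathbb{R}/2\pi\mathbb{Z}$. On $\mathbb{R}^4$ use $\omega_{\mathbb{R}^4}=dp_1\wedge dq_1+dp_2\wedge dq_2$ and $G=(q_1p_2-q_2p_1,\;q_1p_1+q_2p_2)$. Let $T=\begin{pmatrix}1&0\\1&1\end{pmatrix}$. Semitoric system: a $4$-dimensional (connected) completely integrable system $(M,\omega,F=(L,H))$ such that the Hamiltonian flow of $L$ is an effective $\mathbb{S}^1$-action, $L$ is proper, and all singular points of $F$ are non-degenerate without hyperbolic components. It is simple if each level set of $L$ contains at most one focus-focus point. A focus-focus point is a rank $0$ singular point $m$ near which there are a symplectomorphism $\varphi$ from a neighborhood $U$ of $m$ onto a neighborhood of $0$ in $(\mathbb{R}^4,\omega_{\mathbb{R}^4})$ and a local diffeomorphism $\varrho$ with $\varrho(F(m))=0$ and $\varrho\circ F=G\circ\varphi$. The preferred choice, always made, is $\varrho(l,h)=(l,\varrho_2(l,h))$ (using $L(m)=0$) with $\partial\varrho_2/\partial h>0$. Polygon. Let $m_1,\dots,m_n$ be the focus-focus points, $F(m_r)=(\lambda_r,\eta_r)$. For signs $\varepsilon=(\varepsilon_r)\in\{\pm1\}^n$ let $b^\varepsilon$ be the union over $r$ of the vertical closed half-lines starting at $F(m_r)$, going up if $\varepsilon_r=+1$ and down if $\varepsilon_r=-1$. The set of regular values of $F$ carries the integral affine structure given by action coordinates. A cartographic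 homeomorphism is a map $f_\varepsilon:F(M)\to\mathbb{R}^2$ that is a homeomorphism onto a rational convex polygon $\Delta$, of the form $f_\varepsilon(l,h)=(l,f_\varepsilon^{(2)}(l,h))$ with $f_\varepsilon^{(2)}$ increasing in $h$, and that restricts on $F(M)\setminus b^\varepsilon$ to a diffeomorphism onto its image carrying the integral affine structure to the standard one of $\mathbb{R}^2$. The map $\mu_\Delta=f_\varepsilon\circ F=(L,\mu_2^\Delta)$ is the generalized toric momentum map; $(\Delta,b,\varepsilon)$, with $b$ the collection of vertical lines through the $F(m_r)$, is a representative of the semitoric polygon. Semilocal objects at $m$. Let $W=F^{-1}(F(U))$ for a small neighborhood $U$ of $m$, $\Phi=\varrho\circ F=(L,\Phi_2):W\to\mathbb{R}^2\simeq\mathbb{C}$, with coordinate $z=l+ij$, $\Lambda_z=\Phi^{-1}(z)$ (a $2$-torus for $z\ne0$), and $\tilde W=W\setminus F^{-1}(b^\varepsilon)$. Let $\log$ be the determination of the complex logarithm with $\log 1=0$ and branch cut along the vertical ray from $0$ going up if the sign at $m$ is $+1$ and down if it is $-1$. For $z\neq0$ and $p\in\Lambda_z$, follow the flow of $\mathcal X_{\Phi_2}$ from $p$ until it first returns to the $L$-orbit of $p$, at time $\tau_2(z)>0$, then follow $\mathcal X_L$ for time $\tau_1(z)\in\mathbb{R}/2\pi\mathbb{Z}$ to return to $p$; these times do not depend on $p$. Let $\tau_1^{\mathrm{pref}}$ be the real-valued lift of $\tau_1$ that is continuous on $\Phi(\tilde W)$ and satisfies $\lim_{z\to0}\bigl(\tau_1^{\mathrm{pref}}(z)+\mathrm{Im}\log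 z\bigr)\in[-\tfrac{\pi}{2},\tfrac{3\pi}{2}[$. The preferred action $\xi$ is the continuous function on $\Phi(W)$, smooth on $\Phi(\tilde W)$, with $\partial_l\xi=\tfrac1{2\pi}\tau_1^{\mathrm{pref}}$, $\partial_j\xi=\tfrac1{2\pi}\tau_2$ on $\Phi(\tilde W)$ and $\lim_{z\to0}\xi(z)=0$. Set $\Xi=\xi\circ\Phi$ and $\nu=(L,\Xi)$. Twisting index: $\kappa^\Delta$ is the integer with $\mu_\Delta=T^{\kappa^\Delta}\circ\nu$ on $W$. Cycles: $\gamma_L^z,\gamma_\Delta^z\in H_1(\Lambda_z)$ are the classes of the $2\pi$-periodic orbits of the flows of $\mathcal X_L$ and $\mathcal X_{\mu_2^\Delta}$ on $\Lambda_z$, $z\in\Phi(\tilde W)$. $\gamma_{\mathrm{pref}}^z$ is the class of the loop following $\mathcal X_{\Phi_2}$ for time $\tau_2(z)$ and then $\mathcal X_L$ for time $\tau_1^{\mathrm{pref}}(z)$. Actions: $I_\Delta(z)=\frac1{2\pi}\int_{\gamma_\Delta^z}\varpi$ for a primitive $\varpi$ of $\omega|_W$ (normalized so that $I_\Delta(z)\to0$ as $z\to0$); it satisfies $I_\Delta\circ\Phi=\mu_2^\Delta$ on $\tilde W$. Taylor series: $S^\Delta(z)=2\pi I_\Delta(z)-2\pi I_\Delta(0)+\mathrm{Im}(z\log z-z)$, where $I_\Delta(0)=\lim_{z\to0}I_\Delta(z)$, extends to a smooth function near $0$; $(S^\Delta)^\infty$ is its Taylor series at $0$ in $(l,j)$.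 More generally, if $I(z)=\frac1{2\pi}\oint_{\gamma_2^z}\varpi$ for any smoothly varying cycle $\gamma_2^z$, $z\in\Phi(\tilde W)$, such that $\{\gamma_L^z,\gamma_2^z\}$ is a basis of $H_1(\Lambda_z)$ and $\partial I/\partial j>0$, then $S(z)=2\pi I(z)-2\pi I(0)+\mathrm{Im}(z\log z-z)$ extends smoothly and its Taylor series is well defined modulo $2\pi l\,\mathbb{Z}$; $(S^{\mathrm{pref}})^\infty$ denotes the representative whose coefficient of $l$ lies in $[-\tfrac{\pi}{2},\tfrac{3\pi}{2}[$. *)

theory Defs
  imports "HOL-Analysis.Analysis" "HOL-Homology.Homology"
begin

text \<open>The libraries contain no smooth manifolds. A manifold is a Hausdorff, second countable
  type together with a smooth atlas, and a tensor is a family of coordinate expressions, one for each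
  chart, compatible with the transition maps. A pointwise notion that does not depend on the chart
  is read off in one chosen chart \<open>chart_at\<close>. Partial maps are total functions
  constrained only on the domain named in the definitions.\<close>

primrec Ck_on :: "nat \<Rightarrow> ('a::real_normed_vector \<Rightarrow> 'b::real_normed_vector) \<Rightarrow> 'a set \<Rightarrow> bool" where
  "Ck_on 0 f N \<longleftrightarrow> continuous_on N f"
| "Ck_on (Suc n) f N \<longleftrightarrow> (\<forall>x\<in>N. f differentiable (at x)) \<and>
     (\<forall>v. Ck_on n (\<lambda>x. frechet_derivative f (at x) v) N)"

text \<open>On a set that is not open, such as the image of the momentum map, smooth means
  locally extendable to a smooth map.\<close>

definition smooth_on :: "('a::real_normed_vector \<Rightarrow> 'b::real_normed_vector) \<Rightarrow> 'a set \<Rightarrow> bool" where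
  "smooth_on f X \<longleftrightarrow> (\<forall>x\<in>X. \<exists>N g. open N \<and> x \<in> N \<and> (\<forall>n. Ck_on n g N) \<and> (\<forall>y\<in>N \<inter> X. f y = g y))"

definition diffeomorphism_on :: "('a::real_normed_vector \<Rightarrow> 'b::real_normed_vector) \<Rightarrow> 'a set \<Rightarrow> bool" where
  "diffeomorphism_on f X \<longleftrightarrow> inj_on f X \<and> smooth_on f X \<and> smooth_on (inv_into X f) (f ` X)"

type_synonym 'm chart = "'m set \<times> ('m \<Rightarrow> real^4)"

record 'm int_sys =
  atlas :: "'m chart set"
  sform :: "'m chart \<Rightarrow> 'm \<Rightarrow> real^4 \<Rightarrow> real^4 \<Rightarrow> real"
  Lmap :: "'m \<Rightarrow> real"
  Hmap :: "'m \<Rightarrow> real"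

definition Fmap :: "'m int_sys \<Rightarrow> 'm \<Rightarrow> real \<times> real" where
  "Fmap S p = (Lmap S p, Hmap S p)"

definition in_chart :: "'m chart \<Rightarrow> ('m \<Rightarrow> 'b) \<Rightarrow> real^4 \<Rightarrow> 'b" where
  "in_chart c f = f \<circ> inv_into (fst c) (snd c)"

definition chart_deriv :: "'m chart \<Rightarrow> ('m \<Rightarrow> 'b::real_normed_vector) \<Rightarrow> 'm \<Rightarrow> real^4 \<Rightarrow> 'b" where
  "chart_deriv c f p v = frechet_derivative (in_chart c f) (at (snd c p)) v"

definition chart_at :: "'m int_sys \<Rightarrow> 'm \<Rightarrow> 'm chart" where
  "chart_at S p = (SOME c. c \<in> atlas S \<and> p \<in> fst c)"

definition smooth_atlas :: "('m::topological_space) chart set \<Rightarrow> bool" where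
  "smooth_atlas A \<longleftrightarrow> (\<Union>c\<in>A. fst c) = UNIV \<and>
     (\<forall>c\<in>A. open (fst c) \<and> open (snd c ` fst c) \<and>
        homeomorphism (fst c) (snd c ` fst c) (snd c) (inv_into (fst c) (snd c))) \<and>
     (\<forall>c\<in>A. \<forall>d\<in>A. smooth_on (in_chart c (snd d)) (snd c ` (fst c \<inter> fst d)))"

definition smooth_fun :: "'m int_sys \<Rightarrow> ('m \<Rightarrow> 'b::real_normed_vector) \<Rightarrow> 'm set \<Rightarrow> bool" where
  "smooth_fun S f X \<longleftrightarrow> (\<forall>c\<in>atlas S. smooth_on (in_chart c f) (snd c ` (fst c \<inter> X)))"

definition symplectic_manifold :: "('m::topological_space) int_sys \<Rightarrow> bool" where
  "symplectic_manifold S \<longleftrightarrow> smooth_atlas (atlas S) \<and>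
     (\<forall>c\<in>atlas S. \<forall>v w. smooth_fun S (\<lambda>p. sform S c p v w) (fst c)) \<and>
     (\<forall>c\<in>atlas S. \<forall>p\<in>fst c. bilinear (sform S c p) \<and> (\<forall>v. sform S c p v v = 0) \<and>
        (\<forall>v. v \<noteq> 0 \<longrightarrow> (\<exists>w. sform S c p v w \<noteq> 0)) \<and>
        (\<forall>u v w. chart_deriv c (\<lambda>q. sform S c q v w) p u + chart_deriv c (\<lambda>q. sform S c q w u) p v
           + chart_deriv c (\<lambda>q. sform S c q u v) p w = 0)) \<and>
     (\<forall>c\<in>atlas S. \<forall>d\<in>atlas S. \<forall>p\<in>fst c \<inter> fst d. \<forall>v w.
        sform S d p (chart_deriv c (snd d) p v) (chart_deriv c (snd d) p w) = sform S c p v w)"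

type_synonym 'm one_form = "'m chart \<Rightarrow> 'm \<Rightarrow> real^4 \<Rightarrow> real"

text \<open>\<open>\<theta>\<close> is a smooth 1-form on the open set \<open>X\<close> with exterior derivative the symplectic form.\<close>

definition primitive_on :: "'m int_sys \<Rightarrow> 'm set \<Rightarrow> 'm one_form \<Rightarrow> bool" where
  "primitive_on S X \<theta> \<longleftrightarrow>
     (\<forall>c\<in>atlas S. \<forall>v. smooth_fun S (\<lambda>p. \<theta> c p v) (fst c \<inter> X)) \<and>
     (\<forall>c\<in>atlas S. \<forall>p\<in>fst c \<inter> X. linear (\<theta> c p) \<and>
        (\<forall>v w. chart_deriv c (\<lambda>q. \<theta> c q w) p v - chart_deriv c (\<lambda>q. \<theta> c q v) p w = sform S c p v w)) \<and>
     (\<forall>c\<in>atlas S. \<forall>d\<in>atlas S. \<forall>p\<in>fst c \<inter> fst d \<inter> X. \<forall>v.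
        \<theta> d p (chart_deriv c (snd d) p v) = \<theta> c p v)"

definition line_integral :: "'m int_sys \<Rightarrow> 'm one_form \<Rightarrow> (real \<Rightarrow> 'm) \<Rightarrow> real \<Rightarrow> real \<Rightarrow> real" where
  "line_integral S \<theta> \<gamma> a b = integral {a..b} (\<lambda>t.
     \<theta> (chart_at S (\<gamma> t)) (\<gamma> t) (vector_derivative (snd (chart_at S (\<gamma> t)) \<circ> \<gamma>) (at t)))"

definition ham_vec :: "'m int_sys \<Rightarrow> ('m \<Rightarrow> real) \<Rightarrow> 'm chart \<Rightarrow> 'm \<Rightarrow> real^4" where
  "ham_vec S f c p = (THE X. \<forall>v. sform S c p X v = - chart_deriv c f p v)"

text \<open>\<open>X\<close> is an open set on which \<open>f\<close> is smooth.\<close>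

definition ham_curve :: "('m::topological_space) int_sys \<Rightarrow> 'm set \<Rightarrow> ('m \<Rightarrow> real) \<Rightarrow> real set \<Rightarrow> (real \<Rightarrow> 'm) \<Rightarrow> bool" where
  "ham_curve S X f J \<gamma> \<longleftrightarrow> \<gamma> ` J \<subseteq> X \<and> continuous_on J \<gamma> \<and>
     (\<forall>t\<in>J. \<forall>c\<in>atlas S. \<gamma> t \<in> fst c \<longrightarrow>
        ((snd c \<circ> \<gamma>) has_vector_derivative ham_vec S f c (\<gamma> t)) (at t within J))"

definition ham_flow :: "('m::topological_space) int_sys \<Rightarrow> 'm set \<Rightarrow> ('m \<Rightarrow> real) \<Rightarrow> real \<Rightarrow> 'm \<Rightarrow> 'm" where
  "ham_flow S X f t p =
     (THE q. \<exists>\<gamma>. ham_curve S X f (closed_segment 0 t) \<gamma> \<and> \<gamma> 0 = p \<and> \<gamma> t = q)"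

definition periodic_flow :: "('m::topological_space) int_sys \<Rightarrow> 'm set \<Rightarrow> ('m \<Rightarrow> real) \<Rightarrow> bool" where
  "periodic_flow S X f \<longleftrightarrow>
     (\<forall>p\<in>X. \<exists>\<gamma>. ham_curve S X f UNIV \<gamma> \<and> \<gamma> 0 = p \<and> (\<forall>t. \<gamma> (t + 2 * pi) = \<gamma> t))"

definition mrank :: "'m int_sys \<Rightarrow> 'm \<Rightarrow> nat" where
  "mrank S p = dim (range (chart_deriv (chart_at S p) (Fmap S) p))"

definition hess :: "'m int_sys \<Rightarrow> ('m \<Rightarrow> real) \<Rightarrow> 'm \<Rightarrow> real^4 \<Rightarrow> real^4 \<Rightarrow> real" where
  "hess S f p v w = chart_deriv (chart_at S p) (\<lambda>q. chart_deriv (chart_at S p) f q v) p w"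

text \<open>Linearization of the Hamiltonian vector field of \<open>f\<close> at a critical point \<open>p\<close> of \<open>f\<close>; via
  \<open>\<omega>\<^sub>p\<close> it corresponds to the quadratic form given by the Hessian, and the Poisson bracket of
  quadratic forms to the commutator of matrices in \<open>sp_algebra\<close>.\<close>

definition lin_ham :: "'m int_sys \<Rightarrow> ('m \<Rightarrow> real) \<Rightarrow> 'm \<Rightarrow> real^4^4" where
  "lin_ham S f p = (THE B. \<forall>v w. sform S (chart_at S p) p (B *v v) w = - hess S f p v w)"

definition sp_algebra :: "'m int_sys \<Rightarrow> 'm \<Rightarrow> (real^4^4) set" where
  "sp_algebra S p = {B. \<forall>v w. sform S (chart_at S p) p (B *v v) w
     + sform S (chart_at S p) p v (B *v w) = 0}"

primrec lower_central :: "(real^4^4) set \<Rightarrow> nat \<Rightarrow> (real^4^4) set" where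
  "lower_central h 0 = h"
| "lower_central h (Suc n) = span {B ** C - C ** B | B C. B \<in> h \<and> C \<in> lower_central h n}"

definition cartan_subalgebra :: "(real^4^4) set \<Rightarrow> (real^4^4) set \<Rightarrow> bool" where
  "cartan_subalgebra g h \<longleftrightarrow> subspace h \<and> h \<subseteq> g \<and>
     (\<forall>B\<in>h. \<forall>C\<in>h. B ** C - C ** B \<in> h) \<and>
     (\<exists>n. lower_central h n \<subseteq> {0}) \<and>
     (\<forall>B\<in>g. (\<forall>C\<in>h. B ** C - C ** B \<in> h) \<longrightarrow> B \<in> h)"

definition complex_eigenvalues :: "real^4^4 \<Rightarrow> complex set" where
  "complex_eigenvalues B = {x. det ((\<chi> i j. complex_of_real (B $ i $ j)) - mat x) = 0}"

text \<open>A hyperbolic component is a pair of real eigenvalues of a generic element of the Cartan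
  subalgebra; generic means four distinct eigenvalues. (Nongeneric elements at a focus-focus point
  can have real eigenvalues.)\<close>

definition nondegenerate_rank0 :: "'m int_sys \<Rightarrow> 'm \<Rightarrow> bool" where
  "nondegenerate_rank0 S p \<longleftrightarrow>
     cartan_subalgebra (sp_algebra S p) (span {lin_ham S (Lmap S) p, lin_ham S (Hmap S) p})"

definition no_hyperbolic_rank0 :: "'m int_sys \<Rightarrow> 'm \<Rightarrow> bool" where
  "no_hyperbolic_rank0 S p \<longleftrightarrow>
     (\<forall>B\<in>span {lin_ham S (Lmap S) p, lin_ham S (Hmap S) p}.
        card (complex_eigenvalues B) = 4 \<longrightarrow> complex_eigenvalues B \<inter> \<real> = {})"

text \<open>At a rank 1 point let \<open>V\<close> be the line spanned by the Hamiltonian vectors, \<open>V\<^sup>\<omega>\<close> its symplectic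
  orthogonal, and \<open>K = a L + b H\<close> a nontrivial combination that is critical at the point. The Hessian
  of \<open>K\<close> descends to the plane \<open>V\<^sup>\<omega>/V\<close>; its linearization there has as eigenvalues the two
  remaining eigenvalues of \<open>lin_ham K\<close>, the other two being zero.\<close>

definition ham_span :: "'m int_sys \<Rightarrow> 'm \<Rightarrow> (real^4) set" where
  "ham_span S p = span {ham_vec S (Lmap S) (chart_at S p) p, ham_vec S (Hmap S) (chart_at S p) p}"

definition ham_span_orth :: "'m int_sys \<Rightarrow> 'm \<Rightarrow> (real^4) set" where
  "ham_span_orth S p = {v. \<forall>w\<in>ham_span S p. sform S (chart_at S p) p w v = 0}"

definition critical_combination :: "'m int_sys \<Rightarrow> 'm \<Rightarrow> ('m \<Rightarrow> real) \<Rightarrow> bool" where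
  "critical_combination S p K \<longleftrightarrow>
     (\<exists>a b. (a, b) \<noteq> (0, 0) \<and> K = (\<lambda>q. a * Lmap S q + b * Hmap S q)) \<and>
     (\<forall>v. chart_deriv (chart_at S p) K p v = 0)"

definition nondegenerate_rank1 :: "'m int_sys \<Rightarrow> 'm \<Rightarrow> bool" where
  "nondegenerate_rank1 S p \<longleftrightarrow> (\<forall>K. critical_combination S p K \<longrightarrow>
     (\<forall>v\<in>ham_span_orth S p. (\<forall>w\<in>ham_span_orth S p. hess S K p v w = 0) \<longrightarrow> v \<in> ham_span S p))"

definition no_hyperbolic_rank1 :: "'m int_sys \<Rightarrow> 'm \<Rightarrow> bool" where
  "no_hyperbolic_rank1 S p \<longleftrightarrow> (\<forall>K. critical_combination S p K \<longrightarrow>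
     complex_eigenvalues (lin_ham S K p) \<inter> \<real> \<subseteq> {0})"

definition completely_integrable :: "('m::topological_space) int_sys \<Rightarrow> bool" where
  "completely_integrable S \<longleftrightarrow> smooth_fun S (Lmap S) UNIV \<and> smooth_fun S (Hmap S) UNIV \<and>
     (\<forall>c\<in>atlas S. \<forall>p\<in>fst c. sform S c p (ham_vec S (Lmap S) c p) (ham_vec S (Hmap S) c p) = 0) \<and>
     (\<forall>c\<in>atlas S. negligible (snd c ` {p\<in>fst c. mrank S p < 2}))"

definition semitoric :: "('m::{t2_space,second_countable_topology}) int_sys \<Rightarrow> bool" where
  "semitoric S \<longleftrightarrow> connected (UNIV :: 'm set) \<and> symplectic_manifold S \<and> completely_integrable S \<and>
     periodic_flow S UNIV (Lmap S) \<and>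
     (\<forall>t. (\<forall>p. ham_flow S UNIV (Lmap S) t p = p) \<longrightarrow> (\<exists>n::int. t = 2 * pi * of_int n)) \<and>
     (\<forall>K. compact K \<longrightarrow> compact (Lmap S -` K)) \<and>
     (\<forall>p. mrank S p = 0 \<longrightarrow> nondegenerate_rank0 S p \<and> no_hyperbolic_rank0 S p) \<and>
     (\<forall>p. mrank S p = 1 \<longrightarrow> nondegenerate_rank1 S p \<and> no_hyperbolic_rank1 S p)"

text \<open>Coordinates on \<open>real^4\<close> are \<open>(q\<^sub>1, q\<^sub>2, p\<^sub>1, p\<^sub>2)\<close>.\<close>

definition omega_R4 :: "real^4 \<Rightarrow> real^4 \<Rightarrow> real" where
  "omega_R4 v w = (v$3 * w$1 - v$1 * w$3) + (v$4 * w$2 - v$2 * w$4)"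

definition G_ff :: "real^4 \<Rightarrow> real \<times> real" where
  "G_ff x = (x$1 * x$4 - x$2 * x$3, x$1 * x$3 + x$2 * x$4)"

record 'm normal_form =
  nbhd :: "'m set"
  symp :: "'m \<Rightarrow> real^4"
  rho_dom :: "(real \<times> real) set"
  rho :: "real \<times> real \<Rightarrow> real \<times> real"

definition normal_form_at :: "('m::topological_space) int_sys \<Rightarrow> 'm \<Rightarrow> 'm normal_form \<Rightarrow> bool" where
  "normal_form_at S m E \<longleftrightarrow>
     open (nbhd E) \<and> m \<in> nbhd E \<and> symp E m = 0 \<and>
     inj_on (symp E) (nbhd E) \<and> open (symp E ` nbhd E) \<and> smooth_fun S (symp E) (nbhd E) \<and>
     (\<forall>c\<in>atlas S. smooth_on (in_chart (nbhd E, symp E) (snd c)) (symp E ` (nbhd E \<inter> fst c))) \<and>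
     (\<forall>c\<in>atlas S. \<forall>p\<in>fst c \<inter> nbhd E. \<forall>v w.
        omega_R4 (chart_deriv c (symp E) p v) (chart_deriv c (symp E) p w) = sform S c p v w) \<and>
     open (rho_dom E) \<and> Fmap S ` nbhd E \<subseteq> rho_dom E \<and> diffeomorphism_on (rho E) (rho_dom E) \<and>
     rho E (Fmap S m) = (0, 0) \<and>
     (\<forall>p\<in>nbhd E. rho E (Fmap S p) = G_ff (symp E p))"

definition focus_focus :: "('m::topological_space) int_sys \<Rightarrow> 'm \<Rightarrow> bool" where
  "focus_focus S m \<longleftrightarrow> mrank S m = 0 \<and> (\<exists>E. normal_form_at S m E)"

definition simple_semitoric :: "('m::{t2_space,second_countable_topology}) int_sys \<Rightarrow> bool" where
  "simple_semitoric S \<longleftrightarrow> semitoric S \<and>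
     (\<forall>p q. focus_focus S p \<and> focus_focus S q \<and> Lmap S p = Lmap S q \<longrightarrow> p = q)"

definition preferred_normal_form :: "('m::topological_space) int_sys \<Rightarrow> 'm \<Rightarrow> 'm normal_form \<Rightarrow> bool" where
  "preferred_normal_form S m E \<longleftrightarrow> normal_form_at S m E \<and>
     (\<forall>x\<in>rho_dom E. fst (rho E x) = fst x \<and> snd (frechet_derivative (rho E) (at x) (0, 1)) > 0)"

definition cuts :: "('m::topological_space) int_sys \<Rightarrow> ('m \<Rightarrow> real) \<Rightarrow> (real \<times> real) set" where
  "cuts S \<epsilon> = (\<Union>r\<in>{r. focus_focus S r}. {(l, h). l = Lmap S r \<and> \<epsilon> r * h \<ge> \<epsilon> r * Hmap S r})"

definition regular_values :: "'m int_sys \<Rightarrow> (real \<times> real) set" where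
  "regular_values S = {x \<in> range (Fmap S). \<forall>p. Fmap S p = x \<longrightarrow> mrank S p = 2}"

text \<open>Charts of the integral affine structure: \<open>a \<circ> F\<close> is the momentum map of a free action of
  \<open>(\<real>/2\<pi>\<int>)\<^sup>2\<close> over \<open>N\<close>.\<close>

definition action_coordinates ::
    "('m::topological_space) int_sys \<Rightarrow> (real \<times> real) set \<Rightarrow> (real \<times> real \<Rightarrow> real \<times> real) \<Rightarrow> bool" where
  "action_coordinates S N a \<longleftrightarrow> open N \<and> N \<subseteq> regular_values S \<and> diffeomorphism_on a N \<and>
     (let X = Fmap S -` N; a1 = (\<lambda>p. fst (a (Fmap S p))); a2 = (\<lambda>p. snd (a (Fmap S p))) in
        periodic_flow S X a1 \<and> periodic_flow S X a2 \<and>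
        (\<forall>p\<in>X. \<forall>s t. ham_flow S X a1 s (ham_flow S X a2 t p) = p \<longrightarrow>
           (\<exists>i j::int. s = 2 * pi * of_int i \<and> t = 2 * pi * of_int j)))"

definition integral_affine_at ::
    "('m::topological_space) int_sys \<Rightarrow> (real \<times> real) set \<Rightarrow> (real \<times> real \<Rightarrow> real \<times> real) \<Rightarrow> real \<times> real \<Rightarrow> bool" where
  "integral_affine_at S B f x \<longleftrightarrow> (\<exists>N a. x \<in> N \<and> N \<inter> B = {} \<and> action_coordinates S N a \<and>
     (\<exists>(a11::int) (a12::int) (a21::int) (a22::int) c1 c2. \<bar>a11 * a22 - a12 * a21\<bar> = 1 \<and>
        (\<forall>y\<in>N. f y = (of_int a11 * fst (a y) + of_int a12 * snd (a y) + c1,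
                       of_int a21 * fst (a y) + of_int a22 * snd (a y) + c2))))"

text \<open>Possibly unbounded, possibly with infinitely (but locally finitely) many edges.\<close>

definition rational_convex_polygon :: "(real \<times> real) set \<Rightarrow> bool" where
  "rational_convex_polygon D \<longleftrightarrow> closed D \<and> convex D \<and> interior D \<noteq> {} \<and>
     (\<forall>R. \<exists>P :: (int \<times> int \<times> real) set. finite P \<and> (\<forall>(a, b, c)\<in>P. (a, b) \<noteq> (0, 0)) \<and>
        D \<inter> cball 0 R = {x \<in> cball 0 R. \<forall>(a, b, c)\<in>P. of_int a * fst x + of_int b * snd x \<le> c})"

definition cartographic :: "('m::topological_space) int_sys \<Rightarrow> ('m \<Rightarrow> real) \<Rightarrow> (real \<times> real) set \<Rightarrow>
    (real \<times> real \<Rightarrow> real \<times> real) \<Rightarrow> bool" where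
  "cartographic S \<epsilon> \<Delta> f \<longleftrightarrow>
     rational_convex_polygon \<Delta> \<and> (\<exists>g. homeomorphism (range (Fmap S)) \<Delta> f g) \<and>
     (\<forall>x\<in>range (Fmap S). fst (f x) = fst x) \<and>
     (\<forall>l h h'. (l, h) \<in> range (Fmap S) \<and> (l, h') \<in> range (Fmap S) \<and> h < h' \<longrightarrow> snd (f (l, h)) < snd (f (l, h'))) \<and>
     diffeomorphism_on f (range (Fmap S) - cuts S \<epsilon>) \<and>
     (\<forall>x\<in>regular_values S - cuts S \<epsilon>. integral_affine_at S (cuts S \<epsilon>) f x)"

text \<open>The lines \<open>b\<close> are determined by the focus-focus values and are not recorded.\<close>

definition polygon_representative :: "('m::topological_space) int_sys \<Rightarrow> (real \<times> real) set \<Rightarrow>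
    ('m \<Rightarrow> real) \<Rightarrow> (real \<times> real \<Rightarrow> real \<times> real) \<Rightarrow> bool" where
  "polygon_representative S \<Delta> \<epsilon> f \<longleftrightarrow> finite {r. focus_focus S r} \<and>
     (\<forall>r. focus_focus S r \<longrightarrow> \<epsilon> r \<in> {1, -1}) \<and> cartographic S \<epsilon> \<Delta> f"

definition mu_poly :: "'m int_sys \<Rightarrow> (real \<times> real \<Rightarrow> real \<times> real) \<Rightarrow> 'm \<Rightarrow> real \<times> real" where
  "mu_poly S f p = f (Fmap S p)"

definition mu2_poly :: "'m int_sys \<Rightarrow> (real \<times> real \<Rightarrow> real \<times> real) \<Rightarrow> 'm \<Rightarrow> real" where
  "mu2_poly S f p = snd (mu_poly S f p)"

definition Wset :: "'m int_sys \<Rightarrow> 'm normal_form \<Rightarrow> 'm set" where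
  "Wset S E = Fmap S -` (Fmap S ` nbhd E)"

definition Phi2 :: "'m int_sys \<Rightarrow> 'm normal_form \<Rightarrow> 'm \<Rightarrow> real" where
  "Phi2 S E p = snd (rho E (Fmap S p))"

definition Phi :: "'m int_sys \<Rightarrow> 'm normal_form \<Rightarrow> 'm \<Rightarrow> complex" where
  "Phi S E p = Complex (Lmap S p) (Phi2 S E p)"

definition fiber :: "'m int_sys \<Rightarrow> 'm normal_form \<Rightarrow> complex \<Rightarrow> 'm set" where
  "fiber S E z = {p \<in> Wset S E. Phi S E p = z}"

definition Wcut :: "('m::topological_space) int_sys \<Rightarrow> 'm normal_form \<Rightarrow> ('m \<Rightarrow> real) \<Rightarrow> 'm set" where
  "Wcut S E \<epsilon> = Wset S E - Fmap S -` cuts S \<epsilon>"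

definition Dcut :: "('m::topological_space) int_sys \<Rightarrow> 'm normal_form \<Rightarrow> ('m \<Rightarrow> real) \<Rightarrow> complex set" where
  "Dcut S E \<epsilon> = Phi S E ` Wcut S E \<epsilon>"

text \<open>What ``small'' means for \<open>U\<close>: \<open>\<Phi>(W)\<close> is convex, \<open>m\<close> is the only singular
  point in \<open>W\<close>, the fibers over \<open>z \<noteq> 0\<close> are 2-tori, and \<open>F(W)\<close> avoids the vertical lines through
  the other focus-focus values.\<close>

definition small_normal_form :: "('m::topological_space) int_sys \<Rightarrow> 'm \<Rightarrow> 'm normal_form \<Rightarrow> bool" where
  "small_normal_form S m E \<longleftrightarrow> convex (Phi S E ` Wset S E) \<and>
     (\<forall>p\<in>Wset S E. p \<noteq> m \<longrightarrow> mrank S p = 2) \<and>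
     (\<forall>z\<in>Phi S E ` Wset S E. z \<noteq> 0 \<longrightarrow>
        fiber S E z homeomorphic (sphere (0::complex) 1 \<times> sphere (0::complex) 1)) \<and>
     (\<forall>r. focus_focus S r \<and> r \<noteq> m \<longrightarrow> Lmap S r \<notin> Lmap S ` nbhd E)"

text \<open>For \<open>s = 1\<close> (resp. \<open>s = -1\<close>) the cut of the principal logarithm \<open>Ln\<close>, the negative real axis,
  is rotated to the ray from 0 going up (resp. down); the value at 1 is 0.\<close>

definition log_cut :: "real \<Rightarrow> complex \<Rightarrow> complex" where
  "log_cut s z = Ln (of_real s * \<i> * z) - of_real (s * pi / 2) * \<i>"

text \<open>\<open>t1\<close> is a real representative of the class modulo \<open>2\<pi>\<close>.\<close>

definition first_return :: "('m::topological_space) int_sys \<Rightarrow> 'm normal_form \<Rightarrow> complex \<Rightarrow> real \<Rightarrow> real \<Rightarrow> bool" where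
  "first_return S E z t2 t1 \<longleftrightarrow> t2 > 0 \<and>
     (\<forall>p\<in>fiber S E z. \<exists>\<gamma>. ham_curve S (Wset S E) (Phi2 S E) {0..t2} \<gamma> \<and> \<gamma> 0 = p \<and>
        (\<forall>t. 0 < t \<and> t < t2 \<longrightarrow> \<gamma> t \<notin> range (\<lambda>s. ham_flow S UNIV (Lmap S) s p)) \<and>
        ham_flow S UNIV (Lmap S) t1 (\<gamma> t2) = p)"

definition return_time :: "('m::topological_space) int_sys \<Rightarrow> 'm normal_form \<Rightarrow> (complex \<Rightarrow> real) \<Rightarrow> bool" where
  "return_time S E \<tau>2 \<longleftrightarrow> (\<forall>z\<in>Phi S E ` Wset S E. z \<noteq> 0 \<longrightarrow> (\<exists>t1. first_return S E z (\<tau>2 z) t1))"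

definition preferred_tau1 :: "('m::topological_space) int_sys \<Rightarrow> 'm \<Rightarrow> 'm normal_form \<Rightarrow> ('m \<Rightarrow> real) \<Rightarrow>
    (complex \<Rightarrow> real) \<Rightarrow> (complex \<Rightarrow> real) \<Rightarrow> bool" where
  "preferred_tau1 S m E \<epsilon> \<tau>2 \<tau>1 \<longleftrightarrow>
     (\<forall>z\<in>Dcut S E \<epsilon>. first_return S E z (\<tau>2 z) (\<tau>1 z)) \<and> continuous_on (Dcut S E \<epsilon>) \<tau>1 \<and>
     (\<exists>s\<in>{- pi / 2..<3 * pi / 2}.
        ((\<lambda>z. \<tau>1 z + Im (log_cut (\<epsilon> m) z)) \<longlongrightarrow> s) (at 0 within Dcut S E \<epsilon>))"

definition preferred_action :: "('m::topological_space) int_sys \<Rightarrow> 'm normal_form \<Rightarrow> ('m \<Rightarrow> real) \<Rightarrow>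
    (complex \<Rightarrow> real) \<Rightarrow> (complex \<Rightarrow> real) \<Rightarrow> (complex \<Rightarrow> real) \<Rightarrow> bool" where
  "preferred_action S E \<epsilon> \<tau>2 \<tau>1 \<xi> \<longleftrightarrow>
     continuous_on (Phi S E ` Wset S E) \<xi> \<and> smooth_on \<xi> (Dcut S E \<epsilon>) \<and>
     (\<forall>z\<in>Dcut S E \<epsilon>.
        (\<xi> has_derivative (\<lambda>w. \<tau>1 z / (2 * pi) * Re w + \<tau>2 z / (2 * pi) * Im w)) (at z)) \<and>
     (\<xi> \<longlongrightarrow> 0) (at 0 within Phi S E ` Wset S E)"

definition nu :: "'m int_sys \<Rightarrow> 'm normal_form \<Rightarrow> (complex \<Rightarrow> real) \<Rightarrow> 'm \<Rightarrow> real \<times> real" where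
  "nu S E \<xi> p = (Lmap S p, \<xi> (Phi S E p))"

text \<open>The linear map with matrix \<open>(1 0; 1 1)\<close> and its integer powers.\<close>

definition Tmap :: "real \<times> real \<Rightarrow> real \<times> real" where
  "Tmap x = (fst x, fst x + snd x)"

definition Tpow :: "int \<Rightarrow> real \<times> real \<Rightarrow> real \<times> real" where
  "Tpow k = (if 0 \<le> k then Tmap ^^ nat k else inv_into UNIV Tmap ^^ nat (- k))"

definition twisting_index :: "'m int_sys \<Rightarrow> 'm normal_form \<Rightarrow> (real \<times> real \<Rightarrow> real \<times> real) \<Rightarrow>
    (complex \<Rightarrow> real) \<Rightarrow> int \<Rightarrow> bool" where
  "twisting_index S E f \<xi> k \<longleftrightarrow> (\<forall>p\<in>Wset S E. mu_poly S f p = Tpow k (nu S E \<xi> p))"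

definition loop_class :: "('m::topological_space) set \<Rightarrow> (real \<Rightarrow> 'm) \<Rightarrow> 'm chain set" where
  "loop_class X g =
     homologous_rel_set 1 (top_of_set X) {} (frag_of (restrict (\<lambda>x. g (x 1)) (standard_simplex 1)))"

text \<open>Loops on \<open>[0,1]\<close> starting at \<open>p\<close>; their classes in the homology of the fiber through \<open>p\<close> do not
  depend on \<open>p\<close>.\<close>

definition L_loop :: "('m::topological_space) int_sys \<Rightarrow> 'm \<Rightarrow> real \<Rightarrow> 'm" where
  "L_loop S p t = ham_flow S UNIV (Lmap S) (2 * pi * t) p"

definition poly_loop :: "('m::topological_space) int_sys \<Rightarrow> 'm normal_form \<Rightarrow> ('m \<Rightarrow> real) \<Rightarrow>
    (real \<times> real \<Rightarrow> real \<times> real) \<Rightarrow> 'm \<Rightarrow> real \<Rightarrow> 'm" where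
  "poly_loop S E \<epsilon> f p t = ham_flow S (Wcut S E \<epsilon>) (mu2_poly S f) (2 * pi * t) p"

definition pref_loop :: "('m::topological_space) int_sys \<Rightarrow> 'm normal_form \<Rightarrow> real \<Rightarrow> real \<Rightarrow> 'm \<Rightarrow> real \<Rightarrow> 'm" where
  "pref_loop S E t2 t1 p =
     (\<lambda>t. ham_flow S (Wset S E) (Phi2 S E) (t * t2) p) +++
     (\<lambda>t. ham_flow S UNIV (Lmap S) (t * t1) (ham_flow S (Wset S E) (Phi2 S E) t2 p))"

definition gamma_L :: "('m::topological_space) int_sys \<Rightarrow> 'm normal_form \<Rightarrow> complex \<Rightarrow> 'm \<Rightarrow> 'm chain set" where
  "gamma_L S E z p = loop_class (fiber S E z) (L_loop S p)"

definition gamma_poly :: "('m::topological_space) int_sys \<Rightarrow> 'm normal_form \<Rightarrow> ('m \<Rightarrow> real) \<Rightarrow>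
    (real \<times> real \<Rightarrow> real \<times> real) \<Rightarrow> complex \<Rightarrow> 'm \<Rightarrow> 'm chain set" where
  "gamma_poly S E \<epsilon> f z p = loop_class (fiber S E z) (poly_loop S E \<epsilon> f p)"

definition gamma_pref :: "('m::topological_space) int_sys \<Rightarrow> 'm normal_form \<Rightarrow> (complex \<Rightarrow> real) \<Rightarrow>
    (complex \<Rightarrow> real) \<Rightarrow> complex \<Rightarrow> 'm \<Rightarrow> 'm chain set" where
  "gamma_pref S E \<tau>2 \<tau>1 z p = loop_class (fiber S E z) (pref_loop S E (\<tau>2 z) (\<tau>1 z) p)"

definition H1 :: "('m::topological_space) int_sys \<Rightarrow> 'm normal_form \<Rightarrow> complex \<Rightarrow> 'm chain set monoid" where
  "H1 S E z = homology_group 1 (top_of_set (fiber S E z))"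

definition action_of_loops :: "'m int_sys \<Rightarrow> 'm one_form \<Rightarrow> (complex \<Rightarrow> real \<Rightarrow> 'm) \<Rightarrow> complex \<Rightarrow> real" where
  "action_of_loops S \<theta> c z = 1 / (2 * pi) * line_integral S \<theta> (c z) 0 1"

text \<open>The value does not depend on the starting point of the orbit on the fiber.\<close>

definition I_poly :: "('m::topological_space) int_sys \<Rightarrow> 'm normal_form \<Rightarrow> ('m \<Rightarrow> real) \<Rightarrow>
    (real \<times> real \<Rightarrow> real \<times> real) \<Rightarrow> 'm one_form \<Rightarrow> complex \<Rightarrow> real" where
  "I_poly S E \<epsilon> f \<theta> = action_of_loops S \<theta> (\<lambda>z. poly_loop S E \<epsilon> f (SOME p. p \<in> fiber S E z))"

definition normalized_primitive :: "('m::topological_space) int_sys \<Rightarrow> 'm normal_form \<Rightarrow> ('m \<Rightarrow> real) \<Rightarrow>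
    (real \<times> real \<Rightarrow> real \<times> real) \<Rightarrow> 'm one_form \<Rightarrow> bool" where
  "normalized_primitive S E \<epsilon> f \<theta> \<longleftrightarrow> primitive_on S (Wset S E) \<theta> \<and>
     (I_poly S E \<epsilon> f \<theta> \<longlongrightarrow> 0) (at 0 within Dcut S E \<epsilon>)"

definition regularized :: "real \<Rightarrow> complex set \<Rightarrow> (complex \<Rightarrow> real) \<Rightarrow> complex \<Rightarrow> real" where
  "regularized s D I z =
     2 * pi * I z - 2 * pi * Lim (at 0 within D) I + Im (z * log_cut s z - z)"

definition taylor2 :: "(complex \<Rightarrow> real) \<Rightarrow> nat \<Rightarrow> nat \<Rightarrow> real" where
  "taylor2 g a b =
     ((\<lambda>h z. frechet_derivative h (at z) 1) ^^ a)
       (((\<lambda>h z. frechet_derivative h (at z) \<i>) ^^ b) g) 0 / (fact a * fact b)"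

text \<open>\<open>T a b\<close> is the coefficient of \<open>l^a j^b\<close> in the Taylor series at 0 of a smooth extension of
  \<open>s\<close> from \<open>D\<close> to a neighborhood of 0.\<close>

definition taylor_of_extension :: "complex set \<Rightarrow> (complex \<Rightarrow> real) \<Rightarrow> (nat \<Rightarrow> nat \<Rightarrow> real) \<Rightarrow> bool" where
  "taylor_of_extension D s T \<longleftrightarrow>
     (\<exists>r>0. \<exists>g. smooth_on g (ball 0 r) \<and> (\<forall>z\<in>D \<inter> ball 0 r. g z = s z) \<and> T = taylor2 g)"

definition l_series :: "real \<Rightarrow> nat \<Rightarrow> nat \<Rightarrow> real" where
  "l_series x a b = (if a = 1 \<and> b = 0 then x else 0)"

text \<open>A smoothly varying cycle \<open>c z\<close> (a 1-periodic loop in the fiber over \<open>z\<close>) which together with the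
  orbit of \<open>L\<close> is a basis of the first homology, oriented so that the action increases in \<open>j\<close>.\<close>

definition admissible_cycle :: "('m::topological_space) int_sys \<Rightarrow> 'm normal_form \<Rightarrow> ('m \<Rightarrow> real) \<Rightarrow>
    'm one_form \<Rightarrow> (complex \<Rightarrow> real \<Rightarrow> 'm) \<Rightarrow> bool" where
  "admissible_cycle S E \<epsilon> \<theta> c \<longleftrightarrow>
     (\<forall>z\<in>Dcut S E \<epsilon>. \<forall>t. c z t \<in> fiber S E z \<and> c z (t + 1) = c z t) \<and>
     continuous_on (Dcut S E \<epsilon> \<times> UNIV) (\<lambda>(z, t). c z t) \<and>
     (\<forall>d\<in>atlas S. smooth_on (\<lambda>(z, t). snd d (c z t)) {(z, t). z \<in> Dcut S E \<epsilon> \<and> c z t \<in> fst d}) \<and>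
     (\<forall>z\<in>Dcut S E \<epsilon>. \<forall>x\<in>carrier (H1 S E z). \<exists>!(a::int, b::int).
        x = gamma_L S E z (c z 0) [^]\<^bsub>H1 S E z\<^esub> a
            \<otimes>\<^bsub>H1 S E z\<^esub> loop_class (fiber S E z) (c z) [^]\<^bsub>H1 S E z\<^esub> b) \<and>
     (\<forall>z\<in>Dcut S E \<epsilon>. action_of_loops S \<theta> c differentiable (at z) \<and>
        frechet_derivative (action_of_loops S \<theta> c) (at z) \<i> > 0)"

definition taylor_poly :: "('m::topological_space) int_sys \<Rightarrow> 'm \<Rightarrow> 'm normal_form \<Rightarrow> ('m \<Rightarrow> real) \<Rightarrow>
    (real \<times> real \<Rightarrow> real \<times> real) \<Rightarrow> 'm one_form \<Rightarrow> (nat \<Rightarrow> nat \<Rightarrow> real) \<Rightarrow> bool" where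
  "taylor_poly S m E \<epsilon> f \<theta> T \<longleftrightarrow>
     taylor_of_extension (Dcut S E \<epsilon>) (regularized (\<epsilon> m) (Dcut S E \<epsilon>) (I_poly S E \<epsilon> f \<theta>)) T"

definition taylor_pref :: "('m::topological_space) int_sys \<Rightarrow> 'm \<Rightarrow> 'm normal_form \<Rightarrow> ('m \<Rightarrow> real) \<Rightarrow>
    'm one_form \<Rightarrow> (nat \<Rightarrow> nat \<Rightarrow> real) \<Rightarrow> bool" where
  "taylor_pref S m E \<epsilon> \<theta> T \<longleftrightarrow> T 1 0 \<in> {- pi / 2..<3 * pi / 2} \<and>
     (\<exists>c T'. admissible_cycle S E \<epsilon> \<theta> c \<and>
        taylor_of_extension (Dcut S E \<epsilon>)
          (regularized (\<epsilon> m) (Dcut S E \<epsilon>) (action_of_loops S \<theta> c)) T' \<and>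
        (\<exists>n::int. \<forall>a b. T a b = T' a b + l_series (2 * pi * of_int n) a b))"

end

theory Submission
  imports Defs
begin

text \<open>Over a small open set of regular values the flows of two action coordinates \<open>a\<^sub>1\<close>, \<open>a\<^sub>2\<close> define an
  action of the plane whose stabilizers are the lattice \<open>(2\<pi>\<int>)\<^sup>2\<close>. The flows of \<open>L\<close>, \<open>\<mu>\<^sub>2\<close> and \<open>\<Phi>\<^sub>2\<close> on a fiber are
  straight lines in this plane, and a loop in a fiber lifts to a path in the plane ending in a lattice
  vector, which determines its homology class. With \<open>M = \<xi> + \<kappa> Re\<close> the original definition says
  \<open>\<mu>\<^sub>2 = M \<circ> \<Phi>\<close>, so the lines of \<open>\<Phi>\<^sub>2\<close> and \<open>L\<close> followed for the preferred times end in the lattice vector of \<open>\<mu>\<^sub>2\<close>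
  minus \<open>\<kappa>\<close> times that of \<open>L\<close>; this is the difference of cycles.

  If the velocity of a loop in a fiber is \<open>\<alpha> X\<^sub>f + \<beta> X\<^sub>g\<close>, then since \<open>d\<theta> = \<omega>\<close> the first variation of its
  action is \<open>(\<integral>\<alpha>) df + (\<integral>\<beta>) dg\<close>. Applied to the orbits of \<open>\<mu>\<^sub>2\<close> it gives \<open>I\<^sub>\<Delta> = M\<close>. Applied to a family of cycles
  homologous to \<open>i \<gamma>\<^sub>L + j \<gamma>\<^sub>\<Delta>\<close> it gives \<open>dI = i dl + j dM\<close>; the basis property and \<open>\<partial>I/\<partial>j > 0\<close> force \<open>j = 1\<close>.
  Hence the two Taylor series differ by an integer multiple of \<open>2\<pi>l\<close>. The coefficient of \<open>l\<close> in \<open>S\<^sup>\<Delta>\<close> is the limit of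
  \<open>\<tau>\<^sub>1 + Im log\<close> plus \<open>2\<pi>\<kappa>\<close>, and as both this limit and the preferred coefficient lie in \<open>[-\<pi>/2, 3\<pi>/2[\<close>, that
  integer is \<open>\<kappa>\<close>.\<close>

section \<open>Calculus of \<open>Ck_on\<close>\<close>

text \<open>Every flow that occurs is either periodic by hypothesis or a straight line of the plane
  acting on a fiber, so integral curves are never constructed. Gronwall's inequality in charts
  supplies uniqueness and Lipschitz dependence on the initial point, and this is all the regularity
  that the first variation of the action consumes. It matters because the starting points of the
  loops in \<open>I_poly\<close> are arbitrary choices on the fibers: the action is studied as a
  function of the starting point in the manifold and only afterwards as a function of
  \<open>z\<close>.

  The identities hold pointwise on the slit domain \<open>D\<close>, of which 0 is only a boundary
  point. \<open>D\<close> is star-shaped, hence connected, so integers and constants of integration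
  found locally are global; limits at 0 fix the constants, and Taylor coefficients at 0 are limits
  of derivatives taken in \<open>D\<close>.

  The converse for cycles needs the class \<open>gamma_L\<close> to have infinite order. The
  homology of the torus is not computed for this: uniqueness of coordinates in the basis provided by
  an admissible cycle is enough.\<close>

lemma Ck_on_cong:
  assumes "open N" "\<And>x. x \<in> N \<Longrightarrow> f x = g x" "Ck_on n f N"
  shows "Ck_on n g N"
  using assms(2,3)
proof (induction n arbitrary: f g)
  case 0 then show ?case by (simp cong: continuous_on_cong)
next
  case (Suc n)
  have ev: "(f has_derivative h) (at x) \<longleftrightarrow> (g has_derivative h) (at x)" if "x \<in> N" for x h
    using has_derivative_transform_within_open[OF _ assms(1) that] Suc.prems(1) by (metis (no_types, lifting))
  have fd: "frechet_derivative f (at x) = frechet_derivative g (at x)" if "x \<in> N" for x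
    unfolding frechet_derivative_def using ev[OF that] by simp
  show ?case
    using Suc.prems(2) ev fd Suc.IH[of "\<lambda>x. frechet_derivative f (at x) _" "\<lambda>x. frechet_derivative g (at x) _"]
    by (auto simp: differentiable_def)
qed

lemma Ck_on_subset: "Ck_on n f N \<Longrightarrow> N' \<subseteq> N \<Longrightarrow> Ck_on n f N'"
  by (induction n arbitrary: f) (auto intro: continuous_on_subset)

lemma Ck_on_Suc_imp: "Ck_on (Suc n) f N \<Longrightarrow> Ck_on n f N"
proof (induction n arbitrary: f)
  case 0 then show ?case
    by (auto intro!: continuous_at_imp_continuous_on differentiable_imp_continuous_within)
next
  case (Suc n) then show ?case by simp
qed

lemma Ck_on_local:
  assumes "\<And>x. x \<in> X \<Longrightarrow> \<exists>N. open N \<and> x \<in> N \<and> Ck_on n f N"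
  shows "Ck_on n f X"
  using assms
proof (induction n arbitrary: f)
  case 0 then show ?case
    by (simp, meson continuous_at_imp_continuous_on continuous_on_eq_continuous_at)
next
  case (Suc n)
  have "Ck_on n (\<lambda>x. frechet_derivative f (at x) v) X" for v
    by (rule Suc.IH) (use Suc.prems in \<open>simp; blast\<close>)
  then show ?case using Suc.prems by simp blast
qed

text \<open>On an open set the local extension \<open>g\<close> required by \<open>smooth_on\<close>
  coincides with \<open>f\<close> near the point and has the same derivatives there. This converts
  the extension-based notion of the definitions into one to which calculus applies.\<close>

lemma smooth_on_open_imp_Ck_on:
  assumes "smooth_on f X" "open X" shows "Ck_on n f X"
proof (rule Ck_on_local)
  fix x assume "x \<in> X"
  then obtain N g where N: "open N" "x \<in> N" "Ck_on n g N" "\<forall>y\<in>N \<inter> X. f y = g y"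
    using assms(1) unfolding smooth_on_def by blast
  have "Ck_on n g (N \<inter> X)" by (rule Ck_on_subset[OF N(3)]) auto
  then have "Ck_on n f (N \<inter> X)"
    by (rule Ck_on_cong[rotated 2]) (use N assms in auto)
  then show "\<exists>N. open N \<and> x \<in> N \<and> Ck_on n f N"
    using N assms \<open>x \<in> X\<close> by (intro exI[of _ "N \<inter> X"]) auto
qed

lemma Ck_on_has_derivative:
  "Ck_on (Suc n) f N \<Longrightarrow> x \<in> N \<Longrightarrow> (f has_derivative frechet_derivative f (at x)) (at x)"
  by (simp add: frechet_derivative_works[symmetric])

lemma Ck_on_deriv: "Ck_on (Suc n) f N \<Longrightarrow> Ck_on n (\<lambda>x. frechet_derivative f (at x) v) N"
  by simp

lemma Ck_on_const: "Ck_on n (\<lambda>x. k) N"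
  by (induction n arbitrary: k) auto

text \<open>Lets a candidate derivative, computed by the usual rules, stand in for
  \<open>frechet_derivative\<close>; openness of \<open>N\<close> allows the replacement in the
  higher derivatives as well.\<close>

lemma Ck_on_SucI:
  assumes "open N" "\<And>x. x \<in> N \<Longrightarrow> (f has_derivative f' x) (at x)" "\<And>v. Ck_on n (\<lambda>x. f' x v) N"
  shows "Ck_on (Suc n) f N"
proof -
  have "Ck_on n (\<lambda>x. frechet_derivative f (at x) v) N" for v
    by (rule Ck_on_cong[OF assms(1) _ assms(3)[of v]]) (simp add: frechet_derivative_at[OF assms(2)])
  then show ?thesis using assms(2) by (auto simp: differentiable_def)
qed

lemma Ck_on_bounded_linear:
  assumes "open N" "bounded_linear h" "Ck_on n f N" shows "Ck_on n (\<lambda>x. h (f x)) N"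
  using assms(3)
proof (induction n arbitrary: f)
  case 0 then show ?case
    using assms(2) by (simp add: bounded_linear.continuous_on)
next
  case (Suc n)
  show ?case
    by (rule Ck_on_SucI[OF assms(1), of _ "\<lambda>x v. h (frechet_derivative f (at x) v)"])
       (use Suc in \<open>auto intro!: bounded_linear.has_derivative[OF assms(2)] simp: frechet_derivative_works[symmetric]\<close>)
qed

lemma Ck_on_add:
  assumes "open N" "Ck_on n f N" "Ck_on n g N" shows "Ck_on n (\<lambda>x. f x + g x) N"
  using assms(2,3)
proof (induction n arbitrary: f g)
  case 0 then show ?case by (simp add: continuous_on_add)
next
  case (Suc n)
  show ?case
    by (rule Ck_on_SucI[OF assms(1), of _ "\<lambda>x v. frechet_derivative f (at x) v + frechet_derivative g (at x) v"])
       (use Suc in \<open>auto intro!: has_derivative_add simp: frechet_derivative_works[symmetric]\<close>)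
qed

lemma Ck_on_sum:
  assumes "open N" "\<And>i. i \<in> I \<Longrightarrow> Ck_on n (f i) N" shows "Ck_on n (\<lambda>x. \<Sum>i\<in>I. f i x) N"
  using assms(2) by (induction I rule: infinite_finite_induct)
    (auto simp: Ck_on_const assms(1) Ck_on_add)

lemma Ck_on_bilinear:
  assumes "open N" "bounded_bilinear h" "Ck_on n f N" "Ck_on n g N" shows "Ck_on n (\<lambda>x. h (f x) (g x)) N"
  using assms(3,4)
proof (induction n arbitrary: f g)
  case 0 then show ?case
    using assms(2) by (simp add: bounded_bilinear.continuous_on)
next
  case (Suc n)
  have 1: "Ck_on n f N" "Ck_on n g N" using Suc.prems Ck_on_Suc_imp by blast+
  show ?case
  proof (rule Ck_on_SucI[OF assms(1), of _ "\<lambda>x v. h (f x) (frechet_derivative g (at x) v) + h (frechet_derivative f (at x) v) (g x)"])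
    show "((\<lambda>x. h (f x) (g x)) has_derivative
        (\<lambda>v. h (f x) (frechet_derivative g (at x) v) + h (frechet_derivative f (at x) v) (g x))) (at x)"
      if "x \<in> N" for x
      by (rule bounded_bilinear.FDERIV[OF assms(2)]; rule Ck_on_has_derivative) (use that Suc.prems in auto)
    show "Ck_on n (\<lambda>x. h (f x) (frechet_derivative g (at x) v) + h (frechet_derivative f (at x) v) (g x)) N" for v
      by (intro Ck_on_add assms(1) Suc.IH) (use 1 Suc.prems in auto)
  qed
qed

lemmas Ck_on_mult = Ck_on_bilinear[OF _ bounded_bilinear_mult]
lemmas Ck_on_scaleR = Ck_on_bilinear[OF _ bounded_bilinear_scaleR]

lemma Ck_on_prod:
  fixes f :: "'i \<Rightarrow> 'a::real_normed_vector \<Rightarrow> real"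
  assumes "open N" "\<And>i. i \<in> I \<Longrightarrow> Ck_on n (f i) N" shows "Ck_on n (\<lambda>x. \<Prod>i\<in>I. f i x) N"
  using assms(2) by (induction I rule: infinite_finite_induct)
    (auto simp: Ck_on_const assms(1) Ck_on_mult)

lemma Ck_on_inverse:
  fixes f :: "'a::real_normed_vector \<Rightarrow> real"
  assumes "open N" "Ck_on n f N" "\<And>x. x \<in> N \<Longrightarrow> f x \<noteq> 0" shows "Ck_on n (\<lambda>x. inverse (f x)) N"
  using assms(2)
proof (induction n)
  case 0 then show ?case using assms(3) by (simp add: continuous_on_inverse)
next
  case (Suc n)
  have 1: "Ck_on n f N" using Suc.prems Ck_on_Suc_imp by blast
  show ?case
  proof (rule Ck_on_SucI[OF assms(1), of _ "\<lambda>x v. - (inverse (f x) * frechet_derivative f (at x) v * inverse (f x))"])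
    show "((\<lambda>x. inverse (f x)) has_derivative
        (\<lambda>v. - (inverse (f x) * frechet_derivative f (at x) v * inverse (f x)))) (at x)"
      if "x \<in> N" for x
      using that assms(3) Suc.prems by (intro Deriv.has_derivative_inverse Ck_on_has_derivative) auto
    show "Ck_on n (\<lambda>x. - (inverse (f x) * frechet_derivative f (at x) v * inverse (f x))) N" for v
      by (intro Ck_on_bounded_linear[OF assms(1) bounded_linear_minus[OF bounded_linear_ident]]
          Ck_on_mult assms(1) Suc.IH 1) (use Suc.prems in auto)
  qed
qed

text \<open>\<open>Ck_on\<close> speaks of derivatives in a fixed direction, whereas in the chain
  rule the direction in which \<open>f\<close> is differentiated varies with \<open>x\<close>.
  Expanding it in a basis gives a finite sum of scalar functions times derivatives of
  \<open>f\<close> in fixed directions composed with \<open>g\<close>, to which the induction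
  hypothesis applies.\<close>

lemma Ck_on_compose:
  fixes g :: "'a::real_normed_vector \<Rightarrow> 'b::euclidean_space"
  assumes "open N" "open M" "g ` N \<subseteq> M" "Ck_on n f M" "Ck_on n g N"
  shows "Ck_on n (\<lambda>x. f (g x)) N"
  using assms(4,5)
proof (induction n arbitrary: f)
  case 0 then show ?case
    using assms(3) by (auto intro: continuous_on_compose2)
next
  case (Suc n)
  have 1: "Ck_on n g N" using Suc.prems Ck_on_Suc_imp by blast
  let ?D = "\<lambda>x v. \<Sum>b\<in>Basis. (frechet_derivative g (at x) v \<bullet> b) *\<^sub>R frechet_derivative f (at (g x)) b"
  show ?case
  proof (rule Ck_on_SucI[OF assms(1), of _ ?D])
    show "((\<lambda>x. f (g x)) has_derivative ?D x) (at x)" if x: "x \<in> N" for x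
    proof -
      have df: "(f has_derivative frechet_derivative f (at (g x))) (at (g x))"
        by (rule Ck_on_has_derivative[OF Suc.prems(1)]) (use assms(3) x in auto)
      have dg: "(g has_derivative frechet_derivative g (at x)) (at x)"
        by (rule Ck_on_has_derivative[OF Suc.prems(2) x])
      interpret bounded_linear "frechet_derivative f (at (g x))" using df by (rule has_derivative_bounded_linear)
      have "frechet_derivative f (at (g x)) (frechet_derivative g (at x) v) = ?D x v" for v
        by (subst euclidean_representation[symmetric, of "frechet_derivative g (at x) v"]) (simp add: sum scaleR)
      then show ?thesis using diff_chain_at[OF dg df] by (simp add: o_def)
    qed
    show "Ck_on n (\<lambda>x. ?D x v) N" for v
      by (intro Ck_on_sum Ck_on_scaleR assms(1) Suc.IH
          Ck_on_bounded_linear[OF assms(1) bounded_linear_inner_left] 1)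
        (use Suc.prems in auto)
  qed
qed

lemma Ck_on_vec:
  fixes f :: "'i::finite \<Rightarrow> 'a::real_normed_vector \<Rightarrow> real"
  assumes "open N" "\<And>i. Ck_on n (f i) N" shows "Ck_on n (\<lambda>x. \<chi> i. f i x) N"
proof -
  have "(\<chi> i. f i x) = (\<Sum>i\<in>UNIV. f i x *\<^sub>R axis i 1)" for x
    by (vector axis_def) (simp add: if_distrib sum.delta' cong: if_cong)
  then show ?thesis
    using assms by (simp add: Ck_on_sum Ck_on_scaleR Ck_on_const)
qed

section \<open>Uniform estimates\<close>

lemma linear_bound_basis:
  fixes h :: "'a::euclidean_space \<Rightarrow> 'b::real_normed_vector"
  assumes "linear h" "\<And>b. b \<in> Basis \<Longrightarrow> norm (h b) \<le> e"
  shows "norm (h v) \<le> real DIM('a) * e * norm v"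
proof -
  have "h v = (\<Sum>b\<in>Basis. (v \<bullet> b) *\<^sub>R h b)"
    by (subst euclidean_representation[symmetric, of v])
      (simp only: linear_sum[OF assms(1)] linear_scale[OF assms(1)])
  also have "norm \<dots> \<le> (\<Sum>b\<in>(Basis::'a set). norm v * e)"
    by (rule sum_norm_le) (use assms(2) in \<open>auto intro!: mult_mono simp: Basis_le_norm\<close>)
  finally show ?thesis by (simp add: mult_ac)
qed

text \<open>Uniform continuity of the derivative on the compact set is inserted into the mean value
  inequality for \<open>f - D x\<close> on a segment. A remainder that is uniform in the base point
  is needed because the base point later runs along a curve.\<close>

lemma C1_uniform:
  fixes f :: "'a::euclidean_space \<Rightarrow> 'b::real_normed_vector"
  assumes "Ck_on (Suc 0) f U" "compact K" "convex K" "K \<subseteq> U" "e > 0"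
  obtains d where "d > 0"
    "\<And>x y. x \<in> K \<Longrightarrow> y \<in> K \<Longrightarrow> norm (y - x) < d \<Longrightarrow>
       norm (f y - f x - frechet_derivative f (at x) (y - x)) \<le> e * norm (y - x)"
proof -
  define D where "D = (\<lambda>x. frechet_derivative f (at x))"
  \<comment> \<open>Control on the basis vectors costs a factor equal to the dimension in the
    operator norm, see \<open>linear_bound_basis\<close>.\<close>
  define e' where "e' = e / real DIM('a)"
  have e': "e' > 0" using assms(5) by (simp add: e'_def)
  have der: "(f has_derivative D x) (at x)" if "x \<in> K" for x
    unfolding D_def by (rule Ck_on_has_derivative[OF assms(1)]) (use that assms in auto)
  have "\<exists>d>0. \<forall>x\<in>K. \<forall>y\<in>K. dist y x < d \<longrightarrow> dist (D y b) (D x b) < e'" for b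
  proof -
    have "continuous_on K (\<lambda>x. D x b)"
      using assms(1,4) by (auto simp: D_def intro: continuous_on_subset)
    then have "uniformly_continuous_on K (\<lambda>x. D x b)" using assms(2) by (rule compact_uniformly_continuous)
    then show ?thesis unfolding uniformly_continuous_on_def using e' by blast
  qed
  then obtain d where d: "\<And>b. d b > 0" "\<And>b x y. x \<in> K \<Longrightarrow> y \<in> K \<Longrightarrow> dist y x < d b \<Longrightarrow> dist (D y b) (D x b) < e'"
    by metis
  define d0 where "d0 = Min (d ` (Basis::'a set))"
  have d0: "d0 > 0" "\<And>b. b \<in> Basis \<Longrightarrow> d0 \<le> d b" using d(1) by (auto simp: d0_def)
  have "norm (f y - f x - D x (y - x)) \<le> e * norm (y - x)"
    if xy: "x \<in> K" "y \<in> K" "norm (y - x) < d0" for x y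
  proof -
    have lin: "linear (D z)" if "z \<in> K" for z using der[OF that] has_derivative_linear by blast
    have sub: "z \<in> K \<and> norm (z - x) < d0" if "z \<in> closed_segment x y" for z
      using that xy assms(3) segment_bound1[OF that]
      by (auto simp: convex_contains_segment norm_minus_commute)
    have "norm ((f y - D x y) - (f x - D x x)) \<le> e * norm (y - x)"
    proof (rule differentiable_bound[of "closed_segment x y" "\<lambda>z. f z - D x z" "\<lambda>z v. D z v - D x v"])
      fix z assume z: "z \<in> closed_segment x y"
      show "((\<lambda>z. f z - D x z) has_derivative (\<lambda>v. D z v - D x v)) (at z within closed_segment x y)"
        by (intro has_derivative_diff has_derivative_at_withinI[OF der] linear_imp_has_derivative lin)
          (use sub[OF z] xy in auto)
      have l: "linear (\<lambda>v. D z v - D x v)" using lin[of z] lin[of x] sub[OF z] xy by (simp add: linear_compose_sub)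
      have "norm (D z v - D x v) \<le> real DIM('a) * e' * norm v" for v
      proof (rule linear_bound_basis[OF l])
        fix b :: 'a assume "b \<in> Basis"
        then have "dist (D z b) (D x b) < e'"
          using d(2)[of x z b] d0 sub[OF z] xy by (auto simp: dist_norm dest: order_less_le_trans)
        then show "norm (D z b - D x b) \<le> e'" by (simp add: dist_norm)
      qed
      then show "onorm (\<lambda>v. D z v - D x v) \<le> e" by (intro onorm_le) (simp add: e'_def)
    qed auto
    then show ?thesis using lin[OF xy(1)] by (simp add: linear_diff algebra_simps)
  qed
  then show ?thesis using d0 that unfolding D_def by blast
qed

lemma C1_Lipschitz:
  fixes f :: "'a::euclidean_space \<Rightarrow> 'b::real_normed_vector"
  assumes "Ck_on (Suc 0) f U" "compact K" "convex K" "K \<subseteq> U"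
  obtains B where "B \<ge> 0" "\<And>x v. x \<in> K \<Longrightarrow> norm (frechet_derivative f (at x) v) \<le> B * norm v"
    "\<And>x y. x \<in> K \<Longrightarrow> y \<in> K \<Longrightarrow> norm (f x - f y) \<le> B * norm (x - y)"
proof -
  have "\<exists>M. \<forall>x\<in>K. norm (frechet_derivative f (at x) b) \<le> M" for b
  proof -
    have "continuous_on K (\<lambda>x. frechet_derivative f (at x) b)"
      using assms(1,4) by (auto intro: continuous_on_subset)
    then have "bounded ((\<lambda>x. frechet_derivative f (at x) b) ` K)"
      using assms(2) compact_continuous_image compact_imp_bounded by blast
    then show ?thesis by (auto simp: bounded_iff)
  qed
  then obtain M where M: "\<And>b x. x \<in> K \<Longrightarrow> norm (frechet_derivative f (at x) b) \<le> M b" by metis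
  define M0 where "M0 = (\<Sum>b\<in>(Basis::'a set). \<bar>M b\<bar>)"
  have M0: "M b \<le> M0" if "b \<in> Basis" for b
  proof -
    have "\<bar>M b\<bar> \<le> M0" unfolding M0_def by (rule member_le_sum) (use that in auto)
    then show ?thesis by linarith
  qed
  have der: "(f has_derivative frechet_derivative f (at x)) (at x)" if "x \<in> K" for x
    by (rule Ck_on_has_derivative[OF assms(1)]) (use that assms in auto)
  have b: "norm (frechet_derivative f (at x) v) \<le> (real DIM('a) * M0) * norm v" if "x \<in> K" for x v
    by (rule linear_bound_basis) (use der[OF that] M[OF that] M0 has_derivative_linear order_trans in blast)+
  have "norm (f x - f y) \<le> (real DIM('a) * M0) * norm (x - y)" if "x \<in> K" "y \<in> K" for x y
    by (rule differentiable_bound[OF assms(3) has_derivative_at_withinI[OF der]])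
      (use that b in \<open>auto intro: onorm_le\<close>)
  moreover have "0 \<le> real DIM('a) * M0" by (auto simp: M0_def sum_nonneg)
  ultimately show ?thesis using that b by blast
qed

text \<open>The norm need not be differentiable at zeros of \<open>e\<close>, so its square is used:
  with 2 |e| \<eta> \<le> |e|^2 + \<eta>^2 the function (|e|^2 + \<eta>^2) exp(- (2 B + 1) (s - a))
  is nonincreasing. The added \<eta>^2 absorbs the inhomogeneous term, and rounding 2 B + 1 up to 2
  (B + 1) gives the stated exponent after taking the root.\<close>

lemma gronwall:
  fixes e :: "real \<Rightarrow> 'a::real_inner"
  assumes der: "\<And>t. t \<in> {a..b} \<Longrightarrow> (e has_vector_derivative e' t) (at t within {a..b})"
    and bound: "\<And>t. t \<in> {a..b} \<Longrightarrow> norm (e' t) \<le> B * norm (e t) + \<eta>"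
    and "B \<ge> 0" "\<eta> \<ge> 0" "t \<in> {a..b}"
  shows "norm (e t) \<le> (norm (e a) + \<eta>) * exp ((B + 1) * (t - a))"
proof (cases "t = a")
  case True then show ?thesis using assms by simp
next
  case False
  then have ta: "a < t" using assms(5) by auto
  define m where "m = (\<lambda>s. (e s \<bullet> e s + \<eta>\<^sup>2) * exp (- (2 * B + 1) * (s - a)))"
  define m' where "m' = (\<lambda>s. ((e s \<bullet> e' s + e' s \<bullet> e s) - (2 * B + 1) * (e s \<bullet> e s + \<eta>\<^sup>2)) * exp (- (2 * B + 1) * (s - a)))"
  have dm: "(m has_derivative (\<lambda>h. h * m' s)) (at s within {a..t})" if "s \<in> {a..t}" for s
  proof -
    have de: "(e has_derivative (\<lambda>h. h *\<^sub>R e' s)) (at s within {a..t})"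
      using der[of s] that assms(5) unfolding has_vector_derivative_def
      by (auto intro: has_derivative_subset)
    show ?thesis unfolding m_def m'_def
      by (rule derivative_eq_intros de refl | simp)+ (simp add: fun_eq_iff algebra_simps)
  qed
  obtain s where s: "s \<in> {a<..<t}" "m t - m a = (t - a) * m' s"
    using mvt_simple[OF ta, of m "\<lambda>s h. h * m' s"] dm by auto
  have "e s \<bullet> e' s \<le> norm (e s) * norm (e' s)" by (rule norm_cauchy_schwarz)
  also have "\<dots> \<le> norm (e s) * (B * norm (e s) + \<eta>)"
    using bound[of s] s assms(5) by (intro mult_left_mono) auto
  finally have "2 * (e s \<bullet> e' s) \<le> 2 * B * (norm (e s))\<^sup>2 + 2 * (norm (e s) * \<eta>)"
    by (simp add: algebra_simps power2_eq_square)
  also have "2 * (norm (e s) * \<eta>) \<le> (norm (e s))\<^sup>2 + \<eta>\<^sup>2"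
    using sum_squares_bound[of "norm (e s)" \<eta>] by simp
  finally have "2 * (e s \<bullet> e' s) \<le> 2 * B * (norm (e s))\<^sup>2 + ((norm (e s))\<^sup>2 + \<eta>\<^sup>2)"
    by simp
  moreover have "(2 * B + 1) * (e s \<bullet> e s + \<eta>\<^sup>2)
      = 2 * B * (norm (e s))\<^sup>2 + ((norm (e s))\<^sup>2 + \<eta>\<^sup>2) + 2 * (B * \<eta>\<^sup>2)"
    by (simp add: power2_norm_eq_inner algebra_simps)
  moreover have "0 \<le> B * \<eta>\<^sup>2" using assms(3) by simp
  ultimately have "2 * (e s \<bullet> e' s) \<le> (2 * B + 1) * (e s \<bullet> e s + \<eta>\<^sup>2)" by linarith
  then have "m' s \<le> 0" unfolding m'_def
    by (intro mult_nonpos_nonneg) (simp_all add: inner_commute)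
  then have mm: "m t \<le> m a" using s ta by (metis diff_le_0_iff_le less_eq_real_def mult_nonneg_nonpos diff_ge_0_iff_ge)
  have "(norm (e t))\<^sup>2 + \<eta>\<^sup>2 \<le> ((norm (e a))\<^sup>2 + \<eta>\<^sup>2) * exp ((2 * B + 1) * (t - a))"
  proof -
    have "m t * exp ((2 * B + 1) * (t - a)) \<le> m a * exp ((2 * B + 1) * (t - a))" by (rule mult_right_mono[OF mm]) simp
    moreover have "m t * exp ((2 * B + 1) * (t - a)) = (norm (e t))\<^sup>2 + \<eta>\<^sup>2"
    proof -
      have "exp (- (2 * B + 1) * (t - a)) * exp ((2 * B + 1) * (t - a)) = 1"
        unfolding exp_add[symmetric] by (simp only: mult_minus_left) simp
      then show ?thesis unfolding m_def mult.assoc power2_norm_eq_inner by (simp only: mult_1_right)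
    qed
    ultimately have "(norm (e t))\<^sup>2 + \<eta>\<^sup>2 \<le> m a * exp ((2 * B + 1) * (t - a))" by linarith
    then show ?thesis by (simp add: m_def power2_norm_eq_inner)
  qed
  also have "\<dots> \<le> (norm (e a) + \<eta>)\<^sup>2 * exp (2 * ((B + 1) * (t - a)))"
    using ta assms(3,4) by (intro mult_mono) (auto simp: power2_sum algebra_simps mult_left_mono)
  also have "\<dots> = ((norm (e a) + \<eta>) * exp ((B + 1) * (t - a)))\<^sup>2"
    by (simp add: power_mult_distrib exp_double)
  finally have "(norm (e t))\<^sup>2 \<le> ((norm (e a) + \<eta>) * exp ((B + 1) * (t - a)))\<^sup>2"
    by (smt (verit) zero_le_power2)
  then show ?thesis by (rule power2_le_imp_le) (use assms(4) in auto)
qed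

text \<open>The second difference \<open>R v w t\<close> is symmetric in \<open>v\<close> and
  \<open>w\<close>, and divided by the square of \<open>t\<close> it tends to the derivative in
  direction \<open>w\<close> of the derivative in direction \<open>v\<close>. The limit rests on the
  mean value theorem along \<open>v\<close> and on differentiability of the first derivatives at
  \<open>x\<close>.\<close>

lemma second_derivative_symmetric:
  fixes f :: "'a::real_normed_vector \<Rightarrow> real"
  assumes "open U" "x \<in> U" "Ck_on (Suc (Suc 0)) f U"
  shows "frechet_derivative (\<lambda>z. frechet_derivative f (at z) v) (at x) w
       = frechet_derivative (\<lambda>z. frechet_derivative f (at z) w) (at x) v"
proof -
  define D where "D = (\<lambda>z. frechet_derivative f (at z))"
  define Q where "Q = (\<lambda>u. frechet_derivative (\<lambda>z. D z u) (at x))"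
  have df: "(f has_derivative D z) (at z)" if "z \<in> U" for z
    unfolding D_def using Ck_on_has_derivative[OF assms(3)] that by simp
  have dD: "((\<lambda>z. D z u) has_derivative Q u) (at x)" for u
    using assms(2,3) unfolding Q_def D_def by (intro Ck_on_has_derivative[where n=0]) auto
  define R where "R = (\<lambda>v w t. f (x + t *\<^sub>R v + t *\<^sub>R w) - f (x + t *\<^sub>R v) - f (x + t *\<^sub>R w) + f x)"
  have lim: "((\<lambda>t. R v w t / t\<^sup>2) \<longlongrightarrow> Q v w) (at_right 0)" for v w
  proof (rule tendstoI)
    fix e :: real assume e: "e > 0"
    define N where "N = 2 * norm v + norm w + 1"
    have N: "N > 0" by (simp add: N_def add_nonneg_pos)
    \<comment> \<open>Two remainders of size at most \<open>e1\<close> times t N then add up to t e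
      / 2.\<close>
    define e1 where "e1 = e / (4 * N)"
    have e1: "e1 > 0" using e N by (simp add: e1_def)
    obtain d1 where d1: "d1 > 0" "\<And>y. norm (y - x) < d1 \<Longrightarrow> norm (D y v - D x v - Q v (y - x)) \<le> e1 * norm (y - x)"
      using dD[of v] e1 unfolding has_derivative_at_alt by meson
    obtain d2 where d2: "d2 > 0" "ball x d2 \<subseteq> U" using assms(1,2) open_contains_ball by blast
    define d where "d = min d1 d2 / N"
    have d: "d > 0" using d1 d2 N by (simp add: d_def)
    have "dist (R v w t / t\<^sup>2) (Q v w) < e" if t: "0 < t" "t < d" for t
    proof -
      have small: "norm (s *\<^sub>R v + r *\<^sub>R w) < min d1 d2 \<and> norm (s *\<^sub>R v + r *\<^sub>R w) \<le> t * N" if "0 \<le> s" "s \<le> t" "0 \<le> r" "r \<le> t" for s r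
      proof -
        have "norm (s *\<^sub>R v + r *\<^sub>R w) \<le> s * norm v + r * norm w"
          using that by (metis abs_of_nonneg norm_scaleR norm_triangle_ineq)
        also have "\<dots> \<le> t * norm v + t * norm w"
          using that by (intro add_mono mult_right_mono) auto
        also have "\<dots> \<le> t * N" using t by (auto simp: N_def algebra_simps)
        finally show ?thesis using t N by (auto simp: d_def field_simps)
      qed
      have dx: "dist x (x + u) = norm u" for u by (simp add: dist_norm)
      have inU: "x + s *\<^sub>R v + r *\<^sub>R w \<in> U" if "0 \<le> s" "s \<le> t" "0 \<le> r" "r \<le> t" for s r
        unfolding add.assoc by (rule subsetD[OF d2(2)]) (use small[OF that] in \<open>simp only: mem_ball dx, simp\<close>)
      define g where "g = (\<lambda>s. f (x + s *\<^sub>R v + t *\<^sub>R w) - f (x + s *\<^sub>R v))"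
      have dg: "(g has_derivative (\<lambda>h. h * (D (x + s *\<^sub>R v + t *\<^sub>R w) v - D (x + s *\<^sub>R v) v))) (at s within {0..t})"
        if s: "s \<in> {0..t}" for s
      proof -
        have lin: "linear (D z)" if "z \<in> U" for z using df[OF that] has_derivative_linear by blast
        have U: "x + s *\<^sub>R v + t *\<^sub>R w \<in> U" "x + s *\<^sub>R v \<in> U" using inU[of s t] inU[of s 0] s t by auto
        have "((\<lambda>s. f (x + s *\<^sub>R v + t *\<^sub>R w)) has_derivative (\<lambda>h. D (x + s *\<^sub>R v + t *\<^sub>R w) (h *\<^sub>R v))) (at s)"
          by (rule diff_chain_at[where f = "\<lambda>s. x + s *\<^sub>R v + t *\<^sub>R w", unfolded o_def, OF _ df[OF U(1)]])
            (auto intro!: derivative_eq_intros)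
        moreover have "((\<lambda>s. f (x + s *\<^sub>R v)) has_derivative (\<lambda>h. D (x + s *\<^sub>R v) (h *\<^sub>R v))) (at s)"
          by (rule diff_chain_at[where f = "\<lambda>s. x + s *\<^sub>R v", unfolded o_def, OF _ df[OF U(2)]])
            (auto intro!: derivative_eq_intros)
        ultimately have "(g has_derivative (\<lambda>h. D (x + s *\<^sub>R v + t *\<^sub>R w) (h *\<^sub>R v) - D (x + s *\<^sub>R v) (h *\<^sub>R v))) (at s)"
          unfolding g_def by (rule has_derivative_diff)
        then show ?thesis using lin[OF U(1)] lin[OF U(2)]
          by (simp add: linear_scale right_diff_distrib has_derivative_at_withinI)
      qed
      obtain s where s: "s \<in> {0<..<t}" "g t - g 0 = t * (D (x + s *\<^sub>R v + t *\<^sub>R w) v - D (x + s *\<^sub>R v) v)"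
        using mvt_simple[OF t(1) dg] by auto
      define y1 where "y1 = s *\<^sub>R v + t *\<^sub>R w" 
      define y2 where "y2 = s *\<^sub>R v"
      have R: "R v w t = t * (D (x + y1) v - D (x + y2) v)" using s(2) by (simp add: R_def g_def y1_def y2_def add.assoc)
      have y: "norm y1 < d1" "norm y1 \<le> t * N" "norm y2 < d1" "norm y2 \<le> t * N"
        using small[of s t] small[of s 0] s t by (auto simp: y1_def y2_def)
      interpret Q: bounded_linear "Q v" using dD[of v] has_derivative_bounded_linear by blast
      have "Q v y1 - Q v y2 = t * Q v w" by (simp add: y1_def y2_def Q.add Q.scaleR)
      then have "norm (D (x + y1) v - D (x + y2) v - t * Q v w)
        = norm ((D (x + y1) v - D x v - Q v y1) - (D (x + y2) v - D x v - Q v y2))" by simp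
      also have "\<dots> \<le> e1 * norm y1 + e1 * norm y2"
      proof -
        have "\<bar>D (x + y1) v - D x v - Q v y1\<bar> \<le> e1 * norm y1" "\<bar>D (x + y2) v - D x v - Q v y2\<bar> \<le> e1 * norm y2"
          using d1(2)[of "x + y1"] d1(2)[of "x + y2"] y by auto
        then show ?thesis unfolding real_norm_def by linarith
      qed
      also have "\<dots> \<le> e1 * (t * N) + e1 * (t * N)" using y e1 by (intro add_mono mult_left_mono) auto
      also have "\<dots> = t * (e / 2)" using N by (simp add: e1_def field_simps)
      finally have "\<bar>D (x + y1) v - D (x + y2) v - t * Q v w\<bar> < t * e" 
        using t e by (smt (verit) mult_strict_left_mono real_norm_def field_sum_of_halves)
      moreover have "R v w t / t\<^sup>2 - Q v w = (D (x + y1) v - D (x + y2) v - t * Q v w) / t"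
        using t by (simp add: R power2_eq_square field_simps)
      ultimately show ?thesis using t by (simp add: dist_real_def abs_divide pos_divide_less_eq mult.commute)
    qed
    then show "\<forall>\<^sub>F t in at_right 0. dist (R v w t / t\<^sup>2) (Q v w) < e"
      using d by (auto simp: eventually_at_right_field)
  qed
  have "R v w = R w v" by (auto simp: R_def fun_eq_iff add_ac)
  then have "Q v w = Q w v" using lim[of v w] lim[of w v] tendsto_unique trivial_limit_at_right_real by metis
  then show ?thesis by (simp add: Q_def D_def)
qed

section \<open>Charts\<close>

abbreviation chart_inv :: "'m chart \<Rightarrow> real^4 \<Rightarrow> 'm" where
  "chart_inv c \<equiv> inv_into (fst c) (snd c)"

locale smooth_manifold =
  fixes S :: "('m::t2_space) int_sys"
  assumes smooth_atlas: "smooth_atlas (atlas S)"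
begin

lemma chart_homeomorphism:
  "c \<in> atlas S \<Longrightarrow> homeomorphism (fst c) (snd c ` fst c) (snd c) (chart_inv c)"
  and open_chart: "c \<in> atlas S \<Longrightarrow> open (fst c)"
  and open_chart_image: "c \<in> atlas S \<Longrightarrow> open (snd c ` fst c)"
  and charts_cover: "\<exists>c\<in>atlas S. p \<in> fst c"
  using smooth_atlas unfolding smooth_atlas_def by blast+

lemma chart_inv_chart: "c \<in> atlas S \<Longrightarrow> p \<in> fst c \<Longrightarrow> chart_inv c (snd c p) = p"
  using chart_homeomorphism unfolding homeomorphism_def by blast

lemma chart_chart_inv: "c \<in> atlas S \<Longrightarrow> x \<in> snd c ` fst c \<Longrightarrow> snd c (chart_inv c x) = x"
  using chart_homeomorphism unfolding homeomorphism_def by blast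

lemma chart_inv_in: "c \<in> atlas S \<Longrightarrow> x \<in> snd c ` (fst c \<inter> X) \<Longrightarrow> chart_inv c x \<in> fst c \<inter> X"
  using chart_inv_chart by force

lemma continuous_on_chart: "c \<in> atlas S \<Longrightarrow> continuous_on (fst c) (snd c)"
  and continuous_on_chart_inv: "c \<in> atlas S \<Longrightarrow> continuous_on (snd c ` fst c) (chart_inv c)"
  using chart_homeomorphism unfolding homeomorphism_def by blast+

lemma chart_at_atlas: "chart_at S p \<in> atlas S" and in_chart_at: "p \<in> fst (chart_at S p)"
  using someI_ex[of "\<lambda>c. c \<in> atlas S \<and> p \<in> fst c"] charts_cover[of p] unfolding chart_at_def by blast+

lemma open_chart_image_Int:
  assumes c: "c \<in> atlas S" and "open X"
  shows "open (snd c ` (fst c \<inter> X))"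
proof -
  have "snd c ` (fst c \<inter> X) = snd c ` fst c \<inter> chart_inv c -` X"
    using chart_inv_chart[OF c] chart_chart_inv[OF c] by force
  then show ?thesis
    using continuous_on_open_vimage[OF open_chart_image[OF c]] continuous_on_chart_inv[OF c] assms(2)
    by (metis Int_commute)
qed

lemma open_chart_vimage:
  assumes c: "c \<in> atlas S" and "open N"
  shows "open {p \<in> fst c. snd c p \<in> N}"
proof -
  have "{p \<in> fst c. snd c p \<in> N} = snd c -` N \<inter> fst c" by auto
  then show ?thesis
    using continuous_on_open_vimage[OF open_chart[OF c]] continuous_on_chart[OF c] assms(2) by metis
qed

lemma in_chart_chart: "c \<in> atlas S \<Longrightarrow> p \<in> fst c \<Longrightarrow> in_chart c f (snd c p) = f p"
  by (simp add: in_chart_def chart_inv_chart)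

lemma smooth_fun_Ck_on:
  assumes "smooth_fun S f X" "open X" "c \<in> atlas S"
  shows "Ck_on n (in_chart c f) (snd c ` (fst c \<inter> X))"
  using assms by (intro smooth_on_open_imp_Ck_on open_chart_image_Int) (auto simp: smooth_fun_def)

lemma transition_Ck_on:
  assumes "c \<in> atlas S" "d \<in> atlas S"
  shows "Ck_on n (in_chart c (snd d)) (snd c ` (fst c \<inter> fst d))"
  using assms smooth_atlas unfolding smooth_atlas_def
  by (intro smooth_on_open_imp_Ck_on open_chart_image_Int) auto

lemma transition_has_derivative:
  assumes "c \<in> atlas S" "d \<in> atlas S" "p \<in> fst c" "p \<in> fst d"
  shows "(in_chart c (snd d) has_derivative chart_deriv c (snd d) p) (at (snd c p))"
  unfolding chart_deriv_def
  by (rule Ck_on_has_derivative[OF transition_Ck_on[OF assms(1,2), of "Suc 0"]]) (use assms in auto)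

lemma chart_deriv_chain:
  assumes c: "c \<in> atlas S" "d \<in> atlas S" "p \<in> fst c" "p \<in> fst d"
    and f: "in_chart d f differentiable (at (snd d p))"
  shows "(in_chart c f has_derivative (\<lambda>v. chart_deriv d f p (chart_deriv c (snd d) p v))) (at (snd c p))"
    and "chart_deriv c f p v = chart_deriv d f p (chart_deriv c (snd d) p v)"
proof -
  have "(in_chart d f has_derivative chart_deriv d f p) (at (snd d p))"
    using f unfolding chart_deriv_def by (simp add: frechet_derivative_works[symmetric])
  then have df: "(in_chart d f has_derivative chart_deriv d f p) (at (in_chart c (snd d) (snd c p)))"
    by (simp add: in_chart_chart c)
  have "((in_chart d f \<circ> in_chart c (snd d)) has_derivative (chart_deriv d f p \<circ> chart_deriv c (snd d) p)) (at (snd c p))"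
    by (rule diff_chain_at[OF transition_has_derivative[OF c] df])
  then show der: "(in_chart c f has_derivative (\<lambda>v. chart_deriv d f p (chart_deriv c (snd d) p v))) (at (snd c p))"
    unfolding o_def[of "chart_deriv d f p"]
  proof (rule has_derivative_transform_within_open[OF _ open_chart_image_Int[OF c(1) open_chart[OF c(2)]]])
    fix x assume "x \<in> snd c ` (fst c \<inter> fst d)"
    then show "(in_chart d f \<circ> in_chart c (snd d)) x = in_chart c f x"
      using chart_inv_chart c by (force simp: in_chart_def)
  qed (use c in auto)
  then show "chart_deriv c f p v = chart_deriv d f p (chart_deriv c (snd d) p v)"
    unfolding chart_deriv_def[of c f] by (simp add: frechet_derivative_at[OF der, symmetric])
qed

text \<open>The form in which differentiability of a transition map is applied to families of
  points: closeness in the chart \<open>c\<close> alone guarantees membership in the domain of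
  \<open>d\<close>, so first-order estimates at \<open>p\<close> can be moved between
  charts.\<close>

lemma transition_expansion:
  assumes c: "c \<in> atlas S" "d \<in> atlas S" "p \<in> fst c" "p \<in> fst d" and "e > 0"
  obtains \<eta> where "\<eta> > 0" "\<And>q. q \<in> fst c \<Longrightarrow> norm (snd c q - snd c p) < \<eta> \<Longrightarrow> q \<in> fst d \<and>
    norm (snd d q - snd d p - chart_deriv c (snd d) p (snd c q - snd c p)) \<le> e * norm (snd c q - snd c p)"
proof -
  obtain \<eta>1 where 1: "\<eta>1 > 0" "\<And>y. norm (y - snd c p) < \<eta>1 \<Longrightarrow>
     norm (in_chart c (snd d) y - in_chart c (snd d) (snd c p) - chart_deriv c (snd d) p (y - snd c p)) \<le> e * norm (y - snd c p)"
    using transition_has_derivative[OF c] assms(5) unfolding has_derivative_at_alt by meson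
  obtain \<eta>2 where 2: "\<eta>2 > 0" "ball (snd c p) \<eta>2 \<subseteq> snd c ` (fst c \<inter> fst d)"
    using open_contains_ball open_chart_image_Int[OF c(1) open_chart[OF c(2)]] c by blast
  show ?thesis
  proof (rule that[of "min \<eta>1 \<eta>2"])
    fix q assume q: "q \<in> fst c" "norm (snd c q - snd c p) < min \<eta>1 \<eta>2"
    have "snd c q \<in> snd c ` (fst c \<inter> fst d)"
      by (rule subsetD[OF 2(2)]) (use q in \<open>auto simp: dist_norm norm_minus_commute\<close>)
    then have "q \<in> fst d" using chart_inv_in[OF c(1)] chart_inv_chart[OF c(1) q(1)] by force
    then show "q \<in> fst d \<and>
    norm (snd d q - snd d p - chart_deriv c (snd d) p (snd c q - snd c p)) \<le> e * norm (snd c q - snd c p)"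
      using 1(2)[of "snd c q"] q c by (simp add: in_chart_chart)
  qed (use 1 2 in auto)
qed

lemma curve_change_chart:
  assumes c: "c \<in> atlas S" "d \<in> atlas S" "\<gamma> t \<in> fst c" "\<gamma> t \<in> fst d"
    and cont: "continuous_on J \<gamma>" and t: "t \<in> J"
    and der: "((snd c \<circ> \<gamma>) has_vector_derivative v) (at t within J)"
  shows "((snd d \<circ> \<gamma>) has_vector_derivative chart_deriv c (snd d) (\<gamma> t) v) (at t within J)"
proof -
  interpret T: bounded_linear "chart_deriv c (snd d) (\<gamma> t)"
    by (rule has_derivative_bounded_linear[OF transition_has_derivative[OF c]])
  have "((in_chart c (snd d) \<circ> (snd c \<circ> \<gamma>)) has_derivative
      (chart_deriv c (snd d) (\<gamma> t) \<circ> (\<lambda>h. h *\<^sub>R v))) (at t within J)"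
    by (rule diff_chain_within[OF der[unfolded has_vector_derivative_def]])
      (simp add: has_derivative_at_withinI transition_has_derivative[OF c])
  then have "((in_chart c (snd d) \<circ> (snd c \<circ> \<gamma>)) has_vector_derivative chart_deriv c (snd d) (\<gamma> t) v) (at t within J)"
    by (simp add: has_vector_derivative_def o_def T.scaleR)
  moreover have "\<forall>\<^sub>F s in at t within J. (in_chart c (snd d) \<circ> (snd c \<circ> \<gamma>)) s = (snd d \<circ> \<gamma>) s"
  proof -
    have "(\<gamma> \<longlongrightarrow> \<gamma> t) (at t within J)" using cont t by (simp add: continuous_on_def)
    then have "\<forall>\<^sub>F s in at t within J. \<gamma> s \<in> fst c"
      by (rule topological_tendstoD) (use open_chart c in auto)
    then show ?thesis by eventually_elim (simp add: in_chart_chart c)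
  qed
  ultimately show ?thesis unfolding has_vector_derivative_def
    by (elim has_derivative_transform_eventually) (use c t in \<open>auto simp: in_chart_chart\<close>)
qed

section \<open>Integral curves\<close>

text \<open>The velocity may depend on time and is prescribed chart by chart. This covers autonomous
  fields, combinations with time-dependent coefficients and, when the point is ignored, the bare
  statement that a curve has a given velocity, as in \<open>C1_curve\<close>.\<close>

definition icurve :: "real set \<Rightarrow> (real \<Rightarrow> 'm chart \<Rightarrow> 'm \<Rightarrow> real^4) \<Rightarrow> (real \<Rightarrow> 'm) \<Rightarrow> bool" where
  "icurve J u \<gamma> \<longleftrightarrow> continuous_on J \<gamma> \<and>
     (\<forall>t\<in>J. \<forall>c\<in>atlas S. \<gamma> t \<in> fst c \<longrightarrow> ((snd c \<circ> \<gamma>) has_vector_derivative u t c (\<gamma> t)) (at t within J))"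

text \<open>The local Lipschitz condition, uniform in time, that the Gronwall argument consumes. It
  imposes no regularity in time, so that combinations with bounded time-dependent coefficients stay
  within the notion.\<close>

definition lip_field :: "'m set \<Rightarrow> real set \<Rightarrow> (real \<Rightarrow> 'm chart \<Rightarrow> 'm \<Rightarrow> real^4) \<Rightarrow> bool" where
  "lip_field X J u \<longleftrightarrow> (\<forall>c\<in>atlas S. \<forall>p\<in>fst c \<inter> X. \<exists>r>0. \<exists>B\<ge>0. cball (snd c p) r \<subseteq> snd c ` (fst c \<inter> X) \<and>
     (\<forall>t\<in>J. \<forall>x\<in>cball (snd c p) r. \<forall>y\<in>cball (snd c p) r.
        norm (u t c (chart_inv c x) - u t c (chart_inv c y)) \<le> B * norm (x - y)))"

lemma icurve_subset: "icurve J u \<gamma> \<Longrightarrow> J' \<subseteq> J \<Longrightarrow> icurve J' u \<gamma>"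
  unfolding icurve_def by (meson continuous_on_subset has_vector_derivative_within_subset subsetD)

lemma icurve_D: "icurve J u \<gamma> \<Longrightarrow> t \<in> J \<Longrightarrow> c \<in> atlas S \<Longrightarrow> \<gamma> t \<in> fst c \<Longrightarrow>
    ((snd c \<circ> \<gamma>) has_vector_derivative u t c (\<gamma> t)) (at t within J)"
  and icurve_continuous: "icurve J u \<gamma> \<Longrightarrow> continuous_on J \<gamma>"
  unfolding icurve_def by blast+

lemma curve_near_chart_point:
  fixes J :: "real set"
  assumes "continuous_on J \<gamma>" "t \<in> J" "c \<in> atlas S" "\<gamma> t \<in> fst c" "open N" "snd c (\<gamma> t) \<in> N"
  obtains d where "d > 0" "\<And>s. s \<in> J \<Longrightarrow> \<bar>s - t\<bar> < d \<Longrightarrow> \<gamma> s \<in> fst c \<and> snd c (\<gamma> s) \<in> N"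
proof -
  have "(\<gamma> \<longlongrightarrow> \<gamma> t) (at t within J)" using assms by (simp add: continuous_on_def)
  then have "\<forall>\<^sub>F s in at t within J. \<gamma> s \<in> {p \<in> fst c. snd c p \<in> N}"
    by (rule topological_tendstoD) (use assms open_chart_vimage in auto)
  then obtain d where "d > 0" "\<And>s. s \<in> J \<Longrightarrow> s \<noteq> t \<Longrightarrow> dist s t < d \<Longrightarrow> \<gamma> s \<in> fst c \<and> snd c (\<gamma> s) \<in> N"
    unfolding eventually_at by auto
  then show ?thesis using that[of d] assms by (metis dist_real_def)
qed

text \<open>The Hausdorff property enters here: a compact coordinate ball is closed in the whole
  manifold, so a curve that lies in it up to some time still lies in it at that time.\<close>

lemma closed_chart_ball:
  assumes "c \<in> atlas S" "compact C" "C \<subseteq> snd c ` fst c"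
  shows "closed (chart_inv c ` C)"
  by (intro compact_imp_closed compact_continuous_image continuous_on_subset[OF continuous_on_chart_inv]) (use assms in auto)

text \<open>Comparison of integral curves in a single chart over a short time. The radii leave room:
  \<gamma> stays within r / 2 of the centre, and a second curve starting within r / (4 K) of it
  drifts at most r / 4 away, so it cannot reach the boundary of the ball of radius r. Since b - a <
  1, the Gronwall factor is at most K = exp(B + 1).\<close>

lemma tube:
  assumes lip: "lip_field X {a0..b0} u" and g: "icurve {a0..b0} u \<gamma>" "\<gamma> ` {a0..b0} \<subseteq> X"
    and t0: "t0 \<in> {a0..b0}" and c: "c \<in> atlas S" "\<gamma> t0 \<in> fst c"
  obtains d r K where "d > 0" "r > 0" "K \<ge> 1" "cball (snd c (\<gamma> t0)) r \<subseteq> snd c ` (fst c \<inter> X)"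
    "\<And>t. t \<in> {a0..b0} \<Longrightarrow> \<bar>t - t0\<bar> < d \<Longrightarrow> \<gamma> t \<in> fst c \<and> snd c (\<gamma> t) \<in> cball (snd c (\<gamma> t0)) r"
    "\<And>a b \<gamma>' t. a0 \<le> a \<Longrightarrow> a \<le> t0 \<Longrightarrow> t0 \<le> b \<Longrightarrow> b \<le> b0 \<Longrightarrow> b - a < d \<Longrightarrow> icurve {a..b} u \<gamma>' \<Longrightarrow>
       \<gamma>' a \<in> fst c \<Longrightarrow> norm (snd c (\<gamma>' a) - snd c (\<gamma> a)) \<le> r / (4 * K) \<Longrightarrow> t \<in> {a..b} \<Longrightarrow>
       \<gamma>' t \<in> fst c \<and> snd c (\<gamma>' t) \<in> cball (snd c (\<gamma> t0)) r \<and>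
       norm (snd c (\<gamma>' t) - snd c (\<gamma> t)) \<le> K * norm (snd c (\<gamma>' a) - snd c (\<gamma> a))"
proof -
  define x0 where "x0 = snd c (\<gamma> t0)"
  have "\<gamma> t0 \<in> fst c \<inter> X" using c g t0 by auto
  then obtain r B where r: "r > 0" "B \<ge> 0" "cball x0 r \<subseteq> snd c ` (fst c \<inter> X)" and
    B: "\<And>t x y. t \<in> {a0..b0} \<Longrightarrow> x \<in> cball x0 r \<Longrightarrow> y \<in> cball x0 r \<Longrightarrow>
        norm (u t c (chart_inv c x) - u t c (chart_inv c y)) \<le> B * norm (x - y)"
    using lip[unfolded lip_field_def, rule_format, OF c(1), of "\<gamma> t0"] unfolding x0_def by (metis (no_types, lifting))
  obtain d1 where d1: "d1 > 0" "\<And>s. s \<in> {a0..b0} \<Longrightarrow> \<bar>s - t0\<bar> < d1 \<Longrightarrow> \<gamma> s \<in> fst c \<and> snd c (\<gamma> s) \<in> ball x0 (r / 2)"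
    by (rule curve_near_chart_point[OF icurve_continuous[OF g(1)] t0 c, of "ball x0 (r / 2)"])
      (use r in \<open>auto simp: x0_def\<close>)
  define d where "d = min d1 1"
  define K where "K = exp (B + 1)"
  have K: "K \<ge> 1" using r by (simp add: K_def)
  define C where "C = chart_inv c ` cball x0 r"
  have sub: "cball x0 r \<subseteq> snd c ` fst c" using r by auto
  have "closed C" unfolding C_def using closed_chart_ball[OF c(1) compact_cball sub] .
  have memC: "p \<in> C \<longleftrightarrow> p \<in> fst c \<and> snd c p \<in> cball x0 r" for p
    using chart_inv_chart[OF c(1)] chart_chart_inv[OF c(1)] sub unfolding C_def by (force simp: image_iff)
  have main: "\<gamma>' t \<in> fst c \<and> snd c (\<gamma>' t) \<in> cball x0 r \<and>
       norm (snd c (\<gamma>' t) - snd c (\<gamma> t)) \<le> K * norm (snd c (\<gamma>' a) - snd c (\<gamma> a))"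
    if ab: "a0 \<le> a" "a \<le> t0" "t0 \<le> b" "b \<le> b0" "b - a < d" and g': "icurve {a..b} u \<gamma>'"
      and ini: "\<gamma>' a \<in> fst c" "norm (snd c (\<gamma>' a) - snd c (\<gamma> a)) \<le> r / (4 * K)" and t: "t \<in> {a..b}" for a b \<gamma>' t
  proof -
    have gc: "\<gamma> s \<in> fst c" "snd c (\<gamma> s) \<in> ball x0 (r / 2)" if "s \<in> {a..b}" for s
      using d1(2)[of s] that ab by (auto simp: d_def)
    have est: "norm (snd c (\<gamma>' t) - snd c (\<gamma> t)) \<le> K * norm (snd c (\<gamma>' a) - snd c (\<gamma> a))"
      if tC: "t \<in> {a..b}" "\<And>s. s \<in> {a..t} \<Longrightarrow> \<gamma>' s \<in> C" for t
    proof -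
      define e where "e = (\<lambda>s. (snd c \<circ> \<gamma>') s - (snd c \<circ> \<gamma>) s)"
      have "norm (e t) \<le> (norm (e a) + 0) * exp ((B + 1) * (t - a))"
      proof (rule gronwall[where b = t and e' = "\<lambda>s. u s c (\<gamma>' s) - u s c (\<gamma> s)"])
        fix s assume s: "s \<in> {a..t}"
        show "(e has_vector_derivative u s c (\<gamma>' s) - u s c (\<gamma> s)) (at s within {a..t})"
          unfolding e_def
        proof (rule has_vector_derivative_diff)
          show "((snd c \<circ> \<gamma>') has_vector_derivative u s c (\<gamma>' s)) (at s within {a..t})"
            by (rule icurve_D[OF icurve_subset[OF g'] s c(1)]) (use tC s memC in auto)
          show "((snd c \<circ> \<gamma>) has_vector_derivative u s c (\<gamma> s)) (at s within {a..t})"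
            by (rule icurve_D[OF icurve_subset[OF g(1)] s c(1)]) (use tC s gc ab in auto)
        qed
        show "norm (u s c (\<gamma>' s) - u s c (\<gamma> s)) \<le> B * norm (e s) + 0"
          using B[of s "snd c (\<gamma>' s)" "snd c (\<gamma> s)"] gc[of s] tC s ab memC[of "\<gamma>' s"]
            subsetD[OF ball_subset_cball gc(2)[of s]] subsetD[OF subset_ball[of "r / 2" r x0] gc(2)[of s]] r(1)
          by (auto simp: e_def chart_inv_chart[OF c(1)])
      qed (use r tC in auto)
      also have "\<dots> \<le> (norm (e a) + 0) * K"
        using r tC ab mult_left_mono[of "t - a" 1 "B + 1"] by (intro mult_left_mono) (auto simp: K_def d_def)
      finally show ?thesis by (simp add: e_def mult.commute)
    qed
    have ball: "snd c (\<gamma>' t) \<in> ball x0 r" if tC: "t \<in> {a..b}" "\<And>s. s \<in> {a..t} \<Longrightarrow> \<gamma>' s \<in> C" for t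
    proof -
      have "norm (snd c (\<gamma>' t) - snd c (\<gamma> t)) \<le> K * (r / (4 * K))"
        using est[OF tC] mult_left_mono[OF ini(2), of K] K by auto
      also have "\<dots> = r / 4" using K by simp
      finally show ?thesis using gc(2)[OF tC(1)] r
        dist_triangle[of x0 "snd c (\<gamma>' t)" "snd c (\<gamma> t)"] by (simp add: dist_norm norm_minus_commute)
    qed
    have aC: "\<gamma>' a \<in> C"
    proof -
      have "r / (4 * K) \<le> r / 4" using K r by (simp add: field_simps)
      then have "dist x0 (snd c (\<gamma>' a)) \<le> r"
        using dist_triangle[of x0 "snd c (\<gamma>' a)" "snd c (\<gamma> a)"] gc(2)[of a] ab r ini(2)
        by (simp add: dist_norm norm_minus_commute)
      then show ?thesis using ini memC by simp
    qed
    \<comment> \<open>First-exit argument: at the infimum of the exit times the second curve is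
      still in the closed set \<open>C\<close>, hence by the estimate in the open ball, and so it
      remains in \<open>C\<close> for a little longer.\<close>
    define Z where "Z = {t \<in> {a..b}. \<gamma>' t \<notin> C}"
    have "Z = {}"
    proof (rule ccontr)
      assume ne: "Z \<noteq> {}"
      define z where "z = Inf Z"
      have bdd: "bdd_below Z" by (auto simp: Z_def)
      have lb: "a \<le> z" "z \<le> b" unfolding z_def using ne bdd
        by (auto simp: Z_def intro!: cInf_greatest) (metis (no_types, lifting) Z_def bdd atLeastAtMost_iff cInf_lower2 mem_Collect_eq)
      have before: "\<gamma>' s \<in> C" if "s \<in> {a..<z}" for s
      proof (rule ccontr)
        assume "\<gamma>' s \<notin> C" then have "s \<in> Z" using that lb by (auto simp: Z_def)
        then show False using cInf_lower[OF _ bdd] that by (force simp: z_def)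
      qed
      have zC: "\<gamma>' z \<in> C"
      proof (cases "z = a")
        case False
        then have az: "a < z" using lb by simp
        have "continuous_on {a..z} \<gamma>'" using icurve_continuous[OF g'] lb by (auto intro: continuous_on_subset)
        then have "closedin (top_of_set {a..z}) ({a..z} \<inter> \<gamma>' -` C)"
          using \<open>closed C\<close> by (rule continuous_closedin_preimage)
        then have "closed ({a..z} \<inter> \<gamma>' -` C)" using closedin_closed_trans by blast
        moreover have "{a..<z} \<subseteq> {a..z} \<inter> \<gamma>' -` C" using before by auto
        ultimately have "closure {a..<z} \<subseteq> {a..z} \<inter> \<gamma>' -` C" by (rule closure_minimal[rotated])
        then show ?thesis using az by (auto simp: subset_iff)
      qed (use aC in simp)
      have all: "\<gamma>' s \<in> C" if "s \<in> {a..z}" for s using before zC that by (cases "s = z") auto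
      have zb: "snd c (\<gamma>' z) \<in> ball x0 r" by (rule ball) (use lb all in auto)
      obtain h where h: "h > 0" "\<And>s. s \<in> {a..b} \<Longrightarrow> \<bar>s - z\<bar> < h \<Longrightarrow> \<gamma>' s \<in> fst c \<and> snd c (\<gamma>' s) \<in> ball x0 r"
        by (rule curve_near_chart_point[OF icurve_continuous[OF g'] _ c(1) _ open_ball zb]) (use lb zC memC in auto)
      obtain s where s: "s \<in> Z" "s < z + h" using cInf_lessD[OF ne, of "z + h"] h by (auto simp: z_def)
      have "z \<le> s" using cInf_lower[OF s(1) bdd] by (simp add: z_def)
      then have "\<gamma>' s \<in> C" using h(2)[of s] s memC[of "\<gamma>' s"] by (auto simp: Z_def)
      then show False using s by (simp add: Z_def)
    qed
    then have all: "\<gamma>' s \<in> C" if "s \<in> {a..b}" for s using that by (auto simp: Z_def)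
    show ?thesis using est[OF t] all t memC[of "\<gamma>' t"] by auto
  qed
  show ?thesis
  proof (rule that[OF _ r(1) K])
    show "d > 0" using d1 by (simp add: d_def)
    show "\<gamma> t \<in> fst c \<and> snd c (\<gamma> t) \<in> cball (snd c (\<gamma> t0)) r" if "t \<in> {a0..b0}" "\<bar>t - t0\<bar> < d" for t
    proof -
      have "\<gamma> t \<in> fst c" "snd c (\<gamma> t) \<in> ball x0 (r / 2)" using d1(2)[of t] that by (auto simp: d_def)
      then show ?thesis using subset_ball[of "r / 2" r x0] ball_subset_cball[of x0 r] r(1) by (auto simp: x0_def)
    qed
  qed (use r main in \<open>auto simp: x0_def\<close>)
qed

lemma icurve_unique_forward:
  assumes lip: "lip_field X {a0..b0} u" and g: "icurve {a0..b0} u \<gamma>" "\<gamma> ` {a0..b0} \<subseteq> X"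
    and g': "icurve {a0..b0} u \<gamma>'" "\<gamma>' a0 = \<gamma> a0" and t: "t \<in> {a0..b0}"
  shows "\<gamma>' t = \<gamma> t"
proof -
  have "a0 \<le> t" using t by simp
  have "a0 \<le> a0 \<and> t \<le> b0 \<longrightarrow> \<gamma>' a0 = \<gamma> a0 \<longrightarrow> \<gamma>' t = \<gamma> t"
  \<comment> \<open>Bisection: a transitive relation between endpoints that holds on all short
    intervals around each point holds on the whole interval. The same device serves
    \<open>lip_at_propagate\<close>, \<open>vel_at_propagate\<close> and
    \<open>first_variation\<close>, where the chart has to change along the curve.\<close>
  proof (rule Bolzano[OF \<open>a0 \<le> t\<close>, of "\<lambda>a b. a0 \<le> a \<and> b \<le> b0 \<longrightarrow> \<gamma>' a = \<gamma> a \<longrightarrow> \<gamma>' b = \<gamma> b"])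
    fix x assume x: "a0 \<le> x" "x \<le> t"
    obtain c where c: "c \<in> atlas S" "\<gamma> x \<in> fst c" using charts_cover by blast
    have x0: "x \<in> {a0..b0}" using x t by auto
    obtain d r K where d: "d > 0" "r > 0" "K \<ge> (1::real)"
      "\<And>t. t \<in> {a0..b0} \<Longrightarrow> \<bar>t - x\<bar> < d \<Longrightarrow> \<gamma> t \<in> fst c"
      "\<And>a b \<gamma>' t. a0 \<le> a \<Longrightarrow> a \<le> x \<Longrightarrow> x \<le> b \<Longrightarrow> b \<le> b0 \<Longrightarrow> b - a < d \<Longrightarrow> icurve {a..b} u \<gamma>' \<Longrightarrow>
       \<gamma>' a \<in> fst c \<Longrightarrow> norm (snd c (\<gamma>' a) - snd c (\<gamma> a)) \<le> r / (4 * K) \<Longrightarrow> t \<in> {a..b} \<Longrightarrow>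
       \<gamma>' t \<in> fst c \<and> norm (snd c (\<gamma>' t) - snd c (\<gamma> t)) \<le> K * norm (snd c (\<gamma>' a) - snd c (\<gamma> a))"
      using tube[OF lip g x0 c] by (smt (verit))
    show "\<exists>d>0. \<forall>a b. a \<le> x \<and> x \<le> b \<and> b - a < d \<longrightarrow> a0 \<le> a \<and> b \<le> b0 \<longrightarrow> \<gamma>' a = \<gamma> a \<longrightarrow> \<gamma>' b = \<gamma> b"
    proof (intro exI[of _ d] conjI allI impI)
      fix a b assume ab: "a \<le> x \<and> x \<le> b \<and> b - a < d" "a0 \<le> a \<and> b \<le> b0" "\<gamma>' a = \<gamma> a"
      have in_c: "\<gamma> a \<in> fst c" "\<gamma> b \<in> fst c" using d(4)[of a] d(4)[of b] ab by auto
      have "\<gamma>' b \<in> fst c \<and> norm (snd c (\<gamma>' b) - snd c (\<gamma> b)) \<le> K * norm (snd c (\<gamma>' a) - snd c (\<gamma> a))"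
        by (rule d(5)[where b = b]) (use ab in_c d icurve_subset[OF g'(1), of "{a..b}"] in auto)
      then have "\<gamma>' b \<in> fst c" "snd c (\<gamma>' b) = snd c (\<gamma> b)" using ab by auto
      then show "\<gamma>' b = \<gamma> b" using in_c chart_inv_chart[OF c(1)] by metis
    qed (rule d)
  qed auto
  then show ?thesis using g' t by auto
qed

text \<open>Time reversal carries forward uniqueness over to flows at negative times, whose curves
  live on \<open>closed_segment 0 t\<close> with t < 0.\<close>

lemma icurve_reflect:
  assumes "icurve J u \<gamma>" "J' = uminus ` J"
  shows "icurve J' (\<lambda>t c p. - u (- t) c p) (\<lambda>t. \<gamma> (- t))"
  unfolding icurve_def
proof (intro conjI ballI impI)
  have J: "uminus ` J' = J" using assms(2) by (simp add: image_image)
  show "continuous_on J' (\<lambda>t. \<gamma> (- t))"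
    by (rule continuous_on_compose2[OF icurve_continuous[OF assms(1)]]) (use J in \<open>auto intro: continuous_intros\<close>)
  fix t c assume t: "t \<in> J'" "c \<in> atlas S" "\<gamma> (- t) \<in> fst c"
  have "((snd c \<circ> \<gamma>) has_vector_derivative u (- t) c (\<gamma> (- t))) (at (- t) within uminus ` J')"
    unfolding J by (rule icurve_D[OF assms(1)]) (use t J in auto)
  then have "(((snd c \<circ> \<gamma>) \<circ> uminus) has_vector_derivative (- 1) *\<^sub>R u (- t) c (\<gamma> (- t))) (at t within J')"
    by (intro vector_diff_chain_within) (auto intro: derivative_eq_intros)
  then show "((snd c \<circ> (\<lambda>t. \<gamma> (- t))) has_vector_derivative - u (- t) c (\<gamma> (- t))) (at t within J')"
    by (simp add: o_def)
qed

lemma lip_field_reflect: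
  assumes "lip_field X J u" "J' = uminus ` J"
  shows "lip_field X J' (\<lambda>t c p. - u (- t) c p)"
proof -
  have "norm (- a - - b) = norm (a - b)" for a b :: "real^4" by (metis minus_diff_minus norm_minus_cancel)
  then show ?thesis using assms unfolding lip_field_def by (simp add: image_iff)
qed

lemma icurve_unique:
  assumes lip: "lip_field X (closed_segment 0 t) u" and g: "icurve (closed_segment 0 t) u \<gamma>" "\<gamma> ` closed_segment 0 t \<subseteq> X"
    and g': "icurve (closed_segment 0 t) u \<gamma>'" "\<gamma>' 0 = \<gamma> 0"
  shows "\<gamma>' t = \<gamma> t"
proof (cases "0 \<le> t")
  case True
  then show ?thesis
    using icurve_unique_forward[of X 0 t u \<gamma> \<gamma>' t] assms by (simp add: closed_segment_eq_real_ivl)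
next
  case False
  then have seg: "closed_segment 0 t = {t..0}" and im: "{0..-t} = uminus ` {t..0}"
    by (simp_all add: closed_segment_eq_real_ivl)
  have "(\<lambda>t. \<gamma>' (- t)) (- t) = (\<lambda>t. \<gamma> (- t)) (- t)"
  proof (rule icurve_unique_forward[of X 0 "- t" "\<lambda>t c p. - u (- t) c p" "\<lambda>t. \<gamma> (- t)" "\<lambda>t. \<gamma>' (- t)" "- t"])
    show "lip_field X {0..-t} (\<lambda>t c p. - u (- t) c p)" using lip_field_reflect[OF lip[unfolded seg] im] .
    show "icurve {0..-t} (\<lambda>t c p. - u (- t) c p) (\<lambda>t. \<gamma> (- t))" using icurve_reflect[OF g(1)[unfolded seg] im] .
    show "icurve {0..-t} (\<lambda>t c p. - u (- t) c p) (\<lambda>t. \<gamma>' (- t))" using icurve_reflect[OF g'(1)[unfolded seg] im] .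
  qed (use g g' False seg in auto)
  then show ?thesis by simp
qed

end

section \<open>Vector fields and their flows\<close>

context smooth_manifold begin

definition C1_field :: "'m set \<Rightarrow> ('m chart \<Rightarrow> 'm \<Rightarrow> real^4) \<Rightarrow> bool" where
  "C1_field X u \<longleftrightarrow> open X \<and> (\<forall>c\<in>atlas S. Ck_on (Suc 0) (in_chart c (u c)) (snd c ` (fst c \<inter> X))) \<and>
     (\<forall>c\<in>atlas S. \<forall>d\<in>atlas S. \<forall>p\<in>fst c \<inter> fst d \<inter> X. chart_deriv c (snd d) p (u c p) = u d p)"

lemma C1_field_lip:
  assumes "C1_field X u" shows "lip_field X J (\<lambda>_. u)"
  unfolding lip_field_def
proof (intro ballI)
  fix c p assume c: "c \<in> atlas S" and p: "p \<in> fst c \<inter> X"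
  have "open (snd c ` (fst c \<inter> X))" using assms c by (simp add: C1_field_def open_chart_image_Int)
  then obtain r where r: "r > 0" "cball (snd c p) r \<subseteq> snd c ` (fst c \<inter> X)"
    using p open_contains_cball by blast
  have "Ck_on (Suc 0) (in_chart c (u c)) (snd c ` (fst c \<inter> X))" using assms c by (simp add: C1_field_def)
  from C1_Lipschitz[OF this compact_cball convex_cball r(2)] obtain B where "B \<ge> 0"
    "\<And>x y. x \<in> cball (snd c p) r \<Longrightarrow> y \<in> cball (snd c p) r \<Longrightarrow>
      norm (in_chart c (u c) x - in_chart c (u c) y) \<le> B * norm (x - y)" by metis
  then show "\<exists>r>0. \<exists>B\<ge>0. cball (snd c p) r \<subseteq> snd c ` (fst c \<inter> X) \<and> (\<forall>t\<in>J. \<forall>x\<in>cball (snd c p) r. \<forall>y\<in>cball (snd c p) r.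
        norm (u c (chart_inv c x) - u c (chart_inv c y)) \<le> B * norm (x - y))"
    using r by (intro exI[of _ r] exI[of _ B]) (auto simp: in_chart_def)
qed

lemma lip_field_combination:
  assumes u: "lip_field X J u" and v: "lip_field X J v"
    and M: "\<And>t. t \<in> J \<Longrightarrow> \<bar>\<alpha> t\<bar> \<le> M" "\<And>t. t \<in> J \<Longrightarrow> \<bar>\<beta> t\<bar> \<le> M"
  shows "lip_field X J (\<lambda>t c p. \<alpha> t *\<^sub>R u t c p + \<beta> t *\<^sub>R v t c p)"
  unfolding lip_field_def
proof (intro ballI)
  fix c p assume c: "c \<in> atlas S" and p: "p \<in> fst c \<inter> X"
  obtain r B where 1: "r > 0" "B \<ge> 0" "cball (snd c p) r \<subseteq> snd c ` (fst c \<inter> X)"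
     "\<forall>t\<in>J. \<forall>x\<in>cball (snd c p) r. \<forall>y\<in>cball (snd c p) r. norm (u t c (chart_inv c x) - u t c (chart_inv c y)) \<le> B * norm (x - y)"
    using u[unfolded lip_field_def, rule_format, OF c p] by blast
  obtain r' B' where 2: "r' > 0" "B' \<ge> 0" "cball (snd c p) r' \<subseteq> snd c ` (fst c \<inter> X)"
     "\<forall>t\<in>J. \<forall>x\<in>cball (snd c p) r'. \<forall>y\<in>cball (snd c p) r'. norm (v t c (chart_inv c x) - v t c (chart_inv c y)) \<le> B' * norm (x - y)"
    using v[unfolded lip_field_def, rule_format, OF c p] by blast
  have est: "norm ((\<alpha> t *\<^sub>R u t c (chart_inv c x) + \<beta> t *\<^sub>R v t c (chart_inv c x)) - (\<alpha> t *\<^sub>R u t c (chart_inv c y) + \<beta> t *\<^sub>R v t c (chart_inv c y)))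
      \<le> (\<bar>M\<bar> * B + \<bar>M\<bar> * B') * norm (x - y)" (is "norm ?l \<le> _")
    if t: "t \<in> J" and xy: "x \<in> cball (snd c p) (min r r')" "y \<in> cball (snd c p) (min r r')" for t x y
  proof -
    define du dv where "du = u t c (chart_inv c x) - u t c (chart_inv c y)" and "dv = v t c (chart_inv c x) - v t c (chart_inv c y)"
    have eq: "?l = \<alpha> t *\<^sub>R du + \<beta> t *\<^sub>R dv" by (simp add: du_def dv_def algebra_simps)
    have "norm ?l \<le> \<bar>\<alpha> t\<bar> * norm du + \<bar>\<beta> t\<bar> * norm dv"
      unfolding eq by (rule norm_triangle_le) (simp only: norm_scaleR order_refl)
    also have "\<dots> \<le> \<bar>M\<bar> * (B * norm (x - y)) + \<bar>M\<bar> * (B' * norm (x - y))"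
      using M[OF t] 1(4)[rule_format, OF t, of x y] 2(4)[rule_format, OF t, of x y] xy unfolding du_def dv_def
      by (intro add_mono mult_mono) auto
    finally show ?thesis by (simp add: algebra_simps)
  qed
  show "\<exists>r>0. \<exists>B\<ge>0. cball (snd c p) r \<subseteq> snd c ` (fst c \<inter> X) \<and> (\<forall>t\<in>J. \<forall>x\<in>cball (snd c p) r. \<forall>y\<in>cball (snd c p) r.
     norm ((\<alpha> t *\<^sub>R u t c (chart_inv c x) + \<beta> t *\<^sub>R v t c (chart_inv c x)) - (\<alpha> t *\<^sub>R u t c (chart_inv c y) + \<beta> t *\<^sub>R v t c (chart_inv c y)))
      \<le> B * norm (x - y))"
  proof (rule exI[of _ "min r r'"], intro conjI exI[of _ "\<bar>M\<bar> * B + \<bar>M\<bar> * B'"] ballI est)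
    show "cball (snd c p) (min r r') \<subseteq> snd c ` (fst c \<inter> X)" using 1(3) by auto
  qed (use 1 2 in auto)
qed

lemma icurve_affine:
  assumes "icurve J u \<gamma>" "(\<lambda>s. k * s + b) ` J' \<subseteq> J"
  shows "icurve J' (\<lambda>s c p. k *\<^sub>R u (k * s + b) c p) (\<lambda>s. \<gamma> (k * s + b))"
  unfolding icurve_def
proof (intro conjI ballI impI)
  show "continuous_on J' (\<lambda>t. \<gamma> (k * t + b))"
    by (rule continuous_on_compose2[OF icurve_continuous[OF assms(1)]]) (use assms in \<open>auto intro!: continuous_intros\<close>)
  fix t c assume t: "t \<in> J'" "c \<in> atlas S" "\<gamma> (k * t + b) \<in> fst c"
  have "((snd c \<circ> \<gamma>) has_vector_derivative u (k * t + b) c (\<gamma> (k * t + b))) (at (k * t + b) within J)"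
    by (rule icurve_D[OF assms(1)]) (use t assms in auto)
  then have "((snd c \<circ> \<gamma>) has_vector_derivative u (k * t + b) c (\<gamma> (k * t + b))) (at (k * t + b) within (\<lambda>s. k * s + b) ` J')"
    by (rule has_vector_derivative_within_subset) (use assms in auto)
  then have "(((snd c \<circ> \<gamma>) \<circ> (\<lambda>s. k * s + b)) has_vector_derivative k *\<^sub>R u (k * t + b) c (\<gamma> (k * t + b))) (at t within J')"
    by (intro vector_diff_chain_within) (auto intro!: derivative_eq_intros simp: has_real_derivative_iff_has_vector_derivative[symmetric])
  then show "((snd c \<circ> (\<lambda>s. \<gamma> (k * s + b))) has_vector_derivative k *\<^sub>R u (k * t + b) c (\<gamma> (k * t + b))) (at t within J')"
    by (simp add: o_def)
qed

text \<open>A family of points \<open>y q\<close> approaches \<open>p\<close> at linear speed as \<open>q \<rightarrow> q0\<close>; for real \<open>q\<close>, it has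
  the velocity \<open>w\<close> at \<open>q0\<close>.\<close>

definition lip_at :: "'q::real_normed_vector \<Rightarrow> 'm \<Rightarrow> ('q \<Rightarrow> 'm) \<Rightarrow> 'm chart \<Rightarrow> bool" where
  "lip_at q0 p y c \<longleftrightarrow> (\<exists>K. \<forall>\<^sub>F q in at q0. y q \<in> fst c \<and> norm (snd c (y q) - snd c p) \<le> K * norm (q - q0))"

definition vel_at :: "real \<Rightarrow> 'm \<Rightarrow> (real \<Rightarrow> 'm) \<Rightarrow> ('m chart \<Rightarrow> 'm \<Rightarrow> real^4) \<Rightarrow> 'm chart \<Rightarrow> bool" where
  "vel_at q0 p y w c \<longleftrightarrow> (\<forall>e>0. \<forall>\<^sub>F q in at q0. y q \<in> fst c \<and>
     norm (snd c (y q) - snd c p - (q - q0) *\<^sub>R w c p) \<le> e * norm (q - q0))"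

lemma lip_at_change_chart:
  assumes c: "c \<in> atlas S" "d \<in> atlas S" "p \<in> fst c" "p \<in> fst d" and l: "lip_at q0 p y c"
  shows "lip_at q0 p y d"
proof -
  obtain K where K: "\<forall>\<^sub>F q in at q0. y q \<in> fst c \<and> norm (snd c (y q) - snd c p) \<le> K * norm (q - q0)"
    using l unfolding lip_at_def by blast
  obtain \<eta> where \<eta>: "\<eta> > 0" "\<And>q. q \<in> fst c \<Longrightarrow> norm (snd c q - snd c p) < \<eta> \<Longrightarrow> q \<in> fst d \<and>
    norm (snd d q - snd d p - chart_deriv c (snd d) p (snd c q - snd c p)) \<le> 1 * norm (snd c q - snd c p)"
    using transition_expansion[OF c, of 1] by (metis zero_less_one)
  obtain B where B: "\<And>v. norm (chart_deriv c (snd d) p v) \<le> norm v * B"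
    using bounded_linear.bounded[OF has_derivative_bounded_linear[OF transition_has_derivative[OF c]]] by blast
  have "((\<lambda>q. K * norm (q - q0)) \<longlongrightarrow> K * norm (q0 - q0)) (at q0)" by (intro tendsto_intros)
  then have "\<forall>\<^sub>F q in at q0. K * norm (q - q0) < \<eta>" using \<eta>(1) by (auto dest: order_tendstoD)
  with K have "\<forall>\<^sub>F q in at q0. y q \<in> fst d \<and> norm (snd d (y q) - snd d p) \<le> (K * (1 + \<bar>B\<bar>)) * norm (q - q0)"
  proof eventually_elim
    case (elim q)
    define \<delta> where "\<delta> = snd c (y q) - snd c p"
    have 1: "y q \<in> fst d" "norm (snd d (y q) - snd d p - chart_deriv c (snd d) p \<delta>) \<le> norm \<delta>"
      using \<eta>(2)[of "y q"] elim by (auto simp: \<delta>_def)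
    have "norm (snd d (y q) - snd d p) \<le> norm \<delta> + norm (chart_deriv c (snd d) p \<delta>)"
      using 1(2) norm_triangle_sub[of "snd d (y q) - snd d p" "chart_deriv c (snd d) p \<delta>"] by linarith
    also have "\<dots> \<le> norm \<delta> * (1 + \<bar>B\<bar>)"
      using B[of \<delta>] mult_left_mono[OF abs_ge_self[of B] norm_ge_zero[of \<delta>]] by (simp add: algebra_simps)
    also have "\<dots> \<le> (K * norm (q - q0)) * (1 + \<bar>B\<bar>)" using elim by (intro mult_right_mono) (auto simp: \<delta>_def)
    finally show ?case using 1 by (simp add: algebra_simps)
  qed
  then show ?thesis unfolding lip_at_def by blast
qed

lemma vel_at_imp_lip_at:
  assumes "vel_at q0 p y w c" shows "lip_at q0 p y c"
proof -
  have "\<forall>\<^sub>F q in at q0. y q \<in> fst c \<and> norm (snd c (y q) - snd c p - (q - q0) *\<^sub>R w c p) \<le> 1 * norm (q - q0)"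
    using assms unfolding vel_at_def by (rule allE[of _ 1]) simp
  then have "\<forall>\<^sub>F q in at q0. y q \<in> fst c \<and> norm (snd c (y q) - snd c p) \<le> (1 + norm (w c p)) * norm (q - q0)"
  proof eventually_elim
    case (elim q)
    have "norm (snd c (y q) - snd c p) \<le> norm (snd c (y q) - snd c p - (q - q0) *\<^sub>R w c p) + norm ((q - q0) *\<^sub>R w c p)"
      by (metis diff_add_cancel norm_triangle_ineq)
    then have "norm (snd c (y q) - snd c p) \<le> 1 * norm (q - q0) + norm (q - q0) * norm (w c p)"
      using elim[THEN conjunct2] unfolding norm_scaleR real_norm_def by linarith
    then show ?case using elim by (simp add: algebra_simps)
  qed
  then show ?thesis unfolding lip_at_def by blast
qed

lemma vel_at_change_chart:
  assumes c: "c \<in> atlas S" "d \<in> atlas S" "p \<in> fst c" "p \<in> fst d" and l: "vel_at q0 p y w c"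
    and w: "chart_deriv c (snd d) p (w c p) = w d p"
  shows "vel_at q0 p y w d"
  unfolding vel_at_def
proof (intro allI impI)
  fix e :: real assume e: "e > 0"
  obtain K where K: "\<forall>\<^sub>F q in at q0. y q \<in> fst c \<and> norm (snd c (y q) - snd c p) \<le> K * norm (q - q0)"
    using vel_at_imp_lip_at[OF l] unfolding lip_at_def by blast
  interpret T: bounded_linear "chart_deriv c (snd d) p"
    by (rule has_derivative_bounded_linear[OF transition_has_derivative[OF c]])
  obtain B where B: "B > 0" "\<And>v. norm (chart_deriv c (snd d) p v) \<le> norm v * B"
    using T.pos_bounded by blast
  define e1 where "e1 = e / (2 * (\<bar>K\<bar> + 1))"
  have e1: "e1 > 0" using e by (simp add: e1_def)
  obtain \<eta> where \<eta>: "\<eta> > 0" "\<And>q. q \<in> fst c \<Longrightarrow> norm (snd c q - snd c p) < \<eta> \<Longrightarrow> q \<in> fst d \<and>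
    norm (snd d q - snd d p - chart_deriv c (snd d) p (snd c q - snd c p)) \<le> e1 * norm (snd c q - snd c p)"
    using transition_expansion[OF c e1] by metis
  have "((\<lambda>q. K * norm (q - q0)) \<longlongrightarrow> K * norm (q0 - q0)) (at q0)" by (intro tendsto_intros)
  then have "\<forall>\<^sub>F q in at q0. K * norm (q - q0) < \<eta>" using \<eta>(1) by (auto dest: order_tendstoD)
  moreover have "\<forall>\<^sub>F q in at q0. y q \<in> fst c \<and>
     norm (snd c (y q) - snd c p - (q - q0) *\<^sub>R w c p) \<le> (e / (2 * B)) * norm (q - q0)"
    using l e B unfolding vel_at_def by (meson divide_pos_pos mult_pos_pos zero_less_numeral)
  ultimately show "\<forall>\<^sub>F q in at q0. y q \<in> fst d \<and> norm (snd d (y q) - snd d p - (q - q0) *\<^sub>R w d p) \<le> e * norm (q - q0)"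
    using K
  proof eventually_elim
    case (elim q)
    define \<delta> where "\<delta> = snd c (y q) - snd c p"
    define T where "T = chart_deriv c (snd d) p"
    have 1: "y q \<in> fst d" "norm (snd d (y q) - snd d p - T \<delta>) \<le> e1 * norm \<delta>"
      using \<eta>(2)[of "y q"] elim by (auto simp: \<delta>_def T_def)
    have "snd d (y q) - snd d p - (q - q0) *\<^sub>R w d p = (snd d (y q) - snd d p - T \<delta>) + T (\<delta> - (q - q0) *\<^sub>R w c p)"
      by (simp add: T_def T.diff T.scaleR w)
    then have "norm (snd d (y q) - snd d p - (q - q0) *\<^sub>R w d p) \<le> e1 * norm \<delta> + norm (\<delta> - (q - q0) *\<^sub>R w c p) * B"
      using 1(2) B(2)[of "\<delta> - (q - q0) *\<^sub>R w c p"] norm_triangle_ineq[of "snd d (y q) - snd d p - T \<delta>" "T (\<delta> - (q - q0) *\<^sub>R w c p)"]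
      unfolding T_def by (simp only:)
    also have "\<dots> \<le> e1 * (K * norm (q - q0)) + ((e / (2 * B)) * norm (q - q0)) * B"
      using elim e1 B by (intro add_mono mult_left_mono mult_right_mono) (auto simp: \<delta>_def)
    also have "\<dots> \<le> e / 2 * norm (q - q0) + e / 2 * norm (q - q0)"
    proof (rule add_mono)
      have "e1 * K \<le> e1 * (\<bar>K\<bar> + 1)" using e1 by simp
      also have "\<dots> = e / 2" using e by (simp add: e1_def field_simps)
      finally have "e1 * K \<le> e / 2" .
      from mult_right_mono[OF this norm_ge_zero[of "q - q0"]] show "e1 * (K * norm (q - q0)) \<le> e / 2 * norm (q - q0)" by (simp add: mult_ac)
    qed (use B in simp)
    finally show ?case using 1 by simp
  qed
qed

lemma lip_at_tendsto:
  assumes "c \<in> atlas S" "p \<in> fst c" "lip_at q0 p y c" shows "(y \<longlongrightarrow> p) (at q0)"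
proof -
  obtain K where K: "\<forall>\<^sub>F q in at q0. y q \<in> fst c \<and> norm (snd c (y q) - snd c p) \<le> K * norm (q - q0)"
    using assms unfolding lip_at_def by blast
  have yc: "\<forall>\<^sub>F q in at q0. y q \<in> fst c" using K by (rule eventually_mono) simp
  have "((\<lambda>q. K * norm (q - q0)) \<longlongrightarrow> K * norm (q0 - q0)) (at q0)" by (intro tendsto_intros)
  then have "((\<lambda>q. K * norm (q - q0)) \<longlongrightarrow> 0) (at q0)" by simp
  moreover have "\<forall>\<^sub>F q in at q0. norm (snd c (y q) - snd c p) \<le> K * norm (q - q0)" using K by (rule eventually_mono) simp
  ultimately have "((\<lambda>q. snd c (y q) - snd c p) \<longlongrightarrow> 0) (at q0)" by (rule Lim_null_comparison[rotated])
  then have lim: "((\<lambda>q. snd c (y q)) \<longlongrightarrow> snd c p) (at q0)" by (simp only: LIM_zero_iff)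
  have ev: "\<forall>\<^sub>F q in at q0. snd c (y q) \<in> snd c ` fst c" using yc by eventually_elim blast
  have "((\<lambda>q. chart_inv c (snd c (y q))) \<longlongrightarrow> chart_inv c (snd c p)) (at q0)"
    by (rule continuous_on_tendsto_compose[OF continuous_on_chart_inv[OF assms(1)] lim imageI[OF assms(2)] ev])
  moreover have "\<forall>\<^sub>F q in at q0. chart_inv c (snd c (y q)) = y q"
    using yc by eventually_elim (simp add: chart_inv_chart assms)
  ultimately show ?thesis by (simp add: chart_inv_chart assms tendsto_cong)
qed

lemma icurve_vel_at:
  assumes "icurve UNIV (\<lambda>_. u) \<gamma>" "c \<in> atlas S" "\<gamma> t \<in> fst c"
  shows "vel_at t (\<gamma> t) \<gamma> u c"
  unfolding vel_at_def
proof (intro allI impI)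
  fix e :: real assume e: "e > 0"
  have "((snd c \<circ> \<gamma>) has_derivative (\<lambda>h. h *\<^sub>R u c (\<gamma> t))) (at t)"
    using icurve_D[OF assms(1) _ assms(2,3)] by (simp add: has_vector_derivative_def)
  then obtain d where d: "d > 0" "\<And>q. norm (q - t) < d \<Longrightarrow>
      norm (snd c (\<gamma> q) - snd c (\<gamma> t) - (q - t) *\<^sub>R u c (\<gamma> t)) \<le> e * norm (q - t)"
    using e unfolding has_derivative_at_alt by (auto simp: o_def)
  have "(\<gamma> \<longlongrightarrow> \<gamma> t) (at t)" using icurve_continuous[OF assms(1)] by (simp add: continuous_on_def)
  then have "\<forall>\<^sub>F q in at t. \<gamma> q \<in> fst c" by (rule topological_tendstoD) (use assms open_chart in auto)
  moreover have "\<forall>\<^sub>F q in at t. norm (q - t) < d" using d(1) by (auto simp: eventually_at dist_norm)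
  ultimately show "\<forall>\<^sub>F q in at t. \<gamma> q \<in> fst c \<and> norm (snd c (\<gamma> q) - snd c (\<gamma> t) - (q - t) *\<^sub>R u c (\<gamma> t)) \<le> e * norm (q - t)"
    by eventually_elim (use d in auto)
qed

text \<open>The estimate of \<open>tube\<close> is applied to all members of a family at once. The
  resulting constant and the neighborhood of \<open>q0\<close> serve all times in the interval
  simultaneously, which the integral estimates of the first variation need.\<close>

lemma lip_at_tube:
  assumes u: "C1_field X u" and g: "icurve {a0..b0} (\<lambda>_. u) \<gamma>" "\<gamma> ` {a0..b0} \<subseteq> X"
    and Y: "\<forall>\<^sub>F q in at q0. icurve {a0..b0} (\<lambda>_. u) (Y q)"
    and t0: "t0 \<in> {a0..b0}" and c: "c \<in> atlas S" "\<gamma> t0 \<in> fst c"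
  obtains d r where "d > 0" "r > 0" "cball (snd c (\<gamma> t0)) r \<subseteq> snd c ` (fst c \<inter> X)"
    "\<And>t. t \<in> {a0..b0} \<Longrightarrow> \<bar>t - t0\<bar> < d \<Longrightarrow> \<gamma> t \<in> fst c \<and> snd c (\<gamma> t) \<in> cball (snd c (\<gamma> t0)) r"
    "\<And>a b. a0 \<le> a \<Longrightarrow> a \<le> t0 \<Longrightarrow> t0 \<le> b \<Longrightarrow> b \<le> b0 \<Longrightarrow> b - a < d \<Longrightarrow> lip_at q0 (\<gamma> a) (\<lambda>q. Y q a) c \<Longrightarrow>
      \<exists>K\<ge>0. \<forall>\<^sub>F q in at q0. \<forall>t\<in>{a..b}. Y q t \<in> fst c \<and> snd c (Y q t) \<in> cball (snd c (\<gamma> t0)) r \<and>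
        norm (snd c (Y q t) - snd c (\<gamma> t)) \<le> K * norm (q - q0)"
proof (rule tube[OF C1_field_lip[OF u] g t0 c])
  fix d r K :: real assume d: "d > 0" "r > 0" "K \<ge> 1" "cball (snd c (\<gamma> t0)) r \<subseteq> snd c ` (fst c \<inter> X)"
    "\<And>t. t \<in> {a0..b0} \<Longrightarrow> \<bar>t - t0\<bar> < d \<Longrightarrow> \<gamma> t \<in> fst c \<and> snd c (\<gamma> t) \<in> cball (snd c (\<gamma> t0)) r"
    "\<And>a b \<gamma>' t. a0 \<le> a \<Longrightarrow> a \<le> t0 \<Longrightarrow> t0 \<le> b \<Longrightarrow> b \<le> b0 \<Longrightarrow> b - a < d \<Longrightarrow> icurve {a..b} (\<lambda>_. u) \<gamma>' \<Longrightarrow>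
       \<gamma>' a \<in> fst c \<Longrightarrow> norm (snd c (\<gamma>' a) - snd c (\<gamma> a)) \<le> r / (4 * K) \<Longrightarrow> t \<in> {a..b} \<Longrightarrow>
       \<gamma>' t \<in> fst c \<and> snd c (\<gamma>' t) \<in> cball (snd c (\<gamma> t0)) r \<and>
       norm (snd c (\<gamma>' t) - snd c (\<gamma> t)) \<le> K * norm (snd c (\<gamma>' a) - snd c (\<gamma> a))"
  show thesis
  proof (rule that[OF d(1,2,4,5)])
    fix a b assume ab: "a0 \<le> a" "a \<le> t0" "t0 \<le> b" "b \<le> b0" "b - a < d" and l: "lip_at q0 (\<gamma> a) (\<lambda>q. Y q a) c"
    obtain L where L: "\<forall>\<^sub>F q in at q0. Y q a \<in> fst c \<and> norm (snd c (Y q a) - snd c (\<gamma> a)) \<le> L * norm (q - q0)"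
      using l unfolding lip_at_def by blast
    have "((\<lambda>q. L * norm (q - q0)) \<longlongrightarrow> L * norm (q0 - q0)) (at q0)" by (intro tendsto_intros)
    then have "\<forall>\<^sub>F q in at q0. L * norm (q - q0) < r / (4 * K)"
      by (rule order_tendstoD) (use d in auto)
    with L Y have "\<forall>\<^sub>F q in at q0. \<forall>t\<in>{a..b}. Y q t \<in> fst c \<and> snd c (Y q t) \<in> cball (snd c (\<gamma> t0)) r \<and>
        norm (snd c (Y q t) - snd c (\<gamma> t)) \<le> (K * \<bar>L\<bar>) * norm (q - q0)"
    proof eventually_elim
      case (elim q)
      have i: "icurve {a..b} (\<lambda>_. u) (Y q)" using elim(2) ab by (auto intro: icurve_subset)
      show ?case
      proof
        fix t assume t: "t \<in> {a..b}"
        have *: "Y q t \<in> fst c \<and> snd c (Y q t) \<in> cball (snd c (\<gamma> t0)) r \<and>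
           norm (snd c (Y q t) - snd c (\<gamma> t)) \<le> K * norm (snd c (Y q a) - snd c (\<gamma> a))"
          by (rule d(6)[OF ab i _ _ t]) (use elim in auto)
        moreover have "K * norm (snd c (Y q a) - snd c (\<gamma> a)) \<le> K * (\<bar>L\<bar> * norm (q - q0))"
          using elim d(3) mult_right_mono[OF abs_ge_self[of L] norm_ge_zero[of "q - q0"]] by (intro mult_left_mono) auto
        ultimately show "Y q t \<in> fst c \<and> snd c (Y q t) \<in> cball (snd c (\<gamma> t0)) r \<and>
          norm (snd c (Y q t) - snd c (\<gamma> t)) \<le> (K * \<bar>L\<bar>) * norm (q - q0)" by (auto simp: mult.assoc)
      qed
    qed
    then show "\<exists>K\<ge>0. \<forall>\<^sub>F q in at q0. \<forall>t\<in>{a..b}. Y q t \<in> fst c \<and> snd c (Y q t) \<in> cball (snd c (\<gamma> t0)) r \<and>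
        norm (snd c (Y q t) - snd c (\<gamma> t)) \<le> K * norm (q - q0)"
      using d(3) by (intro exI[of _ "K * \<bar>L\<bar>"]) auto
  qed
qed

lemma lip_at_propagate:
  assumes u: "C1_field X u" and g: "icurve {a0..b0} (\<lambda>_. u) \<gamma>" "\<gamma> ` {a0..b0} \<subseteq> X"
    and Y: "\<forall>\<^sub>F q in at q0. icurve {a0..b0} (\<lambda>_. u) (Y q)"
    and l: "c0 \<in> atlas S" "\<gamma> a0 \<in> fst c0" "lip_at q0 (\<gamma> a0) (\<lambda>q. Y q a0) c0"
    and t: "t \<in> {a0..b0}" and c: "c \<in> atlas S" "\<gamma> t \<in> fst c"
  shows "lip_at q0 (\<gamma> t) (\<lambda>q. Y q t) c"
proof -
  define P where "P = (\<lambda>a. \<exists>c\<in>atlas S. \<gamma> a \<in> fst c \<and> lip_at q0 (\<gamma> a) (\<lambda>q. Y q a) c)"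
  have "a0 \<le> t" using t by simp
  have "a0 \<le> a0 \<and> t \<le> b0 \<longrightarrow> P a0 \<longrightarrow> P t"
  proof (rule Bolzano[OF \<open>a0 \<le> t\<close>, of "\<lambda>a b. a0 \<le> a \<and> b \<le> b0 \<longrightarrow> P a \<longrightarrow> P b"])
    fix x assume "a0 \<le> x" "x \<le> t"
    then have x: "x \<in> {a0..b0}" using t by auto
    obtain c where c: "c \<in> atlas S" "\<gamma> x \<in> fst c" using charts_cover by blast
    show "\<exists>d>0. \<forall>a b. a \<le> x \<and> x \<le> b \<and> b - a < d \<longrightarrow> a0 \<le> a \<and> b \<le> b0 \<longrightarrow> P a \<longrightarrow> P b"
    proof (rule lip_at_tube[OF u g Y x c])
      fix d r :: real assume d: "d > 0" "\<And>t. t \<in> {a0..b0} \<Longrightarrow> \<bar>t - x\<bar> < d \<Longrightarrow> \<gamma> t \<in> fst c \<and> snd c (\<gamma> t) \<in> cball (snd c (\<gamma> x)) r"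
       "\<And>a b. a0 \<le> a \<Longrightarrow> a \<le> x \<Longrightarrow> x \<le> b \<Longrightarrow> b \<le> b0 \<Longrightarrow> b - a < d \<Longrightarrow> lip_at q0 (\<gamma> a) (\<lambda>q. Y q a) c \<Longrightarrow>
        \<exists>K\<ge>0. \<forall>\<^sub>F q in at q0. \<forall>t\<in>{a..b}. Y q t \<in> fst c \<and> snd c (Y q t) \<in> cball (snd c (\<gamma> x)) r \<and>
          norm (snd c (Y q t) - snd c (\<gamma> t)) \<le> K * norm (q - q0)"
      show ?thesis
      proof (intro exI[of _ d] conjI allI impI d(1))
        fix a b assume ab: "a \<le> x \<and> x \<le> b \<and> b - a < d" "a0 \<le> a \<and> b \<le> b0" "P a"
        then obtain c' where c': "c' \<in> atlas S" "\<gamma> a \<in> fst c'" "lip_at q0 (\<gamma> a) (\<lambda>q. Y q a) c'" unfolding P_def by blast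
        have in_c: "\<gamma> a \<in> fst c" "\<gamma> b \<in> fst c" using d(2)[of a] d(2)[of b] ab by auto
        have "lip_at q0 (\<gamma> a) (\<lambda>q. Y q a) c" by (rule lip_at_change_chart[OF c'(1) c(1) c'(2) in_c(1) c'(3)])
        from d(3)[OF _ _ _ _ _ this, of b] ab obtain K where "\<forall>\<^sub>F q in at q0. \<forall>t\<in>{a..b}. Y q t \<in> fst c \<and> snd c (Y q t) \<in> cball (snd c (\<gamma> x)) r \<and>
          norm (snd c (Y q t) - snd c (\<gamma> t)) \<le> K * norm (q - q0)" by auto
        then have "\<forall>\<^sub>F q in at q0. Y q b \<in> fst c \<and> norm (snd c (Y q b) - snd c (\<gamma> b)) \<le> K * norm (q - q0)"
          by eventually_elim (use ab in auto)
        then show "P b" unfolding P_def lip_at_def using c in_c by blast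
      qed
    qed
  qed auto
  then have "P t" using l t unfolding P_def by auto
  then show ?thesis unfolding P_def using lip_at_change_chart c by blast
qed

end

section \<open>Commuting flows\<close>

context smooth_manifold begin

text \<open>The vanishing of the Lie bracket [u, v] in coordinates.\<close>

definition commuting :: "'m set \<Rightarrow> ('m chart \<Rightarrow> 'm \<Rightarrow> real^4) \<Rightarrow> ('m chart \<Rightarrow> 'm \<Rightarrow> real^4) \<Rightarrow> bool" where
  "commuting X u v \<longleftrightarrow> (\<forall>c\<in>atlas S. \<forall>p\<in>fst c \<inter> X. chart_deriv c (u c) p (v c p) = chart_deriv c (v c) p (u c p))"

lemma C1_field_has_derivative:
  assumes "C1_field X u" "c \<in> atlas S" "p \<in> fst c" "p \<in> X"
  shows "(in_chart c (u c) has_derivative chart_deriv c (u c) p) (at (snd c p))"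
  unfolding chart_deriv_def
  by (rule Ck_on_has_derivative[of 0 _ "snd c ` (fst c \<inter> X)"]) (use assms in \<open>auto simp: C1_field_def\<close>)

text \<open>A flow maps a velocity along a commuting field to a velocity along the same field: in a chart the
  deviation \<open>c (Y q t) - c (\<gamma> t) - (q - q0) w (\<gamma> t)\<close> satisfies the linearized equation up to
  \<open>o(q - q0)\<close>.\<close>

lemma vel_at_step:
  assumes u: "C1_field X u" and w: "C1_field X w" "commuting X u w"
    and g: "icurve {a0..b0} (\<lambda>_. u) \<gamma>" "\<gamma> ` {a0..b0} \<subseteq> X"
    and Y: "\<forall>\<^sub>F q in at q0. icurve {a0..b0} (\<lambda>_. u) (Y q)"
    and x: "x \<in> {a0..b0}" and c: "c \<in> atlas S" "\<gamma> x \<in> fst c"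
  obtains d where "d > 0" "\<And>t. t \<in> {a0..b0} \<Longrightarrow> \<bar>t - x\<bar> < d \<Longrightarrow> \<gamma> t \<in> fst c"
    "\<And>a b. a0 \<le> a \<Longrightarrow> a \<le> x \<Longrightarrow> x \<le> b \<Longrightarrow> b \<le> b0 \<Longrightarrow> b - a < d \<Longrightarrow> vel_at q0 (\<gamma> a) (\<lambda>q. Y q a) w c \<Longrightarrow>
      vel_at q0 (\<gamma> b) (\<lambda>q. Y q b) w c"
proof (rule lip_at_tube[OF u g Y x c])
  fix d r :: real assume d: "d > 0" "r > 0" "cball (snd c (\<gamma> x)) r \<subseteq> snd c ` (fst c \<inter> X)"
    "\<And>t. t \<in> {a0..b0} \<Longrightarrow> \<bar>t - x\<bar> < d \<Longrightarrow> \<gamma> t \<in> fst c \<and> snd c (\<gamma> t) \<in> cball (snd c (\<gamma> x)) r"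
    "\<And>a b. a0 \<le> a \<Longrightarrow> a \<le> x \<Longrightarrow> x \<le> b \<Longrightarrow> b \<le> b0 \<Longrightarrow> b - a < d \<Longrightarrow> lip_at q0 (\<gamma> a) (\<lambda>q. Y q a) c \<Longrightarrow>
      \<exists>K\<ge>0. \<forall>\<^sub>F q in at q0. \<forall>t\<in>{a..b}. Y q t \<in> fst c \<and> snd c (Y q t) \<in> cball (snd c (\<gamma> x)) r \<and>
        norm (snd c (Y q t) - snd c (\<gamma> t)) \<le> K * norm (q - q0)"
  define f where "f = in_chart c (u c)"
  define D where "D = (\<lambda>z. frechet_derivative f (at z))"
  have f1: "Ck_on (Suc 0) f (snd c ` (fst c \<inter> X))" using u c by (simp add: C1_field_def f_def)
  obtain B where B: "B \<ge> 0" "\<And>z v. z \<in> cball (snd c (\<gamma> x)) r \<Longrightarrow> norm (D z v) \<le> B * norm v"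
    using C1_Lipschitz[OF f1 compact_cball convex_cball d(3)] unfolding D_def by metis
  define E where "E = exp (B + 1)"
  have E: "E > 0" by (simp add: E_def)
  show thesis
  proof (rule that[of "min d 1"])
    fix a b assume ab: "a0 \<le> a" "a \<le> x" "x \<le> b" "b \<le> b0" "b - a < min d 1" and va: "vel_at q0 (\<gamma> a) (\<lambda>q. Y q a) w c"
    obtain K where K: "K \<ge> 0" "\<forall>\<^sub>F q in at q0. \<forall>t\<in>{a..b}. Y q t \<in> fst c \<and> snd c (Y q t) \<in> cball (snd c (\<gamma> x)) r \<and>
        norm (snd c (Y q t) - snd c (\<gamma> t)) \<le> K * norm (q - q0)"
      using d(5)[of a b] ab vel_at_imp_lip_at[OF va] by auto
    have gab: "\<gamma> t \<in> fst c" "snd c (\<gamma> t) \<in> cball (snd c (\<gamma> x)) r" "\<gamma> t \<in> X" "t \<in> {a0..b0}" if "t \<in> {a..b}" for t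
      using d(4)[of t] that ab g by auto
    show "vel_at q0 (\<gamma> b) (\<lambda>q. Y q b) w c"
      unfolding vel_at_def
    proof (intro allI impI)
      fix e :: real assume e: "e > 0"
      \<comment> \<open>Half of \<open>e\<close> is reserved for the initial deviation and half for
        the accumulated remainder \<eta> K |q - q0|, both enlarged by the Gronwall factor
        \<open>E\<close>.\<close>
      define \<eta> where "\<eta> = e / (2 * E * (K + 1))"
      have \<eta>: "\<eta> > 0" "\<eta> * K * E \<le> e / 2"
      proof -
        show \<eta>0: "\<eta> > 0" unfolding \<eta>_def using e E K(1) by (intro divide_pos_pos mult_pos_pos) auto
        have "\<eta> * K * E \<le> \<eta> * (K + 1) * E" using \<eta>0 E by (intro mult_right_mono mult_left_mono) auto
        also have "\<dots> = e / 2" using E K(1) by (simp add: \<eta>_def)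
        finally show "\<eta> * K * E \<le> e / 2" .
      qed
      obtain d1 where d1: "d1 > 0" "\<And>z y. z \<in> cball (snd c (\<gamma> x)) r \<Longrightarrow> y \<in> cball (snd c (\<gamma> x)) r \<Longrightarrow> norm (y - z) < d1 \<Longrightarrow>
         norm (f y - f z - D z (y - z)) \<le> \<eta> * norm (y - z)"
        using C1_uniform[OF f1 compact_cball convex_cball d(3) \<eta>(1)] unfolding D_def by metis
      have "((\<lambda>q. K * norm (q - q0)) \<longlongrightarrow> K * norm (q0 - q0)) (at q0)" by (intro tendsto_intros)
      then have small: "\<forall>\<^sub>F q in at q0. K * norm (q - q0) < d1" using d1(1) by (auto dest: order_tendstoD)
      have va': "\<forall>\<^sub>F q in at q0. Y q a \<in> fst c \<and> norm (snd c (Y q a) - snd c (\<gamma> a) - (q - q0) *\<^sub>R w c (\<gamma> a)) \<le> e / (2 * E) * norm (q - q0)"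
        using va e E unfolding vel_at_def by (meson divide_pos_pos mult_pos_pos zero_less_numeral)
      show "\<forall>\<^sub>F q in at q0. Y q b \<in> fst c \<and> norm (snd c (Y q b) - snd c (\<gamma> b) - (q - q0) *\<^sub>R w c (\<gamma> b)) \<le> e * norm (q - q0)"
        using K(2) small va' Y
      proof eventually_elim
        case (elim q)
        have Yq: "Y q t \<in> fst c" "snd c (Y q t) \<in> cball (snd c (\<gamma> x)) r" "norm (snd c (Y q t) - snd c (\<gamma> t)) \<le> K * norm (q - q0)"
          if "t \<in> {a..b}" for t using elim(1) that by auto
        define er where "er = (\<lambda>t. (snd c \<circ> Y q) t - (snd c \<circ> \<gamma>) t - (q - q0) *\<^sub>R (in_chart c (w c) \<circ> (snd c \<circ> \<gamma>)) t)"
        define er' where "er' = (\<lambda>t. u c (Y q t) - u c (\<gamma> t) - (q - q0) *\<^sub>R D (snd c (\<gamma> t)) (w c (\<gamma> t)))"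
        have "norm (er b) \<le> (norm (er a) + \<eta> * K * norm (q - q0)) * exp ((B + 1) * (b - a))"
        proof (rule gronwall[where b = b and e' = er'])
          fix t assume t: "t \<in> {a..b}"
          \<comment> \<open>Here the fields commute: the derivative of \<open>w\<close> along the
            \<open>u\<close>-curve equals the derivative of \<open>u\<close> in the direction
            \<open>w\<close>, so (q - q0) w solves the linearized equation exactly.\<close>
          have w': "chart_deriv c (w c) (\<gamma> t) (u c (\<gamma> t)) = D (snd c (\<gamma> t)) (w c (\<gamma> t))"
            using w(2) gab[OF t] c unfolding commuting_def D_def f_def chart_deriv_def by simp
          have der\<gamma>: "((snd c \<circ> \<gamma>) has_vector_derivative u c (\<gamma> t)) (at t within {a..b})"
            by (rule icurve_D[OF icurve_subset[OF g(1)] t c(1) gab(1)[OF t]]) (use ab in auto)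
          have "((in_chart c (w c) \<circ> (snd c \<circ> \<gamma>)) has_vector_derivative chart_deriv c (w c) (\<gamma> t) (u c (\<gamma> t))) (at t within {a..b})"
            using vector_derivative_diff_chain_within[OF der\<gamma>, of "in_chart c (w c)" "chart_deriv c (w c) (\<gamma> t)"]
              C1_field_has_derivative[OF w(1) c(1) gab(1,3)[OF t]] by (simp add: has_derivative_at_withinI)
          moreover have "((snd c \<circ> Y q) has_vector_derivative u c (Y q t)) (at t within {a..b})"
            by (rule icurve_D[OF icurve_subset[OF elim(4)] t c(1) Yq(1)[OF t]]) (use ab in auto)
          ultimately show "(er has_vector_derivative er' t) (at t within {a..b})"
            unfolding er_def er'_def w' using der\<gamma>
            by (intro has_vector_derivative_diff bounded_linear.has_vector_derivative[OF bounded_linear_scaleR_right]) (auto simp: o_def)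
          define \<delta> where "\<delta> = snd c (Y q t) - snd c (\<gamma> t)"
          have fe: "f (snd c (Y q t)) = u c (Y q t)" "f (snd c (\<gamma> t)) = u c (\<gamma> t)"
            using Yq[OF t] gab[OF t] c by (simp_all add: f_def in_chart_chart)
          have "(f has_derivative D (snd c (\<gamma> t))) (at (snd c (\<gamma> t)))"
            unfolding D_def by (rule Ck_on_has_derivative[OF f1]) (use gab[OF t] in auto)
          then interpret D: bounded_linear "D (snd c (\<gamma> t))" by (rule has_derivative_bounded_linear)
          have ert: "er t = \<delta> - (q - q0) *\<^sub>R w c (\<gamma> t)" using gab[OF t] c by (simp add: er_def \<delta>_def in_chart_chart)
          have "er' t = (f (snd c (Y q t)) - f (snd c (\<gamma> t)) - D (snd c (\<gamma> t)) \<delta>) + D (snd c (\<gamma> t)) (er t)"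
            unfolding er'_def ert fe by (simp add: D.diff D.scaleR)
          moreover have "norm (f (snd c (Y q t)) - f (snd c (\<gamma> t)) - D (snd c (\<gamma> t)) \<delta>) \<le> \<eta> * norm \<delta>"
            unfolding \<delta>_def by (rule d1(2)) (use Yq[OF t] gab[OF t] elim in auto)
          moreover have "\<eta> * norm \<delta> \<le> \<eta> * (K * norm (q - q0))" using Yq(3)[OF t] \<eta>(1) unfolding \<delta>_def by (intro mult_left_mono) auto
          moreover have "norm (D (snd c (\<gamma> t)) (er t)) \<le> B * norm (er t)" by (rule B(2)[OF gab(2)[OF t]])
          ultimately show "norm (er' t) \<le> B * norm (er t) + \<eta> * K * norm (q - q0)"
            using norm_triangle_ineq[of "f (snd c (Y q t)) - f (snd c (\<gamma> t)) - D (snd c (\<gamma> t)) \<delta>" "D (snd c (\<gamma> t)) (er t)"]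
            by (simp only: mult.assoc)
        qed (use B \<eta> K ab in auto)
        also have "\<dots> \<le> (e / (2 * E) * norm (q - q0) + \<eta> * K * norm (q - q0)) * E"
        proof (rule mult_mono)
          have a: "a \<in> {a..b}" using ab by auto
          show "norm (er a) + \<eta> * K * norm (q - q0) \<le> e / (2 * E) * norm (q - q0) + \<eta> * K * norm (q - q0)"
            using elim(3) gab[OF a] c by (simp add: er_def in_chart_chart)
          show "exp ((B + 1) * (b - a)) \<le> E" using ab B(1) mult_left_mono[of "b - a" 1 "B + 1"] by (simp add: E_def)
        qed (use e E \<eta> K in auto)
        also have "\<dots> = (e / 2 + \<eta> * K * E) * norm (q - q0)" using E by (simp add: field_simps)
        also have "\<dots> \<le> e * norm (q - q0)" using \<eta>(2) by (intro mult_right_mono) auto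
        finally have "norm (er b) \<le> e * norm (q - q0)" .
        moreover have b: "b \<in> {a..b}" using ab by auto
        ultimately show ?case using Yq(1)[OF b] gab[OF b] c by (simp add: er_def in_chart_chart)
      qed
    qed
  qed (use d in auto)
qed

lemma vel_at_propagate:
  assumes u: "C1_field X u" and w: "C1_field X w" "commuting X u w"
    and g: "icurve {a0..b0} (\<lambda>_. u) \<gamma>" "\<gamma> ` {a0..b0} \<subseteq> X"
    and Y: "\<forall>\<^sub>F q in at q0. icurve {a0..b0} (\<lambda>_. u) (Y q)"
    and l: "c0 \<in> atlas S" "\<gamma> a0 \<in> fst c0" "vel_at q0 (\<gamma> a0) (\<lambda>q. Y q a0) w c0"
    and t: "t \<in> {a0..b0}" and c: "c \<in> atlas S" "\<gamma> t \<in> fst c"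
  shows "vel_at q0 (\<gamma> t) (\<lambda>q. Y q t) w c"
proof -
  have chg: "vel_at q0 (\<gamma> a) (\<lambda>q. Y q a) w d" if "vel_at q0 (\<gamma> a) (\<lambda>q. Y q a) w c" "a \<in> {a0..b0}"
    "c \<in> atlas S" "d \<in> atlas S" "\<gamma> a \<in> fst c" "\<gamma> a \<in> fst d" for a c d
  proof (rule vel_at_change_chart[OF that(3-6,1)])
    have "\<gamma> a \<in> X" using that g by auto
    then show "chart_deriv c (snd d) (\<gamma> a) (w c (\<gamma> a)) = w d (\<gamma> a)"
      using w(1) that unfolding C1_field_def by simp
  qed
  define P where "P = (\<lambda>a. \<exists>c\<in>atlas S. \<gamma> a \<in> fst c \<and> vel_at q0 (\<gamma> a) (\<lambda>q. Y q a) w c)"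
  have "a0 \<le> t" using t by simp
  have "a0 \<le> a0 \<and> t \<le> b0 \<longrightarrow> P a0 \<longrightarrow> P t"
  proof (rule Bolzano[OF \<open>a0 \<le> t\<close>, of "\<lambda>a b. a0 \<le> a \<and> b \<le> b0 \<longrightarrow> P a \<longrightarrow> P b"])
    fix x assume "a0 \<le> x" "x \<le> t"
    then have x: "x \<in> {a0..b0}" using t by auto
    obtain c where c: "c \<in> atlas S" "\<gamma> x \<in> fst c" using charts_cover by blast
    show "\<exists>d>0. \<forall>a b. a \<le> x \<and> x \<le> b \<and> b - a < d \<longrightarrow> a0 \<le> a \<and> b \<le> b0 \<longrightarrow> P a \<longrightarrow> P b"
    proof (rule vel_at_step[OF u w g Y x c])
      fix d :: real assume d: "d > 0" "\<And>t. t \<in> {a0..b0} \<Longrightarrow> \<bar>t - x\<bar> < d \<Longrightarrow> \<gamma> t \<in> fst c"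
       "\<And>a b. a0 \<le> a \<Longrightarrow> a \<le> x \<Longrightarrow> x \<le> b \<Longrightarrow> b \<le> b0 \<Longrightarrow> b - a < d \<Longrightarrow> vel_at q0 (\<gamma> a) (\<lambda>q. Y q a) w c \<Longrightarrow>
        vel_at q0 (\<gamma> b) (\<lambda>q. Y q b) w c"
      show ?thesis
      proof (intro exI[of _ d] conjI allI impI d(1))
        fix a b assume ab: "a \<le> x \<and> x \<le> b \<and> b - a < d" "a0 \<le> a \<and> b \<le> b0" "P a"
        then obtain c' where c': "c' \<in> atlas S" "\<gamma> a \<in> fst c'" "vel_at q0 (\<gamma> a) (\<lambda>q. Y q a) w c'" unfolding P_def by blast
        have in_c: "\<gamma> a \<in> fst c" "\<gamma> b \<in> fst c" using d(2)[of a] d(2)[of b] ab by auto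
        have "vel_at q0 (\<gamma> a) (\<lambda>q. Y q a) w c"
          by (rule chg[OF c'(3) _ c'(1) c(1) c'(2) in_c(1)]) (use ab in auto)
        then have "vel_at q0 (\<gamma> b) (\<lambda>q. Y q b) w c" using d(3)[of a b] ab by auto
        then show "P b" unfolding P_def using c in_c by blast
      qed
    qed
  qed auto
  then have "P t" using l t unfolding P_def by auto
  then show ?thesis unfolding P_def using chg t c by blast
qed

lemma vel_at_has_vector_derivative:
  assumes "vel_at q0 (y q0) y w c"
  shows "((snd c \<circ> y) has_vector_derivative w c (y q0)) (at q0)"
  unfolding has_vector_derivative_def has_derivative_at_alt
proof (intro conjI allI impI)
  show "bounded_linear (\<lambda>h. h *\<^sub>R w c (y q0))" by (rule bounded_linear_scaleR_left)
  fix e :: real assume "e > 0"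
  then have "\<forall>\<^sub>F q in at q0. norm (snd c (y q) - snd c (y q0) - (q - q0) *\<^sub>R w c (y q0)) \<le> e * norm (q - q0)"
    using assms unfolding vel_at_def by (auto elim: eventually_mono)
  then obtain d where "d > 0" and d: "\<And>q. q \<noteq> q0 \<Longrightarrow> dist q q0 < d \<Longrightarrow>
      norm (snd c (y q) - snd c (y q0) - (q - q0) *\<^sub>R w c (y q0)) \<le> e * norm (q - q0)"
    unfolding eventually_at by auto
  show "\<exists>d>0. \<forall>q. norm (q - q0) < d \<longrightarrow>
      norm ((snd c \<circ> y) q - (snd c \<circ> y) q0 - (q - q0) *\<^sub>R w c (y q0)) \<le> e * norm (q - q0)"
  proof (intro exI[of _ d] conjI allI impI)
    fix q assume "norm (q - q0) < d"
    then show "norm ((snd c \<circ> y) q - (snd c \<circ> y) q0 - (q - q0) *\<^sub>R w c (y q0)) \<le> e * norm (q - q0)"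
      using d[of q] by (cases "q = q0") (auto simp: dist_norm)
  qed (use \<open>d > 0\<close> in auto)
qed

lemma icurveI_vel_at:
  assumes "\<And>t c. c \<in> atlas S \<Longrightarrow> \<gamma> t \<in> fst c \<Longrightarrow> vel_at t (\<gamma> t) \<gamma> u c"
  shows "icurve UNIV (\<lambda>_. u) \<gamma>"
  unfolding icurve_def
proof (intro conjI ballI impI)
  show "continuous_on UNIV \<gamma>"
    unfolding continuous_on_def using charts_cover lip_at_tendsto vel_at_imp_lip_at assms by (metis)
qed (use assms vel_at_has_vector_derivative in auto)

text \<open>A complete flow on an invariant open set, supplied together with its field. The period 2
  pi is part of the notion because the flows in question are those of action coordinates.\<close>

definition cflow :: "'m set \<Rightarrow> ('m chart \<Rightarrow> 'm \<Rightarrow> real^4) \<Rightarrow> (real \<Rightarrow> 'm \<Rightarrow> 'm) \<Rightarrow> bool" where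
  "cflow X u \<phi> \<longleftrightarrow> C1_field X u \<and> (\<forall>p\<in>X. icurve UNIV (\<lambda>_. u) (\<lambda>t. \<phi> t p) \<and> \<phi> 0 p = p \<and>
     (\<forall>t. \<phi> t p \<in> X \<and> \<phi> (t + 2 * pi) p = \<phi> t p))"

lemma cflow_unique:
  assumes "cflow X u \<phi>" "p \<in> X" "icurve (closed_segment 0 t) (\<lambda>_. u) \<gamma>" "\<gamma> 0 = p"
  shows "\<gamma> t = \<phi> t p"
  by (rule icurve_unique[where X = X and u = "\<lambda>_. u" and \<gamma> = "\<lambda>t. \<phi> t p"])
    (use assms C1_field_lip icurve_subset[OF _ subset_UNIV] in \<open>auto simp: cflow_def\<close>)

lemma cflow_add:
  assumes f: "cflow X u \<phi>" "p \<in> X" shows "\<phi> (s + t) p = \<phi> s (\<phi> t p)"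
proof -
  have "icurve UNIV (\<lambda>_. u) (\<lambda>s. \<phi> (1 * s + t) p)"
    using icurve_affine[of UNIV "\<lambda>_. u" "\<lambda>t. \<phi> t p" 1 t UNIV] f by (simp add: cflow_def)
  then have "icurve (closed_segment 0 s) (\<lambda>_. u) (\<lambda>s. \<phi> (s + t) p)"
    using icurve_subset by simp blast
  then show ?thesis using cflow_unique[OF f(1), of "\<phi> t p"] f by (simp add: cflow_def)
qed

lemma cflow_period:
  assumes f: "cflow X u \<phi>" "p \<in> X" shows "\<phi> (t + 2 * pi * of_int n) p = \<phi> t p"
proof -
  have nat: "\<phi> (t + 2 * pi * real n) p = \<phi> t p" for n t
  proof (induction n)
    case (Suc n)
    have "\<phi> (t + 2 * pi * real (Suc n)) p = \<phi> (t + 2 * pi * real n + 2 * pi) p" by (simp add: algebra_simps)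
    then show ?case using Suc f by (simp add: cflow_def)
  qed simp
  show ?thesis
  proof (cases "n \<ge> 0")
    case True then show ?thesis using nat[of t "nat n"] by simp
  next
    case False then show ?thesis using nat[of "t + 2 * pi * of_int n" "nat (- n)"] by simp
  qed
qed

text \<open>Transporting the velocity \<open>v\<close> along the \<open>u\<close>-orbits with
  \<open>vel_at_propagate\<close> shows that every time-s map of the first flow preserves integral
  curves of \<open>v\<close>; uniqueness of these then gives \<open>cflow_commute\<close>.\<close>

lemma cflow_commuting_icurve:
  assumes f: "cflow X u \<phi>" and g: "cflow X v \<psi>" and uv: "commuting X u v" and p: "p \<in> X"
  shows "icurve UNIV (\<lambda>_. v) (\<lambda>t. \<phi> s (\<psi> t p))"
proof -
  \<comment> \<open>Velocities are transported forward in time only, so a negative \<open>s\<close>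
    is shifted by periods.\<close>
  obtain n :: nat where "- s / (2 * pi) \<le> real n" using real_arch_simple by blast
  then have n: "0 \<le> s + 2 * pi * real n" by (simp add: divide_simps algebra_simps)
  define s' where "s' = s + 2 * pi * real n"
  have \<psi>X: "\<psi> t p \<in> X" for t using g p by (simp add: cflow_def)
  have "icurve UNIV (\<lambda>_. v) (\<lambda>t. \<phi> s' (\<psi> t p))"
  proof (rule icurveI_vel_at)
    fix t c assume c: "c \<in> atlas S" "\<phi> s' (\<psi> t p) \<in> fst c"
    obtain c0 where c0: "c0 \<in> atlas S" "\<psi> t p \<in> fst c0" using charts_cover by blast
    have ic: "icurve {0..s'} (\<lambda>_. u) (\<lambda>h. \<phi> h q)" if "q \<in> X" for q
      using f that icurve_subset[OF _ subset_UNIV] by (auto simp: cflow_def)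
    have "vel_at t (\<psi> t p) (\<lambda>t. \<psi> t p) v c0"
      using icurve_vel_at[of v "\<lambda>t. \<psi> t p"] g p c0 by (simp add: cflow_def)
    then have v0: "vel_at t (\<phi> 0 (\<psi> t p)) (\<lambda>q. \<phi> 0 (\<psi> q p)) v c0"
      using f \<psi>X by (simp add: cflow_def)
    show "vel_at t (\<phi> s' (\<psi> t p)) (\<lambda>t. \<phi> s' (\<psi> t p)) v c"
      by (rule vel_at_propagate[where u = u and X = X and ?a0.0 = 0 and ?b0.0 = s' and Y = "\<lambda>q h. \<phi> h (\<psi> q p)" and \<gamma> = "\<lambda>h. \<phi> h (\<psi> t p)",
          OF _ _ uv ic _ _ c0(1) _ v0 _ c])
        (use f g \<psi>X n c0 ic in \<open>auto simp: cflow_def s'_def\<close>)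
  qed
  moreover have "\<phi> s' (\<psi> t p) = \<phi> s (\<psi> t p)" for t
    using cflow_period[OF f \<psi>X, of s "int n"] by (simp add: s'_def)
  ultimately show ?thesis by simp
qed

lemma cflow_commute:
  assumes f: "cflow X u \<phi>" and g: "cflow X v \<psi>" and uv: "commuting X u v" and p: "p \<in> X"
  shows "\<phi> s (\<psi> t p) = \<psi> t (\<phi> s p)"
  using cflow_unique[OF g, of "\<phi> s p" t "\<lambda>t. \<phi> s (\<psi> t p)"] icurve_subset[OF cflow_commuting_icurve[OF assms] subset_UNIV]
    f g p by (simp add: cflow_def)

end

section \<open>The action of the plane generated by two commuting periodic flows\<close>

locale flow_pair = smooth_manifold S for S :: "('m::t2_space) int_sys" +
  fixes X :: "'m set" and u v :: "'m chart \<Rightarrow> 'm \<Rightarrow> real^4" and \<phi> \<psi> :: "real \<Rightarrow> 'm \<Rightarrow> 'm"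
  assumes flow_u: "cflow X u \<phi>" and flow_v: "cflow X v \<psi>" and uv: "commuting X u v"
begin

definition act :: "real \<times> real \<Rightarrow> 'm \<Rightarrow> 'm" where
  "act a p = \<phi> (fst a) (\<psi> (snd a) p)"

lemma act_in: "p \<in> X \<Longrightarrow> act a p \<in> X"
  using flow_u flow_v by (simp add: act_def cflow_def)

lemma act_add: "p \<in> X \<Longrightarrow> act (a + b) p = act a (act b p)"
proof -
  assume p: "p \<in> X"
  have "\<psi> t p \<in> X" for t using flow_v p by (simp add: cflow_def)
  then show ?thesis
    using cflow_add[OF flow_u, of "\<psi> (snd a) (\<psi> (snd b) p)"] cflow_add[OF flow_v p] flow_v
      cflow_commute[OF flow_u flow_v uv, of "\<psi> (snd b) p" "fst b" "snd a", symmetric]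
    by (simp add: act_def cflow_def)
qed

lemma act_0: "p \<in> X \<Longrightarrow> act 0 p = p"
  using flow_u flow_v by (simp add: act_def cflow_def)

lemma act_period: "p \<in> X \<Longrightarrow> act (a + (2 * pi * of_int i, 2 * pi * of_int j)) p = act a p"
  using cflow_period[OF flow_u] cflow_period[OF flow_v] flow_v by (simp add: act_def cflow_def)

text \<open>Joint differentiability from separate information. The increment in \<open>k\<close> at
  h = 0 is the velocity of a \<open>v\<close>-curve. The increment in \<open>h\<close> is controlled
  by the mean value inequality along the \<open>u\<close>-curve through \<open>act (0, k) p\<close>,
  on which \<open>u\<close> stays within \<open>e\<close> of its value at \<open>p\<close>.\<close>

lemma act_expansion:
  assumes p: "p \<in> X" and c: "c \<in> atlas S" "p \<in> fst c" and e: "e > 0"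
  obtains \<eta> where "\<eta> > 0" "\<And>h k. \<bar>h\<bar> < \<eta> \<Longrightarrow> \<bar>k\<bar> < \<eta> \<Longrightarrow> act (h, k) p \<in> fst c \<and>
    norm (snd c (act (h, k) p) - snd c p - (h *\<^sub>R u c p + k *\<^sub>R v c p)) \<le> e * (\<bar>h\<bar> + \<bar>k\<bar>)"
proof -
  \<comment> \<open>Starting one time unit earlier places \<open>p\<close> at time 1 inside the
    interval [0, 2], so that increments \<open>h\<close> of both signs are covered by the forward
    estimates.\<close>
  define p2 where "p2 = \<phi> (- 1) p"
  have X2: "p2 \<in> X" using flow_u p by (simp add: p2_def cflow_def)
  have \<psi>X: "\<psi> k p2 \<in> X" for k using flow_v X2 by (simp add: cflow_def)
  define \<gamma> where "\<gamma> = (\<lambda>t. \<phi> t p2)"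
  define Y where "Y = (\<lambda>k t. \<phi> t (\<psi> k p2))"
  have \<gamma>1: "\<gamma> (1 + h) = \<phi> h p" for h
    using cflow_add[OF flow_u p, of "1 + h" "- 1"] by (simp add: \<gamma>_def p2_def)
  have Y1: "Y k (1 + h) = act (h, k) p" for h k
  proof -
    have "Y k (1 + h) = \<phi> h (\<phi> 1 (\<psi> k p2))" unfolding Y_def using cflow_add[OF flow_u \<psi>X, of h 1] by (simp add: add.commute)
    also have "\<phi> 1 (\<psi> k p2) = \<psi> k (\<gamma> (1 + 0))" using cflow_commute[OF flow_u flow_v uv X2] by (simp add: \<gamma>_def)
    finally show ?thesis using \<gamma>1[of 0] flow_u p by (simp add: act_def cflow_def)
  qed
  have Y0: "Y 0 = \<gamma>" using flow_v X2 by (simp add: Y_def \<gamma>_def cflow_def fun_eq_iff)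
  have icY: "icurve UNIV (\<lambda>_. u) (Y k)" for k using flow_u \<psi>X by (simp add: Y_def cflow_def)
  have ic: "icurve J (\<lambda>_. u) \<gamma>" "icurve J (\<lambda>_. u) (Y k)" for J k
    using icY[of k] icY[of 0] icurve_subset[OF _ subset_UNIV] unfolding Y0 by blast+
  have \<gamma>X: "\<gamma> t \<in> X" for t using flow_u X2 by (simp add: \<gamma>_def cflow_def)
  have u: "C1_field X u" using flow_u by (simp add: cflow_def)
  have vel: "vel_at 0 (\<gamma> t) (\<lambda>k. Y k t) v d" if "d \<in> atlas S" "\<gamma> t \<in> fst d" for t d
    using icurve_vel_at[OF cflow_commuting_icurve[OF flow_u flow_v uv X2, of t], of d 0] that Y0
    by (simp add: Y_def fun_eq_iff)
  have c1: "\<gamma> 1 \<in> fst c" and \<gamma>10: "\<gamma> 1 = p" using c \<gamma>1[of 0] flow_u p by (simp_all add: cflow_def)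
  show ?thesis
  proof (rule lip_at_tube[where ?a0.0 = 0 and ?b0.0 = 2 and ?t0.0 = 1 and ?q0.0 = "0::real", OF u ic(1) _ _ _ c(1) c1])
    show "\<gamma> ` {0..2} \<subseteq> X" using \<gamma>X by auto
    show "\<forall>\<^sub>F q in at 0. icurve {0..2} (\<lambda>_. u) (Y q)" using ic(2) by simp
    fix d r :: real assume d: "d > 0" "r > 0"
       "\<And>t. t \<in> {0..2} \<Longrightarrow> \<bar>t - 1\<bar> < d \<Longrightarrow> \<gamma> t \<in> fst c \<and> snd c (\<gamma> t) \<in> cball (snd c (\<gamma> 1)) r"
       "\<And>a b. 0 \<le> a \<Longrightarrow> a \<le> 1 \<Longrightarrow> 1 \<le> b \<Longrightarrow> b \<le> 2 \<Longrightarrow> b - a < d \<Longrightarrow> lip_at (0::real) (\<gamma> a) (\<lambda>q. Y q a) c \<Longrightarrow>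
        \<exists>K\<ge>0. \<forall>\<^sub>F q in at 0. \<forall>t\<in>{a..b}. Y q t \<in> fst c \<and> snd c (Y q t) \<in> cball (snd c (\<gamma> 1)) r \<and>
          norm (snd c (Y q t) - snd c (\<gamma> t)) \<le> K * norm (q - 0)"
    define d' where "d' = min d 1 / 3"
    have d': "d' > 0" "d' < 1" "2 * d' < d" using d(1) by (auto simp: d'_def min_def)
    have "\<gamma> (1 - d') \<in> fst c" using d(3)[of "1 - d'"] d' by auto
    then have "lip_at 0 (\<gamma> (1 - d')) (\<lambda>q. Y q (1 - d')) c" using vel_at_imp_lip_at[OF vel] c by blast
    from d(4)[of "1 - d'" "1 + d'", OF _ _ _ _ _ this] d' obtain K where K0: "K \<ge> 0" 
      "\<forall>\<^sub>F q in at 0. \<forall>t\<in>{1 - d'..1 + d'}. Y q t \<in> fst c \<and> snd c (Y q t) \<in> cball (snd c (\<gamma> 1)) r \<and>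
          norm (snd c (Y q t) - snd c (\<gamma> t)) \<le> K * norm (q - 0)"
      by auto
    have K: "K \<ge> 0" "\<forall>\<^sub>F q in at 0. \<forall>t\<in>{1 - d'..1 + d'}. Y q t \<in> fst c \<and> norm (snd c (Y q t) - snd c (\<gamma> t)) \<le> K * \<bar>q\<bar>"
      using K0 by (auto elim: eventually_mono)
    from K(2) obtain k1 where k1: "k1 > 0" 
      "\<And>k t. k \<noteq> 0 \<Longrightarrow> \<bar>k\<bar> < k1 \<Longrightarrow> t \<in> {1 - d'..1 + d'} \<Longrightarrow> Y k t \<in> fst c \<and> norm (snd c (Y k t) - snd c (\<gamma> t)) \<le> K * \<bar>k\<bar>"
      unfolding eventually_at by auto
    have k1': "Y k t \<in> fst c \<and> norm (snd c (Y k t) - snd c (\<gamma> t)) \<le> K * \<bar>k\<bar>"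
      if "\<bar>k\<bar> < k1" "t \<in> {1 - d'..1 + d'}" for k t
      using k1(2)[of k t] d(3)[of t] that d' Y0 by (cases "k = 0") auto
    have "\<forall>\<^sub>F k in at 0. Y k 1 \<in> fst c \<and> norm (snd c (Y k 1) - snd c (\<gamma> 1) - (k - 0) *\<^sub>R v c (\<gamma> 1)) \<le> e * norm (k - 0)"
      using vel[OF c(1) c1] e unfolding vel_at_def by blast
    then obtain k2 where k2: "k2 > 0"
      "\<And>k. k \<noteq> 0 \<Longrightarrow> \<bar>k\<bar> < k2 \<Longrightarrow> norm (snd c (Y k 1) - snd c p - k *\<^sub>R v c p) \<le> e * \<bar>k\<bar>"
      unfolding eventually_at \<gamma>10 by auto
    have k2': "norm (snd c (Y k 1) - snd c p - k *\<^sub>R v c p) \<le> e * \<bar>k\<bar>" if "\<bar>k\<bar> < k2" for k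
      using k2(2)[of k] that Y0 \<gamma>10 by (cases "k = 0") auto
    have "isCont (in_chart c (u c)) (snd c p)"
      using C1_field_has_derivative[OF u c p] has_derivative_continuous by blast
    then obtain \<rho> where \<rho>: "\<rho> > 0" "\<And>x. dist x (snd c p) < \<rho> \<Longrightarrow> dist (in_chart c (u c) x) (in_chart c (u c) (snd c p)) < e"
      using e unfolding continuous_at_eps_delta by blast
    obtain h1 where h1: "h1 > 0" "\<And>t. t \<in> UNIV \<Longrightarrow> \<bar>t - 1\<bar> < h1 \<Longrightarrow> \<gamma> t \<in> fst c \<and> snd c (\<gamma> t) \<in> ball (snd c p) (\<rho> / 2)"
      by (rule curve_near_chart_point[OF icurve_continuous[OF ic(1)[of UNIV]] UNIV_I c(1) c1 open_ball[of "snd c p" "\<rho> / 2"]])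
        (use \<rho> \<gamma>10 in auto)
    define \<eta> where "\<eta> = Min {d', k1, k2, h1, \<rho> / (2 * (K + 1))}"
    have \<eta>: "\<eta> > 0" "\<eta> \<le> d'" "\<eta> \<le> k1" "\<eta> \<le> k2" "\<eta> \<le> h1" "\<eta> \<le> \<rho> / (2 * (K + 1))"
      using d' k1 k2 h1 \<rho>(1) K(1) by (auto simp: \<eta>_def)
    show ?thesis
    proof (rule that[OF \<eta>(1)])
      fix h k :: real assume hk: "\<bar>h\<bar> < \<eta>" "\<bar>k\<bar> < \<eta>"
      have in_c: "Y k t \<in> fst c" "norm (u c (Y k t) - u c p) \<le> e" if t: "\<bar>t - 1\<bar> < \<eta>" for t
      proof -
        have 1: "Y k t \<in> fst c \<and> norm (snd c (Y k t) - snd c (\<gamma> t)) \<le> K * \<bar>k\<bar>"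
          by (rule k1') (use hk \<eta> t in auto)
        then show "Y k t \<in> fst c" by simp
        have "K * \<bar>k\<bar> \<le> K * (\<rho> / (2 * (K + 1)))" using hk \<eta> K(1) by (intro mult_left_mono) auto
        also have "\<dots> \<le> \<rho> / 2" using K(1) \<rho>(1) by (simp add: field_simps)
        finally have "dist (snd c (Y k t)) (snd c (\<gamma> t)) \<le> \<rho> / 2" using 1 by (simp add: dist_norm)
        moreover have "dist (snd c (\<gamma> t)) (snd c p) < \<rho> / 2" using h1(2)[of t] t \<eta> by (simp add: dist_commute)
        ultimately have "dist (snd c (Y k t)) (snd c p) < \<rho>" by (smt (verit) dist_triangle field_sum_of_halves)
        from \<rho>(2)[OF this] show "norm (u c (Y k t) - u c p) \<le> e" using 1 c by (simp add: in_chart_chart dist_norm)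
      qed
      have seg: "\<bar>t - 1\<bar> < \<eta>" if "t \<in> closed_segment 1 (1 + h)" for t
        using that hk by (auto simp: closed_segment_eq_real_ivl split: if_splits)
      have bd: "norm ((snd c (Y k (1 + h)) - (1 + h) *\<^sub>R u c p) - (snd c (Y k 1) - 1 *\<^sub>R u c p)) \<le> e * norm ((1 + h) - 1)"
      proof (rule differentiable_bound[of "closed_segment 1 (1 + h)" "\<lambda>t. snd c (Y k t) - t *\<^sub>R u c p" "\<lambda>t x. x *\<^sub>R (u c (Y k t) - u c p)"])
        fix t assume t: "t \<in> closed_segment 1 (1 + h)"
        have "((snd c \<circ> Y k) has_vector_derivative u c (Y k t)) (at t within closed_segment 1 (1 + h))"
          by (rule icurve_D[OF ic(2) t c(1) in_c(1)[OF seg[OF t]]])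
        then show "((\<lambda>t. snd c (Y k t) - t *\<^sub>R u c p) has_derivative (\<lambda>x. x *\<^sub>R (u c (Y k t) - u c p))) (at t within closed_segment 1 (1 + h))"
          unfolding has_vector_derivative_def o_def scaleR_diff_right
          by (intro has_derivative_diff has_derivative_scaleR_left has_derivative_ident)
        show "onorm (\<lambda>x. x *\<^sub>R (u c (Y k t) - u c p)) \<le> e"
          using mult_left_mono[OF in_c(2)[OF seg[OF t]] abs_ge_zero] by (intro onorm_le) (simp add: mult.commute)
      qed auto
      have eq0: "(snd c (Y k (1 + h)) - (1 + h) *\<^sub>R u c p) - (snd c (Y k 1) - 1 *\<^sub>R u c p)
          = snd c (Y k (1 + h)) - snd c (Y k 1) - h *\<^sub>R u c p" by (simp add: scaleR_add_left)
      have 1: "norm (snd c (Y k (1 + h)) - snd c (Y k 1) - h *\<^sub>R u c p) \<le> e * \<bar>h\<bar>"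
        using bd unfolding eq0 by simp
      have 2: "norm (snd c (Y k 1) - snd c p - k *\<^sub>R v c p) \<le> e * \<bar>k\<bar>" using k2' hk \<eta> by simp
      have eq: "snd c (act (h, k) p) - snd c p - (h *\<^sub>R u c p + k *\<^sub>R v c p)
        = (snd c (Y k (1 + h)) - snd c (Y k 1) - h *\<^sub>R u c p) + (snd c (Y k 1) - snd c p - k *\<^sub>R v c p)"
        by (simp add: Y1)
      have "norm (snd c (act (h, k) p) - snd c p - (h *\<^sub>R u c p + k *\<^sub>R v c p)) \<le> e * (\<bar>h\<bar> + \<bar>k\<bar>)"
        unfolding eq using norm_triangle_mono[OF 1 2] by (simp add: distrib_left)
      then show "act (h, k) p \<in> fst c \<and>
          norm (snd c (act (h, k) p) - snd c p - (h *\<^sub>R u c p + k *\<^sub>R v c p)) \<le> e * (\<bar>h\<bar> + \<bar>k\<bar>)"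
        using in_c(1)[of "1 + h"] hk by (simp add: Y1)
    qed
  qed auto
qed

lemma act_near:
  assumes p: "p \<in> X" and c: "c \<in> atlas S" "act a p \<in> fst c" and e: "e > 0"
  obtains \<eta> where "\<eta> > 0" "\<And>b. norm (b - a) < \<eta> \<Longrightarrow> act b p \<in> fst c \<and>
    norm (snd c (act b p) - snd c (act a p) - (fst (b - a) *\<^sub>R u c (act a p) + snd (b - a) *\<^sub>R v c (act a p))) \<le> e * norm (b - a)"
proof -
  have e2: "e / 2 > 0" using e by simp
  obtain \<eta> where \<eta>: "\<eta> > 0" "\<And>h k. \<bar>h\<bar> < \<eta> \<Longrightarrow> \<bar>k\<bar> < \<eta> \<Longrightarrow> act (h, k) (act a p) \<in> fst c \<and>
    norm (snd c (act (h, k) (act a p)) - snd c (act a p) - (h *\<^sub>R u c (act a p) + k *\<^sub>R v c (act a p))) \<le> e / 2 * (\<bar>h\<bar> + \<bar>k\<bar>)"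
    using act_expansion[OF act_in[OF p] c e2] by metis
  show ?thesis
  proof (rule that[OF \<eta>(1)])
    fix b assume b: "norm (b - a) < \<eta>"
    have n: "\<bar>fst (b - a)\<bar> \<le> norm (b - a)" "\<bar>snd (b - a)\<bar> \<le> norm (b - a)"
      using norm_fst_le[of "fst (b - a)" "snd (b - a)"] norm_snd_le[of "snd (b - a)" "fst (b - a)"]
      by (simp_all only: prod.collapse real_norm_def)
    have ab: "act (fst (b - a), snd (b - a)) (act a p) = act b p"
      using act_add[OF p, of "b - a" a] unfolding prod.collapse by simp
    have "e / 2 * (\<bar>fst (b - a)\<bar> + \<bar>snd (b - a)\<bar>) \<le> e / 2 * (norm (b - a) + norm (b - a))"
      using n e by (intro mult_left_mono add_mono) auto
    then show "act b p \<in> fst c \<and>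
    norm (snd c (act b p) - snd c (act a p) - (fst (b - a) *\<^sub>R u c (act a p) + snd (b - a) *\<^sub>R v c (act a p))) \<le> e * norm (b - a)"
      using \<eta>(2)[of "fst (b - a)" "snd (b - a)"] n b unfolding ab by auto
  qed
qed

lemma act_has_derivative:
  assumes p: "p \<in> X" and c: "c \<in> atlas S" "act a p \<in> fst c"
  shows "((\<lambda>a. snd c (act a p)) has_derivative (\<lambda>h. fst h *\<^sub>R u c (act a p) + snd h *\<^sub>R v c (act a p))) (at a)"
  unfolding has_derivative_at_alt
proof (intro conjI allI impI)
  show "bounded_linear (\<lambda>h::real\<times>real. fst h *\<^sub>R u c (act a p) + snd h *\<^sub>R v c (act a p))"
    by (intro bounded_linear_add bounded_linear_scaleR_const bounded_linear_fst bounded_linear_snd)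
qed (use act_near[OF p c] in metis)

lemma act_continuous: "p \<in> X \<Longrightarrow> continuous_on UNIV (\<lambda>a. act a p)"
  unfolding continuous_on_def
proof
  fix a assume p: "p \<in> X"
  obtain c where c: "c \<in> atlas S" "act a p \<in> fst c" using charts_cover by blast
  obtain \<eta> where "\<eta> > 0" "\<And>b. norm (b - a) < \<eta> \<Longrightarrow> act b p \<in> fst c"
    using act_near[OF p c zero_less_one] by metis
  then have ev: "\<forall>\<^sub>F b in at a. act b p \<in> fst c" unfolding eventually_at by (auto simp: dist_norm)
  have "((\<lambda>a. snd c (act a p)) \<longlongrightarrow> snd c (act a p)) (at a)"
    using has_derivative_continuous[OF act_has_derivative[OF p c]] by (simp add: continuous_within)
  moreover have "\<forall>\<^sub>F b in at a. snd c (act b p) \<in> snd c ` fst c" using ev by eventually_elim blast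
  ultimately have "((\<lambda>b. chart_inv c (snd c (act b p))) \<longlongrightarrow> chart_inv c (snd c (act a p))) (at a)"
    by (rule continuous_on_tendsto_compose[OF continuous_on_chart_inv[OF c(1)] _ imageI[OF c(2)]])
  moreover have "\<forall>\<^sub>F b in at a. chart_inv c (snd c (act b p)) = act b p"
    using ev by eventually_elim (simp add: chart_inv_chart c)
  ultimately show "((\<lambda>a. act a p) \<longlongrightarrow> act a p) (at a)"
    using tendsto_cong[of "\<lambda>b. chart_inv c (snd c (act b p))" "\<lambda>b. act b p" "at a"] by (simp add: chart_inv_chart c)
qed

lemma act_curve:
  assumes p: "p \<in> X" and A: "\<And>t. t \<in> J \<Longrightarrow> (A has_vector_derivative (\<alpha> t, \<beta> t)) (at t within J)"
  shows "icurve J (\<lambda>t c p. \<alpha> t *\<^sub>R u c p + \<beta> t *\<^sub>R v c p) (\<lambda>t. act (A t) p)"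
  unfolding icurve_def
proof (intro conjI ballI impI)
  have "continuous_on J A" by (rule continuous_on_vector_derivative[OF A])
  then show "continuous_on J (\<lambda>t. act (A t) p)"
    by (rule continuous_on_compose2[OF act_continuous[OF p]]) simp
  fix t c assume t: "t \<in> J" "c \<in> atlas S" "act (A t) p \<in> fst c"
  have "((\<lambda>a. snd c (act a p)) has_derivative (\<lambda>h. fst h *\<^sub>R u c (act (A t) p) + snd h *\<^sub>R v c (act (A t) p))) (at (A t) within A ` J)"
    by (rule has_derivative_at_withinI[OF act_has_derivative[OF p t(2,3)]])
  from vector_derivative_diff_chain_within[OF A[OF t(1)] this]
  show "((snd c \<circ> (\<lambda>t. act (A t) p)) has_vector_derivative \<alpha> t *\<^sub>R u c (act (A t) p) + \<beta> t *\<^sub>R v c (act (A t) p)) (at t within J)"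
    by (simp add: o_def)
qed

lemma act_line: "p \<in> X \<Longrightarrow> icurve J (\<lambda>_ c p. a *\<^sub>R u c p + b *\<^sub>R v c p) (\<lambda>t. act (t *\<^sub>R (a, b)) p)"
  by (rule act_curve[where \<alpha> = "\<lambda>_. a" and \<beta> = "\<lambda>_. b"]) (auto intro!: derivative_eq_intros)

lemma lip_field_pair: "lip_field X J (\<lambda>_. u)" "lip_field X J (\<lambda>_. v)"
  using flow_u flow_v by (auto simp: cflow_def intro: C1_field_lip)

lemma act_line_unique:
  assumes p: "p \<in> X" and g: "icurve (closed_segment 0 t) (\<lambda>_ c p. a *\<^sub>R u c p + b *\<^sub>R v c p) \<gamma>" "\<gamma> 0 = p"
  shows "\<gamma> t = act (t *\<^sub>R (a, b)) p"
  by (rule icurve_unique[where X = X, OF lip_field_combination[OF lip_field_pair, where M = "max \<bar>a\<bar> \<bar>b\<bar>"] act_line[OF p] _ g(1)])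
    (use act_in[OF p] act_0[OF p] g(2) in \<open>auto simp: zero_prod_def\<close>)

text \<open>The path of integrated coefficients, applied to \<open>p\<close>, solves the same
  time-dependent equation, and uniqueness does the rest. This path is the lift to the plane of a
  curve in a fiber.\<close>

lemma act_curve_lift:
  assumes p: "p \<in> X" and ab: "continuous_on {0..1} \<alpha>" "continuous_on {0..1} \<beta>"
    and g: "icurve {0..1} (\<lambda>t c p. \<alpha> t *\<^sub>R u c p + \<beta> t *\<^sub>R v c p) \<gamma>" "\<gamma> 0 = p" and t: "t \<in> {0..1}"
  shows "\<gamma> t = act (integral {0..t} \<alpha>, integral {0..t} \<beta>) p"
proof -
  define A where "A = (\<lambda>t. (integral {0..t} \<alpha>, integral {0..t} \<beta>))"
  have A: "(A has_vector_derivative (\<alpha> t, \<beta> t)) (at t within {0..1})" if "t \<in> {0..1}" for t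
    unfolding A_def using that ab by (intro has_vector_derivative_Pair integral_has_vector_derivative)
  have bounded: "\<exists>M. \<forall>t\<in>{0..1}. \<bar>f t\<bar> \<le> M" if "continuous_on {0..1} f" for f :: "real \<Rightarrow> real"
    using compact_imp_bounded[OF compact_continuous_image[OF that compact_Icc]] by (simp add: bounded_iff)
  obtain M1 M2 where M: "\<And>t. t \<in> {0..1} \<Longrightarrow> \<bar>\<alpha> t\<bar> \<le> M1" "\<And>t. t \<in> {0..1} \<Longrightarrow> \<bar>\<beta> t\<bar> \<le> M2"
    using bounded[OF ab(1)] bounded[OF ab(2)] by blast
  have "\<gamma> t = act (A t) p"
    by (rule icurve_unique_forward[where X = X, OF lip_field_combination[OF lip_field_pair, where M = "max M1 M2"] act_curve[OF p A] _ g(1) _ t])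
      (use act_in[OF p] act_0[OF p] g(2) max.coboundedI1[OF M(1)] max.coboundedI2[OF M(2)] in \<open>auto simp: A_def zero_prod_def\<close>)
  then show ?thesis by (simp add: A_def)
qed

end

section \<open>Hamiltonian vector fields\<close>

locale symplectic = smooth_manifold S for S :: "('m::t2_space) int_sys" +
  assumes symplectic: "symplectic_manifold S"
begin

definition smooth_map :: "'m set \<Rightarrow> ('m \<Rightarrow> 'b::real_normed_vector) \<Rightarrow> bool" where
  "smooth_map X f \<longleftrightarrow> open X \<and> (\<forall>c\<in>atlas S. \<forall>n. Ck_on n (in_chart c f) (snd c ` (fst c \<inter> X)))"

lemma sform_Ck_on: "c \<in> atlas S \<Longrightarrow> Ck_on n (in_chart c (\<lambda>p. sform S c p v w)) (snd c ` fst c)"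
  using smooth_fun_Ck_on[of "\<lambda>p. sform S c p v w" "fst c" c n] open_chart symplectic
  by (simp add: symplectic_manifold_def)

lemma
  assumes "c \<in> atlas S" "p \<in> fst c"
  shows sform_bilinear: "bilinear (sform S c p)"
    and sform_alt: "sform S c p v v = 0"
    and sform_nondegenerate: "(\<And>w. sform S c p v w = 0) \<Longrightarrow> v = 0"
    and sform_closed: "chart_deriv c (\<lambda>q. sform S c q v w) p u' + chart_deriv c (\<lambda>q. sform S c q w u') p v
           + chart_deriv c (\<lambda>q. sform S c q u' v) p w = 0"
  using symplectic assms unfolding symplectic_manifold_def by blast+

lemma sform_change_chart:
  "c \<in> atlas S \<Longrightarrow> d \<in> atlas S \<Longrightarrow> p \<in> fst c \<Longrightarrow> p \<in> fst d \<Longrightarrow>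
    sform S d p (chart_deriv c (snd d) p v) (chart_deriv c (snd d) p w) = sform S c p v w"
  using symplectic unfolding symplectic_manifold_def by blast

lemma sform_linear:
  assumes "c \<in> atlas S" "p \<in> fst c"
  shows sform_linear_left: "linear (\<lambda>v. sform S c p v w)" and sform_linear_right: "linear (sform S c p v)"
  using sform_bilinear[OF assms] unfolding bilinear_def by blast+

lemma sform_antisym:
  assumes "c \<in> atlas S" "p \<in> fst c" shows "sform S c p w v = - sform S c p v w"
proof -
  note l = bilinear_ladd[OF sform_bilinear[OF assms]] bilinear_radd[OF sform_bilinear[OF assms]]
  have "sform S c p (v + w) (v + w) = sform S c p v w + sform S c p w v"
    unfolding l by (simp add: sform_alt[OF assms])
  then show ?thesis using sform_alt[OF assms, of "v + w"] by linarith
qed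

lemma smooth_map_has_derivative:
  assumes "smooth_map X f" "c \<in> atlas S" "p \<in> fst c" "p \<in> X"
  shows "(in_chart c f has_derivative chart_deriv c f p) (at (snd c p))"
  unfolding chart_deriv_def
  by (rule Ck_on_has_derivative[of 0 _ "snd c ` (fst c \<inter> X)"]) (use assms in \<open>auto simp: smooth_map_def simp del: Ck_on.simps\<close>)

lemma smooth_map_linear:
  "smooth_map X f \<Longrightarrow> c \<in> atlas S \<Longrightarrow> p \<in> fst c \<Longrightarrow> p \<in> X \<Longrightarrow> linear (chart_deriv c f p)"
  using smooth_map_has_derivative has_derivative_linear by blast

lemma smooth_map_subset: "smooth_map X f \<Longrightarrow> open Y \<Longrightarrow> Y \<subseteq> X \<Longrightarrow> smooth_map Y f"
  unfolding smooth_map_def by (metis (no_types, lifting) Ck_on_subset Int_mono image_mono order_refl)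

lemma chart_deriv_Ck_on:
  assumes "smooth_map X f" "c \<in> atlas S"
  shows "Ck_on n (in_chart c (\<lambda>p. chart_deriv c f p v)) (snd c ` (fst c \<inter> X))"
proof (rule Ck_on_cong)
  show "open (snd c ` (fst c \<inter> X))" using assms by (simp add: smooth_map_def open_chart_image_Int)
  show "Ck_on n (\<lambda>x. frechet_derivative (in_chart c f) (at x) v) (snd c ` (fst c \<inter> X))"
    using assms Ck_on_deriv unfolding smooth_map_def by blast
  show "frechet_derivative (in_chart c f) (at x) v = in_chart c (\<lambda>p. chart_deriv c f p v) x"
    if "x \<in> snd c ` (fst c \<inter> X)" for x
    using that assms by (auto simp: in_chart_chart chart_deriv_def)
qed

text \<open>The matrix of the equations \<open>\<omega>(X, e\<^sub>j) = - df(e\<^sub>j)\<close> in \<open>X\<close>; Cramer's rule makes the Hamiltonian vector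
  field smooth.\<close>

definition form_matrix :: "'m chart \<Rightarrow> 'm \<Rightarrow> real^4^4" where
  "form_matrix c p = (\<chi> j i. sform S c p (axis i 1) (axis j 1))"

lemma linear_eq_on_axes:
  assumes "linear h" "linear g" "\<And>j. h (axis j 1 :: real^4) = (g (axis j 1) :: real)"
  shows "h v = g v"
proof -
  have E: "h v = (\<Sum>i\<in>UNIV. v $ i * h (axis i 1))" if "linear h" for h :: "real^4 \<Rightarrow> real" and v
  proof -
    have "v = (\<Sum>i\<in>UNIV. v $ i *\<^sub>R axis i 1)" using basis_expansion[of v] by (simp add: scalar_mult_eq_scaleR)
    then have "h v = h (\<Sum>i\<in>UNIV. v $ i *\<^sub>R axis i 1)" by simp
    then show ?thesis using \<open>linear h\<close> by (simp add: linear_sum linear_scale)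
  qed
  show ?thesis using E[OF assms(1), of v] E[OF assms(2), of v] assms(3) by simp
qed

lemma form_matrix_mult:
  assumes "c \<in> atlas S" "p \<in> fst c"
  shows "(form_matrix c p *v Z) $ j = sform S c p Z (axis j 1)"
proof -
  have "sform S c p Z (axis j 1) = sform S c p (\<Sum>i\<in>UNIV. Z $ i *\<^sub>R axis i 1) (axis j 1)"
    using basis_expansion[of Z] by (simp add: scalar_mult_eq_scaleR)
  also have "\<dots> = (\<Sum>i\<in>UNIV. Z $ i * sform S c p (axis i 1) (axis j 1))"
    using linear_sum[OF sform_linear_left[OF assms], of "\<lambda>i. Z $ i *\<^sub>R axis i 1" UNIV "axis j 1"]
      linear_scale[OF sform_linear_left[OF assms], of _ _ "axis j 1"] by simp
  finally show ?thesis by (simp add: form_matrix_def matrix_vector_mult_def mult.commute)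
qed

lemma det_form_matrix:
  assumes "c \<in> atlas S" "p \<in> fst c" shows "det (form_matrix c p) \<noteq> 0"
proof -
  have "Z = 0" if "form_matrix c p *v Z = 0" for Z
  proof (rule sform_nondegenerate[OF assms])
    fix w
    have "sform S c p Z w = (\<lambda>_. 0) w"
      by (rule linear_eq_on_axes[OF sform_linear_right[OF assms]])
        (use that form_matrix_mult[OF assms, of Z] in \<open>auto simp: linear_0 intro: linear_zero\<close>)
    then show "sform S c p Z w = 0" by simp
  qed
  then have "inj ((*v) (form_matrix c p))"
    by (simp add: linear_injective_0[OF matrix_vector_mul_linear])
  then show ?thesis
    using matrix_left_invertible_injective invertible_det_nz invertible_left_inverse by metis
qed

lemma ham_vec_unique:
  assumes c: "c \<in> atlas S" "p \<in> fst c" and Z: "\<And>v. sform S c p Z v = - chart_deriv c f p v"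
  shows "ham_vec S f c p = Z"
  unfolding ham_vec_def
proof (rule the_equality)
  fix Z' assume "\<forall>v. sform S c p Z' v = - chart_deriv c f p v"
  then have "sform S c p (Z' - Z) v = 0" for v
    using linear_diff[OF sform_linear_left[OF c], of Z' Z v] Z by simp
  then show "Z' = Z" using sform_nondegenerate[OF c, of "Z' - Z"] by simp
qed (use Z in simp)

definition cramer_ham :: "('m \<Rightarrow> real) \<Rightarrow> 'm chart \<Rightarrow> 'm \<Rightarrow> real^4" where
  "cramer_ham f c p = (\<chi> k. det (\<chi> i j. if j = k then - chart_deriv c f p (axis i 1) else form_matrix c p $ i $ j)
     * inverse (det (form_matrix c p)))"

lemma cramer_ham:
  assumes c: "c \<in> atlas S" "p \<in> fst c" and f: "linear (chart_deriv c f p)"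
  shows "sform S c p (cramer_ham f c p) v = - chart_deriv c f p v"
proof (rule linear_eq_on_axes[OF sform_linear_right[OF c]])
  show "linear (\<lambda>v. - chart_deriv c f p v)" using f by (rule linear_compose_neg)
  fix j
  have "cramer_ham f c p = (\<chi> k. det (\<chi> i j. if j = k then (\<chi> i. - chart_deriv c f p (axis i 1)) $ i else form_matrix c p $ i $ j)
     / det (form_matrix c p))"
    by (simp add: cramer_ham_def divide_inverse cong: if_cong)
  then have "form_matrix c p *v cramer_ham f c p = (\<chi> i. - chart_deriv c f p (axis i 1))"
    using cramer[OF det_form_matrix[OF c]] by blast
  then show "sform S c p (cramer_ham f c p) (axis j 1) = - chart_deriv c f p (axis j 1)"
    using form_matrix_mult[OF c, of "cramer_ham f c p" j] by simp
qed

lemma sform_ham_vec: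
  assumes "c \<in> atlas S" "p \<in> fst c" and "linear (chart_deriv c f p)"
  shows "sform S c p (ham_vec S f c p) v = - chart_deriv c f p v"
  using ham_vec_unique[OF assms(1,2), of "cramer_ham f c p" f] cramer_ham[OF assms] by simp

lemma ham_vec_Ck_on:
  assumes f: "smooth_map X f" and c: "c \<in> atlas S"
  shows "Ck_on n (in_chart c (ham_vec S f c)) (snd c ` (fst c \<inter> X))"
proof -
  define U where "U = snd c ` (fst c \<inter> X)"
  have oU: "open U" using f c by (simp add: U_def smooth_map_def open_chart_image_Int)
  have W: "Ck_on n (in_chart c (\<lambda>p. form_matrix c p $ i $ j)) U" for i j
    using Ck_on_subset[OF sform_Ck_on[OF c], of U] by (auto simp: form_matrix_def U_def)
  have F: "Ck_on n (in_chart c (\<lambda>p. - chart_deriv c f p v)) U" for v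
    using Ck_on_bounded_linear[OF oU bounded_linear_minus[OF bounded_linear_ident] chart_deriv_Ck_on[OF f c, of n v, folded U_def]]
    by (simp add: in_chart_def o_def)
  have det: "Ck_on n (\<lambda>x. det (\<chi> i j. a i j x)) U" if "\<And>i j. Ck_on n (a i j) U" for a :: "4 \<Rightarrow> 4 \<Rightarrow> real^4 \<Rightarrow> real"
    unfolding det_def by (simp, intro Ck_on_sum Ck_on_mult Ck_on_const Ck_on_prod oU that)
  have "Ck_on n (in_chart c (cramer_ham f c)) U"
    unfolding cramer_ham_def in_chart_def o_def
  proof (intro Ck_on_vec Ck_on_mult Ck_on_inverse oU det)
    fix k i j
    show "Ck_on n (\<lambda>x. if j = k then - chart_deriv c f (chart_inv c x) (axis i 1) else form_matrix c (chart_inv c x) $ i $ j) U"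
      using W F by (cases "j = k") (auto simp: in_chart_def o_def)
  next
    have "form_matrix c q = (\<chi> i j. form_matrix c q $ i $ j)" for q by simp
    then show "Ck_on n (\<lambda>x. det (form_matrix c (chart_inv c x))) U"
      using det[of "\<lambda>i j x. form_matrix c (chart_inv c x) $ i $ j"] W by (simp add: in_chart_def o_def)
  next
    fix x assume "x \<in> U"
    then show "det (form_matrix c (chart_inv c x)) \<noteq> 0"
      using det_form_matrix[OF c] chart_inv_in[OF c] by (auto simp: U_def)
  qed
  then show ?thesis unfolding U_def[symmetric]
  proof (rule Ck_on_cong[OF oU, rotated])
    fix x assume "x \<in> U"
    then obtain p where p: "p \<in> fst c" "p \<in> X" "x = snd c p" by (auto simp: U_def)
    show "in_chart c (cramer_ham f c) x = in_chart c (ham_vec S f c) x"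
      using ham_vec_unique[OF c p(1), of "cramer_ham f c p" f] cramer_ham[OF c p(1) smooth_map_linear[OF f c p(1,2)]] p c
      by (simp add: in_chart_chart)
  qed
qed

lemma chart_deriv_self:
  assumes "c \<in> atlas S" "p \<in> fst c" shows "chart_deriv c (snd c) p v = v"
proof -
  have "((\<lambda>x. x) has_derivative (\<lambda>v. v)) (at (snd c p))" by (rule has_derivative_ident)
  then have "(in_chart c (snd c) has_derivative (\<lambda>v. v)) (at (snd c p))"
    by (rule has_derivative_transform_within_open[OF _ open_chart_image[OF assms(1)]])
      (use assms in \<open>auto simp: in_chart_chart\<close>)
  then show ?thesis unfolding chart_deriv_def by (simp add: frechet_derivative_at[symmetric])
qed

lemma chart_deriv_inverse:
  assumes c: "c \<in> atlas S" "d \<in> atlas S" "p \<in> fst c" "p \<in> fst d"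
  shows "chart_deriv c (snd d) p (chart_deriv d (snd c) p w) = w"
proof -
  have "in_chart c (snd d) differentiable (at (snd c p))"
    using transition_has_derivative[OF c] by (auto simp: differentiable_def)
  from chart_deriv_chain(2)[OF c(2,1,4,3) this, of w] show ?thesis by (simp add: chart_deriv_self c)
qed

lemma smooth_map_chart_deriv_change:
  assumes f: "smooth_map X f" and c: "c \<in> atlas S" "d \<in> atlas S" "p \<in> fst c" "p \<in> fst d" and p: "p \<in> X"
  shows "chart_deriv c f p v = chart_deriv d f p (chart_deriv c (snd d) p v)"
  by (rule chart_deriv_chain(2)[OF c]) (use smooth_map_has_derivative[OF f c(2,4) p] in \<open>auto simp: differentiable_def\<close>)

lemma ham_vec_change_chart:
  assumes f: "smooth_map X f" and c: "c \<in> atlas S" "d \<in> atlas S" "p \<in> fst c" "p \<in> fst d" and p: "p \<in> X"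
  shows "chart_deriv c (snd d) p (ham_vec S f c p) = ham_vec S f d p"
proof (rule ham_vec_unique[OF c(2,4), symmetric])
  fix w
  define v where "v = chart_deriv d (snd c) p w"
  have w: "chart_deriv c (snd d) p v = w" unfolding v_def by (rule chart_deriv_inverse[OF c])
  have "sform S d p (chart_deriv c (snd d) p (ham_vec S f c p)) w = sform S c p (ham_vec S f c p) v"
    using sform_change_chart[OF c, of _ v] w by simp
  also have "\<dots> = - chart_deriv c f p v" by (rule sform_ham_vec[OF c(1,3) smooth_map_linear[OF f c(1,3) p]])
  also have "\<dots> = - chart_deriv d f p w" using smooth_map_chart_deriv_change[OF f c p, of v] w by simp
  finally show "sform S d p (chart_deriv c (snd d) p (ham_vec S f c p)) w = - chart_deriv d f p w" .
qed

lemma C1_field_ham_vec: "smooth_map X f \<Longrightarrow> C1_field X (ham_vec S f)"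
  using ham_vec_Ck_on[of X f _ "Suc 0"] ham_vec_change_chart[of X f]
  by (auto simp: C1_field_def smooth_map_def simp del: Ck_on.simps)

text \<open>Differentiating \<omega>(X_f, w) = - df(w), the same for \<open>g\<close>, and
  \<omega>(X_f, X_g) = 0 in coordinates gives linear relations between the derivatives of the fields
  and of \<omega>. With the symmetry of the Hessians and the closedness of \<omega> they yield
  \<omega>([X_f, X_g], w) = 0 for all w, and nondegeneracy concludes.\<close>

lemma commuting_ham_vec:
  assumes f: "smooth_map X f" and g: "smooth_map X g"
    and fg: "\<And>c p. c \<in> atlas S \<Longrightarrow> p \<in> fst c \<Longrightarrow> p \<in> X \<Longrightarrow> sform S c p (ham_vec S f c p) (ham_vec S g c p) = 0"
  shows "commuting X (ham_vec S f) (ham_vec S g)"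
  unfolding commuting_def
proof (intro ballI)
  fix c p assume c: "c \<in> atlas S" and p': "p \<in> fst c \<inter> X"
  then have p: "p \<in> fst c" "p \<in> X" by auto
  define U where "U = snd c ` (fst c \<inter> X)"
  have oU: "open U" using f c by (simp add: U_def smooth_map_def open_chart_image_Int)
  define x where "x = snd c p"
  have xU: "x \<in> U" using p by (simp add: x_def U_def)
  define W where "W = (\<lambda>a b. in_chart c (\<lambda>p. sform S c p a b))"
  define dW where "dW = (\<lambda>a b. frechet_derivative (W a b) (at x))"
  have W: "(W a b has_derivative dW a b) (at x)" for a b
    unfolding dW_def W_def
    by (rule Ck_on_has_derivative[OF sform_Ck_on[OF c, of "Suc 0"]]) (use p in \<open>auto simp: x_def\<close>)
  have inU: "chart_inv c y \<in> fst c" "chart_inv c y \<in> X" "snd c (chart_inv c y) = y" if "y \<in> U" for y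
    using that chart_inv_in[OF c] chart_chart_inv[OF c] by (auto simp: U_def)
  have Wlin: "linear (\<lambda>a. W a b y)" "linear (\<lambda>b. W a b y)" if "y \<in> U" for a b y
    using sform_linear[OF c inU(1)[OF that]] by (simp_all add: W_def in_chart_def)
  have Wanti: "W a b y = - W b a y" if "y \<in> U" for a b y
    unfolding W_def in_chart_def o_def by (rule sform_antisym[OF c inU(1)[OF that]])
  have exp4: "v = (\<Sum>i\<in>UNIV. v $ i *\<^sub>R axis i 1)" for v :: "real^4"
    using basis_expansion[of v] by (simp add: scalar_mult_eq_scaleR)
  have Wexp: "W a b y = (\<Sum>i\<in>UNIV. a $ i * W (axis i 1) b y)" if "y \<in> U" for a b y
    by (subst exp4[of a]) (simp add: linear_sum[OF Wlin(1)[OF that]] linear_scale[OF Wlin(1)[OF that]])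
  have Wexp2: "W a b y = (\<Sum>i\<in>UNIV. b $ i * W a (axis i 1) y)" if "y \<in> U" for a b y
    by (subst exp4[of b]) (simp add: linear_sum[OF Wlin(2)[OF that]] linear_scale[OF Wlin(2)[OF that]])
  text \<open>The derivative of \<open>y \<mapsto> W (a y) b y\<close> by the product rule.\<close>
  have prod: "((\<lambda>y. W (a y) b y) has_derivative (\<lambda>v. W (a' v) b x + dW (a x) b v)) (at x)"
    if a: "(a has_derivative a') (at x)" for a a' b
  proof -
    have "((\<lambda>y. \<Sum>i\<in>UNIV. a y $ i * W (axis i 1) b y) has_derivative
        (\<lambda>v. \<Sum>i\<in>UNIV. a x $ i * dW (axis i 1) b v + a' v $ i * W (axis i 1) b x)) (at x)"
      by (intro has_derivative_sum has_derivative_mult W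
          bounded_linear.has_derivative[OF bounded_linear_vec_nth a])
    then have d: "((\<lambda>y. W (a y) b y) has_derivative
        (\<lambda>v. \<Sum>i\<in>UNIV. a x $ i * dW (axis i 1) b v + a' v $ i * W (axis i 1) b x)) (at x)"
      by (rule has_derivative_transform_within_open[OF _ oU xU]) (use Wexp in simp)
    have "((\<lambda>y. \<Sum>i\<in>UNIV. a x $ i * W (axis i 1) b y) has_derivative (\<lambda>v. \<Sum>i\<in>UNIV. a x $ i * dW (axis i 1) b v)) (at x)"
      by (intro has_derivative_sum has_derivative_mult_right W)
    then have "(W (a x) b has_derivative (\<lambda>v. \<Sum>i\<in>UNIV. a x $ i * dW (axis i 1) b v)) (at x)"
      by (rule has_derivative_transform_within_open[OF _ oU xU]) (use Wexp in simp)
    then have "dW (a x) b = (\<lambda>v. \<Sum>i\<in>UNIV. a x $ i * dW (axis i 1) b v)"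
      using W has_derivative_unique by blast
    moreover have "W (a' v) b x = (\<Sum>i\<in>UNIV. a' v $ i * W (axis i 1) b x)" for v by (rule Wexp[OF xU])
    ultimately show ?thesis using d by (simp add: sum.distrib add.commute)
  qed
  have dWanti: "dW a b v = - dW b a v" for a b v
  proof -
    have "((\<lambda>y. - W b a y) has_derivative (\<lambda>v. - dW b a v)) (at x)" by (intro has_derivative_minus W)
    then have "(W a b has_derivative (\<lambda>v. - dW b a v)) (at x)"
      by (rule has_derivative_transform_within_open[OF _ oU xU]) (rule Wanti[symmetric])
    then show ?thesis using W has_derivative_unique by metis
  qed
  define uf where "uf = in_chart c (ham_vec S f c)"
  define ug where "ug = in_chart c (ham_vec S g c)"
  define Du where "Du = chart_deriv c (ham_vec S f c) p"
  define Dv where "Dv = chart_deriv c (ham_vec S g c) p"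
  have uf: "(uf has_derivative Du) (at x)" and ug: "(ug has_derivative Dv) (at x)"
    unfolding uf_def ug_def Du_def Dv_def x_def using C1_field_has_derivative[OF C1_field_ham_vec c p] f g by auto
  have ham: "((\<lambda>y. W (in_chart c (ham_vec S h c) y) w y) has_derivative
     (\<lambda>v. - frechet_derivative (\<lambda>z. frechet_derivative (in_chart c h) (at z) w) (at x) v)) (at x)"
    if h: "smooth_map X h" for h w
  proof -
    have C2: "Ck_on (Suc (Suc 0)) (in_chart c h) U" using h c unfolding smooth_map_def U_def by blast
    have "((\<lambda>z. - frechet_derivative (in_chart c h) (at z) w) has_derivative
      (\<lambda>v. - frechet_derivative (\<lambda>z. frechet_derivative (in_chart c h) (at z) w) (at x) v)) (at x)"
      by (intro has_derivative_minus Ck_on_has_derivative[OF Ck_on_deriv[OF C2] xU])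
    then show ?thesis
    proof (rule has_derivative_transform_within_open[OF _ oU xU])
      fix y assume y: "y \<in> U"
      show "- frechet_derivative (in_chart c h) (at y) w = W (in_chart c (ham_vec S h c) y) w y"
        using sform_ham_vec[OF c inU(1)[OF y] smooth_map_linear[OF h c inU(1,2)[OF y]], of w] inU(3)[OF y]
        by (simp add: W_def in_chart_def chart_deriv_def)
    qed
  qed
  define Qf where "Qf = (\<lambda>w v. frechet_derivative (\<lambda>z. frechet_derivative (in_chart c f) (at z) w) (at x) v)"
  define Qg where "Qg = (\<lambda>w v. frechet_derivative (\<lambda>z. frechet_derivative (in_chart c g) (at z) w) (at x) v)"
  have sym: "Qf a b = Qf b a" "Qg a b = Qg b a" for a b
    using f g c second_derivative_symmetric[OF oU xU] unfolding Qf_def Qg_def smooth_map_def U_def by blast+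
  have Ef: "W (Du v) w x + dW (uf x) w v = - Qf w v" for v w
    unfolding Qf_def by (rule fun_cong[OF has_derivative_unique[OF prod[OF uf, of w] ham[OF f, of w, folded uf_def]]])
  have Eg: "W (Dv v) w x + dW (ug x) w v = - Qg w v" for v w
    unfolding Qg_def by (rule fun_cong[OF has_derivative_unique[OF prod[OF ug, of w] ham[OF g, of w, folded ug_def]]])
  \<comment> \<open>The relation \<omega>(X_f, X_g) = 0, differentiated. Both arguments vary with
    the point, so the second one is expanded in the coordinate basis before \<open>prod\<close> is
    applied.\<close>
  have inv: "W (Du w) (ug x) x + W (uf x) (Dv w) x + dW (uf x) (ug x) w = 0" for w
  proof -
    have "((\<lambda>y. \<Sum>j\<in>UNIV. ug y $ j * W (uf y) (axis j 1) y) has_derivative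
        (\<lambda>v. \<Sum>j\<in>UNIV. ug x $ j * (W (Du v) (axis j 1) x + dW (uf x) (axis j 1) v) + Dv v $ j * W (uf x) (axis j 1) x)) (at x)"
      (is "(?G has_derivative ?G') _")
      by (intro has_derivative_sum has_derivative_mult prod[OF uf]
          bounded_linear.has_derivative[OF bounded_linear_vec_nth ug])
    moreover have "?G y = 0" if "y \<in> U" for y
    proof -
      have "(\<Sum>j\<in>UNIV. ug y $ j * W (uf y) (axis j 1) y) = W (uf y) (ug y) y"
        by (rule Wexp2[OF that, symmetric])
      also have "\<dots> = 0" using fg[OF c inU(1,2)[OF that]] by (simp add: W_def uf_def ug_def in_chart_def)
      finally show ?thesis .
    qed
    ultimately have "((\<lambda>y. 0) has_derivative ?G') (at x)"
      by (rule has_derivative_transform_within_open[OF _ oU xU])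
    then have z: "(\<Sum>j\<in>UNIV. ug x $ j * (W (Du w) (axis j 1) x + dW (uf x) (axis j 1) w) + Dv w $ j * W (uf x) (axis j 1) x) = 0"
      by (rule fun_cong[OF has_derivative_unique[OF _ has_derivative_const]])
    note W2 = Wexp2[OF xU]
    have dW2: "dW a b v = (\<Sum>j\<in>UNIV. b $ j * dW a (axis j 1) v)" for a b v
    proof -
      have "((\<lambda>y. \<Sum>j\<in>UNIV. b $ j * W a (axis j 1) y) has_derivative (\<lambda>v. \<Sum>j\<in>UNIV. b $ j * dW a (axis j 1) v)) (at x)"
        by (intro has_derivative_sum has_derivative_mult_right W)
      then have "(W a b has_derivative (\<lambda>v. \<Sum>j\<in>UNIV. b $ j * dW a (axis j 1) v)) (at x)"
        by (rule has_derivative_transform_within_open[OF _ oU xU])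
          (rule Wexp2[symmetric])
      then show ?thesis by (rule fun_cong[OF has_derivative_unique[OF W]])
    qed
    show ?thesis
      using z W2[of "Du w" "ug x"] W2[of "uf x" "Dv w"] dW2[of "uf x" "ug x" w]
      by (simp add: sum.distrib algebra_simps)
  qed
  have closed: "dW v w u' + dW w u' v + dW u' v w = 0" for u' v w
    using sform_closed[OF c p(1), of v w u'] by (simp add: dW_def W_def chart_deriv_def x_def)
  have "W (Du (ug x) - Dv (uf x)) w x = 0" for w
  proof -
    have "W (Du (ug x) - Dv (uf x)) w x = W (Du (ug x)) w x - W (Dv (uf x)) w x"
      by (rule linear_diff[OF Wlin(1)[OF xU]])
    also have "\<dots> = - Qf w (ug x) - dW (uf x) w (ug x) + Qg w (uf x) + dW (ug x) w (uf x)"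
      using Ef[of "ug x" w] Eg[of "uf x" w] by linarith
    also have "\<dots> = 0"
      using Ef[of w "ug x"] Eg[of w "uf x"] sym(1)[of w "ug x"] sym(2)[of w "uf x"] inv[of w] closed[of "uf x" "ug x" w]
        dWanti[of "ug x" "uf x" w] dWanti[of w "uf x" "ug x"] Wanti[OF xU, of "Dv w" "uf x"]
      by linarith
    finally show ?thesis .
  qed
  then have "Du (ug x) - Dv (uf x) = 0"
    by (intro sform_nondegenerate[OF c p(1)]) (use p c in \<open>simp add: W_def x_def in_chart_chart\<close>)
  then show "chart_deriv c (ham_vec S f c) p (ham_vec S g c p) = chart_deriv c (ham_vec S g c) p (ham_vec S f c p)"
    using p c by (simp add: Du_def Dv_def uf_def ug_def x_def in_chart_chart)
qed

lemma ham_curve_iff: "ham_curve S X f J \<gamma> \<longleftrightarrow> \<gamma> ` J \<subseteq> X \<and> icurve J (\<lambda>_. ham_vec S f) \<gamma>"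
  by (simp add: ham_curve_def icurve_def)

lemma ham_flow_eq:
  assumes f: "smooth_map X f" and g: "ham_curve S X f (closed_segment 0 t) \<gamma>" "\<gamma> 0 = p"
  shows "ham_flow S X f t p = \<gamma> t"
  unfolding ham_flow_def
proof (rule the_equality)
  fix q assume "\<exists>\<gamma>. ham_curve S X f (closed_segment 0 t) \<gamma> \<and> \<gamma> 0 = p \<and> \<gamma> t = q"
  then obtain \<gamma>' where g': "ham_curve S X f (closed_segment 0 t) \<gamma>'" "\<gamma>' 0 = p" "\<gamma>' t = q" by blast
  have "\<gamma>' t = \<gamma> t"
    by (rule icurve_unique[OF C1_field_lip[OF C1_field_ham_vec[OF f]]]) (use g g' in \<open>auto simp: ham_curve_iff\<close>)
  then show "q = \<gamma> t" using g' by simp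
qed (use g in blast)

text \<open>\<open>ham_flow\<close> is a definite description; the periodic curve granted by
  \<open>periodic_flow\<close>, together with uniqueness, shows what it denotes at every
  time.\<close>

lemma cflow_ham_flow:
  assumes f: "smooth_map X f" and "periodic_flow S X f"
  shows "cflow X (ham_vec S f) (ham_flow S X f)"
  unfolding cflow_def
proof (intro conjI ballI)
  fix p assume "p \<in> X"
  then obtain \<gamma> where g: "ham_curve S X f UNIV \<gamma>" "\<gamma> 0 = p" "\<And>t. \<gamma> (t + 2 * pi) = \<gamma> t"
    using assms(2) unfolding periodic_flow_def by blast
  have "ham_flow S X f t p = \<gamma> t" for t
    by (rule ham_flow_eq[where \<gamma> = \<gamma>, OF f _ g(2)]) (use g in \<open>auto simp: ham_curve_iff intro: icurve_subset\<close>)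
  then show "icurve UNIV (\<lambda>_. ham_vec S f) (\<lambda>t. ham_flow S X f t p)" "ham_flow S X f 0 p = p"
    "\<forall>t. ham_flow S X f t p \<in> X \<and> ham_flow S X f (t + 2 * pi) p = ham_flow S X f t p"
    using g by (auto simp: ham_curve_iff)
qed (rule C1_field_ham_vec[OF f])

end

section \<open>First variation of the action\<close>

context symplectic begin

definition pairing :: "'m one_form \<Rightarrow> (real \<Rightarrow> 'm) \<Rightarrow> (real \<Rightarrow> 'm chart \<Rightarrow> real^4) \<Rightarrow> real \<Rightarrow> real" where
  "pairing \<theta> \<gamma> \<gamma>' t = \<theta> (chart_at S (\<gamma> t)) (\<gamma> t) (\<gamma>' t (chart_at S (\<gamma> t)))"

text \<open>\<open>\<gamma>' t c\<close> is the velocity of \<open>\<gamma>\<close> in the chart \<open>c\<close>.\<close>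

definition C1_curve :: "'m set \<Rightarrow> (real \<Rightarrow> 'm) \<Rightarrow> (real \<Rightarrow> 'm chart \<Rightarrow> real^4) \<Rightarrow> bool" where
  "C1_curve X \<gamma> \<gamma>' \<longleftrightarrow> icurve UNIV (\<lambda>t c p. \<gamma>' t c) \<gamma> \<and> range \<gamma> \<subseteq> X \<and>
     (\<forall>c\<in>atlas S. continuous_on {t. \<gamma> t \<in> fst c} (\<lambda>t. \<gamma>' t c))"

definition form_vec :: "'m one_form \<Rightarrow> 'm chart \<Rightarrow> 'm \<Rightarrow> real^4" where
  "form_vec \<theta> c p = (\<chi> j. \<theta> c p (axis j 1))"

lemma C1_curve_has_vector_derivative:
  assumes "C1_curve X \<gamma> \<gamma>'" "c \<in> atlas S" "\<gamma> t \<in> fst c"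
  shows "((snd c \<circ> \<gamma>) has_vector_derivative \<gamma>' t c) (at t)"
  using icurve_D[of UNIV "\<lambda>t c p. \<gamma>' t c" \<gamma> t c] assms by (simp add: C1_curve_def)

lemma C1_curve_open:
  assumes "C1_curve X \<gamma> \<gamma>'" "c \<in> atlas S" shows "open {t. \<gamma> t \<in> fst c}"
  using assms icurve_continuous open_vimage[OF open_chart[OF assms(2)], of \<gamma>]
  unfolding C1_curve_def vimage_def by blast

lemma line_integral_pairing:
  assumes "C1_curve X \<gamma> \<gamma>'" shows "line_integral S \<theta> \<gamma> a b = integral {a..b} (pairing \<theta> \<gamma> \<gamma>')"
proof -
  have "vector_derivative (snd (chart_at S (\<gamma> t)) \<circ> \<gamma>) (at t) = \<gamma>' t (chart_at S (\<gamma> t))" for t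
    by (rule vector_derivative_at[OF C1_curve_has_vector_derivative[OF assms chart_at_atlas in_chart_at]])
  then show ?thesis unfolding line_integral_def pairing_def by simp
qed

lemma C1_field_scale:
  assumes "C1_field X u" shows "C1_field X (\<lambda>c p. k *\<^sub>R u c p)"
proof -
  have "linear (chart_deriv c (snd d) p)" if "c \<in> atlas S" "d \<in> atlas S" "p \<in> fst c" "p \<in> fst d" for c d p
    using transition_has_derivative[OF that] has_derivative_linear by blast
  moreover have "Ck_on (Suc 0) (in_chart c (\<lambda>p. k *\<^sub>R u c p)) (snd c ` (fst c \<inter> X))" if c: "c \<in> atlas S" for c
  proof -
    have "open X" "Ck_on (Suc 0) (in_chart c (u c)) (snd c ` (fst c \<inter> X))"
      using assms c by (simp_all add: C1_field_def)
    from Ck_on_bounded_linear[OF open_chart_image_Int[OF c this(1)] bounded_linear_scaleR_right this(2), of k]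
    show ?thesis by (simp add: in_chart_def o_def)
  qed
  ultimately show ?thesis
    using assms unfolding C1_field_def by (auto simp: linear_scale simp del: Ck_on.simps)
qed

lemma C1_curve_icurve:
  assumes u: "C1_field X u" and g: "icurve UNIV (\<lambda>_. u) \<gamma>" "range \<gamma> \<subseteq> X"
  shows "C1_curve X \<gamma> (\<lambda>t c. u c (\<gamma> t))"
  unfolding C1_curve_def
proof (intro conjI ballI g(2))
  show "icurve UNIV (\<lambda>t c p. u c (\<gamma> t)) \<gamma>" using g(1) by (simp add: icurve_def)
  fix c assume c: "c \<in> atlas S"
  have "continuous_on (snd c ` (fst c \<inter> X)) (in_chart c (u c))"
    using u c Ck_on_Suc_imp[of 0 "in_chart c (u c)"] unfolding C1_field_def by (auto simp del: Ck_on.simps(2))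
  moreover have "continuous_on {t. \<gamma> t \<in> fst c} (\<lambda>t. snd c (\<gamma> t))"
    by (rule continuous_on_compose2[OF continuous_on_chart[OF c] continuous_on_subset[OF icurve_continuous[OF g(1)]]]) auto
  ultimately have "continuous_on {t. \<gamma> t \<in> fst c} (\<lambda>t. in_chart c (u c) (snd c (\<gamma> t)))"
    by (rule continuous_on_compose2) (use g(2) in auto)
  then show "continuous_on {t. \<gamma> t \<in> fst c} (\<lambda>t. u c (\<gamma> t))"
    by (rule continuous_on_eq) (simp add: in_chart_chart c)
qed

end

locale primitive_form = symplectic S for S :: "('m::t2_space) int_sys" +
  fixes X :: "'m set" and \<theta> :: "'m one_form"
  assumes X: "open X" and primitive: "primitive_on S X \<theta>"
begin

lemma form_vec_Ck_on: "c \<in> atlas S \<Longrightarrow> Ck_on n (in_chart c (form_vec \<theta> c)) (snd c ` (fst c \<inter> X))"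
proof -
  assume c: "c \<in> atlas S"
  have "Ck_on n (in_chart c (\<lambda>p. \<theta> c p v)) (snd c ` (fst c \<inter> (fst c \<inter> X)))" for v
    by (rule smooth_fun_Ck_on) (use primitive c open_Int[OF open_chart[OF c] X] in \<open>auto simp: primitive_on_def\<close>)
  moreover have "fst c \<inter> (fst c \<inter> X) = fst c \<inter> X" by auto
  ultimately show ?thesis
    unfolding form_vec_def in_chart_def o_def by (intro Ck_on_vec open_chart_image_Int c X) simp
qed

lemma form_linear: "c \<in> atlas S \<Longrightarrow> p \<in> fst c \<Longrightarrow> p \<in> X \<Longrightarrow> linear (\<theta> c p)"
  and form_closed: "c \<in> atlas S \<Longrightarrow> p \<in> fst c \<Longrightarrow> p \<in> X \<Longrightarrow>
     chart_deriv c (\<lambda>q. \<theta> c q w) p v - chart_deriv c (\<lambda>q. \<theta> c q v) p w = sform S c p v w"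
  and form_change_chart: "c \<in> atlas S \<Longrightarrow> d \<in> atlas S \<Longrightarrow> p \<in> fst c \<Longrightarrow> p \<in> fst d \<Longrightarrow> p \<in> X \<Longrightarrow>
     \<theta> d p (chart_deriv c (snd d) p v) = \<theta> c p v"
  using primitive unfolding primitive_on_def by blast+

lemma form_inner: "c \<in> atlas S \<Longrightarrow> p \<in> fst c \<Longrightarrow> p \<in> X \<Longrightarrow> \<theta> c p v = form_vec \<theta> c p \<bullet> v"
  by (rule linear_eq_on_axes[OF form_linear])
    (auto simp: form_vec_def inner_axis bounded_linear.linear[OF bounded_linear_inner_right])

lemma form_vec_has_derivative:
  assumes "c \<in> atlas S" "p \<in> fst c" "p \<in> X"
  shows "(in_chart c (form_vec \<theta> c) has_derivative chart_deriv c (form_vec \<theta> c) p) (at (snd c p))"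
  unfolding chart_deriv_def by (rule Ck_on_has_derivative[OF form_vec_Ck_on[of c "Suc 0"]]) (use assms in auto)

lemma form_vec_closed:
  assumes c: "c \<in> atlas S" "p \<in> fst c" "p \<in> X"
  shows "chart_deriv c (form_vec \<theta> c) p v \<bullet> w - chart_deriv c (form_vec \<theta> c) p w \<bullet> v = sform S c p v w"
proof -
  have "chart_deriv c (\<lambda>q. \<theta> c q w) p v = chart_deriv c (form_vec \<theta> c) p v \<bullet> w" for v w
  proof -
    have "((\<lambda>x. in_chart c (form_vec \<theta> c) x \<bullet> w) has_derivative (\<lambda>v. chart_deriv c (form_vec \<theta> c) p v \<bullet> w)) (at (snd c p))"
      by (intro has_derivative_inner_left form_vec_has_derivative c)
    then have "(in_chart c (\<lambda>q. \<theta> c q w) has_derivative (\<lambda>v. chart_deriv c (form_vec \<theta> c) p v \<bullet> w)) (at (snd c p))"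
      by (rule has_derivative_transform_within_open[OF _ open_chart_image_Int[OF c(1) X]])
        (use c in \<open>auto simp: in_chart_chart form_inner\<close>)
    then show ?thesis unfolding chart_deriv_def[of c "\<lambda>q. \<theta> c q w"] by (simp add: frechet_derivative_at[symmetric])
  qed
  then show ?thesis using form_closed[OF c, of w v] by simp
qed

text \<open>\<open>chart_at\<close> may jump along the curve. The value of the integrand does not
  depend on the chart, so locally it can be read in a fixed one, where continuity becomes
  visible.\<close>

lemma pairing_chart:
  assumes g: "C1_curve X \<gamma> \<gamma>'" and c: "c \<in> atlas S" "\<gamma> t \<in> fst c"
  shows "pairing \<theta> \<gamma> \<gamma>' t = form_vec \<theta> c (\<gamma> t) \<bullet> \<gamma>' t c"
proof -
  define d where "d = chart_at S (\<gamma> t)"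
  have d: "d \<in> atlas S" "\<gamma> t \<in> fst d" unfolding d_def by (rule chart_at_atlas in_chart_at)+
  have "((snd d \<circ> \<gamma>) has_vector_derivative chart_deriv c (snd d) (\<gamma> t) (\<gamma>' t c)) (at t)"
    by (rule curve_change_chart[OF c(1) d(1) c(2) d(2) _ UNIV_I C1_curve_has_vector_derivative[OF g c]])
      (use g icurve_continuous in \<open>auto simp: C1_curve_def\<close>)
  then have "\<gamma>' t d = chart_deriv c (snd d) (\<gamma> t) (\<gamma>' t c)"
    using C1_curve_has_vector_derivative[OF g d] vector_derivative_unique_at by blast
  moreover have "\<gamma> t \<in> X" using g by (auto simp: C1_curve_def)
  ultimately show ?thesis
    using form_change_chart[OF c(1) d(1) c(2) d(2), of "\<gamma>' t c"] form_inner[OF c, of "\<gamma>' t c"] by (simp add: pairing_def d_def)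
qed

lemma form_vec_continuous:
  assumes g: "C1_curve X \<gamma> \<gamma>'" and c: "c \<in> atlas S"
  shows "continuous_on {t. \<gamma> t \<in> fst c} (\<lambda>t. form_vec \<theta> c (\<gamma> t))"
proof -
  have gX: "\<gamma> t \<in> X" for t using g by (auto simp: C1_curve_def)
  have "continuous_on {t. \<gamma> t \<in> fst c} (\<lambda>t. snd c (\<gamma> t))"
    by (rule continuous_on_compose2[OF continuous_on_chart[OF c]])
      (use g icurve_continuous in \<open>auto simp: C1_curve_def intro: continuous_on_subset\<close>)
  then have "continuous_on {t. \<gamma> t \<in> fst c} (\<lambda>t. in_chart c (form_vec \<theta> c) (snd c (\<gamma> t)))"
    by (rule continuous_on_compose2[rotated]) (use form_vec_Ck_on[OF c, of 0] gX in auto)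
  then show ?thesis by (rule continuous_on_eq) (simp add: in_chart_chart c)
qed

lemma pairing_continuous:
  assumes g: "C1_curve X \<gamma> \<gamma>'" shows "continuous_on UNIV (pairing \<theta> \<gamma> \<gamma>')"
proof (rule continuous_on_open_UN[of UNIV "\<lambda>t0. {t. \<gamma> t \<in> fst (chart_at S (\<gamma> t0))}", simplified, THEN continuous_on_subset])
  fix t0
  define c where "c = chart_at S (\<gamma> t0)"
  have c: "c \<in> atlas S" unfolding c_def by (rule chart_at_atlas)
  show "open {t. \<gamma> t \<in> fst (chart_at S (\<gamma> t0))}" using C1_curve_open[OF g c] by (simp add: c_def)
  have "continuous_on {t. \<gamma> t \<in> fst c} (\<lambda>t. form_vec \<theta> c (\<gamma> t) \<bullet> \<gamma>' t c)"
    using g c form_vec_continuous[OF g c] by (auto simp: C1_curve_def intro!: continuous_on_inner)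
  then show "continuous_on {t. \<gamma> t \<in> fst (chart_at S (\<gamma> t0))} (pairing \<theta> \<gamma> \<gamma>')"
    unfolding c_def[symmetric] by (rule continuous_on_eq) (use pairing_chart[OF g c] in simp)
qed (use in_chart_at in auto)

lemma pairing_integrable: "C1_curve X \<gamma> \<gamma>' \<Longrightarrow> pairing \<theta> \<gamma> \<gamma>' integrable_on {a..b}"
  by (intro integrable_continuous_real continuous_on_subset[OF pairing_continuous]) auto

end

text \<open>A family of loops \<open>Y q\<close> in the common levels of \<open>f\<close> and \<open>g\<close>, with Lipschitz dependence on \<open>q\<close> at the
  loop \<open>\<gamma>\<close> over \<open>q0\<close>. No differentiability in \<open>q\<close> is needed for the first variation of the action: only
  values of \<open>f\<close> and \<open>g\<close> enter, up to \<open>o(\<bar>q - q0\<bar>)\<close>.\<close>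

locale curve_family = primitive_form S X \<theta> for S :: "('m::t2_space) int_sys" and X \<theta> +
  fixes f g :: "'m \<Rightarrow> real" and \<gamma> :: "real \<Rightarrow> 'm" and \<gamma>' :: "real \<Rightarrow> 'm chart \<Rightarrow> real^4"
    and Y :: "'q::real_normed_vector \<Rightarrow> real \<Rightarrow> 'm" and Y' :: "'q \<Rightarrow> real \<Rightarrow> 'm chart \<Rightarrow> real^4" and q0 :: 'q
    and \<alpha> \<beta> :: "real \<Rightarrow> real" and fv gv :: "'q \<Rightarrow> real"
  assumes f: "smooth_map X f" and g: "smooth_map X g"
    and \<gamma>: "C1_curve X \<gamma> \<gamma>'" and Y: "\<forall>\<^sub>F q in at q0. C1_curve X (Y q) (Y' q)"
    and closed: "\<gamma> 1 = \<gamma> 0" "\<forall>\<^sub>F q in at q0. Y q 1 = Y q 0"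
    and \<alpha>: "continuous_on {0..1} \<alpha>" and \<beta>: "continuous_on {0..1} \<beta>"
    and \<gamma>': "\<And>t c. t \<in> {0..1} \<Longrightarrow> c \<in> atlas S \<Longrightarrow> \<gamma> t \<in> fst c \<Longrightarrow>
       \<gamma>' t c = \<alpha> t *\<^sub>R ham_vec S f c (\<gamma> t) + \<beta> t *\<^sub>R ham_vec S g c (\<gamma> t)"
    and fg\<gamma>: "\<And>t. t \<in> {0..1} \<Longrightarrow> f (\<gamma> t) = fv q0 \<and> g (\<gamma> t) = gv q0"
    and fgY: "\<forall>\<^sub>F q in at q0. \<forall>t\<in>{0..1}. f (Y q t) = fv q \<and> g (Y q t) = gv q"
    and lip: "\<And>t0. t0 \<in> {0..1} \<Longrightarrow> \<exists>c\<in>atlas S. \<gamma> t0 \<in> fst c \<and> (\<exists>d>0. \<exists>K\<ge>0. \<forall>\<^sub>F q in at q0. \<forall>t\<in>{0..1}. \<bar>t - t0\<bar> < d \<longrightarrow>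
       Y q t \<in> fst c \<and> norm (snd c (Y q t) - snd c (\<gamma> t)) \<le> K * norm (q - q0) \<and> norm (Y' q t c - \<gamma>' t c) \<le> K * norm (q - q0))"
begin

text \<open>The boundary term of the integration by parts in the first variation; the displacement
  from the loop \<gamma> to the nearby loop makes sense only in chart coordinates, whence the
  parameter \<open>c\<close>.\<close>

definition bdry :: "'m chart \<Rightarrow> real \<Rightarrow> 'q \<Rightarrow> real" where
  "bdry c t q = \<theta> c (\<gamma> t) (snd c (Y q t) - snd c (\<gamma> t))"

text \<open>The error of the expected first variation on a subinterval; it will turn out to be a
  difference of boundary terms up to o(|q - q0|).\<close>

definition defect :: "real \<Rightarrow> real \<Rightarrow> 'q \<Rightarrow> real" where
  "defect a b q = integral {a..b} (pairing \<theta> (Y q) (Y' q)) - integral {a..b} (pairing \<theta> \<gamma> \<gamma>')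
     - integral {a..b} \<alpha> * (fv q - fv q0) - integral {a..b} \<beta> * (gv q - gv q0)"

lemma small_norm: "e > 0 \<Longrightarrow> \<forall>\<^sub>F q in at q0. K * norm (q - q0) < e"
proof -
  assume "e > 0"
  have "((\<lambda>q. K * norm (q - q0)) \<longlongrightarrow> K * norm (q0 - q0)) (at q0)" by (intro tendsto_intros)
  then show ?thesis using \<open>e > 0\<close> by (auto dest: order_tendstoD)
qed

lemma \<gamma>_in: "\<gamma> t \<in> X" using \<gamma> by (auto simp: C1_curve_def)

lemma lip_at_family:
  assumes t: "t \<in> {0..1}" and c: "c \<in> atlas S" "\<gamma> t \<in> fst c"
  shows "lip_at q0 (\<gamma> t) (\<lambda>q. Y q t) c"
proof -
  obtain d \<delta> K where d: "d \<in> atlas S" "\<gamma> t \<in> fst d" and "\<delta> > 0"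
    and ev: "\<forall>\<^sub>F q in at q0. \<forall>s\<in>{0..1}. \<bar>s - t\<bar> < \<delta> \<longrightarrow>
       Y q s \<in> fst d \<and> norm (snd d (Y q s) - snd d (\<gamma> s)) \<le> K * norm (q - q0) \<and> norm (Y' q s d - \<gamma>' s d) \<le> K * norm (q - q0)"
    using lip[OF t] by blast
  have "lip_at q0 (\<gamma> t) (\<lambda>q. Y q t) d"
    unfolding lip_at_def by (rule exI[of _ K], rule eventually_mono[OF ev]) (use t \<open>\<delta> > 0\<close> in auto)
  then show ?thesis by (rule lip_at_change_chart[OF d(1) c(1) d(2) c(2)])
qed

text \<open>Displacements in two charts correspond to first order under the derivative of the
  transition map, and the form is invariant under it. Boundary terms computed in different charts at
  a common division point may thus be identified up to o(|q - q0|), which lets them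
  telescope.\<close>

lemma bdry_change_chart:
  assumes t: "t \<in> {0..1}" and c: "c \<in> atlas S" "\<gamma> t \<in> fst c" and d: "d \<in> atlas S" "\<gamma> t \<in> fst d" and e: "e > 0"
  shows "\<forall>\<^sub>F q in at q0. \<bar>bdry d t q - bdry c t q\<bar> \<le> e * norm (q - q0)"
proof -
  obtain K where K: "\<forall>\<^sub>F q in at q0. Y q t \<in> fst c \<and> norm (snd c (Y q t) - snd c (\<gamma> t)) \<le> K * norm (q - q0)"
    using lip_at_family[OF t c] unfolding lip_at_def by blast
  define B where "B = norm (form_vec \<theta> d (\<gamma> t)) + 1"
  have B: "B > 0" by (simp add: B_def add_nonneg_pos)
  define e1 where "e1 = e / (B * (\<bar>K\<bar> + 1))"
  have e1: "e1 > 0" using e B by (simp add: e1_def)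
  obtain \<eta> where \<eta>: "\<eta> > 0" "\<And>q. q \<in> fst c \<Longrightarrow> norm (snd c q - snd c (\<gamma> t)) < \<eta> \<Longrightarrow> q \<in> fst d \<and>
    norm (snd d q - snd d (\<gamma> t) - chart_deriv c (snd d) (\<gamma> t) (snd c q - snd c (\<gamma> t))) \<le> e1 * norm (snd c q - snd c (\<gamma> t))"
    using transition_expansion[OF c(1) d(1) c(2) d(2) e1] by metis
  show ?thesis using K small_norm[OF \<eta>(1), of K]
  proof eventually_elim
    case (elim q)
    define z where "z = snd d (Y q t) - snd d (\<gamma> t) - chart_deriv c (snd d) (\<gamma> t) (snd c (Y q t) - snd c (\<gamma> t))"
    have z: "norm z \<le> e1 * norm (snd c (Y q t) - snd c (\<gamma> t))" using \<eta>(2)[of "Y q t"] elim by (simp add: z_def)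
    have "bdry d t q - bdry c t q = \<theta> d (\<gamma> t) z"
      unfolding bdry_def z_def using form_change_chart[OF c(1) d(1) c(2) d(2) \<gamma>_in]
      by (simp add: linear_diff[OF form_linear[OF d \<gamma>_in]])
    also have "\<dots> = form_vec \<theta> d (\<gamma> t) \<bullet> z" by (rule form_inner[OF d \<gamma>_in])
    finally have "\<bar>bdry d t q - bdry c t q\<bar> \<le> norm (form_vec \<theta> d (\<gamma> t)) * norm z" by (simp add: Cauchy_Schwarz_ineq2)
    also have "\<dots> \<le> B * (e1 * ((\<bar>K\<bar> + 1) * norm (q - q0)))"
    proof (intro mult_mono order_trans[OF z] mult_left_mono)
      show "norm (snd c (Y q t) - snd c (\<gamma> t)) \<le> (\<bar>K\<bar> + 1) * norm (q - q0)"
        by (rule order_trans[OF conjunct2[OF elim(1)]]) (auto intro: mult_right_mono)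
    qed (use B e1 in \<open>auto simp: B_def\<close>)
    also have "\<dots> = e * norm (q - q0)"
    proof -
      have "\<bar>K\<bar> + 1 \<noteq> 0" using abs_ge_zero[of K] by linarith
      then show ?thesis using B by (simp add: e1_def)
    qed
    finally show ?case .
  qed
qed

lemma bounded_on_Icc:
  fixes h :: "real \<Rightarrow> 'z::real_normed_vector"
  assumes "continuous_on {a..b} h" obtains M where "M \<ge> 0" "\<And>t. t \<in> {a..b} \<Longrightarrow> norm (h t) \<le> M"
proof -
  obtain M where "\<forall>x\<in>h ` {a..b}. norm x \<le> M"
    using compact_imp_bounded[OF compact_continuous_image[OF assms compact_Icc]] unfolding bounded_iff by blast
  then show ?thesis using that[of "max M 0"] by (auto simp: max.coboundedI1)
qed

text \<open>Summed over a subdivision of \<open>[0, 1]\<close>, the boundary terms telescope and cancel since the loops are closed.\<close>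

lemma defect_step:
  assumes t0: "t0 \<in> {0..1}"
  obtains d where "d > 0" "\<And>a b e. a \<le> t0 \<Longrightarrow> t0 \<le> b \<Longrightarrow> b - a < d \<Longrightarrow> 0 \<le> a \<Longrightarrow> b \<le> 1 \<Longrightarrow> e > 0 \<Longrightarrow>
    \<forall>\<^sub>F q in at q0. \<bar>defect a b q - (bdry (chart_at S (\<gamma> b)) b q - bdry (chart_at S (\<gamma> a)) a q)\<bar> \<le> e * norm (q - q0)"
proof -
  obtain c d0 K where c: "c \<in> atlas S" "\<gamma> t0 \<in> fst c" and d0: "d0 > 0" "K \<ge> 0"
    and ev: "\<forall>\<^sub>F q in at q0. \<forall>t\<in>{0..1}. \<bar>t - t0\<bar> < d0 \<longrightarrow> Y q t \<in> fst c \<and> norm (snd c (Y q t) - snd c (\<gamma> t)) \<le> K * norm (q - q0) \<and>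
       norm (Y' q t c - \<gamma>' t c) \<le> K * norm (q - q0)"
    using lip[OF t0] by blast
  define x0 where "x0 = snd c (\<gamma> t0)"
  define U where "U = snd c ` (fst c \<inter> X)"
  have "open U" "x0 \<in> U" unfolding U_def x0_def using open_chart_image_Int[OF c(1) X] c \<gamma>_in by auto
  then obtain r where r: "r > 0" "cball x0 r \<subseteq> U" using open_contains_cball by blast
  have ic\<gamma>: "continuous_on UNIV \<gamma>" using \<gamma> icurve_continuous by (auto simp: C1_curve_def)
  obtain d1 where d1: "d1 > 0" "\<And>s. s \<in> UNIV \<Longrightarrow> \<bar>s - t0\<bar> < d1 \<Longrightarrow> \<gamma> s \<in> fst c \<and> snd c (\<gamma> s) \<in> ball x0 (r / 2)"
    by (rule curve_near_chart_point[OF ic\<gamma> UNIV_I c open_ball[of x0 "r / 2"]]) (use r x0_def in auto)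
  define \<Theta> where "\<Theta> = in_chart c (form_vec \<theta> c)"
  define F where "F = in_chart c f"
  define G where "G = in_chart c g"
  have C1: "Ck_on (Suc 0) \<Theta> U" "Ck_on (Suc 0) F U" "Ck_on (Suc 0) G U"
    using form_vec_Ck_on[OF c(1), of "Suc 0"] f g c unfolding \<Theta>_def F_def G_def U_def smooth_map_def by blast+
  obtain B where B: "B \<ge> 0" "\<And>x y. x \<in> cball x0 r \<Longrightarrow> y \<in> cball x0 r \<Longrightarrow> norm (\<Theta> x - \<Theta> y) \<le> B * norm (x - y)"
    using C1_Lipschitz[OF C1(1) compact_cball convex_cball r(2)] by metis
  obtain A1 where A1: "A1 \<ge> 0" "\<And>t. t \<in> {0..1} \<Longrightarrow> norm (\<alpha> t) \<le> A1" using bounded_on_Icc[OF \<alpha>] by metis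
  obtain A2 where A2: "A2 \<ge> 0" "\<And>t. t \<in> {0..1} \<Longrightarrow> norm (\<beta> t) \<le> A2" using bounded_on_Icc[OF \<beta>] by metis
  show ?thesis
  proof (rule that)
    show "min d0 (min d1 1) > 0" using d0 d1 by simp
    fix a b e :: real assume ab: "a \<le> t0" "t0 \<le> b" "b - a < min d0 (min d1 1)" "0 \<le> a" "b \<le> 1" and e: "e > 0"
    have I: "\<gamma> t \<in> fst c" "snd c (\<gamma> t) \<in> ball x0 (r / 2)" "t \<in> {0..1}" "\<bar>t - t0\<bar> < d0" if "t \<in> {a..b}" for t
      using d1(2)[of t] that ab by auto
    have "continuous_on {a..b} (\<lambda>t. \<gamma>' t c)"
      by (rule continuous_on_subset[of "{t. \<gamma> t \<in> fst c}"]) (use \<gamma> c I in \<open>auto simp: C1_curve_def\<close>)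
    then obtain M where M: "M \<ge> 0" "\<And>t. t \<in> {a..b} \<Longrightarrow> norm (\<gamma>' t c) \<le> M" using bounded_on_Icc by metis
    define N where "N = K * (M + A1 + A2)"
    have N: "N \<ge> 0" using d0 M A1 A2 by (simp add: N_def)
    \<comment> \<open>The linear remainders contribute \<eta> N |q - q0| in total, kept below e / 6;
      the quadratic term B K^2 |q - q0|^2 takes another e / 6. The remaining 2 e / 3 pays for the
      chart changes at \<open>a\<close> and \<open>b\<close>.\<close>
    define \<eta> where "\<eta> = e / (6 * (N + 1))"
    have \<eta>: "\<eta> > 0" using e N by (simp add: \<eta>_def)
    have \<eta>N: "\<eta> * N \<le> e / 6"
    proof -
      have "\<eta> * N \<le> \<eta> * (N + 1)" using \<eta> by (intro mult_left_mono) auto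
      also have "\<dots> = e / 6"
      proof -
        have "N + 1 \<noteq> 0" using N by linarith
        then show ?thesis unfolding \<eta>_def by (simp only: divide_divide_eq_left[symmetric]) (simp add: field_simps)
      qed
      finally show ?thesis .
    qed
    obtain u1 where u1: "u1 > 0" "\<And>x y. x \<in> cball x0 r \<Longrightarrow> y \<in> cball x0 r \<Longrightarrow> norm (y - x) < u1 \<Longrightarrow>
       norm (\<Theta> y - \<Theta> x - frechet_derivative \<Theta> (at x) (y - x)) \<le> \<eta> * norm (y - x)"
      using C1_uniform[OF C1(1) compact_cball convex_cball r(2) \<eta>] by metis
    obtain u2 where u2: "u2 > 0" "\<And>x y. x \<in> cball x0 r \<Longrightarrow> y \<in> cball x0 r \<Longrightarrow> norm (y - x) < u2 \<Longrightarrow>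
       norm (F y - F x - frechet_derivative F (at x) (y - x)) \<le> \<eta> * norm (y - x)"
      using C1_uniform[OF C1(2) compact_cball convex_cball r(2) \<eta>] by metis
    obtain u3 where u3: "u3 > 0" "\<And>x y. x \<in> cball x0 r \<Longrightarrow> y \<in> cball x0 r \<Longrightarrow> norm (y - x) < u3 \<Longrightarrow>
       norm (G y - G x - frechet_derivative G (at x) (y - x)) \<le> \<eta> * norm (y - x)"
      using C1_uniform[OF C1(3) compact_cball convex_cball r(2) \<eta>] by metis
    have e6: "e / 6 > 0" and e3: "e / 3 > 0" using e by auto
    have umin: "min (min u1 u2) (min u3 (r / 2)) > 0" using u1 u2 u3 r by simp
    have "\<forall>\<^sub>F q in at q0. \<bar>defect a b q - (bdry c b q - bdry c a q)\<bar> \<le> e / 3 * norm (q - q0)"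
      using ev Y fgY small_norm[OF umin, of K] small_norm[OF e6, of "B * K * K"]
    proof eventually_elim
      case (elim q)
      define w where "w = norm (q - q0)"
      define \<delta> where "\<delta> = (\<lambda>t. snd c (Y q t) - snd c (\<gamma> t))"
      define \<delta>' where "\<delta>' = (\<lambda>t. Y' q t c - \<gamma>' t c)"
      define D where "D = (\<lambda>t. chart_deriv c (form_vec \<theta> c) (\<gamma> t))"
      \<comment> \<open>The derivative in \<open>t\<close> of the boundary term; subtracting it
        removes from the variation of the integrand the part that is a total derivative.\<close>
      define h where "h = (\<lambda>t. form_vec \<theta> c (\<gamma> t) \<bullet> \<delta>' t + D t (\<gamma>' t c) \<bullet> \<delta> t)"
      define k where "k = (\<lambda>t. pairing \<theta> (Y q) (Y' q) t - pairing \<theta> \<gamma> \<gamma>' t - \<alpha> t * (fv q - fv q0) - \<beta> t * (gv q - gv q0) - h t)"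
      have q: "Y q t \<in> fst c" "norm (\<delta> t) \<le> K * w" "norm (\<delta>' t) \<le> K * w" if "t \<in> {a..b}" for t
        using elim(1) I[OF that] by (auto simp: \<delta>_def \<delta>'_def w_def)
      have YX: "Y q t \<in> X" for t using elim(2) by (auto simp: C1_curve_def)
      have "((\<lambda>t. \<Theta> (snd c (\<gamma> t)) \<bullet> \<delta> t) has_vector_derivative h t) (at t within {a..b})" if t: "t \<in> {a..b}" for t
      proof -
        have d\<gamma>: "((snd c \<circ> \<gamma>) has_vector_derivative \<gamma>' t c) (at t within {a..b})"
          using C1_curve_has_vector_derivative[OF \<gamma> c(1) I(1)[OF t]] by (rule has_vector_derivative_at_within)
        have dY: "((snd c \<circ> Y q) has_vector_derivative Y' q t c) (at t within {a..b})"
          using C1_curve_has_vector_derivative[OF elim(2) c(1) q(1)[OF t]] by (rule has_vector_derivative_at_within)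
        have d\<delta>: "(\<delta> has_vector_derivative \<delta>' t) (at t within {a..b})"
          using has_vector_derivative_diff[OF dY d\<gamma>] by (simp add: \<delta>_def \<delta>'_def o_def)
        have "((\<Theta> \<circ> (snd c \<circ> \<gamma>)) has_vector_derivative D t (\<gamma>' t c)) (at t within {a..b})"
          unfolding \<Theta>_def D_def
          by (rule vector_derivative_diff_chain_within[OF d\<gamma>])
            (use form_vec_has_derivative[OF c(1) I(1)[OF t] \<gamma>_in] in \<open>simp add: has_derivative_at_withinI\<close>)
        from bounded_bilinear.has_vector_derivative[OF bounded_bilinear_inner this d\<delta>]
        show ?thesis using I(1)[OF t] c(1) by (simp add: h_def o_def \<Theta>_def in_chart_chart)
      qed
      then have hi: "(h has_integral (\<Theta> (snd c (\<gamma> b)) \<bullet> \<delta> b - \<Theta> (snd c (\<gamma> a)) \<bullet> \<delta> a)) {a..b}"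
        by (rule fundamental_theorem_of_calculus[rotated]) (use ab in auto)
      have bd: "\<Theta> (snd c (\<gamma> t)) \<bullet> \<delta> t = bdry c t q" if "t \<in> {a..b}" for t
        using I(1)[OF that] c(1) form_inner[OF c(1) I(1)[OF that] \<gamma>_in] by (simp add: \<Theta>_def in_chart_chart bdry_def \<delta>_def)
      have aI: "a \<in> {a..b}" "b \<in> {a..b}" using ab by auto
      have i\<alpha>: "\<alpha> integrable_on {a..b}" "\<beta> integrable_on {a..b}"
        using \<alpha> \<beta> ab by (auto intro!: integrable_continuous_real intro: continuous_on_subset)
      have ki: "(k has_integral (defect a b q - (bdry c b q - bdry c a q))) {a..b}"
        unfolding k_def defect_def using hi[unfolded bd[OF aI(1)] bd[OF aI(2)]]
        by (intro has_integral_diff has_integral_mult_left integrable_integral i\<alpha> pairing_integrable[OF \<gamma>] pairing_integrable[OF elim(2)])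
      have kb: "norm (k t) \<le> e / 3 * w" if t: "t \<in> {a..b}" for t
      proof -
        define x where "x = snd c (\<gamma> t)"
        define y where "y = snd c (Y q t)"
        note p = I(1)[OF t]
        have \<delta>: "\<delta> t = y - x" by (simp add: \<delta>_def x_def y_def)
        have xb: "x \<in> cball x0 r" using subset_ball[of "r / 2" r x0] ball_subset_cball[of x0 r] I(2)[OF t] r(1) by (auto simp: x_def)
        have small: "norm (y - x) < u1" "norm (y - x) < u2" "norm (y - x) < u3" "norm (y - x) < r / 2"
          using q(2)[OF t] elim(4) unfolding \<delta> w_def by auto
        have yb: "y \<in> cball x0 r"
          using dist_triangle[of x0 y x] I(2)[OF t] small(4) by (simp add: x_def dist_norm norm_minus_commute)
        have vals: "\<Theta> x = form_vec \<theta> c (\<gamma> t)" "\<Theta> y = form_vec \<theta> c (Y q t)" "F x = fv q0" "F y = fv q" "G x = gv q0" "G y = gv q"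
          using p q(1)[OF t] c(1) fg\<gamma>[OF I(3)[OF t]] elim(3) I(3)[OF t] by (auto simp: \<Theta>_def F_def G_def x_def y_def in_chart_chart)
        have ders: "frechet_derivative \<Theta> (at x) = D t" "frechet_derivative F (at x) = chart_deriv c f (\<gamma> t)" "frechet_derivative G (at x) = chart_deriv c g (\<gamma> t)"
          by (simp_all add: \<Theta>_def D_def F_def G_def x_def chart_deriv_def fun_eq_iff)
        have Kw: "0 \<le> K * w" using d0(2) by (simp add: w_def)
        then have \<eta>Kw: "0 \<le> \<eta> * (K * w)" using \<eta> by simp
        note \<eta>\<delta> = mult_left_mono[OF q(2)[OF t] less_imp_le[OF \<eta>]]
        have b\<Theta>: "norm (\<Theta> y - \<Theta> x - D t (\<delta> t)) \<le> \<eta> * (K * w)"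
          using order_trans[OF u1(2)[OF xb yb small(1), unfolded ders, folded \<delta>] \<eta>\<delta>] .
        have bF: "\<bar>F y - F x - chart_deriv c f (\<gamma> t) (\<delta> t)\<bar> \<le> \<eta> * (K * w)"
          using order_trans[OF u2(2)[OF xb yb small(2), unfolded ders, folded \<delta>] \<eta>\<delta>] by simp
        have bG: "\<bar>G y - G x - chart_deriv c g (\<gamma> t) (\<delta> t)\<bar> \<le> \<eta> * (K * w)"
          using order_trans[OF u3(2)[OF xb yb small(3), unfolded ders, folded \<delta>] \<eta>\<delta>] by simp
        have bB: "norm (\<Theta> y - \<Theta> x) \<le> B * (K * w)"
          using order_trans[OF B(2)[OF yb xb, folded \<delta>] mult_left_mono[OF q(2)[OF t] B(1)]] .
        \<comment> \<open>The antisymmetrized derivative of the coefficients of \<theta> is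
          \<omega>, since d\<theta> = \<omega>, and \<omega> contracted with Hamiltonian velocities
          gives the differentials of \<open>f\<close> and \<open>g\<close>.\<close>
        have \<omega>: "D t (\<delta> t) \<bullet> \<gamma>' t c - D t (\<gamma>' t c) \<bullet> \<delta> t = \<alpha> t * chart_deriv c f (\<gamma> t) (\<delta> t) + \<beta> t * chart_deriv c g (\<gamma> t) (\<delta> t)"
        proof -
          note lin = sform_linear_right[OF c(1) p]
          have "sform S c (\<gamma> t) (\<delta> t) (ham_vec S h c (\<gamma> t)) = chart_deriv c h (\<gamma> t) (\<delta> t)" if "smooth_map X h" for h
            using sform_ham_vec[OF c(1) p smooth_map_linear[OF that c(1) p \<gamma>_in], of "\<delta> t"]
              sform_antisym[OF c(1) p, of "\<delta> t" "ham_vec S h c (\<gamma> t)"] by simp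
          then show ?thesis
            unfolding D_def form_vec_closed[OF c(1) p \<gamma>_in] \<gamma>'[OF I(3)[OF t] c(1) p]
            using f g by (simp add: linear_add[OF lin] linear_scale[OF lin])
        qed
        \<comment> \<open>What is left are Taylor remainders of \<Theta>, \<open>F\<close>,
          \<open>G\<close> and one product of two small increments.\<close>
        have "k t = (\<Theta> y - \<Theta> x - D t (\<delta> t)) \<bullet> \<gamma>' t c + (\<Theta> y - \<Theta> x) \<bullet> \<delta>' t
            - \<alpha> t * (F y - F x - chart_deriv c f (\<gamma> t) (\<delta> t)) - \<beta> t * (G y - G x - chart_deriv c g (\<gamma> t) (\<delta> t))"
          unfolding k_def h_def pairing_chart[OF \<gamma> c(1) p] pairing_chart[OF elim(2) c(1) q(1)[OF t]] vals
          using \<omega> by (simp add: \<delta>'_def inner_diff_left inner_diff_right algebra_simps)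
        moreover have "\<bar>(\<Theta> y - \<Theta> x - D t (\<delta> t)) \<bullet> \<gamma>' t c\<bar> \<le> (\<eta> * (K * w)) * M"
          by (rule order_trans[OF Cauchy_Schwarz_ineq2 mult_mono[OF b\<Theta> M(2)[OF t] \<eta>Kw norm_ge_zero]])
        moreover have "\<bar>(\<Theta> y - \<Theta> x) \<bullet> \<delta>' t\<bar> \<le> (B * (K * w)) * (K * w)"
          by (rule order_trans[OF Cauchy_Schwarz_ineq2 mult_mono[OF bB q(3)[OF t] _ norm_ge_zero]]) (use B(1) Kw in simp)
        moreover have "\<bar>\<alpha> t * (F y - F x - chart_deriv c f (\<gamma> t) (\<delta> t))\<bar> \<le> A1 * (\<eta> * (K * w))"
          unfolding abs_mult by (rule mult_mono[OF A1(2)[OF I(3)[OF t], unfolded real_norm_def] bF A1(1) abs_ge_zero])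
        moreover have "\<bar>\<beta> t * (G y - G x - chart_deriv c g (\<gamma> t) (\<delta> t))\<bar> \<le> A2 * (\<eta> * (K * w))"
          unfolding abs_mult by (rule mult_mono[OF A2(2)[OF I(3)[OF t], unfolded real_norm_def] bG A2(1) abs_ge_zero])
        ultimately have "\<bar>k t\<bar> \<le> (\<eta> * (K * w)) * M + (B * (K * w)) * (K * w) + A1 * (\<eta> * (K * w)) + A2 * (\<eta> * (K * w))"
          by linarith
        also have "\<dots> = (\<eta> * N) * w + (B * K * K * w) * w" by (simp add: N_def algebra_simps)
        also have "\<dots> \<le> e / 6 * w + e / 6 * w"
          using \<eta>N elim(5) by (intro add_mono mult_right_mono) (auto simp: w_def)
        finally show ?thesis by simp
      qed
      have "norm (defect a b q - (bdry c b q - bdry c a q)) \<le> (e / 3 * w) * measure lborel {a..b}"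
        by (rule has_integral_bound_real[OF _ finite.emptyI ki]) (use kb e in \<open>auto simp: w_def\<close>)
      also have "\<dots> \<le> (e / 3 * w) * 1" using ab e by (intro mult_left_mono) (auto simp: w_def)
      finally show ?case by (simp add: w_def)
    qed
    moreover have "\<forall>\<^sub>F q in at q0. \<bar>bdry (chart_at S (\<gamma> t)) t q - bdry c t q\<bar> \<le> e / 3 * norm (q - q0)" if "t \<in> {a..b}" for t
      by (rule bdry_change_chart[OF I(3)[OF that] c(1) I(1)[OF that] chart_at_atlas in_chart_at e3])
    then have "\<forall>\<^sub>F q in at q0. \<bar>bdry (chart_at S (\<gamma> a)) a q - bdry c a q\<bar> \<le> e / 3 * norm (q - q0)"
      "\<forall>\<^sub>F q in at q0. \<bar>bdry (chart_at S (\<gamma> b)) b q - bdry c b q\<bar> \<le> e / 3 * norm (q - q0)"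
      using ab by auto
    ultimately show "\<forall>\<^sub>F q in at q0. \<bar>defect a b q - (bdry (chart_at S (\<gamma> b)) b q - bdry (chart_at S (\<gamma> a)) a q)\<bar> \<le> e * norm (q - q0)"
    proof eventually_elim
      case (elim q)
      have "e * norm (q - q0) = e / 3 * norm (q - q0) + e / 3 * norm (q - q0) + e / 3 * norm (q - q0)" by simp
      then show ?case using elim by linarith
    qed
  qed
qed

text \<open>\<open>R\<close> is additive under concatenation of intervals and small on short ones,
  so bisection reaches [0, 1]. There the two boundary terms coincide: both loops close up, and
  \<open>chart_at\<close> depends on the point only.\<close>

lemma first_variation:
  assumes "e > 0"
  shows "\<forall>\<^sub>F q in at q0. \<bar>line_integral S \<theta> (Y q) 0 1 - line_integral S \<theta> \<gamma> 0 1
    - integral {0..1} \<alpha> * (fv q - fv q0) - integral {0..1} \<beta> * (gv q - gv q0)\<bar> \<le> e * norm (q - q0)"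
proof -
  define R where "R = (\<lambda>a b q. defect a b q - (bdry (chart_at S (\<gamma> b)) b q - bdry (chart_at S (\<gamma> a)) a q))"
  have "0 \<le> (0::real) \<and> 1 \<le> (1::real) \<longrightarrow> (\<forall>e>0. \<forall>\<^sub>F q in at q0. \<bar>R 0 1 q\<bar> \<le> e * norm (q - q0))"
  proof (rule Bolzano[of 0 1 "\<lambda>a b. 0 \<le> a \<and> b \<le> 1 \<longrightarrow> (\<forall>e>0. \<forall>\<^sub>F q in at q0. \<bar>R a b q\<bar> \<le> e * norm (q - q0))"])
    fix a b c :: real
    assume 1: "0 \<le> a \<and> b \<le> 1 \<longrightarrow> (\<forall>e>0. \<forall>\<^sub>F q in at q0. \<bar>R a b q\<bar> \<le> e * norm (q - q0))"
      and 2: "0 \<le> b \<and> c \<le> 1 \<longrightarrow> (\<forall>e>0. \<forall>\<^sub>F q in at q0. \<bar>R b c q\<bar> \<le> e * norm (q - q0))" and abc: "a \<le> b" "b \<le> c"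
    show "0 \<le> a \<and> c \<le> 1 \<longrightarrow> (\<forall>e>0. \<forall>\<^sub>F q in at q0. \<bar>R a c q\<bar> \<le> e * norm (q - q0))"
    proof (intro impI allI)
      fix e :: real assume e: "e > 0" and ac: "0 \<le> a \<and> c \<le> 1"
      have "\<forall>\<^sub>F q in at q0. \<bar>R a b q\<bar> \<le> e / 2 * norm (q - q0)" "\<forall>\<^sub>F q in at q0. \<bar>R b c q\<bar> \<le> e / 2 * norm (q - q0)"
        using 1 2 abc ac e by (meson half_gt_zero order_trans)+
      then show "\<forall>\<^sub>F q in at q0. \<bar>R a c q\<bar> \<le> e * norm (q - q0)"
        using Y
      proof eventually_elim
        case (elim q)
        have i\<alpha>: "\<alpha> integrable_on {a..c}" "\<beta> integrable_on {a..c}"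
          using \<alpha> \<beta> ac by (auto intro!: integrable_continuous_real intro: continuous_on_subset)
        have "R a c q = R a b q + R b c q"
          unfolding R_def defect_def
            Henstock_Kurzweil_Integration.integral_combine[OF abc i\<alpha>(1), symmetric]
            Henstock_Kurzweil_Integration.integral_combine[OF abc i\<alpha>(2), symmetric]
            Henstock_Kurzweil_Integration.integral_combine[OF abc pairing_integrable[OF \<gamma>], symmetric]
            Henstock_Kurzweil_Integration.integral_combine[OF abc pairing_integrable[OF elim(3)], symmetric]
          by (simp add: algebra_simps)
        moreover have "e * norm (q - q0) = e / 2 * norm (q - q0) + e / 2 * norm (q - q0)" by simp
        ultimately show ?case using elim by linarith
      qed
    qed
  next
    fix x :: real assume x: "0 \<le> x" "x \<le> 1"
    then have "x \<in> {0..1}" by simp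
    then show "\<exists>d>0. \<forall>a b. a \<le> x \<and> x \<le> b \<and> b - a < d \<longrightarrow> 0 \<le> a \<and> b \<le> 1 \<longrightarrow> (\<forall>e>0. \<forall>\<^sub>F q in at q0. \<bar>R a b q\<bar> \<le> e * norm (q - q0))"
    proof (rule defect_step)
      fix d assume d: "d > 0" "\<And>a b e. a \<le> x \<Longrightarrow> x \<le> b \<Longrightarrow> b - a < d \<Longrightarrow> 0 \<le> a \<Longrightarrow> b \<le> 1 \<Longrightarrow> e > 0 \<Longrightarrow>
        \<forall>\<^sub>F q in at q0. \<bar>defect a b q - (bdry (chart_at S (\<gamma> b)) b q - bdry (chart_at S (\<gamma> a)) a q)\<bar> \<le> e * norm (q - q0)"
      show ?thesis unfolding R_def by (intro exI[of _ d] conjI d(1) allI impI d(2)) auto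
    qed
  qed auto
  then have "\<forall>\<^sub>F q in at q0. \<bar>R 0 1 q\<bar> \<le> e * norm (q - q0)" using assms by simp
  then show ?thesis using Y closed(2)
  proof eventually_elim
    case (elim q)
    have "bdry (chart_at S (\<gamma> 1)) 1 q = bdry (chart_at S (\<gamma> 0)) 0 q" using closed(1) elim(3) by (simp add: bdry_def)
    then show ?case using elim(1) by (simp add: R_def defect_def line_integral_pairing[OF \<gamma>] line_integral_pairing[OF elim(2)])
  qed
qed

end

section \<open>Homology classes of loops in an orbit of the plane\<close>

text \<open>The barycentric coordinate \<open>x 1\<close> serves as the parameter, so that
  \<open>g 0\<close> and \<open>g 1\<close> sit at the vertices 0 and 1, in agreement with
  \<open>loop_class\<close>.\<close>

definition path_chain :: "(real \<Rightarrow> 'a) \<Rightarrow> 'a chain" where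
  "path_chain g = frag_of (restrict (\<lambda>x. g (x 1)) (standard_simplex 1))"

lemma loop_class_path_chain: "loop_class Z g = homologous_rel_set 1 (top_of_set Z) {} (path_chain g)"
  by (simp add: loop_class_def path_chain_def)

lemma standard_simplex_1: "x \<in> standard_simplex 1 \<Longrightarrow> x 1 \<in> {0..1::real}"
  using standard_simplex_01[of 1] by (auto simp: PiE_def Pi_def)

lemma loop_class_cong:
  assumes "\<And>t. t \<in> {0..1} \<Longrightarrow> g t = h t" shows "loop_class Z g = loop_class Z h"
proof -
  have "restrict (\<lambda>x. g (x 1)) (standard_simplex 1) = restrict (\<lambda>x. h (x 1)) (standard_simplex 1)"
    using assms standard_simplex_1 by (intro restrict_ext) blast
  then show ?thesis by (simp only: loop_class_path_chain path_chain_def)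
qed

lemma singular_chain_path_chain:
  assumes "continuous_on {0..1} g" "g ` {0..1} \<subseteq> Z"
  shows "singular_chain 1 (top_of_set Z) (path_chain g)"
proof -
  let ?T = "subtopology (powertop_real UNIV) (standard_simplex 1)"
  have pr: "continuous_map (powertop_real UNIV) euclideanreal (\<lambda>x. x (1::nat))"
    by (rule continuous_map_product_projection) simp
  have "continuous_map ?T euclideanreal (\<lambda>x. x (1::nat))"
    by (rule continuous_map_from_subtopology[OF pr])
  then have "continuous_map ?T (top_of_set {0..1}) (\<lambda>x. x (1::nat))"
    using standard_simplex_1 by (auto simp: continuous_map_in_subtopology)
  moreover have "continuous_map (top_of_set {0..1}) (top_of_set Z) g"
    using assms by (auto simp: continuous_map_in_subtopology)
  ultimately have "continuous_map ?T (top_of_set Z) (g \<circ> (\<lambda>x. x 1))" by (rule continuous_map_compose)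
  then have "continuous_map ?T (top_of_set Z) (restrict (\<lambda>x. g (x 1)) (standard_simplex 1))"
    by (rule continuous_map_eq) auto
  then show ?thesis by (simp only: path_chain_def singular_chain_of singular_simplex_def restrict_extensional simp_thms)
qed

lemma chain_boundary_path_chain:
  "chain_boundary 1 (path_chain g)
     = frag_of (restrict (\<lambda>_. g 1) (standard_simplex 0)) - frag_of (restrict (\<lambda>_. g 0) (standard_simplex 0))"
proof -
  have "singular_face 1 k (restrict (\<lambda>x. g (x 1)) (standard_simplex 1)) = restrict (\<lambda>_. g (if k = 0 then 1 else 0)) (standard_simplex 0)"
    if "k \<le> 1" for k
  proof
    fix x :: "nat \<Rightarrow> real"
    show "singular_face 1 k (restrict (\<lambda>x. g (x 1)) (standard_simplex 1)) x = restrict (\<lambda>_. g (if k = 0 then 1 else 0)) (standard_simplex 0) x"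
    proof (cases "x \<in> standard_simplex 0")
      case True
      have "simplical_face k x \<in> standard_simplex 1"
        by (rule simplical_face_in_standard_simplex) (use True that in auto)
      moreover have "x 0 = 1" using True by (simp add: standard_simplex_0)
      ultimately show ?thesis using True that by (auto simp: singular_face_def simplical_face_def)
    qed (simp add: singular_face_def)
  qed
  note face = this
  have "chain_boundary 1 (path_chain g) = (\<Sum>k\<le>1. frag_cmul ((-1) ^ k) (frag_of (singular_face 1 k (restrict (\<lambda>x. g (x 1)) (standard_simplex 1)))))"
    unfolding path_chain_def by (subst chain_boundary_of) simp
  also have "\<dots> = (\<Sum>k\<in>{0,1}. frag_cmul ((-1) ^ k) (frag_of (restrict (\<lambda>_. g (if k = 0 then 1 else 0)) (standard_simplex 0))))"
    by (rule sum.cong) (use face in auto)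
  finally show ?thesis by simp
qed

lemma chain_map_path_chain: "chain_map 1 f (path_chain g) = path_chain (\<lambda>t. f (g t))"
  unfolding path_chain_def chain_map_of simplex_map_def
  by (rule arg_cong[of _ _ frag_of]) (auto simp: restrict_def fun_eq_iff)

text \<open>In degree 1 reduced and ordinary homology agree, so contractibility makes the group
  trivial; lying in the trivial class is then read back as being a boundary.\<close>

lemma singular_cycle_contractible:
  assumes "contractible Z" and c: "singular_relcycle 1 (top_of_set Z) {} a"
  shows "singular_relboundary 1 (top_of_set Z) {} a"
proof -
  let ?H = "homology_group 1 (top_of_set Z)"
  have "trivial_group (reduced_homology_group 1 (top_of_set Z))"
    by (rule trivial_reduced_homology_group_contractible_space) (use assms in \<open>simp add: contractible_space_top_of_set\<close>)
  then have "trivial_group ?H" by (simp add: un_reduced_homology_group)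
  then have "carrier ?H = {one ?H}" by (simp add: trivial_group_def)
  moreover have "homologous_rel_set 1 (top_of_set Z) {} a \<in> carrier ?H"
    using carrier_relative_homology_group[of 1 "top_of_set Z" "{}"] c by auto
  ultimately have "homologous_rel_set 1 (top_of_set Z) {} a = singular_relboundary_set 1 (top_of_set Z) {}"
    using one_relative_homology_group[of 1 "top_of_set Z" "{}"] by auto
  then show ?thesis using homologous_rel_set_eq_relboundary by blast
qed

lemma homology_mult:
  "homologous_rel_set 1 X {} a \<otimes>\<^bsub>homology_group 1 X\<^esub> homologous_rel_set 1 X {} b = homologous_rel_set 1 X {} (a + b)"
proof -
  have m: "(\<otimes>\<^bsub>homology_group 1 X\<^esub>) = (\<lambda>R S. (\<Union>r\<in>R. \<Union>s\<in>S. {r + s}))"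
    using mult_relative_homology_group[of 1 X "{}"] by simp
  show ?thesis unfolding m
  proof (intro equalityI subsetI)
    fix x assume "x \<in> homologous_rel_set 1 X {} (a + b)"
    then have "homologous_rel 1 X {} b (x - a)" by (simp add: homologous_rel_def algebra_simps)
    moreover have "x = a + (x - a)" by simp
    ultimately show "x \<in> (\<Union>r\<in>homologous_rel_set 1 X {} a. \<Union>s\<in>homologous_rel_set 1 X {} b. {r + s})"
      using homologous_rel_refl[of 1 X "{}" a] by blast
  qed (auto intro: homologous_rel_add)
qed

context flow_pair begin

context
  fixes p :: 'm and Z :: "'m set"
  assumes p: "p \<in> X" and Z: "\<And>a. act a p \<in> Z"
begin

definition line_class :: "real \<times> real \<Rightarrow> 'm chain set" where
  "line_class l = loop_class Z (\<lambda>t. act (t *\<^sub>R l) p)"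

lemma act_map: "continuous_map (top_of_set UNIV) (top_of_set Z) (\<lambda>a. act a p)"
  using act_continuous[OF p] Z by (auto simp: continuous_map_in_subtopology)

text \<open>Relations between loops are proved upstairs: a 1-cycle in the plane bounds, and the
  orbit map carries the bounding chain into \<open>Z\<close>. The boundaries have to cancel in the
  plane, not merely after projection.\<close>

lemma plane_boundary:
  assumes "singular_chain 1 (top_of_set UNIV) a" "chain_boundary 1 a = 0"
  shows "singular_relboundary 1 (top_of_set Z) {} (chain_map 1 (\<lambda>a. act a p) a)"
proof (rule singular_relboundary_chain_map[OF _ act_map])
  have "singular_relcycle 1 (top_of_set UNIV) {} a" using assms by (simp add: singular_cycle)
  then show "singular_relboundary 1 (top_of_set (UNIV :: (real \<times> real) set)) {} a"
    by (rule singular_cycle_contractible[rotated]) (simp add: convex_imp_contractible)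
qed auto

text \<open>The path \<eta> and the segment to its endpoint have the same ends in the plane, so
  their difference is a cycle there.\<close>

lemma loop_class_act:
  assumes \<eta>: "continuous_on {0..1} \<eta>" "\<eta> 0 = 0"
  shows "loop_class Z (\<lambda>t. act (\<eta> t) p) = line_class (\<eta> 1)"
proof -
  define l where "l = (\<lambda>t. t *\<^sub>R \<eta> 1)"
  have "singular_relboundary 1 (top_of_set Z) {} (chain_map 1 (\<lambda>a. act a p) (path_chain \<eta> - path_chain l))"
  proof (rule plane_boundary)
    show "singular_chain 1 (top_of_set UNIV) (path_chain \<eta> - path_chain l)"
      by (intro singular_chain_diff singular_chain_path_chain \<eta>) (auto simp: l_def intro!: continuous_intros)
    show "chain_boundary 1 (path_chain \<eta> - path_chain l) = 0"
      unfolding chain_boundary_diff chain_boundary_path_chain by (simp add: l_def \<eta>)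
  qed
  then have "homologous_rel 1 (top_of_set Z) {} (path_chain (\<lambda>t. act (\<eta> t) p)) (path_chain (\<lambda>t. act (t *\<^sub>R \<eta> 1) p))"
    by (simp only: homologous_rel_def chain_map_diff chain_map_path_chain l_def)
  then show ?thesis unfolding line_class_def loop_class_path_chain homologous_rel_set_eq .
qed

lemma line_cycle:
  assumes "act l p = p" shows "singular_relcycle 1 (top_of_set Z) {} (path_chain (\<lambda>t. act (t *\<^sub>R l) p))"
  unfolding singular_cycle
proof
  show "singular_chain 1 (top_of_set Z) (path_chain (\<lambda>t. act (t *\<^sub>R l) p))"
  proof (rule singular_chain_path_chain)
    show "continuous_on {0..1} (\<lambda>t. act (t *\<^sub>R l) p)"
      by (rule continuous_on_compose2[OF act_continuous[OF p]]) (auto intro!: continuous_intros)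
  qed (use Z in blast)
  show "chain_boundary 1 (path_chain (\<lambda>t. act (t *\<^sub>R l) p)) = 0"
    unfolding chain_boundary_path_chain using assms act_0[OF p] by simp
qed

lemma line_class_in: "act l p = p \<Longrightarrow> line_class l \<in> carrier (homology_group 1 (top_of_set Z))"
  using carrier_relative_homology_group[of 1 "top_of_set Z" "{}"] line_cycle
  by (simp add: line_class_def loop_class_path_chain)

text \<open>The triangle with vertices 0, l and l + l' bounds in the plane. Its side from l to l +
  l' has the same image as the segment from 0 to l', because \<open>l\<close> fixes
  \<open>p\<close>.\<close>

lemma line_class_add:
  assumes "act l p = p"
  shows "line_class (l + l') = line_class l \<otimes>\<^bsub>homology_group 1 (top_of_set Z)\<^esub> line_class l'"
proof -
  define a b c where "a = (\<lambda>t. t *\<^sub>R l)" and "b = (\<lambda>t. l + t *\<^sub>R l')" and "c = (\<lambda>t. t *\<^sub>R (l + l'))"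
  have ch: "singular_chain 1 (top_of_set UNIV) (path_chain a)" "singular_chain 1 (top_of_set UNIV) (path_chain b)" "singular_chain 1 (top_of_set UNIV) (path_chain c)"
    unfolding a_def b_def c_def by (intro singular_chain_path_chain subset_UNIV continuous_intros)+
  have "singular_relboundary 1 (top_of_set Z) {} (chain_map 1 (\<lambda>a. act a p) (path_chain c - (path_chain a + path_chain b)))"
  proof (rule plane_boundary)
    show "chain_boundary 1 (path_chain c - (path_chain a + path_chain b)) = 0"
      unfolding chain_boundary_diff chain_boundary_add chain_boundary_path_chain by (simp add: a_def b_def c_def)
  qed (intro singular_chain_diff singular_chain_add ch)
  moreover have "act (b t) p = act (t *\<^sub>R l') p" for t
    unfolding b_def using act_add[OF p, of "t *\<^sub>R l'" l] assms by (simp add: add.commute)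
  ultimately have "homologous_rel 1 (top_of_set Z) {} (path_chain (\<lambda>t. act (t *\<^sub>R (l + l')) p))
      (path_chain (\<lambda>t. act (t *\<^sub>R l) p) + path_chain (\<lambda>t. act (t *\<^sub>R l') p))"
    by (simp only: homologous_rel_def chain_map_diff chain_map_add chain_map_path_chain a_def c_def)
  then show ?thesis
    unfolding line_class_def loop_class_path_chain homology_mult homologous_rel_set_eq .
qed

lemma line_class_pow:
  assumes l: "act l p = p"
  shows "line_class (of_int k *\<^sub>R l) = line_class l [^]\<^bsub>homology_group 1 (top_of_set Z)\<^esub> k"
    and "act (of_int k *\<^sub>R l) p = p"
proof -
  let ?H = "homology_group 1 (top_of_set Z)"
  interpret H: group ?H by simp
  have n: "act (real n *\<^sub>R l) p = p" for n
  proof (induction n)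
    case (Suc n)
    have "act (real (Suc n) *\<^sub>R l) p = act (real n *\<^sub>R l) (act l p)"
      using act_add[OF p, of "real n *\<^sub>R l" l] by (simp add: algebra_simps)
    then show ?case using Suc l by simp
  qed (simp add: act_0[OF p])
  have neg: "act (- m) p = p" if "act m p = p" for m
    using act_add[OF p, of "- m" m] that act_0[OF p] by simp
  show per: "act (of_int k *\<^sub>R l) p = p"
  proof (cases "k \<ge> 0")
    case True then show ?thesis using n[of "nat k"] by simp
  next
    case False then show ?thesis using neg[OF n[of "nat (- k)"]] by simp
  qed
  have "line_class 0 = line_class 0 \<otimes>\<^bsub>?H\<^esub> line_class 0" using line_class_add[of 0 0] act_0[OF p] by simp
  then have one: "line_class 0 = \<one>\<^bsub>?H\<^esub>"
    using H.l_cancel_one'[of "line_class 0" "line_class 0"] line_class_in[OF act_0[OF p]] by simp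
  have pow: "line_class (real n *\<^sub>R l) = line_class l [^]\<^bsub>?H\<^esub> n" for n
  proof (induction n)
    case (Suc n)
    have "line_class (real (Suc n) *\<^sub>R l) = line_class (real n *\<^sub>R l + l)" by (simp add: algebra_simps)
    then show ?case using line_class_add[OF n] Suc by simp
  qed (simp add: one)
  show "line_class (of_int k *\<^sub>R l) = line_class l [^]\<^bsub>?H\<^esub> k"
  proof (cases k rule: int_cases2)
    case (nonneg m)
    show ?thesis unfolding nonneg int_pow_int of_int_of_nat_eq by (rule pow)
  next
    case (nonpos m)
    have m: "line_class (real m *\<^sub>R l) \<in> carrier ?H" "line_class (of_int k *\<^sub>R l) \<in> carrier ?H"
      by (rule line_class_in[OF n] line_class_in[OF per])+
    have km: "of_int k *\<^sub>R l + real m *\<^sub>R l = 0" by (simp add: nonpos)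
    have "line_class (of_int k *\<^sub>R l) \<otimes>\<^bsub>?H\<^esub> line_class (real m *\<^sub>R l) = \<one>\<^bsub>?H\<^esub>"
      unfolding line_class_add[OF per, symmetric] km by (rule one)
    then have "inv\<^bsub>?H\<^esub> (line_class (real m *\<^sub>R l)) = line_class (of_int k *\<^sub>R l)"
      by (rule H.inv_equality[OF _ m])
    then show ?thesis unfolding nonpos H.int_pow_neg_int[OF line_class_in[OF l]] pow[symmetric] by (rule sym)
  qed
qed

end

end

section \<open>Geometry near the focus-focus fiber\<close>

text \<open>A right inverse that passes through \<open>x\<close> and is continuous at the single
  point \<open>G x\<close> already shows that nearby values are attained near \<open>x\<close>.
  Continuity at one point leaves room for sections built from square roots.\<close>

lemma open_image_local_section:
  assumes "open V" "\<And>x. x \<in> V \<Longrightarrow> \<exists>g. isCont g (G x) \<and> g (G x) = x \<and> (\<forall>y. G (g y) = y)"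
  shows "open (G ` V)"
proof (subst open_subopen, intro ballI)
  fix y assume "y \<in> G ` V"
  then obtain x where x: "x \<in> V" "y = G x" by blast
  then obtain g where g: "isCont g y" "g y = x" "\<And>y. G (g y) = y" using assms(2) by blast
  then obtain A where "open A" "y \<in> A" "\<forall>z\<in>A. g z \<in> V"
    using continuous_at_open[of y g] assms(1) x by blast
  then show "\<exists>T. open T \<and> y \<in> T \<and> T \<subseteq> G ` V" using g(3) by (metis imageI subsetI)
qed

lemma vector_4:
  "(vector [a, b, c, d] :: 'a::zero^4) $ 1 = a" "(vector [a, b, c, d] :: 'a^4) $ 2 = b"
  "(vector [a, b, c, d] :: 'a^4) $ 3 = c" "(vector [a, b, c, d] :: 'a^4) $ 4 = d"
  unfolding vector_def by simp_all

text \<open>Openness is needed at the singular point too, where the differential vanishes. Away from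
  0 the momenta or the positions are not both zero; with a nonzero pair fixed, \<open>G_ff\<close>
  is an invertible linear map of the other pair and is solved explicitly.\<close>

lemma open_G_ff: assumes "open V" shows "open (G_ff ` V)"
proof (rule open_image_local_section[OF assms])
  fix x :: "real^4"
  let ?v = "\<lambda>a b c d. vector [a, b, c, d] :: real^4"
  have cont: "isCont (\<lambda>y. ?v (a y) (b y) (c y) (d y)) y0" if "isCont a y0" "isCont b y0" "isCont c y0" "isCont d y0"
    for a b c d and y0 :: "real \<times> real"
    unfolding continuous_at
  proof (rule vec_tendstoI)
    fix i :: 4
    show "((\<lambda>y. ?v (a y) (b y) (c y) (d y) $ i) \<longlongrightarrow> ?v (a y0) (b y0) (c y0) (d y0) $ i) (at y0)"
      using exhaust_4[of i] that by (auto simp: continuous_at vector_4)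
  qed
  have eqv: "?v (x$1) (x$2) (x$3) (x$4) = x" by (simp add: vec_eq_iff forall_4 vector_4)
  show "\<exists>g. isCont g (G_ff x) \<and> g (G_ff x) = x \<and> (\<forall>y. G_ff (g y) = y)"
  proof (cases "x$3 = 0 \<and> x$4 = 0")
    case False
    define n where "n = (x$3)\<^sup>2 + (x$4)\<^sup>2"
    have n: "n \<noteq> 0" using False by (simp add: n_def sum_power2_eq_zero_iff)
    define g where "g = (\<lambda>y. ?v ((x$4 * fst y + x$3 * snd y) / n) ((x$4 * snd y - x$3 * fst y) / n) (x$3) (x$4))"
    have "isCont g (G_ff x)" unfolding g_def by (intro cont continuous_intros n)
    moreover have "g (G_ff x) = x"
    proof -
      have "x$4 * (x$1 * x$4 - x$2 * x$3) + x$3 * (x$1 * x$3 + x$2 * x$4) = x$1 * n"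
        "x$4 * (x$1 * x$3 + x$2 * x$4) - x$3 * (x$1 * x$4 - x$2 * x$3) = x$2 * n"
        by (simp_all add: n_def power2_eq_square algebra_simps)
      then show ?thesis using eqv n by (simp add: g_def G_ff_def)
    qed
    moreover have "G_ff (g y) = y" for y
    proof -
      have "(x$4 * fst y + x$3 * snd y) * x$4 - (x$4 * snd y - x$3 * fst y) * x$3 = fst y * n"
        "(x$4 * fst y + x$3 * snd y) * x$3 + (x$4 * snd y - x$3 * fst y) * x$4 = snd y * n"
        by (simp_all add: n_def power2_eq_square algebra_simps)
      then show ?thesis using n by (simp add: g_def G_ff_def vector_4 prod_eq_iff divide_simps)
    qed
    ultimately show ?thesis by blast
  next
    case p0: True
    show ?thesis
    proof (cases "x$1 = 0 \<and> x$2 = 0")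
      case False
      define n where "n = (x$1)\<^sup>2 + (x$2)\<^sup>2"
      have n: "n \<noteq> 0" using False by (simp add: n_def sum_power2_eq_zero_iff)
      define g where "g = (\<lambda>y. ?v (x$1) (x$2) ((x$1 * snd y - x$2 * fst y) / n) ((x$1 * fst y + x$2 * snd y) / n))"
      have "isCont g (G_ff x)" unfolding g_def by (intro cont continuous_intros n)
      moreover have "g (G_ff x) = x" using eqv p0 by (simp add: g_def G_ff_def)
      moreover have "G_ff (g y) = y" for y
      proof -
        have "x$1 * (x$1 * fst y + x$2 * snd y) - x$2 * (x$1 * snd y - x$2 * fst y) = fst y * n"
          "x$1 * (x$1 * snd y - x$2 * fst y) + x$2 * (x$1 * fst y + x$2 * snd y) = snd y * n"
          by (simp_all add: n_def power2_eq_square algebra_simps)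
        then show ?thesis using n by (simp add: g_def G_ff_def vector_4 prod_eq_iff divide_simps)
      qed
      ultimately show ?thesis by blast
    next
      case True
      then have x0: "x = 0" using p0 by (simp add: vec_eq_iff forall_4)
      then have G0: "G_ff x = 0" by (simp add: G_ff_def zero_prod_def)
      \<comment> \<open>At 0 no linear section exists. Giving one coordinate the size sqrt |y| and
        dividing the values by it keeps the other coordinates at most that large, so the section is
        continuous at 0.\<close>
      define r where "r = (\<lambda>y::real\<times>real. sqrt (norm y))"
      have rc: "(r \<longlongrightarrow> 0) (at 0)"
      proof -
        have "((\<lambda>y::real\<times>real. sqrt (norm y)) \<longlongrightarrow> sqrt (norm (0::real\<times>real))) (at 0)" by (intro tendsto_intros)
        then show ?thesis by (simp add: r_def)
      qed
      have b: "\<bar>h y\<bar> / r y \<le> r y" if "\<bar>h y\<bar> \<le> norm y" for h :: "real\<times>real \<Rightarrow> real" and y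
      proof (cases "y = 0")
        case False
        then have "norm y / r y = r y" by (simp add: r_def real_div_sqrt)
        then show ?thesis using that divide_right_mono[of "\<bar>h y\<bar>" "norm y" "r y"] by (simp add: r_def)
      qed (simp add: r_def)
      have lim: "isCont (\<lambda>y. h y / r y) 0" if h: "\<And>y. \<bar>h y\<bar> \<le> norm y" for h :: "real\<times>real \<Rightarrow> real"
      proof -
        have "((\<lambda>y. h y / r y) \<longlongrightarrow> 0) (at 0)"
        proof (rule Lim_null_comparison[OF always_eventually rc], rule allI)
          fix y
          have "0 \<le> r y" by (simp add: r_def)
          then show "norm (h y / r y) \<le> r y" using b[of h y, OF h[of y]] by (simp add: abs_divide)
        qed
        then show ?thesis by (simp add: continuous_at r_def)
      qed
      define g where "g = (\<lambda>y. ?v (r y) 0 (snd y / r y) (fst y / r y))"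
      have n: "\<bar>snd y\<bar> \<le> norm y" "\<bar>fst y\<bar> \<le> norm y" for y :: "real \<times> real"
        using norm_snd_le[of "snd y" "fst y"] norm_fst_le[of "fst y" "snd y"] unfolding prod.collapse by auto
      have "isCont r 0" using rc by (simp add: continuous_at r_def)
      then have "isCont g 0" unfolding g_def by (intro cont lim n continuous_const)
      moreover have "g 0 = x" using eqv p0 True by (simp add: g_def r_def)
      moreover have "G_ff (g y) = y" for y by (cases "y = 0") (simp_all add: g_def G_ff_def vector_4 prod_eq_iff r_def)
      ultimately show ?thesis using G0 by auto
    qed
  qed
qed

lemma smooth_on_subset:
  assumes "smooth_on f X" "Y \<subseteq> X" shows "smooth_on f Y"
  unfolding smooth_on_def
proof
  fix x assume "x \<in> Y"
  then obtain N g where 1: "open N" "x \<in> N" "\<forall>n. Ck_on n g N" and 2: "\<forall>y\<in>N \<inter> X. f y = g y"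
    using bspec[OF assms(1)[unfolded smooth_on_def], of x] assms(2) by (meson subsetD)
  have "\<forall>y\<in>N \<inter> Y. f y = g y" using 2 assms(2) by blast
  with 1 show "\<exists>N g. open N \<and> x \<in> N \<and> (\<forall>n. Ck_on n g N) \<and> (\<forall>y\<in>N \<inter> Y. f y = g y)"
    by (intro exI[of _ N] exI[of _ g] conjI)
qed

section \<open>Domains slit along a vertical ray\<close>

definition slit :: "real \<Rightarrow> complex set" where
  "slit s = {z. Re z = 0 \<and> s * Im z \<ge> 0}"

lemma closed_slit: "closed (slit s)"
  unfolding slit_def by (intro closed_Collect_conj closed_Collect_eq closed_Collect_le continuous_intros)

text \<open>Star-shaped about a point on the opposite vertical half-line: a segment from there meets
  the vertical axis again only if it lies in it, and then both of its ends are on the side away from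
  the slit.\<close>

lemma connected_slit_complement:
  assumes V: "convex V" "open V" "0 \<in> V" and s: "s = 1 \<or> s = - 1"
  shows "connected (V - slit s)"
proof (rule starlike_imp_connected)
  obtain d where d: "d > 0" "ball 0 d \<subseteq> V" using V open_contains_ball by blast
  define a where "a = Complex 0 (- s * d / 2)"
  have "norm a < d" using d s by (auto simp: a_def cmod_def)
  then have aV: "a \<in> V" using d by auto
  have "s * Im a < 0" using s d by (auto simp: a_def)
  then have as: "a \<notin> slit s" by (simp add: slit_def)
  show "starlike (V - slit s)"
    unfolding starlike_def
  proof (intro bexI[of _ a] ballI subsetI)
    fix x y assume x: "x \<in> V - slit s" and y: "y \<in> closed_segment a x"
    then obtain u where u: "0 \<le> u" "u \<le> 1" "y = (1 - u) *\<^sub>R a + u *\<^sub>R x" by (auto simp: in_segment)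
    have "y \<in> V" using V(1) aV x y by (auto simp: convex_contains_segment)
    moreover have "y \<notin> slit s"
    proof
      assume ys: "y \<in> slit s"
      then have "u * Re x = 0" using u by (simp add: slit_def a_def)
      then consider "u = 0" | "u > 0" "Re x = 0" using u by force
      then show False
      proof cases
        case 1 then show ?thesis using ys as u by simp
      next
        case 2
        then have "s * Im x < 0" using x by (simp add: slit_def)
        then have "u * (s * Im x) < 0" using 2 by (simp add: mult_pos_neg)
        moreover have "(1 - u) * (s * Im a) \<le> 0" using u \<open>s * Im a < 0\<close> mult_nonneg_nonpos[of "1 - u" "s * Im a"] by linarith
        moreover have Imy: "Im y = (1 - u) * Im a + u * Im x" unfolding u(3) by simp
        have "s * Im y = (1 - u) * (s * Im a) + u * (s * Im x)" unfolding Imy by (simp add: algebra_simps)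
        ultimately show False using ys by (simp add: slit_def)
      qed
    qed
    ultimately show "y \<in> V - slit s" by blast
  qed (use aV as in blast)
qed

context symplectic begin

lemma smooth_map_continuous_on:
  fixes f :: "'m \<Rightarrow> 'b::real_normed_vector"
  assumes "smooth_map X f" shows "continuous_on X f"
proof (rule continuous_at_imp_continuous_on, rule ballI)
  fix p assume p: "p \<in> X"
  obtain c where c: "c \<in> atlas S" "p \<in> fst c" using charts_cover by blast
  have X: "open X" using assms by (simp add: smooth_map_def)
  have "continuous_on (snd c ` (fst c \<inter> X)) (in_chart c f)" using assms c Ck_on.simps(1) unfolding smooth_map_def by metis
  moreover have "continuous_on (fst c \<inter> X) (snd c)" using continuous_on_chart[OF c(1)] by (rule continuous_on_subset) simp
  ultimately have "continuous_on (fst c \<inter> X) (\<lambda>p. in_chart c f (snd c p))" by (rule continuous_on_compose2) simp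
  then have "continuous_on (fst c \<inter> X) f" by (rule continuous_on_eq) (simp add: in_chart_chart c)
  then show "isCont f p" using continuous_on_eq_continuous_at[OF open_Int[OF open_chart[OF c(1)] X]] p c by blast
qed

lemma smooth_mapI: "smooth_fun S f X \<Longrightarrow> open X \<Longrightarrow> smooth_map X f"
  unfolding smooth_map_def using smooth_fun_Ck_on by blast

lemma smooth_map_Pair:
  fixes f g :: "'m \<Rightarrow> real"
  assumes "smooth_map X f" "smooth_map X g" shows "smooth_map X (\<lambda>p. (f p, g p))"
  unfolding smooth_map_def
proof (intro conjI ballI allI)
  show X: "open X" using assms by (simp add: smooth_map_def)
  fix c n assume c: "c \<in> atlas S"
  have eq: "in_chart c (\<lambda>p. (f p, g p)) = (\<lambda>x. in_chart c f x *\<^sub>R (1, 0) + in_chart c g x *\<^sub>R (0, 1))"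
    by (simp add: in_chart_def fun_eq_iff)
  show "Ck_on n (in_chart c (\<lambda>p. (f p, g p))) (snd c ` (fst c \<inter> X))"
    unfolding eq by (intro Ck_on_add Ck_on_scaleR Ck_on_const open_chart_image_Int[OF c X])
      (use assms c in \<open>simp_all add: smooth_map_def\<close>)
qed

lemma smooth_map_compose:
  fixes h :: "'a::euclidean_space \<Rightarrow> 'b::real_normed_vector"
  assumes g: "smooth_map X g" and N: "open N" "g ` X \<subseteq> N" "\<And>n. Ck_on n h N"
  shows "smooth_map X (\<lambda>p. h (g p))"
  unfolding smooth_map_def
proof (intro conjI ballI allI)
  show X: "open X" using g by (simp add: smooth_map_def)
  fix c n assume c: "c \<in> atlas S"
  have "Ck_on n (\<lambda>x. h (in_chart c g x)) (snd c ` (fst c \<inter> X))"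
    by (rule Ck_on_compose[OF open_chart_image_Int[OF c X] N(1) _ N(3)])
      (use g c N(2) in \<open>auto simp: smooth_map_def in_chart_chart\<close>)
  then show "Ck_on n (in_chart c (\<lambda>p. h (g p))) (snd c ` (fst c \<inter> X))" by (simp add: in_chart_def o_def)
qed

end

section \<open>The focus-focus fiber, its saturated neighborhood and the momentum image\<close>

locale focus_setting = symplectic S for S :: "('m::{t2_space,second_countable_topology}) int_sys" +
  fixes m :: 'm and \<Delta> :: "(real \<times> real) set" and \<epsilon> :: "'m \<Rightarrow> real" and f :: "real \<times> real \<Rightarrow> real \<times> real"
    and E :: "'m normal_form"
  assumes semitoric: "simple_semitoric S" and focus: "focus_focus S m"
    and polygon: "polygon_representative S \<Delta> \<epsilon> f"
    and L_m: "Lmap S m = 0" and mu_m: "mu_poly S f m = (0, 0)"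
    and preferred: "preferred_normal_form S m E" and small: "small_normal_form S m E"
begin

abbreviation "F \<equiv> Fmap S"
abbreviation "W \<equiv> Wset S E"
abbreviation "WC \<equiv> Wcut S E \<epsilon>"
abbreviation "D \<equiv> Dcut S E \<epsilon>"
abbreviation "\<Phi> \<equiv> Phi S E"
abbreviation "N \<equiv> F ` nbhd E"

lemma normal_form: "normal_form_at S m E"
  and rho_fst: "x \<in> rho_dom E \<Longrightarrow> fst (rho E x) = fst x"
  and rho_pos: "x \<in> rho_dom E \<Longrightarrow> snd (frechet_derivative (rho E) (at x) (0, 1)) > 0"
  using preferred unfolding preferred_normal_form_def by blast+

lemma eps: "\<epsilon> m = 1 \<or> \<epsilon> m = - 1"
  using polygon focus unfolding polygon_representative_def by blast

lemma integrable: "completely_integrable S" and L_periodic: "periodic_flow S UNIV (Lmap S)"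
  using semitoric unfolding simple_semitoric_def semitoric_def by blast+

lemma smooth_L: "smooth_map UNIV (Lmap S)" and smooth_H: "smooth_map UNIV (Hmap S)"
  using integrable unfolding completely_integrable_def by (auto intro: smooth_mapI)

lemma smooth_F: "smooth_map UNIV F"
proof -
  have "F = (\<lambda>p. (Lmap S p, Hmap S p))" by (simp add: Fmap_def fun_eq_iff)
  then show ?thesis using smooth_map_Pair[OF smooth_L smooth_H] by simp
qed

lemma open_F_vimage: "open A \<Longrightarrow> open (F -` A)"
  using smooth_map_continuous_on[OF smooth_F] by (simp add: open_vimage)

lemma rho_inj: "inj_on (rho E) (rho_dom E)" and open_rho_dom: "open (rho_dom E)" and N_rho: "N \<subseteq> rho_dom E"
  and rho_smooth: "smooth_on (rho E) (rho_dom E)" and rho_inv_smooth: "smooth_on (inv_into (rho_dom E) (rho E)) (rho E ` rho_dom E)"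
  and rho_m: "rho E (F m) = (0, 0)" and rho_G: "p \<in> nbhd E \<Longrightarrow> rho E (F p) = G_ff (symp E p)"
  and m_nbhd: "m \<in> nbhd E" and open_symp: "open (symp E ` nbhd E)" and symp_m: "symp E m = 0"
  using normal_form unfolding normal_form_at_def diffeomorphism_on_def by blast+

lemma rho_Ck_on: "Ck_on n (rho E) (rho_dom E)"
  by (rule smooth_on_open_imp_Ck_on[OF rho_smooth open_rho_dom])

text \<open>\<open>F\<close> is not a submersion at \<open>m\<close>; that the image of the
  neighborhood is open comes from the normal form and \<open>open_G_ff\<close>.\<close>

lemma open_rho_N: "open (rho E ` N)"
proof -
  have "rho E ` N = G_ff ` symp E ` nbhd E" using rho_G by (auto simp: image_iff)
  then show ?thesis using open_G_ff[OF open_symp] by simp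
qed

lemma open_N: "open N"
proof -
  have "N = rho_dom E \<inter> rho E -` (rho E ` N)"
    using N_rho inj_onD[OF rho_inj] by blast
  moreover have "continuous_on (rho_dom E) (rho E)" using rho_Ck_on[of 0] by simp
  ultimately show ?thesis
    using continuous_on_open_vimage[OF open_rho_dom] open_rho_N by (metis Int_commute)
qed

lemma W_iff: "p \<in> W \<longleftrightarrow> F p \<in> N" by (simp add: Wset_def)

lemma open_W: "open W" unfolding Wset_def by (rule open_F_vimage[OF open_N])

lemma m_W: "m \<in> W" using m_nbhd by (simp add: W_iff)

lemma rho_F: "p \<in> W \<Longrightarrow> rho E (F p) = (Re (\<Phi> p), Im (\<Phi> p))"
  using rho_fst[of "F p"] N_rho by (auto simp: W_iff Phi_def Phi2_def Fmap_def prod_eq_iff)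

lemma Re_Phi: "Re (\<Phi> p) = Lmap S p" by (simp add: Phi_def)

lemma Phi_W: "\<Phi> ` W = {z. (Re z, Im z) \<in> rho E ` N}"
proof (intro equalityI subsetI)
  fix z assume "z \<in> {z. (Re z, Im z) \<in> rho E ` N}"
  then obtain p where p: "p \<in> nbhd E" "(Re z, Im z) = rho E (F p)" by auto
  then have "p \<in> W" by (simp add: W_iff)
  then show "z \<in> \<Phi> ` W" using rho_F p by (auto simp: complex_eq_iff intro!: image_eqI[of _ _ p])
next
  fix z assume "z \<in> \<Phi> ` W"
  then show "z \<in> {z. (Re z, Im z) \<in> rho E ` N}" using rho_F W_iff by (auto simp: image_iff) metis
qed

lemma open_Phi_W: "open (\<Phi> ` W)"
proof -
  have "continuous_on UNIV (\<lambda>z. (Re z, Im z))" by (intro continuous_intros)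
  then have "open ((\<lambda>z. (Re z, Im z)) -` (rho E ` N))" using open_rho_N by (rule open_vimage[rotated])
  moreover have "(\<lambda>z. (Re z, Im z)) -` (rho E ` N) = \<Phi> ` W" unfolding Phi_W by auto
  ultimately show ?thesis by simp
qed

lemma convex_Phi_W: "convex (\<Phi> ` W)" using small by (simp add: small_normal_form_def)

lemma Phi_m: "\<Phi> m = 0" using rho_F[OF m_W] rho_m by (simp add: complex_eq_iff)

lemma zero_Phi_W: "0 \<in> \<Phi> ` W" using Phi_m m_W by (metis imageI)

lemma Phi_eq_iff: "p \<in> W \<Longrightarrow> q \<in> W \<Longrightarrow> \<Phi> p = \<Phi> q \<longleftrightarrow> F p = F q"
  using rho_F[of p] rho_F[of q] N_rho inj_on_eq_iff[OF rho_inj, of "F p" "F q"]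
  by (auto simp: W_iff complex_eq_iff)

text \<open>The cut is described by \<open>H\<close>, the slit by Im \<Phi>. Monotonicity of
  \<rho>_2 in h cannot be integrated directly, since \<open>rho_dom\<close> may fail to contain the
  vertical segment from F(m) to F(p). Instead the vertical segment from 0 to \<Phi>(p), which lies
  in the convex set \<Phi>(W), is followed through the inverse of \<rho>; along it the second
  component has a derivative with the sign of \<open>j\<close>.\<close>

lemma sgn_Phi2:
  assumes p: "p \<in> W" "Lmap S p = 0"
  shows "sgn (Hmap S p - Hmap S m) = sgn (Im (\<Phi> p))"
proof -
  define j where "j = Im (\<Phi> p)"
  define \<sigma> where "\<sigma> = inv_into (rho_dom E) (rho E)"
  have \<sigma>: "\<sigma> (rho E x) = x" if "x \<in> rho_dom E" for x using that rho_inj by (simp add: \<sigma>_def)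
  have \<sigma>s: "Ck_on n \<sigma> (rho E ` N)" for n
    unfolding \<sigma>_def
    by (rule smooth_on_open_imp_Ck_on[OF smooth_on_subset[OF rho_inv_smooth image_mono[OF N_rho]] open_rho_N])
  have seg: "(0, s * j) \<in> rho E ` N" if "0 \<le> s" "s \<le> 1" for s
  proof -
    have "(1 - s) *\<^sub>R 0 + s *\<^sub>R \<Phi> p \<in> \<Phi> ` W"
      using convex_Phi_W zero_Phi_W p that unfolding convex_alt by blast
    then show ?thesis using p Re_Phi[of p] by (simp add: Phi_W j_def)
  qed
  define g where "g = (\<lambda>s. snd (\<sigma> (0, s * j)))"
  have der: "\<exists>y. (g has_real_derivative y) (at s) \<and> sgn y = sgn j" if s: "0 \<le> s" "s \<le> 1" for s
  proof -
    define x where "x = \<sigma> (0, s * j)"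
    obtain n where n: "n \<in> N" "(0, s * j) = rho E n" using seg[OF s] by auto
    then have x: "x \<in> N" "rho E x = (0, s * j)" using \<sigma>[OF subsetD[OF N_rho n(1)]] by (simp_all add: x_def)
    define A where "A = frechet_derivative \<sigma> (at (0, s * j))"
    define B where "B = frechet_derivative (rho E) (at x)"
    have A: "(\<sigma> has_derivative A) (at (0, s * j))"
      unfolding A_def by (rule Ck_on_has_derivative[OF \<sigma>s[of "Suc 0"] seg[OF s]])
    have B: "(rho E has_derivative B) (at x)"
      unfolding B_def by (rule Ck_on_has_derivative[OF rho_Ck_on[of "Suc 0"] subsetD[OF N_rho x(1)]])
    interpret B: bounded_linear B using B by (rule has_derivative_bounded_linear)
    interpret A: bounded_linear A using A by (rule has_derivative_bounded_linear)
    have r\<sigma>: "rho E (\<sigma> y) = y" "fst (\<sigma> y) = fst y" if "y \<in> rho E ` N" for y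
    proof -
      from that obtain x where "y = rho E x" "x \<in> N" by (rule imageE)
      moreover have "x \<in> rho_dom E" by (rule subsetD[OF N_rho \<open>x \<in> N\<close>])
      ultimately show "rho E (\<sigma> y) = y" "fst (\<sigma> y) = fst y" by (simp_all add: \<sigma> rho_fst)
    qed
    have "((rho E \<circ> \<sigma>) has_derivative (B \<circ> A)) (at (0, s * j))"
      by (rule diff_chain_at[OF A]) (use B in \<open>simp add: x_def\<close>)
    then have "((\<lambda>y. y) has_derivative (B \<circ> A)) (at (0, s * j))"
      by (rule has_derivative_transform_within_open[OF _ open_rho_N seg[OF s]]) (use r\<sigma> in simp)
    then have BA: "B \<circ> A = (\<lambda>v. v)" using has_derivative_ident by (rule has_derivative_unique)
    have "((\<lambda>y. fst (\<sigma> y)) has_derivative (\<lambda>v. fst (A v))) (at (0, s * j))" by (rule has_derivative_fst[OF A])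
    then have "(fst has_derivative (\<lambda>v. fst (A v))) (at (0, s * j))"
      by (rule has_derivative_transform_within_open[OF _ open_rho_N seg[OF s]]) (use r\<sigma> in simp)
    then have fA: "(\<lambda>v. fst (A v)) = fst"
      using has_derivative_fst[OF has_derivative_ident] by (rule has_derivative_unique)
    define a where "a = snd (A (0, j))"
    \<comment> \<open>\<rho> preserves the first coordinate, so the derivative of its inverse maps
      vertical vectors to vertical ones, and the sign comes from \<open>rho_pos\<close>.\<close>
    have eqA: "A (0, j) = a *\<^sub>R (0, 1)" using fun_cong[OF fA, of "(0, j)"] by (simp add: prod_eq_iff a_def)
    have "B (A (0, j)) = (0, j)" using fun_cong[OF BA, of "(0, j)"] by (simp only: o_apply)
    then have "a *\<^sub>R B (0, 1) = (0, j)" unfolding eqA B.scaleR .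
    then have "a * snd (B (0, 1)) = j" by (metis snd_conv snd_scaleR real_scaleR_def)
    moreover have "snd (B (0, 1)) > 0" unfolding B_def by (rule rho_pos[OF subsetD[OF N_rho x(1)]])
    ultimately have sg: "sgn (snd (A (0, j))) = sgn j"
      using sgn_mult[of a "snd (B (0, 1))"] by (simp add: a_def)
    have "((\<lambda>s. (0, s * j)) has_derivative (\<lambda>h. (0, h * j))) (at s)" by (auto intro!: derivative_eq_intros)
    from has_derivative_snd[OF diff_chain_at[OF this A]]
    have "(g has_derivative (\<lambda>h. snd (A (0, h * j)))) (at s)" by (simp add: g_def o_def)
    moreover have "snd (A (0, h * j)) = snd (A (0, j)) * h" for h using A.scaleR[of h "(0, j)"] by (simp add: mult.commute)
    ultimately show ?thesis using sg unfolding has_field_derivative_def by (intro exI[of _ "snd (A (0, j))"]) simp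
  qed
  have F0: "F q \<in> rho_dom E" if "q \<in> W" for q using that N_rho by (auto simp: W_iff)
  have g0: "g 0 = Hmap S m" using \<sigma>[OF F0[OF m_W]] rho_m by (simp add: g_def Fmap_def)
  have g1: "g 1 = Hmap S p" using \<sigma>[OF F0[OF p(1)]] rho_F[OF p(1)] p(2) Re_Phi[of p] by (simp add: g_def j_def Fmap_def)
  consider "j = 0" | "j > 0" | "j < 0" by linarith
  then have "sgn (g 1 - g 0) = sgn j"
  proof cases
    case 1 then show ?thesis by (simp add: g_def)
  next
    case 2
    then have pos: "\<exists>y. (g has_real_derivative y) (at s) \<and> 0 < y" if "0 \<le> s" "s \<le> 1" for s
      using der[OF that] by (simp add: sgn_1_pos)
    have "g 0 < g 1" by (rule DERIV_pos_imp_increasing[of 0 1 g]) (use pos in auto)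
    then show ?thesis using 2 by simp
  next
    case 3
    then have neg: "\<exists>y. (g has_real_derivative y) (at s) \<and> y < 0" if "0 \<le> s" "s \<le> 1" for s
      using der[OF that] by (simp add: sgn_1_neg)
    have "g 0 > g 1" by (rule DERIV_neg_imp_decreasing[of 0 1 g]) (use neg in auto)
    then show ?thesis using 3 by simp
  qed
  then show ?thesis by (simp add: g0 g1 j_def)
qed

text \<open>Cuts at other focus-focus values lie on vertical lines that F(W) avoids by
  \<open>small_normal_form\<close>; for the cut at \<open>m\<close>, \<open>sgn_Phi2\<close>
  translates the condition on \<open>H\<close> into one on Im \<Phi>.\<close>

lemma cuts_iff:
  assumes p: "p \<in> W" shows "F p \<in> cuts S \<epsilon> \<longleftrightarrow> \<Phi> p \<in> slit (\<epsilon> m)"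
proof -
  have rm: "r = m" if "focus_focus S r" "Lmap S p = Lmap S r" for r
  proof (rule ccontr)
    assume "r \<noteq> m"
    then have "Lmap S r \<notin> Lmap S ` nbhd E" using small that by (auto simp: small_normal_form_def)
    moreover obtain q where "q \<in> nbhd E" "F p = F q" using p by (auto simp: W_iff)
    ultimately show False using that by (auto simp: Fmap_def)
  qed
  have "F p \<in> cuts S \<epsilon> \<longleftrightarrow> (\<exists>r. focus_focus S r \<and> Lmap S p = Lmap S r \<and> \<epsilon> r * Hmap S p \<ge> \<epsilon> r * Hmap S r)"
    unfolding cuts_def Fmap_def by simp
  also have "\<dots> \<longleftrightarrow> Lmap S p = 0 \<and> \<epsilon> m * Hmap S p \<ge> \<epsilon> m * Hmap S m"
  proof
    assume "\<exists>r. focus_focus S r \<and> Lmap S p = Lmap S r \<and> \<epsilon> r * Hmap S p \<ge> \<epsilon> r * Hmap S r"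
    then obtain r where r: "focus_focus S r" "Lmap S p = Lmap S r" "\<epsilon> r * Hmap S p \<ge> \<epsilon> r * Hmap S r" by blast
    have "r = m" by (rule rm[OF r(1,2)])
    then show "Lmap S p = 0 \<and> \<epsilon> m * Hmap S p \<ge> \<epsilon> m * Hmap S m" using r L_m by simp
  next
    assume "Lmap S p = 0 \<and> \<epsilon> m * Hmap S p \<ge> \<epsilon> m * Hmap S m"
    then show "\<exists>r. focus_focus S r \<and> Lmap S p = Lmap S r \<and> \<epsilon> r * Hmap S p \<ge> \<epsilon> r * Hmap S r"
      using focus L_m by (intro exI[of _ m]) simp
  qed
  finally have "F p \<in> cuts S \<epsilon> \<longleftrightarrow> Lmap S p = 0 \<and> \<epsilon> m * Hmap S p \<ge> \<epsilon> m * Hmap S m" .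
  moreover have "\<epsilon> m * Hmap S p \<ge> \<epsilon> m * Hmap S m \<longleftrightarrow> \<epsilon> m * Im (\<Phi> p) \<ge> 0" if "Lmap S p = 0"
    using sgn_Phi2[OF p that] eps by (auto simp: sgn_if split: if_splits)
  ultimately show ?thesis by (auto simp: slit_def Re_Phi)
qed

lemma WC_iff: "p \<in> WC \<longleftrightarrow> p \<in> W \<and> \<Phi> p \<notin> slit (\<epsilon> m)"
  using cuts_iff by (auto simp: Wcut_def)

lemma D_eq: "D = \<Phi> ` W - slit (\<epsilon> m)" unfolding Dcut_def using WC_iff by auto

lemma WC_D: "p \<in> W \<Longrightarrow> p \<in> WC \<longleftrightarrow> \<Phi> p \<in> D" using WC_iff D_eq by auto

lemma open_D: "open D" unfolding D_eq by (rule open_Diff[OF open_Phi_W closed_slit])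

lemma connected_D: "connected D" unfolding D_eq
  by (rule connected_slit_complement[OF convex_Phi_W open_Phi_W zero_Phi_W eps])

lemma connected_D_ball: "r > 0 \<Longrightarrow> connected (D \<inter> ball 0 r)"
proof -
  assume "r > 0"
  then have "connected (\<Phi> ` W \<inter> ball 0 r - slit (\<epsilon> m))"
    by (intro connected_slit_complement convex_Int open_Int convex_Phi_W open_Phi_W eps) (use zero_Phi_W in auto)
  then show ?thesis by (simp add: D_eq Diff_Int_distrib2 Int_commute Int_Diff)
qed

lemma zero_notin_D: "0 \<notin> D" by (simp add: D_eq slit_def)

lemma D_contains_right: obtains d where "d > 0" "\<And>x. 0 < x \<Longrightarrow> x < d \<Longrightarrow> complex_of_real x \<in> D"
proof -
  obtain d where d: "d > 0" "ball 0 d \<subseteq> \<Phi> ` W" using open_contains_ball open_Phi_W zero_Phi_W by blast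
  then show ?thesis using that[of d] by (auto simp: D_eq slit_def subset_iff)
qed

lemma zero_islimpt: "0 islimpt (D \<inter> ball 0 r)" if "r > 0"
  unfolding islimpt_approachable
proof (intro allI impI)
  fix e :: real assume "e > 0"
  obtain d where d: "d > 0" "\<And>x. 0 < x \<Longrightarrow> x < d \<Longrightarrow> complex_of_real x \<in> D" using D_contains_right by blast
  define x where "x = min d (min e r) / 2"
  have "0 < x" "x < d" "x < e" "x < r" using d \<open>e > 0\<close> that by (auto simp: x_def)
  then show "\<exists>x'\<in>D \<inter> ball 0 r. x' \<noteq> 0 \<and> dist x' 0 < e"
    using d(2) by (intro bexI[of _ "complex_of_real x"]) (auto simp: dist_norm)
qed

lemma F_saturated: "F p = F q \<Longrightarrow> p \<in> W \<longleftrightarrow> q \<in> W" "F p = F q \<Longrightarrow> p \<in> WC \<longleftrightarrow> q \<in> WC"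
  by (simp_all add: W_iff Wcut_def)

lemma Phi_F: "F p = F q \<Longrightarrow> \<Phi> p = \<Phi> q" by (simp add: Phi_def Phi2_def Fmap_def)

text \<open>Injectivity of \<rho> and saturation of \<open>W\<close> turn a fiber of \<Phi> over
  \<open>W\<close> into a complete fiber of \<open>F\<close>. Curves along which \<open>F\<close> is
  constant can therefore not leave it.\<close>

lemma fiber_eq: "fiber S E (\<Phi> p) = F -` {F p}" if p: "p \<in> W"
proof (intro equalityI subsetI)
  fix q assume "q \<in> fiber S E (\<Phi> p)"
  then show "q \<in> F -` {F p}" using Phi_eq_iff[of q p] p by (simp add: fiber_def)
next
  fix q assume "q \<in> F -` {F p}"
  then have "F q = F p" by simp
  then show "q \<in> fiber S E (\<Phi> p)" using F_saturated(1)[of q p] Phi_F[of q p] p by (simp add: fiber_def)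
qed

lemma fiber_WC: "z \<in> D \<Longrightarrow> p \<in> fiber S E z \<Longrightarrow> p \<in> WC \<and> \<Phi> p = z"
  using WC_D[of p] by (simp add: fiber_def)

lemma fiber_nonempty: "z \<in> D \<Longrightarrow> \<exists>p. p \<in> fiber S E z"
  by (auto simp: D_eq fiber_def)

lemma rank_WC: "p \<in> WC \<Longrightarrow> mrank S p = 2"
  using small WC_iff[of p] Phi_m unfolding small_normal_form_def by (cases "p = m") (simp_all add: slit_def)

lemma F_WC_regular: "p \<in> WC \<Longrightarrow> F p \<in> regular_values S - cuts S \<epsilon>"
  using rank_WC F_saturated(2)[of _ p] unfolding regular_values_def by (simp add: Wcut_def)

lemma Phi_continuous: "continuous_on W \<Phi>"
proof -
  have "continuous_on W (\<lambda>p. rho E (F p))"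
    by (rule continuous_on_compose2[of "rho_dom E" "rho E"])
      (use rho_Ck_on[of 0] N_rho W_iff continuous_on_subset[OF smooth_map_continuous_on[OF smooth_F]] in auto)
  then have "continuous_on W (\<lambda>p. Complex (fst (rho E (F p))) (snd (rho E (F p))))" by (intro continuous_intros)
  then show ?thesis by (rule continuous_on_eq) (simp add: rho_F)
qed

lemma open_WC: "open WC"
proof -
  have "WC = W \<inter> \<Phi> -` D" using WC_D WC_iff by blast
  then show ?thesis using continuous_on_open_vimage[OF open_W] Phi_continuous open_D by (metis Int_commute)
qed

lemma open_F_WC: "open (F ` WC)"
proof -
  have "F ` WC = rho_dom E \<inter> rho E -` ((\<lambda>z. (Re z, Im z)) ` D)"
  proof (intro equalityI subsetI)
    fix x assume "x \<in> F ` WC"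
    then obtain p where "p \<in> WC" "x = F p" by blast
    then show "x \<in> rho_dom E \<inter> rho E -` ((\<lambda>z. (Re z, Im z)) ` D)"
      using N_rho rho_F[of p] WC_iff[of p] WC_D[of p] W_iff[of p] by (simp add: subsetD image_iff) blast
  next
    fix x assume x: "x \<in> rho_dom E \<inter> rho E -` ((\<lambda>z. (Re z, Im z)) ` D)"
    then obtain p where p: "p \<in> WC" "rho E x = (Re (\<Phi> p), Im (\<Phi> p))" unfolding Dcut_def by auto
    then have "rho E x = rho E (F p)" using rho_F WC_iff by simp
    then have "x = F p" using x p N_rho WC_iff W_iff inj_onD[OF rho_inj] by blast
    then show "x \<in> F ` WC" using p by blast
  qed
  moreover have "open ((\<lambda>z. (Re z, Im z)) ` D)"
  proof -
    have "(\<lambda>z. (Re z, Im z)) ` D = (\<lambda>x. Complex (fst x) (snd x)) -` D" by (force simp: image_iff)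
    moreover have "continuous_on UNIV (\<lambda>x. Complex (fst x) (snd x))" by (intro continuous_intros)
    ultimately show ?thesis using open_D open_vimage by metis
  qed
  moreover have "continuous_on (rho_dom E) (rho E)" using rho_Ck_on[of 0] by simp
  ultimately show ?thesis using continuous_on_open_vimage[OF open_rho_dom] by (metis Int_commute)
qed

end

section \<open>The torus action near a regular fiber\<close>

context symplectic begin

lemma icurve_smooth_map:
  fixes g :: "'m \<Rightarrow> 'b::real_normed_vector"
  assumes g: "smooth_map X g" and \<gamma>: "icurve J u \<gamma>" and t: "t \<in> J" "\<gamma> t \<in> X" and c: "c \<in> atlas S" "\<gamma> t \<in> fst c"
  shows "((\<lambda>t. g (\<gamma> t)) has_vector_derivative chart_deriv c g (\<gamma> t) (u t c (\<gamma> t))) (at t within J)"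
proof -
  have "((in_chart c g \<circ> (snd c \<circ> \<gamma>)) has_vector_derivative chart_deriv c g (\<gamma> t) (u t c (\<gamma> t))) (at t within J)"
    by (rule vector_derivative_diff_chain_within[OF icurve_D[OF \<gamma> t(1) c]])
      (simp add: has_derivative_at_withinI smooth_map_has_derivative[OF g c t(2)])
  moreover have "\<forall>\<^sub>F s in at t within J. (in_chart c g \<circ> (snd c \<circ> \<gamma>)) s = g (\<gamma> s)"
  proof -
    have "(\<gamma> \<longlongrightarrow> \<gamma> t) (at t within J)" using icurve_continuous[OF \<gamma>] t by (simp add: continuous_on_def)
    then have "\<forall>\<^sub>F s in at t within J. \<gamma> s \<in> fst c"
      by (rule topological_tendstoD) (use open_chart c in auto)
    then show ?thesis by eventually_elim (simp add: in_chart_chart c)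
  qed
  ultimately show ?thesis unfolding has_vector_derivative_def
    by (rule has_derivative_transform_eventually) (use c t in \<open>auto simp: in_chart_chart\<close>)
qed

lemma icurve_cong:
  assumes "\<And>t c. t \<in> J \<Longrightarrow> c \<in> atlas S \<Longrightarrow> \<gamma> t \<in> fst c \<Longrightarrow> u t c (\<gamma> t) = v t c (\<gamma> t)" "icurve J u \<gamma>"
  shows "icurve J v \<gamma>"
  using assms unfolding icurve_def by simp

lemma chart_deriv_eq:
  assumes "c \<in> atlas S" "p \<in> fst c" "(in_chart c g has_derivative g') (at (snd c p))"
  shows "chart_deriv c g p v = g' v"
  unfolding chart_deriv_def by (simp add: frechet_derivative_at[OF assms(3), symmetric])

end

context focus_setting begin

abbreviation "XL \<equiv> ham_vec S (Lmap S)"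
abbreviation "XH \<equiv> ham_vec S (Hmap S)"
abbreviation "dL c \<equiv> chart_deriv c (Lmap S)"
abbreviation "dH c \<equiv> chart_deriv c (Hmap S)"
abbreviation "mu2 \<equiv> mu2_poly S f"

lemma F_has_derivative:
  assumes c: "c \<in> atlas S" "p \<in> fst c"
  shows "(in_chart c F has_derivative (\<lambda>v. (dL c p v, dH c p v))) (at (snd c p))"
proof -
  have "in_chart c F = (\<lambda>x. (in_chart c (Lmap S) x, in_chart c (Hmap S) x))"
    by (simp add: in_chart_def Fmap_def fun_eq_iff)
  then show ?thesis
    using has_derivative_Pair[OF smooth_map_has_derivative[OF smooth_L c UNIV_I] smooth_map_has_derivative[OF smooth_H c UNIV_I]]
    by simp
qed

lemma linear_dL: "c \<in> atlas S \<Longrightarrow> p \<in> fst c \<Longrightarrow> linear (dL c p)"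
  and linear_dH: "c \<in> atlas S \<Longrightarrow> p \<in> fst c \<Longrightarrow> linear (dH c p)"
  using smooth_map_linear[OF smooth_L] smooth_map_linear[OF smooth_H] by auto

lemma sform_XL: "c \<in> atlas S \<Longrightarrow> p \<in> fst c \<Longrightarrow> sform S c p (XL c p) v = - dL c p v"
  and sform_XH: "c \<in> atlas S \<Longrightarrow> p \<in> fst c \<Longrightarrow> sform S c p (XH c p) v = - dH c p v"
  by (simp_all add: sform_ham_vec linear_dL linear_dH)

lemma chart_deriv_F_compose:
  fixes h :: "real \<times> real \<Rightarrow> real"
  assumes h: "(h has_derivative h') (at (F p))" and c: "c \<in> atlas S" "p \<in> fst c"
  shows "chart_deriv c (\<lambda>q. h (F q)) p v = h' (dL c p v, dH c p v)"
proof (rule chart_deriv_eq[OF c])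
  have "((h \<circ> in_chart c F) has_derivative (h' \<circ> (\<lambda>v. (dL c p v, dH c p v)))) (at (snd c p))"
    by (rule diff_chain_at[OF F_has_derivative[OF c]]) (use h c in \<open>simp add: in_chart_chart\<close>)
  then show "(in_chart c (\<lambda>q. h (F q)) has_derivative (\<lambda>v. h' (dL c p v, dH c p v))) (at (snd c p))"
    by (simp add: in_chart_def o_def)
qed

lemma ham_vec_F_compose:
  fixes h :: "real \<times> real \<Rightarrow> real"
  assumes h: "(h has_derivative h') (at (F p))" and c: "c \<in> atlas S" "p \<in> fst c"
  shows "ham_vec S (\<lambda>q. h (F q)) c p = h' (1, 0) *\<^sub>R XL c p + h' (0, 1) *\<^sub>R XH c p"
proof (rule ham_vec_unique[OF c])
  fix v
  interpret h': bounded_linear h' using h by (rule has_derivative_bounded_linear)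
  have "(dL c p v, dH c p v) = dL c p v *\<^sub>R (1, 0) + dH c p v *\<^sub>R (0, 1)" by simp
  then have "h' (dL c p v, dH c p v) = dL c p v * h' (1, 0) + dH c p v * h' (0, 1)"
    by (simp only: h'.add h'.scaleR real_scaleR_def)
  then show "sform S c p (h' (1, 0) *\<^sub>R XL c p + h' (0, 1) *\<^sub>R XH c p) v = - chart_deriv c (\<lambda>q. h (F q)) p v"
    unfolding chart_deriv_F_compose[OF assms] linear_add[OF sform_linear_left[OF c]] linear_scale[OF sform_linear_left[OF c]]
    by (simp add: sform_XL sform_XH c)
qed

lemma sform_XL_XH: "c \<in> atlas S \<Longrightarrow> p \<in> fst c \<Longrightarrow> sform S c p (XL c p) (XH c p) = 0"
  using integrable unfolding completely_integrable_def by blast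

lemma sform_span_zero:
  assumes c: "c \<in> atlas S" "p \<in> fst c"
  shows "sform S c p (a *\<^sub>R XL c p + b *\<^sub>R XH c p) (a' *\<^sub>R XL c p + b' *\<^sub>R XH c p) = 0"
proof -
  note l = linear_add[OF sform_linear_left[OF c]] linear_scale[OF sform_linear_left[OF c]]
  note r = linear_add[OF sform_linear_right[OF c]] linear_scale[OF sform_linear_right[OF c]]
  show ?thesis
    unfolding l r using sform_alt[OF c] sform_XL_XH[OF c] sform_antisym[OF c, of "XH c p" "XL c p"] by simp
qed

lemma dF_span_zero:
  assumes c: "c \<in> atlas S" "p \<in> fst c"
  shows "dL c p (a *\<^sub>R XL c p + b *\<^sub>R XH c p) = 0" "dH c p (a *\<^sub>R XL c p + b *\<^sub>R XH c p) = 0"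
  using sform_span_zero[OF c, of 1 0 a b] sform_span_zero[OF c, of 0 1 a b] sform_XL[OF c] sform_XH[OF c] by simp_all

lemma F_constant:
  assumes \<gamma>: "icurve UNIV u \<gamma>"
    and u: "\<And>t c. c \<in> atlas S \<Longrightarrow> \<gamma> t \<in> fst c \<Longrightarrow> \<exists>a b. u t c (\<gamma> t) = a *\<^sub>R XL c (\<gamma> t) + b *\<^sub>R XH c (\<gamma> t)"
  shows "F (\<gamma> t) = F (\<gamma> s)"
proof -
  have "((\<lambda>t. F (\<gamma> t)) has_vector_derivative 0) (at t within UNIV)" for t
  proof -
    obtain c where c: "c \<in> atlas S" "\<gamma> t \<in> fst c" using charts_cover by blast
    obtain a b where ab: "u t c (\<gamma> t) = a *\<^sub>R XL c (\<gamma> t) + b *\<^sub>R XH c (\<gamma> t)" using u c by blast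
    have "chart_deriv c F (\<gamma> t) (u t c (\<gamma> t)) = 0"
      using chart_deriv_eq[OF c F_has_derivative[OF c]] dF_span_zero[OF c] ab by (simp add: zero_prod_def)
    then show ?thesis using icurve_smooth_map[OF smooth_F \<gamma> UNIV_I UNIV_I c] by simp
  qed
  then obtain k where "\<And>t. F (\<gamma> t) = k" using has_vector_derivative_zero_constant[OF convex_UNIV, of "\<lambda>t. F (\<gamma> t)"] by auto
  then show ?thesis by simp
qed

lemma f_fst: "fst (f (F p)) = Lmap S p"
  using polygon unfolding polygon_representative_def cartographic_def by (auto simp: Fmap_def)

lemma mu2_F: "mu2 p = snd (f (F p))" by (simp add: mu2_poly_def mu_poly_def)

lemma f_Ck_on: "Ck_on n f (F ` WC)"
proof (rule smooth_on_open_imp_Ck_on[OF _ open_F_WC])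
  have "smooth_on f (range F - cuts S \<epsilon>)"
    using polygon unfolding polygon_representative_def cartographic_def diffeomorphism_on_def by blast
  then show "smooth_on f (F ` WC)" by (rule smooth_on_subset) (auto simp: Wcut_def)
qed

lemma smooth_mu2: "smooth_map WC mu2"
proof -
  have "smooth_map WC (\<lambda>p. snd (f (F p)))"
    by (rule smooth_map_compose[OF smooth_map_subset[OF smooth_F open_WC] open_F_WC, where h = "\<lambda>x. snd (f x)"])
      (auto intro: Ck_on_bounded_linear[OF open_F_WC bounded_linear_snd f_Ck_on])
  then show ?thesis by (simp add: mu2_F[abs_def])
qed

lemma smooth_Phi2: "smooth_map W (Phi2 S E)"
proof -
  have "smooth_map W (\<lambda>p. snd (rho E (F p)))"
    by (rule smooth_map_compose[OF smooth_map_subset[OF smooth_F open_W] open_N, where h = "\<lambda>x. snd (rho E x)"])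
      (auto simp: W_iff intro: Ck_on_bounded_linear[OF open_N bounded_linear_snd Ck_on_subset[OF rho_Ck_on N_rho]])
  then show ?thesis by (simp add: Phi2_def[abs_def])
qed

text \<open>\<open>mrank\<close> is read off in the chart \<open>chart_at\<close>; a vector found
  there is moved to an arbitrary chart by the transition map.\<close>

lemma rank_surj:
  assumes p: "p \<in> WC" and c: "c \<in> atlas S" "p \<in> fst c"
  shows "\<exists>v. dL c p v = a \<and> dH c p v = b"
proof -
  define d where "d = chart_at S p"
  have d: "d \<in> atlas S" "p \<in> fst d" unfolding d_def by (rule chart_at_atlas in_chart_at)+
  have eq: "chart_deriv d F p = (\<lambda>v. (dL d p v, dH d p v))"
    using chart_deriv_eq[OF d F_has_derivative[OF d]] by blast
  have "dim (range (\<lambda>v. (dL d p v, dH d p v))) = 2"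
    using rank_WC[OF p] unfolding mrank_def d_def[symmetric] eq .
  then have su: "span (range (\<lambda>v. (dL d p v, dH d p v))) = UNIV"
    using dim_eq_full[of "range (\<lambda>v. (dL d p v, dH d p v))"] by (simp add: DIM_prod)
  have "linear (\<lambda>v. (dL d p v, dH d p v))"
    using linear_dL[OF d] linear_dH[OF d] by (auto intro!: linearI simp: linear_add linear_scale)
  then have sp: "span (range (\<lambda>v. (dL d p v, dH d p v))) = range (\<lambda>v. (dL d p v, dH d p v))"
    unfolding span_eq_iff by (rule linear_subspace_image[OF _ subspace_UNIV])
  have "range (\<lambda>v. (dL d p v, dH d p v)) = UNIV" by (rule trans[OF sp[symmetric] su])
  from surjD[OF this, of "(a, b)"] obtain w where w: "(a, b) = (dL d p w, dH d p w)" by blast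
  define v where "v = chart_deriv d (snd c) p w"
  have "chart_deriv c (snd d) p v = w" unfolding v_def by (rule chart_deriv_inverse) (use c d in auto)
  then have "dL c p v = dL d p w" "dH c p v = dH d p w"
    using smooth_map_chart_deriv_change[OF smooth_L c(1) d(1) c(2) d(2) UNIV_I, of v]
      smooth_map_chart_deriv_change[OF smooth_H c(1) d(1) c(2) d(2) UNIV_I, of v] by simp_all
  then show ?thesis using w by auto
qed

lemma XL_XH_independent:
  assumes p: "p \<in> WC" and c: "c \<in> atlas S" "p \<in> fst c" and z: "a *\<^sub>R XL c p + b *\<^sub>R XH c p = 0"
  shows "a = 0 \<and> b = 0"
proof -
  have "a * dL c p v + b * dH c p v = 0" for v
  proof -
    have "sform S c p (a *\<^sub>R XL c p + b *\<^sub>R XH c p) v = - (a * dL c p v + b * dH c p v)"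
      unfolding linear_add[OF sform_linear_left[OF c]] linear_scale[OF sform_linear_left[OF c]]
      by (simp add: sform_XL sform_XH c)
    then show ?thesis using z linear_0[OF sform_linear_left[OF c]] by simp
  qed
  note z = this
  obtain v where "dL c p v = 1" "dH c p v = 0" using rank_surj[OF p c] by blast
  moreover obtain w where "dL c p w = 0" "dH c p w = 1" using rank_surj[OF p c] by blast
  ultimately show ?thesis using z[of v] z[of w] by simp
qed

text \<open>The regular fibers are Lagrangian. With \<open>e1\<close>, \<open>e2\<close> dual to dL,
  dH, the vectors X_L, X_H, e1, e2 span the tangent space. Correcting \<open>v\<close> by a
  combination of X_L and X_H makes it \<omega>-orthogonal to \<open>e1\<close> and
  \<open>e2\<close>; it is orthogonal to X_L and X_H because dL and dH vanish on it.\<close>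

lemma kernel_dF:
  assumes p: "p \<in> WC" and c: "c \<in> atlas S" "p \<in> fst c" and v: "dL c p v = 0" "dH c p v = 0"
  obtains a b where "v = a *\<^sub>R XL c p + b *\<^sub>R XH c p"
proof -
  obtain e1 where e1: "dL c p e1 = 1" "dH c p e1 = 0" using rank_surj[OF p c] by blast
  obtain e2 where e2: "dL c p e2 = 0" "dH c p e2 = 1" using rank_surj[OF p c] by blast
  define T :: "real^4 \<Rightarrow> real^4" where "T = (\<lambda>x. (x$1 *\<^sub>R XL c p + x$2 *\<^sub>R XH c p) + (x$3 *\<^sub>R e1 + x$4 *\<^sub>R e2))"
  note l = linear_add[OF linear_dL[OF c]] linear_scale[OF linear_dL[OF c]] linear_add[OF linear_dH[OF c]] linear_scale[OF linear_dH[OF c]]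
  have T: "linear T" unfolding T_def by (rule linearI) (simp_all add: algebra_simps)
  have T0: "x = 0" if "T x = 0" for x
  proof -
    have "dL c p (T x) = x$3" "dH c p (T x) = x$4"
      unfolding T_def using dF_span_zero[OF c, of "x$1" "x$2"] by (simp_all only: l e1 e2) simp_all
    then have 34: "x$3 = 0" "x$4 = 0" using that linear_0[OF linear_dL[OF c]] linear_0[OF linear_dH[OF c]] by simp_all
    then have "x$1 = 0 \<and> x$2 = 0" using that XL_XH_independent[OF p c, of "x$1" "x$2"] by (simp add: T_def)
    then show ?thesis using 34 by (simp add: vec_eq_iff forall_4)
  qed
  have "surj T" by (rule linear_injective_imp_surjective[OF T]) (use T0 linear_injective_0[OF T] in auto)
  \<comment> \<open>Since \<omega>(X_L, e1) = - dL(e1) = - 1 and \<omega>(X_L, e2) = 0, and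
    similarly for X_H, these coefficients cancel the pairings of \<open>v\<close> with
    \<open>e1\<close> and \<open>e2\<close>.\<close>
  define a where "a = - sform S c p v e1"
  define b where "b = - sform S c p v e2"
  define v' where "v' = v - (a *\<^sub>R XL c p + b *\<^sub>R XH c p)"
  note sl = linear_diff[OF sform_linear_left[OF c]] linear_add[OF sform_linear_left[OF c]] linear_scale[OF sform_linear_left[OF c]]
  note sr = linear_add[OF sform_linear_right[OF c]] linear_scale[OF sform_linear_right[OF c]]
  have "sform S c p v' w = 0" for w
  proof -
    obtain x where x: "w = T x" using surjD[OF \<open>surj T\<close>, of w] by blast
    have e: "sform S c p v' e1 = 0" "sform S c p v' e2 = 0"
      unfolding v'_def sl by (simp_all add: sform_XL sform_XH c e1 e2 a_def b_def)
    have "dL c p v' = 0" "dH c p v' = 0"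
      unfolding v'_def linear_diff[OF linear_dL[OF c]] linear_diff[OF linear_dH[OF c]] using v dF_span_zero[OF c] by simp_all
    then have "sform S c p v' (XL c p) = 0" "sform S c p v' (XH c p) = 0"
      using sform_antisym[OF c, of v' "XL c p"] sform_antisym[OF c, of v' "XH c p"] sform_XL[OF c, of v'] sform_XH[OF c, of v'] by simp_all
    then show ?thesis unfolding x T_def sr by (simp add: e)
  qed
  then have "v' = 0" by (rule sform_nondegenerate[OF c])
  then show ?thesis using that[of a b] by (simp add: v'_def)
qed

end

text \<open>The integral affine structure: over \<open>A\<close> the toric momentum map \<open>(L, \<mu>\<^sub>2)\<close> is an element of
  \<open>GL(2,\<int>) \<ltimes> \<real>\<^sup>2\<close> applied to the action coordinates \<open>a\<close>.\<close>

locale affine_chart = focus_setting S m \<Delta> \<epsilon> f E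
  for S :: "('m::{t2_space,second_countable_topology}) int_sys" and m \<Delta> \<epsilon> f E +
  fixes A :: "(real \<times> real) set" and a :: "real \<times> real \<Rightarrow> real \<times> real" and a11 a12 a21 a22 :: int and c1 c2 :: real
  assumes A_cuts: "A \<inter> cuts S \<epsilon> = {}" and action: "action_coordinates S A a"
    and unimodular: "\<bar>a11 * a22 - a12 * a21\<bar> = 1"
    and f_affine: "\<And>y. y \<in> A \<Longrightarrow> f y = (of_int a11 * fst (a y) + of_int a12 * snd (a y) + c1,
                       of_int a21 * fst (a y) + of_int a22 * snd (a y) + c2)"
begin

definition "a1 = (\<lambda>p. fst (a (F p)))"
definition "a2 = (\<lambda>p. snd (a (F p)))"
abbreviation "X0 \<equiv> F -` A"

lemma open_A: "open A" and smooth_a: "smooth_on a A"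
  and periodic_a: "periodic_flow S X0 a1" "periodic_flow S X0 a2"
  and free_a: "p \<in> X0 \<Longrightarrow> ham_flow S X0 a1 s (ham_flow S X0 a2 t p) = p \<Longrightarrow>
           (\<exists>i j::int. s = 2 * pi * of_int i \<and> t = 2 * pi * of_int j)"
  using action unfolding action_coordinates_def diffeomorphism_on_def a1_def a2_def Let_def by blast+

lemma a_Ck_on: "Ck_on n a A" by (rule smooth_on_open_imp_Ck_on[OF smooth_a open_A])

lemma open_X0: "open X0" by (rule open_F_vimage[OF open_A])

lemma smooth_a1: "smooth_map X0 a1" and smooth_a2: "smooth_map X0 a2"
  unfolding a1_def a2_def
  by (rule smooth_map_compose[OF smooth_map_subset[OF smooth_F open_X0] open_A, where h = "\<lambda>x. fst (a x)"]
      smooth_map_compose[OF smooth_map_subset[OF smooth_F open_X0] open_A, where h = "\<lambda>x. snd (a x)"],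
      auto intro: Ck_on_bounded_linear[OF open_A bounded_linear_fst a_Ck_on] Ck_on_bounded_linear[OF open_A bounded_linear_snd a_Ck_on])+

lemma ham_a_span:
  assumes "p \<in> X0" "c \<in> atlas S" "p \<in> fst c"
  shows "\<exists>r s. ham_vec S a1 c p = r *\<^sub>R XL c p + s *\<^sub>R XH c p" "\<exists>r s. ham_vec S a2 c p = r *\<^sub>R XL c p + s *\<^sub>R XH c p"
proof -
  have d: "(a has_derivative frechet_derivative a (at (F p))) (at (F p))"
    by (rule Ck_on_has_derivative[OF a_Ck_on[of "Suc 0"]]) (use assms in simp)
  show "\<exists>r s. ham_vec S a1 c p = r *\<^sub>R XL c p + s *\<^sub>R XH c p" "\<exists>r s. ham_vec S a2 c p = r *\<^sub>R XL c p + s *\<^sub>R XH c p"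
    unfolding a1_def a2_def
    using ham_vec_F_compose[OF has_derivative_fst[OF d] assms(2,3)] ham_vec_F_compose[OF has_derivative_snd[OF d] assms(2,3)] by blast+
qed

text \<open>Both action coordinates are functions of \<open>F\<close>, so their Hamiltonian fields
  are combinations of X_L and X_H and have vanishing Poisson bracket;
  \<open>commuting_ham_vec\<close> turns this into commuting flows.\<close>

sublocale flow_pair S X0 "ham_vec S a1" "ham_vec S a2" "ham_flow S X0 a1" "ham_flow S X0 a2"
proof
  show "cflow X0 (ham_vec S a1) (ham_flow S X0 a1)" by (rule cflow_ham_flow[OF smooth_a1 periodic_a(1)])
  show "cflow X0 (ham_vec S a2) (ham_flow S X0 a2)" by (rule cflow_ham_flow[OF smooth_a2 periodic_a(2)])
  show "commuting X0 (ham_vec S a1) (ham_vec S a2)"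
  proof (rule commuting_ham_vec[OF smooth_a1 smooth_a2])
    fix c p assume c: "c \<in> atlas S" "p \<in> fst c" and p: "p \<in> X0"
    obtain r s r' s' where "ham_vec S a1 c p = r *\<^sub>R XL c p + s *\<^sub>R XH c p" "ham_vec S a2 c p = r' *\<^sub>R XL c p + s' *\<^sub>R XH c p"
      using ham_a_span[OF p c] by blast
    then show "sform S c p (ham_vec S a1 c p) (ham_vec S a2 c p) = 0" using sform_span_zero[OF c] by simp
  qed
qed

lemma ham_a_combination:
  assumes "p \<in> X0" "c \<in> atlas S" "p \<in> fst c"
  shows "\<exists>r s. x *\<^sub>R ham_vec S a1 c p + y *\<^sub>R ham_vec S a2 c p = r *\<^sub>R XL c p + s *\<^sub>R XH c p"
proof -
  obtain r s r' s' where "ham_vec S a1 c p = r *\<^sub>R XL c p + s *\<^sub>R XH c p" "ham_vec S a2 c p = r' *\<^sub>R XL c p + s' *\<^sub>R XH c p"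
    using ham_a_span[OF assms] by blast
  then show ?thesis by (intro exI[of _ "x * r + y * r'"] exI[of _ "x * s + y * s'"]) (simp add: algebra_simps)
qed

lemma act_F: assumes p: "p \<in> X0" shows "F (act l p) = F p"
proof -
  have "icurve UNIV (\<lambda>_ c p. fst l *\<^sub>R ham_vec S a1 c p + snd l *\<^sub>R ham_vec S a2 c p) (\<lambda>t. act (t *\<^sub>R (fst l, snd l)) p)"
    by (rule act_line[OF p])
  then have "F (act (1 *\<^sub>R (fst l, snd l)) p) = F (act (0 *\<^sub>R (fst l, snd l)) p)"
    by (rule F_constant) (use ham_a_combination act_in[OF p] in blast)
  then show ?thesis by (simp add: act_0[OF p] flip: zero_prod_def)
qed

lemma act_free:
  assumes p: "p \<in> X0" and l: "act l p = p"
  obtains i j :: int where "l = (2 * pi * of_int i, 2 * pi * of_int j)"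
  using free_a[OF p, of "fst l" "snd l"] l by (auto simp: act_def prod_eq_iff)

lemma act_lattice: "p \<in> X0 \<Longrightarrow> act (2 * pi * of_int i, 2 * pi * of_int j) p = p"
  using act_period[of p 0 i j] by (simp add: act_0)

lemma ham_vec_affine:
  assumes g: "\<And>q. q \<in> X0 \<Longrightarrow> g q = r1 * a1 q + r2 * a2 q + k" and p: "p \<in> X0" and c: "c \<in> atlas S" "p \<in> fst c"
  shows "ham_vec S g c p = r1 *\<^sub>R ham_vec S a1 c p + r2 *\<^sub>R ham_vec S a2 c p"
proof (rule ham_vec_unique[OF c])
  fix v
  have "((\<lambda>x. r1 * in_chart c a1 x + r2 * in_chart c a2 x + k) has_derivative (\<lambda>v. r1 * chart_deriv c a1 p v + r2 * chart_deriv c a2 p v)) (at (snd c p))"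
    using smooth_map_has_derivative[OF smooth_a1 c p] smooth_map_has_derivative[OF smooth_a2 c p] by (auto intro!: derivative_eq_intros)
  then have "(in_chart c g has_derivative (\<lambda>v. r1 * chart_deriv c a1 p v + r2 * chart_deriv c a2 p v)) (at (snd c p))"
  proof (rule has_derivative_transform_within_open[OF _ open_chart_image_Int[OF c(1) open_X0]])
    fix x assume "x \<in> snd c ` (fst c \<inter> X0)"
    then obtain q where "q \<in> fst c" "q \<in> X0" "x = snd c q" by blast
    then show "r1 * in_chart c a1 x + r2 * in_chart c a2 x + k = in_chart c g x"
      using g by (simp add: in_chart_chart c)
  qed (use c p in blast)
  then have "chart_deriv c g p v = r1 * chart_deriv c a1 p v + r2 * chart_deriv c a2 p v" by (rule chart_deriv_eq[OF c])
  then show "sform S c p (r1 *\<^sub>R ham_vec S a1 c p + r2 *\<^sub>R ham_vec S a2 c p) v = - chart_deriv c g p v"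
    unfolding linear_add[OF sform_linear_left[OF c]] linear_scale[OF sform_linear_left[OF c]]
    by (simp add: sform_ham_vec[OF c smooth_map_linear[OF smooth_a1 c p]] sform_ham_vec[OF c smooth_map_linear[OF smooth_a2 c p]])
qed

lemma XL_affine:
  assumes "p \<in> X0" "c \<in> atlas S" "p \<in> fst c"
  shows "XL c p = of_int a11 *\<^sub>R ham_vec S a1 c p + of_int a12 *\<^sub>R ham_vec S a2 c p"
proof (rule ham_vec_affine[OF _ assms])
  fix q assume "q \<in> X0"
  then show "Lmap S q = of_int a11 * a1 q + of_int a12 * a2 q + c1"
    using f_fst[of q] f_affine[of "F q"] by (simp add: a1_def a2_def)
qed

lemma mu2_affine:
  assumes "p \<in> X0" "c \<in> atlas S" "p \<in> fst c"
  shows "ham_vec S mu2 c p = of_int a21 *\<^sub>R ham_vec S a1 c p + of_int a22 *\<^sub>R ham_vec S a2 c p"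
proof (rule ham_vec_affine[OF _ assms])
  fix q assume "q \<in> X0"
  then show "mu2 q = of_int a21 * a1 q + of_int a22 * a2 q + c2"
    using f_affine[of "F q"] by (simp add: a1_def a2_def mu2_F)
qed

text \<open>The coefficients have to be constant on the fiber through \<open>p\<close> only. Hence
  straight lines in the plane also describe the flow of \<Phi>_2, whose coefficients vary from fiber
  to fiber. The orbit runs in the fiber, which \<open>Y\<close> is required to contain.\<close>

lemma ham_flow_act:
  assumes g: "smooth_map Y g" and p: "p \<in> X0" and Y: "F -` {F p} \<subseteq> Y"
    and ham: "\<And>q c. F q = F p \<Longrightarrow> c \<in> atlas S \<Longrightarrow> q \<in> fst c \<Longrightarrow> ham_vec S g c q = r1 *\<^sub>R ham_vec S a1 c q + r2 *\<^sub>R ham_vec S a2 c q"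
  shows "ham_flow S Y g t p = act (t *\<^sub>R (r1, r2)) p"
proof (rule ham_flow_eq[OF g])
  have Fc: "F (act b p) = F p" for b by (rule act_F[OF p])
  then have "range (\<lambda>t. act (t *\<^sub>R (r1, r2)) p) \<subseteq> Y" using Y by (auto simp: vimage_def)
  moreover have "icurve J (\<lambda>_. ham_vec S g) (\<lambda>t. act (t *\<^sub>R (r1, r2)) p)" for J
    by (rule icurve_cong[OF _ act_line[OF p, of J r1 r2]]) (use ham[OF Fc] in simp)
  ultimately show "ham_curve S Y g (closed_segment 0 t) (\<lambda>t. act (t *\<^sub>R (r1, r2)) p)"
    unfolding ham_curve_iff by blast
  show "act (0 *\<^sub>R (r1, r2)) p = p" using act_0[OF p] by (simp add: zero_prod_def)
qed

lemma X0_F: "F q = F p \<Longrightarrow> p \<in> X0 \<Longrightarrow> q \<in> X0" by simp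

lemma flow_L: "p \<in> X0 \<Longrightarrow> ham_flow S UNIV (Lmap S) t p = act (t *\<^sub>R (of_int a11, of_int a12)) p"
  by (rule ham_flow_act[OF smooth_L _ subset_UNIV]) (assumption, rule XL_affine[OF X0_F])

lemma flow_mu2:
  assumes p: "p \<in> X0" "p \<in> WC"
  shows "ham_flow S WC mu2 t p = act (t *\<^sub>R (of_int a21, of_int a22)) p"
proof (rule ham_flow_act[OF smooth_mu2 p(1)])
  show "F -` {F p} \<subseteq> WC"
  proof
    fix q assume "q \<in> F -` {F p}"
    then have "F q = F p" by simp
    then show "q \<in> WC" using F_saturated(2)[of q p] p(2) by blast
  qed
qed (rule mu2_affine[OF X0_F[OF _ p(1)]])

end

lemma (in focus_setting) affine_chart_exists:
  assumes p: "p \<in> WC"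
  obtains A a a11 a12 a21 a22 c1 c2 where "affine_chart S m \<Delta> \<epsilon> f E A a a11 a12 a21 a22 c1 c2" "F p \<in> A"
proof -
  have "integral_affine_at S (cuts S \<epsilon>) f (F p)"
    using polygon F_WC_regular[OF p] unfolding polygon_representative_def cartographic_def by blast
  then obtain A a a11 a12 a21 a22 c1 c2 where "F p \<in> A" "A \<inter> cuts S \<epsilon> = {}" "action_coordinates S A a" "\<bar>a11 * a22 - a12 * a21\<bar> = 1"
    "\<And>y. y \<in> A \<Longrightarrow> f y = (of_int a11 * fst (a y) + of_int a12 * snd (a y) + c1, of_int a21 * fst (a y) + of_int a22 * snd (a y) + c2)"
    unfolding integral_affine_at_def by (elim exE conjE) (rule that, blast+)
  then show ?thesis
    by (intro that[of A a a11 a12 a21 a22 c1 c2] affine_chart.intro focus_setting_axioms affine_chart_axioms.intro)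
qed

section \<open>The action of the generalized toric momentum map\<close>

context smooth_manifold begin

text \<open>Supplies the Lipschitz assumption of \<open>curve_family\<close> for orbits of an
  autonomous field: positions are controlled by \<open>lip_at_tube\<close>, and velocities because
  the field is Lipschitz in the chart.\<close>

lemma flow_family_lip:
  assumes u: "C1_field X u" and g: "icurve {0..1} (\<lambda>_. u) \<gamma>" "\<gamma> ` {0..1} \<subseteq> X"
    and Y: "\<forall>\<^sub>F q in at q0. icurve {0..1} (\<lambda>_. u) (Y q)"
    and l: "c0 \<in> atlas S" "\<gamma> 0 \<in> fst c0" "lip_at q0 (\<gamma> 0) (\<lambda>q. Y q 0) c0" and t0: "t0 \<in> {0..1}"
  shows "\<exists>c\<in>atlas S. \<gamma> t0 \<in> fst c \<and> (\<exists>d>0. \<exists>K\<ge>0. \<forall>\<^sub>F q in at q0. \<forall>t\<in>{0..1}. \<bar>t - t0\<bar> < d \<longrightarrow>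
       Y q t \<in> fst c \<and> norm (snd c (Y q t) - snd c (\<gamma> t)) \<le> K * norm (q - q0) \<and>
       norm (u c (Y q t) - u c (\<gamma> t)) \<le> K * norm (q - q0))"
proof -
  obtain c where c: "c \<in> atlas S" "\<gamma> t0 \<in> fst c" using charts_cover by blast
  show ?thesis
  proof (rule lip_at_tube[OF u g Y t0 c])
    fix d r :: real assume d: "d > 0" "r > 0" "cball (snd c (\<gamma> t0)) r \<subseteq> snd c ` (fst c \<inter> X)"
      "\<And>t. t \<in> {0..1} \<Longrightarrow> \<bar>t - t0\<bar> < d \<Longrightarrow> \<gamma> t \<in> fst c \<and> snd c (\<gamma> t) \<in> cball (snd c (\<gamma> t0)) r"
      "\<And>a b. 0 \<le> a \<Longrightarrow> a \<le> t0 \<Longrightarrow> t0 \<le> b \<Longrightarrow> b \<le> 1 \<Longrightarrow> b - a < d \<Longrightarrow> lip_at q0 (\<gamma> a) (\<lambda>q. Y q a) c \<Longrightarrow>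
        \<exists>K\<ge>0. \<forall>\<^sub>F q in at q0. \<forall>t\<in>{a..b}. Y q t \<in> fst c \<and> snd c (Y q t) \<in> cball (snd c (\<gamma> t0)) r \<and>
          norm (snd c (Y q t) - snd c (\<gamma> t)) \<le> K * norm (q - q0)"
    define a where "a = max 0 (t0 - d / 3)"
    define b where "b = min 1 (t0 + d / 3)"
    have ab: "0 \<le> a" "a \<le> t0" "t0 \<le> b" "b \<le> 1" "b - a < d" "\<bar>a - t0\<bar> < d" "a \<in> {0..1}"
      using d(1) t0 by (auto simp: a_def b_def)
    have "lip_at q0 (\<gamma> a) (\<lambda>q. Y q a) c"
      by (rule lip_at_propagate[OF u g Y l ab(7) c(1)]) (use d(4)[OF ab(7,6)] in simp)
    from d(5)[OF ab(1-5) this] obtain K where K: "K \<ge> 0"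
      "\<forall>\<^sub>F q in at q0. \<forall>t\<in>{a..b}. Y q t \<in> fst c \<and> snd c (Y q t) \<in> cball (snd c (\<gamma> t0)) r \<and>
          norm (snd c (Y q t) - snd c (\<gamma> t)) \<le> K * norm (q - q0)" by blast
    have "Ck_on (Suc 0) (in_chart c (u c)) (snd c ` (fst c \<inter> X))" using u c by (simp add: C1_field_def)
    then obtain B where B: "B \<ge> 0" "\<And>x y. x \<in> cball (snd c (\<gamma> t0)) r \<Longrightarrow> y \<in> cball (snd c (\<gamma> t0)) r \<Longrightarrow>
        norm (in_chart c (u c) x - in_chart c (u c) y) \<le> B * norm (x - y)"
      using C1_Lipschitz[OF _ compact_cball convex_cball d(3)] by metis
    define K' where "K' = K + B * K"
    have K': "K' \<ge> 0" "K \<le> K'" "B * K \<le> K'" using K(1) B(1) by (auto simp: K'_def)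
    have "\<forall>\<^sub>F q in at q0. \<forall>t\<in>{0..1}. \<bar>t - t0\<bar> < d / 3 \<longrightarrow>
       Y q t \<in> fst c \<and> norm (snd c (Y q t) - snd c (\<gamma> t)) \<le> K' * norm (q - q0) \<and>
       norm (u c (Y q t) - u c (\<gamma> t)) \<le> K' * norm (q - q0)"
      using K(2)
    proof (eventually_elim, intro ballI impI)
      fix q t assume q: "\<forall>t\<in>{a..b}. Y q t \<in> fst c \<and> snd c (Y q t) \<in> cball (snd c (\<gamma> t0)) r \<and>
          norm (snd c (Y q t) - snd c (\<gamma> t)) \<le> K * norm (q - q0)" and t: "t \<in> {0..1}" "\<bar>t - t0\<bar> < d / 3"
      have "t0 - d / 3 \<le> t" "t \<le> t0 + d / 3" using t(2) unfolding abs_less_iff by linarith+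
      then have tab: "t \<in> {a..b}" using t(1) by (auto simp: a_def b_def)
      have tg: "\<gamma> t \<in> fst c" "snd c (\<gamma> t) \<in> cball (snd c (\<gamma> t0)) r" using d(4)[OF t(1)] t(2) d(1) by auto
      have qt: "Y q t \<in> fst c" "snd c (Y q t) \<in> cball (snd c (\<gamma> t0)) r" "norm (snd c (Y q t) - snd c (\<gamma> t)) \<le> K * norm (q - q0)"
        using q tab by auto
      have "norm (u c (Y q t) - u c (\<gamma> t)) \<le> B * norm (snd c (Y q t) - snd c (\<gamma> t))"
        using B(2)[OF qt(2) tg(2)] by (simp add: in_chart_chart c qt tg)
      also have "\<dots> \<le> B * (K * norm (q - q0))" by (rule mult_left_mono[OF qt(3) B(1)])
      also have "\<dots> \<le> K' * norm (q - q0)" using mult_right_mono[OF K'(3) norm_ge_zero[of "q - q0"]] by (simp add: mult.assoc)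
      finally show "Y q t \<in> fst c \<and> norm (snd c (Y q t) - snd c (\<gamma> t)) \<le> K' * norm (q - q0) \<and>
         norm (u c (Y q t) - u c (\<gamma> t)) \<le> K' * norm (q - q0)"
        using qt order_trans[OF qt(3) mult_right_mono[OF K'(2) norm_ge_zero]] by simp
    qed
    then show ?thesis using c d(1) K'(1) by (intro bexI[of _ c] conjI exI[of _ "d / 3"] exI[of _ K']) auto
  qed
qed

end

context symplectic begin

lemma primitive_on_subset:
  assumes "primitive_on S X \<theta>" "Y \<subseteq> X" shows "primitive_on S Y \<theta>"
  unfolding primitive_on_def
proof (intro conjI ballI allI)
  fix c v assume "c \<in> atlas S"
  then have "smooth_fun S (\<lambda>p. \<theta> c p v) (fst c \<inter> X)" using assms by (simp add: primitive_on_def)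
  then show "smooth_fun S (\<lambda>p. \<theta> c p v) (fst c \<inter> Y)"
    unfolding smooth_fun_def using assms(2)
    by (intro ballI) (rule smooth_on_subset, blast, blast)
next
  fix c p assume c: "c \<in> atlas S" and "p \<in> fst c \<inter> Y"
  then have p: "p \<in> fst c \<inter> X" using assms(2) by blast
  show "linear (\<theta> c p)" "\<And>v w. chart_deriv c (\<lambda>q. \<theta> c q w) p v - chart_deriv c (\<lambda>q. \<theta> c q v) p w = sform S c p v w"
    using assms(1) c p unfolding primitive_on_def by blast+
next
  fix c d p v assume c: "c \<in> atlas S" "d \<in> atlas S" and "p \<in> fst c \<inter> fst d \<inter> Y"
  then have p: "p \<in> fst c \<inter> fst d \<inter> X" using assms(2) by blast
  show "\<theta> d p (chart_deriv c (snd d) p v) = \<theta> c p v"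
    using assms(1) c p unfolding primitive_on_def by blast
qed

end

context focus_setting begin

lemma open_map_F:
  assumes C: "open C" "C \<subseteq> WC" shows "open (F ` C)"
proof (subst open_subopen, intro ballI)
  fix y assume "y \<in> F ` C"
  then obtain p where p: "p \<in> C" "y = F p" by blast
  obtain c where c: "c \<in> atlas S" "p \<in> fst c" using charts_cover by blast
  define T where "T = snd c ` (fst c \<inter> C)"
  have T: "open T" unfolding T_def by (rule open_chart_image_Int[OF c(1) C(1)])
  have pW: "p \<in> WC" using p C by blast
  obtain e1 where e1: "dL c p e1 = 1" "dH c p e1 = 0" using rank_surj[OF pW c] by blast
  obtain e2 where e2: "dL c p e2 = 0" "dH c p e2 = 1" using rank_surj[OF pW c] by blast
  note l = linear_add[OF linear_dL[OF c]] linear_scale[OF linear_dL[OF c]] linear_add[OF linear_dH[OF c]] linear_scale[OF linear_dH[OF c]]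
  have "in_chart c F (snd c p) \<in> interior (in_chart c F ` T)"
  proof (rule sussmann_open_mapping[OF T, where g' = "\<lambda>y. fst y *\<^sub>R e1 + snd y *\<^sub>R e2"])
    show "continuous_on T (in_chart c F)"
    proof (rule continuous_on_subset)
      show "continuous_on (snd c ` (fst c \<inter> UNIV)) (in_chart c F)"
        using smooth_F c Ck_on.simps(1) unfolding smooth_map_def by blast
    qed (auto simp: T_def)
    show "snd c p \<in> T" using p c by (simp add: T_def)
    then show "snd c p \<in> interior T" using T by (simp add: interior_open)
    show "(in_chart c F has_derivative (\<lambda>v. (dL c p v, dH c p v))) (at (snd c p))" by (rule F_has_derivative[OF c])
    show "bounded_linear (\<lambda>y::real\<times>real. fst y *\<^sub>R e1 + snd y *\<^sub>R e2)"
      by (intro bounded_linear_add bounded_linear_scaleR_const bounded_linear_fst bounded_linear_snd)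
    show "(\<lambda>v. (dL c p v, dH c p v)) \<circ> (\<lambda>y. fst y *\<^sub>R e1 + snd y *\<^sub>R e2) = id"
      by (simp add: fun_eq_iff l e1 e2)
  qed simp
  moreover have "in_chart c F ` T \<subseteq> F ` C" using c by (auto simp: T_def in_chart_chart)
  ultimately show "\<exists>T. open T \<and> y \<in> T \<and> T \<subseteq> F ` C"
    using p c interior_subset[of "in_chart c F ` T"]
    by (intro exI[of _ "interior (in_chart c F ` T)"]) (auto simp: in_chart_chart)
qed

lemma connected_F_WC: "connected (F ` WC)"
proof -
  define h where "h = (\<lambda>z. inv_into (rho_dom E) (rho E) (Re z, Im z))"
  have hF: "h (\<Phi> p) = F p" if "p \<in> W" for p
    using rho_F[OF that] inv_into_f_f[OF rho_inj, of "F p"] N_rho that W_iff by (simp add: h_def subsetD)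
  have "F ` WC = h ` D" unfolding Dcut_def image_image using hF WC_iff by (auto intro!: image_cong)
  moreover have "continuous_on D h"
  proof (rule continuous_on_compose2[where f = "\<lambda>z. (Re z, Im z)" and t = "rho E ` N" and g = "inv_into (rho_dom E) (rho E)", folded h_def])
    have "Ck_on 0 (inv_into (rho_dom E) (rho E)) (rho E ` N)"
      by (rule smooth_on_open_imp_Ck_on[OF smooth_on_subset[OF rho_inv_smooth image_mono[OF N_rho]] open_rho_N])
    then show "continuous_on (rho E ` N) (inv_into (rho_dom E) (rho E))" by simp
    show "(\<lambda>z. (Re z, Im z)) ` D \<subseteq> rho E ` N" using Phi_W by (auto simp: D_eq)
  qed (intro continuous_intros)
  ultimately show ?thesis using connected_D connected_continuous_image by metis
qed

text \<open>On \<open>WC\<close> the map \<open>F\<close> is open with connected fibers, namely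
  tori, over a connected base. Connectedness upstairs is what makes a locally constant function of
  the starting point constant.\<close>

lemma connected_WC: "connected WC"
proof -
  have "connected (WC \<inter> F -` (F ` WC))"
  proof (rule connected_open_monotone_preimage[of WC F "F ` WC"])
    show "continuous_on WC F" by (rule continuous_on_subset[OF smooth_map_continuous_on[OF smooth_F] subset_UNIV])
    show "openin (top_of_set (F ` WC)) (F ` C)" if "openin (top_of_set WC) C" for C
    proof -
      have "open C" "C \<subseteq> WC" using that open_WC openin_open_eq by blast+
      then show ?thesis using open_map_F by (intro open_subset) auto
    qed
    fix y assume "y \<in> F ` WC"
    then obtain p where p: "p \<in> WC" "y = F p" by blast
    have pW: "p \<in> W" "\<Phi> p \<in> D" "\<Phi> p \<noteq> 0" using p WC_iff[of p] WC_D[of p] zero_notin_D by auto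
    have "WC \<inter> F -` {y} = fiber S E (\<Phi> p)"
      unfolding fiber_eq[OF pW(1)] p(2) using F_saturated(2)[of _ p] p(1) by blast
    moreover have "fiber S E (\<Phi> p) homeomorphic (sphere (0::complex) 1 \<times> sphere (0::complex) 1)"
      using small pW unfolding small_normal_form_def by blast
    moreover have "connected (sphere (0::complex) 1 \<times> sphere (0::complex) 1)"
      by (intro connected_Times connected_sphere) simp_all
    ultimately show "connected (WC \<inter> F -` {y})" using homeomorphic_connectedness by metis
  qed (use connected_F_WC in auto)
  moreover have "WC \<inter> F -` (F ` WC) = WC" by blast
  ultimately show ?thesis by simp
qed

abbreviation "PL \<equiv> poly_loop S E \<epsilon> f"

text \<open>In the plane of the action coordinates the orbit is the segment from 0 to a lattice
  vector. This replaces the definite description in \<open>poly_loop\<close> by an explicit curve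
  and shows that it closes up at parameter 1.\<close>

lemma PL_props:
  assumes p: "p \<in> WC"
  shows "icurve UNIV (\<lambda>_ c q. (2 * pi) *\<^sub>R ham_vec S mu2 c q) (PL p)" "PL p t \<in> WC" "PL p 0 = p" "PL p 1 = p" "F (PL p t) = F p"
proof -
  obtain A a a11 a12 a21 a22 c1 c2 where "affine_chart S m \<Delta> \<epsilon> f E A a a11 a12 a21 a22 c1 c2" and FA: "F p \<in> A"
    using affine_chart_exists[OF p] by metis
  then interpret affine_chart S m \<Delta> \<epsilon> f E A a a11 a12 a21 a22 c1 c2 by blast
  have pX: "p \<in> X0" using FA by simp
  have PL: "PL p = (\<lambda>t. act (t *\<^sub>R (2 * pi * of_int a21, 2 * pi * of_int a22)) p)"
    using flow_mu2[OF pX p] by (simp add: poly_loop_def fun_eq_iff algebra_simps)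
  show FP: "F (PL p t) = F p" for t unfolding PL by (rule act_F[OF pX])
  then show "PL p t \<in> WC" for t using F_saturated(2)[of "PL p t" p] p by blast
  show "PL p 0 = p" "PL p 1 = p" unfolding PL using act_0[OF pX] act_lattice[OF pX] by (simp_all add: zero_prod_def)
  show "icurve UNIV (\<lambda>_ c q. (2 * pi) *\<^sub>R ham_vec S mu2 c q) (PL p)"
  proof (rule icurve_cong)
    show "icurve UNIV (\<lambda>_ c q. (2 * pi * of_int a21) *\<^sub>R ham_vec S a1 c q + (2 * pi * of_int a22) *\<^sub>R ham_vec S a2 c q) (PL p)"
      unfolding PL by (rule act_line[OF pX])
    fix t c assume c: "c \<in> atlas S" "PL p t \<in> fst c"
    have "PL p t \<in> X0" using X0_F[OF FP pX] .
    then show "(2 * pi * of_int a21) *\<^sub>R ham_vec S a1 c (PL p t) + (2 * pi * of_int a22) *\<^sub>R ham_vec S a2 c (PL p t)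
       = (2 * pi) *\<^sub>R ham_vec S mu2 c (PL p t)"
      using mu2_affine[OF _ c] by (simp add: scaleR_add_right)
  qed
qed

lemma mu2_F_eq: "F p = F q \<Longrightarrow> mu2 p = mu2 q" by (simp add: mu2_F)

text \<open>The first variation applied to the orbits of \<mu>_2, with the starting point in a
  four-dimensional chart as the parameter. Parametrizing by the starting point avoids a section over
  \<open>D\<close>; the one inside \<open>I_poly\<close> is an arbitrary choice.\<close>

lemma action_poly_local:
  assumes \<theta>: "primitive_on S W \<theta>" and c: "c \<in> atlas S" and p: "p \<in> fst c" "p \<in> WC"
  shows "((\<lambda>x. line_integral S \<theta> (PL (chart_inv c x)) 0 1 - 2 * pi * mu2 (chart_inv c x)) has_derivative (\<lambda>_. 0)) (at (snd c p))"
proof -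
  define x0 where "x0 = snd c p"
  have cx0: "chart_inv c x0 = p" using chart_inv_chart[OF c p(1)] by (simp add: x0_def)
  define u where "u = (\<lambda>c q. (2 * pi) *\<^sub>R ham_vec S mu2 c q)"
  have u: "C1_field WC u" unfolding u_def by (rule C1_field_scale[OF C1_field_ham_vec[OF smooth_mu2]])
  have oU: "open (snd c ` (fst c \<inter> WC))" by (rule open_chart_image_Int[OF c open_WC])
  have ev: "\<forall>\<^sub>F x in at x0. x \<in> snd c ` (fst c \<inter> WC)"
    using oU p by (intro eventually_at_in_open') (auto simp: x0_def)
  have inW: "chart_inv c x \<in> fst c" "chart_inv c x \<in> WC" "snd c (chart_inv c x) = x" if "x \<in> snd c ` (fst c \<inter> WC)" for x
    using that chart_inv_in[OF c that] chart_chart_inv[OF c, of x] by auto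
  have Cu: "C1_curve WC (PL q) (\<lambda>t c. u c (PL q t))" if "q \<in> WC" for q
    using C1_curve_icurve[OF u] PL_props[OF that] unfolding u_def by blast
  have ic: "icurve {0..1} (\<lambda>_. u) (PL q)" if "q \<in> WC" for q
    using PL_props(1)[OF that] icurve_subset[OF _ subset_UNIV] unfolding u_def by blast
  have levels: "mu2 (PL q t) = mu2 q" if "q \<in> WC" for q t by (rule mu2_F_eq[OF PL_props(5)[OF that]])
  \<comment> \<open>The velocity is 2 pi times the field of \<mu>_2 alone; the second function is a
    copy of the first with coefficient 0.\<close>
  interpret curve_family S WC \<theta> mu2 mu2 "PL p" "\<lambda>t c. u c (PL p t)" "\<lambda>x. PL (chart_inv c x)" "\<lambda>x t c'. u c' (PL (chart_inv c x) t)" x0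
    "\<lambda>_. 2 * pi" "\<lambda>_. 0" "\<lambda>x. mu2 (chart_inv c x)" "\<lambda>x. mu2 (chart_inv c x)"
  proof unfold_locales
    show "open WC" by (rule open_WC)
    show "primitive_on S WC \<theta>" by (rule primitive_on_subset[OF \<theta>]) (use WC_iff in blast)
    show "smooth_map WC mu2" by (rule smooth_mu2)
    show "C1_curve WC (PL p) (\<lambda>t c. u c (PL p t))" by (rule Cu[OF p(2)])
    show "\<forall>\<^sub>F q in at x0. C1_curve WC (PL (chart_inv c q)) (\<lambda>t c'. u c' (PL (chart_inv c q) t))"
      using ev by eventually_elim (rule Cu[OF inW(2)])
    show "PL p 1 = PL p 0" using PL_props(3,4)[OF p(2)] by simp
    show "\<forall>\<^sub>F q in at x0. PL (chart_inv c q) 1 = PL (chart_inv c q) 0"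
      using ev by eventually_elim (simp add: PL_props(3,4)[OF inW(2)])
    show "\<And>t c'. t \<in> {0..1} \<Longrightarrow> c' \<in> atlas S \<Longrightarrow> PL p t \<in> fst c' \<Longrightarrow>
        u c' (PL p t) = (2 * pi) *\<^sub>R ham_vec S mu2 c' (PL p t) + 0 *\<^sub>R ham_vec S mu2 c' (PL p t)" by (simp add: u_def)
    show "\<And>t. t \<in> {0..1} \<Longrightarrow> mu2 (PL p t) = mu2 (chart_inv c x0) \<and> mu2 (PL p t) = mu2 (chart_inv c x0)"
      using levels[OF p(2)] by (simp add: cx0)
    show "\<forall>\<^sub>F q in at x0. \<forall>t\<in>{0..1}. mu2 (PL (chart_inv c q) t) = mu2 (chart_inv c q) \<and> mu2 (PL (chart_inv c q) t) = mu2 (chart_inv c q)"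
      using ev by eventually_elim (simp add: levels[OF inW(2)])
    fix t0 :: real assume t0: "t0 \<in> {0..1}"
    show "\<exists>c'\<in>atlas S. PL p t0 \<in> fst c' \<and> (\<exists>d>0. \<exists>K\<ge>0. \<forall>\<^sub>F q in at x0. \<forall>t\<in>{0..1}. \<bar>t - t0\<bar> < d \<longrightarrow>
       PL (chart_inv c q) t \<in> fst c' \<and> norm (snd c' (PL (chart_inv c q) t) - snd c' (PL p t)) \<le> K * norm (q - x0) \<and>
       norm (u c' (PL (chart_inv c q) t) - u c' (PL p t)) \<le> K * norm (q - x0))"
    proof (rule flow_family_lip[OF u ic[OF p(2)] _ _ c _ _ t0])
      show "PL p ` {0..1} \<subseteq> WC" using PL_props(2)[OF p(2)] by blast
      show "\<forall>\<^sub>F q in at x0. icurve {0..1} (\<lambda>_. u) (PL (chart_inv c q))" using ev by eventually_elim (rule ic[OF inW(2)])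
      show "PL p 0 \<in> fst c" using PL_props(3)[OF p(2)] p by simp
      have "\<forall>\<^sub>F q in at x0. PL (chart_inv c q) 0 \<in> fst c \<and> norm (snd c (PL (chart_inv c q) 0) - snd c (PL p 0)) \<le> 1 * norm (q - x0)"
        using ev by eventually_elim (simp add: PL_props(3)[OF inW(2)] PL_props(3)[OF p(2)] inW x0_def)
      then show "lip_at x0 (PL p 0) (\<lambda>q. PL (chart_inv c q) 0) c" unfolding lip_at_def by blast
    qed
  qed (intro continuous_intros)+
  define h where "h = (\<lambda>x. line_integral S \<theta> (PL (chart_inv c x)) 0 1 - 2 * pi * mu2 (chart_inv c x))"
  have "(h has_derivative (\<lambda>_. 0)) (at x0)"
    unfolding has_derivative_at_alt
  proof (intro conjI allI impI)
    fix e :: real assume e: "e > 0"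
    have "\<forall>\<^sub>F x in at x0. norm (h x - h x0 - 0) \<le> e * norm (x - x0)"
      using first_variation[OF e] by eventually_elim (simp add: h_def cx0 algebra_simps)
    then obtain d where d: "d > 0" "\<And>x. x \<noteq> x0 \<Longrightarrow> dist x x0 < d \<Longrightarrow> norm (h x - h x0 - 0) \<le> e * norm (x - x0)"
      unfolding eventually_at by auto
    have "norm (h x - h x0 - 0) \<le> e * norm (x - x0)" if "norm (x - x0) < d" for x
      using d(2)[of x] that by (cases "x = x0") (simp_all add: dist_norm)
    then show "\<exists>d>0. \<forall>y. norm (y - x0) < d \<longrightarrow> norm (h y - h x0 - 0) \<le> e * norm (y - x0)" using d(1) by blast
  qed simp
  then show ?thesis by (simp add: h_def x0_def)
qed

text \<open>By \<open>action_poly_local\<close> the derivative vanishes on a ball in a chart, so the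
  function is locally constant; \<open>connected_WC\<close> makes it constant.\<close>

lemma action_poly_constant:
  assumes \<theta>: "primitive_on S W \<theta>" and p: "p \<in> WC" "q \<in> WC"
  shows "line_integral S \<theta> (PL p) 0 1 - 2 * pi * mu2 p = line_integral S \<theta> (PL q) 0 1 - 2 * pi * mu2 q"
proof (rule connected_local_const[OF connected_WC p])
  show "\<forall>p\<in>WC. \<forall>\<^sub>F q in at p within WC. line_integral S \<theta> (PL p) 0 1 - 2 * pi * mu2 p = line_integral S \<theta> (PL q) 0 1 - 2 * pi * mu2 q"
  proof
    fix p assume p: "p \<in> WC"
    obtain c where c: "c \<in> atlas S" "p \<in> fst c" using charts_cover by blast
    define h where "h = (\<lambda>x. line_integral S \<theta> (PL (chart_inv c x)) 0 1 - 2 * pi * mu2 (chart_inv c x))"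
    have "open (snd c ` (fst c \<inter> WC))" "snd c p \<in> snd c ` (fst c \<inter> WC)" using open_chart_image_Int[OF c(1) open_WC] c p by auto
    then obtain r where r: "r > 0" "ball (snd c p) r \<subseteq> snd c ` (fst c \<inter> WC)" using open_contains_ball by blast
    have "(h has_derivative (\<lambda>_. 0)) (at x within ball (snd c p) r)" if x: "x \<in> ball (snd c p) r" for x
    proof -
      obtain q where "q \<in> fst c" "q \<in> WC" "x = snd c q" using r(2) x by blast
      then show ?thesis unfolding h_def using action_poly_local[OF \<theta> c(1)] has_derivative_at_withinI by blast
    qed
    then obtain k where k: "\<And>x. x \<in> ball (snd c p) r \<Longrightarrow> h x = k"
      using has_derivative_zero_constant[OF convex_ball] by blast
    have "open {q \<in> fst c. snd c q \<in> ball (snd c p) r}" by (rule open_chart_vimage[OF c(1) open_ball])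
    then have "\<forall>\<^sub>F q in at p within WC. q \<in> {q \<in> fst c. snd c q \<in> ball (snd c p) r}"
      using c r by (auto simp: eventually_at_topological intro!: exI[of _ "{q \<in> fst c. snd c q \<in> ball (snd c p) r}"])
    then show "\<forall>\<^sub>F q in at p within WC. line_integral S \<theta> (PL p) 0 1 - 2 * pi * mu2 p = line_integral S \<theta> (PL q) 0 1 - 2 * pi * mu2 q"
    proof eventually_elim
      case (elim q)
      have "h (snd c p) = h (snd c q)" using k[of "snd c p"] k[of "snd c q"] elim r by simp
      then show ?case using elim c by (simp add: h_def chart_inv_chart)
    qed
  qed
qed

end

section \<open>Cycles on the fibers\<close>

lemma Tmap_inv: "inv_into UNIV Tmap x = (fst x, snd x - fst x)"
  by (rule inv_f_eq) (auto simp: Tmap_def inj_def prod_eq_iff)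

lemma Tpow_eq: "Tpow k x = (fst x, snd x + of_int k * fst x)"
proof -
  have 1: "(Tmap ^^ n) x = (fst x, snd x + real n * fst x)" for n x
    by (induction n) (auto simp: Tmap_def algebra_simps)
  have 2: "(inv_into UNIV Tmap ^^ n) x = (fst x, snd x - real n * fst x)" for n x
    by (induction n) (auto simp: Tmap_inv algebra_simps)
  show ?thesis by (cases "0 \<le> k") (auto simp: Tpow_def 1 2)
qed

locale twisting_setting = focus_setting S m \<Delta> \<epsilon> f E
  for S :: "('m::{t2_space,second_countable_topology}) int_sys" and m \<Delta> \<epsilon> f E +
  fixes \<tau>2 \<tau>1 \<xi> :: "complex \<Rightarrow> real" and \<kappa> :: int
  assumes tau1: "preferred_tau1 S m E \<epsilon> \<tau>2 \<tau>1" and xi: "preferred_action S E \<epsilon> \<tau>2 \<tau>1 \<xi>"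
    and twisting: "twisting_index S E f \<xi> \<kappa>"
begin

lemma tau2_pos: "z \<in> D \<Longrightarrow> \<tau>2 z > 0"
  using tau1 unfolding preferred_tau1_def first_return_def by blast

definition M :: "complex \<Rightarrow> real" where "M z = \<xi> z + of_int \<kappa> * Re z"

lemma mu2_M: "p \<in> W \<Longrightarrow> mu2 p = M (\<Phi> p)"
  using twisting unfolding twisting_index_def by (simp add: Tpow_eq mu2_poly_def nu_def M_def Re_Phi)

lemma M_has_derivative:
  "z \<in> D \<Longrightarrow> (M has_derivative (\<lambda>w. (\<tau>1 z / (2 * pi) + of_int \<kappa>) * Re w + \<tau>2 z / (2 * pi) * Im w)) (at z)"
proof -
  assume "z \<in> D"
  then have "(\<xi> has_derivative (\<lambda>w. \<tau>1 z / (2 * pi) * Re w + \<tau>2 z / (2 * pi) * Im w)) (at z)"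
    using xi unfolding preferred_action_def by blast
  then have "((\<lambda>z. \<xi> z + of_int \<kappa> * Re z) has_derivative
      (\<lambda>w. (\<tau>1 z / (2 * pi) * Re w + \<tau>2 z / (2 * pi) * Im w) + of_int \<kappa> * Re w)) (at z)"
    by (intro has_derivative_add has_derivative_mult_right bounded_linear_imp_has_derivative bounded_linear_Re)
  then show ?thesis unfolding M_def[abs_def] by (simp add: algebra_simps)
qed

lemma M_tendsto: "(M \<longlongrightarrow> 0) (at 0 within D)"
proof -
  have "(\<xi> \<longlongrightarrow> 0) (at 0 within \<Phi> ` W)" using xi unfolding preferred_action_def by blast
  then have "(\<xi> \<longlongrightarrow> 0) (at 0 within D)" by (rule tendsto_within_subset) (auto simp: D_eq)
  moreover have "((\<lambda>z. of_int \<kappa> * Re z) \<longlongrightarrow> of_int \<kappa> * Re 0) (at 0 within D)" by (intro tendsto_intros)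
  ultimately have "((\<lambda>z. \<xi> z + of_int \<kappa> * Re z) \<longlongrightarrow> 0 + of_int \<kappa> * Re 0) (at 0 within D)" by (rule tendsto_add)
  then show ?thesis unfolding M_def[abs_def] by simp
qed

text \<open>The chain rule for \<mu>_2 = M \<circ> \<Phi>, the partial derivatives of
  \<open>M\<close> being \<tau>_1 / (2 pi) + \<kappa> and \<tau>_2 / (2 pi). It ties the periodic
  field to the two fields that generate the preferred loop.\<close>

lemma ham_mu2:
  assumes p: "p \<in> WC" and c: "c \<in> atlas S" "p \<in> fst c"
  shows "ham_vec S mu2 c p = (\<tau>1 (\<Phi> p) / (2 * pi) + of_int \<kappa>) *\<^sub>R XL c p + (\<tau>2 (\<Phi> p) / (2 * pi)) *\<^sub>R ham_vec S (Phi2 S E) c p"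
proof (rule ham_vec_unique[OF c])
  fix v
  define x y where "x = \<tau>1 (\<Phi> p) / (2 * pi) + of_int \<kappa>" and "y = \<tau>2 (\<Phi> p) / (2 * pi)"
  have pW: "p \<in> W" "\<Phi> p \<in> D" using p WC_iff WC_D by blast+
  define P where "P = (\<lambda>x. complex_of_real (in_chart c (Lmap S) x) + \<i> * complex_of_real (in_chart c (Phi2 S E) x))"
  have P: "P (snd c q) = \<Phi> q" if "q \<in> fst c" for q
    using c that by (simp add: P_def in_chart_chart Phi_def complex_eq_iff)
  have "(P has_derivative (\<lambda>v. complex_of_real (dL c p v) + \<i> * complex_of_real (chart_deriv c (Phi2 S E) p v))) (at (snd c p))"
    unfolding P_def using smooth_map_has_derivative[OF smooth_L c UNIV_I] smooth_map_has_derivative[OF smooth_Phi2 c pW(1)]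
    by (intro has_derivative_add has_derivative_mult_right bounded_linear.has_derivative[OF bounded_linear_of_real])
  moreover have "(M has_derivative (\<lambda>w. x * Re w + y * Im w)) (at (P (snd c p)))"
    using M_has_derivative[OF pW(2)] P[OF c(2)] by (simp add: x_def y_def)
  ultimately have "((M \<circ> P) has_derivative ((\<lambda>w. x * Re w + y * Im w) \<circ> (\<lambda>v. complex_of_real (dL c p v) + \<i> * complex_of_real (chart_deriv c (Phi2 S E) p v)))) (at (snd c p))"
    by (rule diff_chain_at)
  then have "((M \<circ> P) has_derivative (\<lambda>v. x * dL c p v + y * chart_deriv c (Phi2 S E) p v)) (at (snd c p))"
    by (simp add: o_def)
  then have "(in_chart c mu2 has_derivative (\<lambda>v. x * dL c p v + y * chart_deriv c (Phi2 S E) p v)) (at (snd c p))"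
  proof (rule has_derivative_transform_within_open[OF _ open_chart_image_Int[OF c(1) open_WC]])
    fix x assume "x \<in> snd c ` (fst c \<inter> WC)"
    then obtain q where "q \<in> fst c" "q \<in> WC" "x = snd c q" by blast
    then show "(M \<circ> P) x = in_chart c mu2 x" using mu2_M[of q] WC_iff[of q] c by (simp add: P in_chart_chart)
  qed (use p c in blast)
  from chart_deriv_eq[OF c this]
  show "sform S c p ((\<tau>1 (\<Phi> p) / (2 * pi) + of_int \<kappa>) *\<^sub>R XL c p + (\<tau>2 (\<Phi> p) / (2 * pi)) *\<^sub>R ham_vec S (Phi2 S E) c p) v = - chart_deriv c mu2 p v"
    unfolding linear_add[OF sform_linear_left[OF c]] linear_scale[OF sform_linear_left[OF c]]
    by (simp add: sform_XL[OF c] sform_ham_vec[OF c smooth_map_linear[OF smooth_Phi2 c pW(1)]] x_def y_def)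
qed

end

locale twisting_chart = affine_chart S m \<Delta> \<epsilon> f E A a a11 a12 a21 a22 c1 c2 + twisting_setting S m \<Delta> \<epsilon> f E \<tau>2 \<tau>1 \<xi> \<kappa>
  for S :: "('m::{t2_space,second_countable_topology}) int_sys" and m \<Delta> \<epsilon> f E A a a11 a12 a21 a22 c1 c2 \<tau>2 \<tau>1 \<xi> \<kappa> +
  fixes p :: 'm and z :: complex
  assumes p_X0: "p \<in> F -` A" and z_D: "z \<in> D" and p_fiber: "p \<in> fiber S E z"
begin

text \<open>\<open>vL\<close> and \<open>vM\<close> are the endpoints in the plane of the lifts of
  the 2 pi-periodic orbits of \<open>L\<close> and \<mu>_2; by unimodularity they form a basis of
  the lattice of stabilizers.\<close>

definition "vL = (2 * pi * of_int a11, 2 * pi * of_int a12 :: real)"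
definition "vM = (2 * pi * of_int a21, 2 * pi * of_int a22 :: real)"

lemma p_WC: "p \<in> WC" and Phi_p: "\<Phi> p = z"
  using fiber_WC[OF z_D p_fiber] by blast+

lemma p_W: "p \<in> W" using p_WC WC_iff by blast

lemma act_fiber: "act l p \<in> fiber S E z"
  using act_F[OF p_X0, of l] F_saturated(1)[of "act l p" p] Phi_F[of "act l p" p] p_W Phi_p by (simp add: fiber_def)

lemma act_vL: "act vL p = p" and act_vM: "act vM p = p"
  unfolding vL_def vM_def by (rule act_lattice[OF p_X0])+

abbreviation "cls \<equiv> line_class p (fiber S E z)"
abbreviation "HG \<equiv> homology_group 1 (top_of_set (fiber S E z))"

lemma gamma_L_cls: "gamma_L S E z p = cls vL"
proof -
  have "L_loop S p = (\<lambda>t. act (t *\<^sub>R vL) p)"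
  proof
    show "L_loop S p t = act (t *\<^sub>R vL) p" for t
      using flow_L[OF p_X0, of "2 * pi * t"] by (simp add: L_loop_def vL_def algebra_simps)
  qed
  then show ?thesis unfolding gamma_L_def line_class_def[OF p_X0 act_fiber] by simp
qed

lemma gamma_poly_cls: "gamma_poly S E \<epsilon> f z p = cls vM"
proof -
  have "PL p = (\<lambda>t. act (t *\<^sub>R vM) p)"
  proof
    show "PL p t = act (t *\<^sub>R vM) p" for t
      using flow_mu2[OF p_X0 p_WC, of "2 * pi * t"] by (simp add: poly_loop_def vM_def algebra_simps)
  qed
  then show ?thesis unfolding gamma_poly_def line_class_def[OF p_X0 act_fiber] by simp
qed

lemma gamma_pref_cls: "gamma_pref S E \<tau>2 \<tau>1 z p = cls (vM - of_int \<kappa> *\<^sub>R vL)"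
proof -
  \<comment> \<open>The direction in the plane of the field of \<Phi>_2, found by solving
    \<open>ham_mu2\<close> for it; \<open>vL\<close> and \<open>vM\<close> already contain the
    factor 2 pi.\<close>
  define r where "r = (1 / \<tau>2 z) *\<^sub>R (vM - (\<tau>1 z / (2 * pi) + of_int \<kappa>) *\<^sub>R vL)"
  have t2: "\<tau>2 z > 0" by (rule tau2_pos[OF z_D])
  have flow: "ham_flow S W (Phi2 S E) t p = act (t *\<^sub>R (fst r, snd r)) p" for t
  proof (rule ham_flow_act[OF smooth_Phi2 p_X0])
    show "F -` {F p} \<subseteq> W" using F_saturated(1)[of _ p] p_W by blast
    fix q c assume q: "F q = F p" and c: "c \<in> atlas S" "q \<in> fst c"
    have qW: "q \<in> WC" "\<Phi> q = z" "q \<in> X0" using F_saturated(2)[OF q] Phi_F[OF q] p_WC Phi_p X0_F[OF q p_X0] by auto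
    have "ham_vec S mu2 c q = (\<tau>1 z / (2 * pi) + of_int \<kappa>) *\<^sub>R XL c q + (\<tau>2 z / (2 * pi)) *\<^sub>R ham_vec S (Phi2 S E) c q"
      using ham_mu2[OF qW(1) c] qW(2) by simp
    then have "(2 * pi / \<tau>2 z) *\<^sub>R (ham_vec S mu2 c q - (\<tau>1 z / (2 * pi) + of_int \<kappa>) *\<^sub>R XL c q)
        = (2 * pi / \<tau>2 z * (\<tau>2 z / (2 * pi))) *\<^sub>R ham_vec S (Phi2 S E) c q" by simp
    also have "2 * pi / \<tau>2 z * (\<tau>2 z / (2 * pi)) = 1" using t2 by simp
    finally have "ham_vec S (Phi2 S E) c q = (2 * pi / \<tau>2 z) *\<^sub>R (ham_vec S mu2 c q - (\<tau>1 z / (2 * pi) + of_int \<kappa>) *\<^sub>R XL c q)" by simp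
    also have "\<dots> = fst r *\<^sub>R ham_vec S a1 c q + snd r *\<^sub>R ham_vec S a2 c q"
      unfolding XL_affine[OF qW(3) c] mu2_affine[OF qW(3) c]
      by (simp add: r_def vL_def vM_def algebra_simps)
    finally show "ham_vec S (Phi2 S E) c q = fst r *\<^sub>R ham_vec S a1 c q + snd r *\<^sub>R ham_vec S a2 c q" .
  qed
  have rr: "\<tau>2 z *\<^sub>R r = vM - (\<tau>1 z / (2 * pi) + of_int \<kappa>) *\<^sub>R vL" using t2 by (simp add: r_def)
  \<comment> \<open>Lift of the concatenated loop: the line of \<Phi>_2 up to time \<tau>_2 on the
    first half, the line of \<open>L\<close> up to time \<tau>_1 on the second. The real number
    \<tau>_1, not its class modulo 2 pi, decides the endpoint.\<close>
  define \<eta> where "\<eta> = (\<lambda>t. if t \<le> 1 / 2 then (2 * t * \<tau>2 z) *\<^sub>R r else \<tau>2 z *\<^sub>R r + ((2 * t - 1) * \<tau>1 z / (2 * pi)) *\<^sub>R vL)"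
  have \<eta>1: "\<eta> 1 = vM - of_int \<kappa> *\<^sub>R vL" by (simp add: \<eta>_def rr scaleR_add_left)
  have cont: "continuous_on {0..1} \<eta>"
  proof -
    have mid: "(2 * t * \<tau>2 z) *\<^sub>R r = \<tau>2 z *\<^sub>R r + ((2 * t - 1) * \<tau>1 z / (2 * pi)) *\<^sub>R vL" if "t * 2 = 1" for t
    proof -
      have t: "t = 1 / 2" using that by simp
      show ?thesis unfolding t by simp
    qed
    have "continuous_on ({0..1/2} \<union> {1/2..1}) \<eta>"
      unfolding \<eta>_def
    proof (rule continuous_on_If)
      show "continuous_on {0..1/2} (\<lambda>t. (2 * t * \<tau>2 z) *\<^sub>R r)"
        "continuous_on {1/2..1} (\<lambda>t. \<tau>2 z *\<^sub>R r + ((2 * t - 1) * \<tau>1 z / (2 * pi)) *\<^sub>R vL)" by (intro continuous_intros; simp)+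
    qed (use mid in auto)
    moreover have "{0..1/2} \<union> {1/2..1} = {0..1::real}" by auto
    ultimately show ?thesis by simp
  qed
  have loop: "pref_loop S E (\<tau>2 z) (\<tau>1 z) p t = act (\<eta> t) p" for t
  proof (cases "t \<le> 1 / 2")
    case True
    then show ?thesis using flow[of "2 * t * \<tau>2 z"] by (simp add: pref_loop_def joinpaths_def \<eta>_def)
  next
    case False
    define q where "q = ham_flow S W (Phi2 S E) (\<tau>2 z) p"
    have q: "q = act (\<tau>2 z *\<^sub>R r) p" using flow[of "\<tau>2 z"] by (simp add: q_def)
    have qX: "q \<in> X0" unfolding q by (rule act_in[OF p_X0])
    have "pref_loop S E (\<tau>2 z) (\<tau>1 z) p t = ham_flow S UNIV (Lmap S) ((2 * t - 1) * \<tau>1 z) q"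
      using False by (simp add: pref_loop_def joinpaths_def q_def)
    also have "\<dots> = act (((2 * t - 1) * \<tau>1 z / (2 * pi)) *\<^sub>R vL) q"
      using flow_L[OF qX] by (simp add: vL_def mult.assoc)
    also have "\<dots> = act (\<eta> t) p"
      using False act_add[OF p_X0, of "((2 * t - 1) * \<tau>1 z / (2 * pi)) *\<^sub>R vL" "\<tau>2 z *\<^sub>R r"] by (simp add: q \<eta>_def add.commute)
    finally show ?thesis .
  qed
  have "gamma_pref S E \<tau>2 \<tau>1 z p = loop_class (fiber S E z) (\<lambda>t. act (\<eta> t) p)"
    unfolding gamma_pref_def using loop by (metis (no_types, lifting) loop_class_cong)
  also have "\<dots> = cls (\<eta> 1)" by (rule loop_class_act[OF p_X0 act_fiber cont]) (simp add: \<eta>_def zero_prod_def)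
  finally show ?thesis unfolding \<eta>1 .
qed

lemma cls_combination:
  "cls (of_int i *\<^sub>R vL + of_int j *\<^sub>R vM) = cls vL [^]\<^bsub>HG\<^esub> i \<otimes>\<^bsub>HG\<^esub> cls vM [^]\<^bsub>HG\<^esub> j"
  using line_class_add[OF p_X0 act_fiber line_class_pow(2)[OF p_X0 act_fiber act_vL]]
    line_class_pow(1)[OF p_X0 act_fiber act_vL] line_class_pow(1)[OF p_X0 act_fiber act_vM] by simp

lemma cls_in: "cls vL \<in> carrier HG" "cls vM \<in> carrier HG" "cls (vM - of_int \<kappa> *\<^sub>R vL) \<in> carrier HG"
proof -
  show "cls vL \<in> carrier HG" "cls vM \<in> carrier HG" using line_class_in[OF p_X0 act_fiber] act_vL act_vM by blast+
  have "act (of_int (- \<kappa>) *\<^sub>R vL + vM) p = act (of_int (- \<kappa>) *\<^sub>R vL) (act vM p)" by (rule act_add[OF p_X0])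
  also have "\<dots> = p" unfolding act_vM by (rule line_class_pow(2)[OF p_X0 act_fiber act_vL])
  finally have "act (vM - of_int \<kappa> *\<^sub>R vL) p = p" by simp
  then show "cls (vM - of_int \<kappa> *\<^sub>R vL) \<in> carrier HG" by (rule line_class_in[OF p_X0 act_fiber])
qed

lemma cycle_difference:
  "gamma_L S E z p [^]\<^bsub>H1 S E z\<^esub> \<kappa>
     = gamma_poly S E \<epsilon> f z p \<otimes>\<^bsub>H1 S E z\<^esub> inv\<^bsub>H1 S E z\<^esub> gamma_pref S E \<tau>2 \<tau>1 z p"
proof -
  interpret H: group HG by simp
  have "cls vM = cls (of_int \<kappa> *\<^sub>R vL + (vM - of_int \<kappa> *\<^sub>R vL))" by simp
  also have "\<dots> = cls vL [^]\<^bsub>HG\<^esub> \<kappa> \<otimes>\<^bsub>HG\<^esub> cls (vM - of_int \<kappa> *\<^sub>R vL)"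
    unfolding line_class_add[OF p_X0 act_fiber line_class_pow(2)[OF p_X0 act_fiber act_vL]] line_class_pow(1)[OF p_X0 act_fiber act_vL] ..
  finally show ?thesis
    unfolding gamma_L_cls gamma_poly_cls gamma_pref_cls H1_def
    using cls_in by (simp add: H.m_assoc H.int_pow_closed)
qed

end

section \<open>Velocities of curves in a fiber in terms of the action fields\<close>

lemma gram_coefficients:
  fixes u v :: "'a::real_inner"
  assumes ind: "\<And>x y. x *\<^sub>R u + y *\<^sub>R v = 0 \<Longrightarrow> x = 0 \<and> y = 0"
  shows "(u \<bullet> u) * (v \<bullet> v) - (u \<bullet> v)\<^sup>2 \<noteq> 0"
    and "w = \<alpha> *\<^sub>R u + \<beta> *\<^sub>R v \<Longrightarrow> \<alpha> = ((w \<bullet> u) * (v \<bullet> v) - (w \<bullet> v) * (u \<bullet> v)) / ((u \<bullet> u) * (v \<bullet> v) - (u \<bullet> v)\<^sup>2)"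
    and "w = \<alpha> *\<^sub>R u + \<beta> *\<^sub>R v \<Longrightarrow> \<beta> = ((w \<bullet> v) * (u \<bullet> u) - (w \<bullet> u) * (u \<bullet> v)) / ((u \<bullet> u) * (v \<bullet> v) - (u \<bullet> v)\<^sup>2)"
proof -
  show G: "(u \<bullet> u) * (v \<bullet> v) - (u \<bullet> v)\<^sup>2 \<noteq> 0"
  proof
    assume 0: "(u \<bullet> u) * (v \<bullet> v) - (u \<bullet> v)\<^sup>2 = 0"
    have "((v \<bullet> v) *\<^sub>R u - (u \<bullet> v) *\<^sub>R v) \<bullet> ((v \<bullet> v) *\<^sub>R u - (u \<bullet> v) *\<^sub>R v)
        = (v \<bullet> v) * ((u \<bullet> u) * (v \<bullet> v) - (u \<bullet> v)\<^sup>2)"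
      by (simp add: inner_diff_left inner_diff_right inner_commute algebra_simps power2_eq_square)
    then have "(v \<bullet> v) *\<^sub>R u + (- (u \<bullet> v)) *\<^sub>R v = 0" using 0 by simp
    from ind[OF this] have "v = 0" by simp
    then show False using ind[of 0 1] by simp
  qed
  show "\<alpha> = ((w \<bullet> u) * (v \<bullet> v) - (w \<bullet> v) * (u \<bullet> v)) / ((u \<bullet> u) * (v \<bullet> v) - (u \<bullet> v)\<^sup>2)" if w: "w = \<alpha> *\<^sub>R u + \<beta> *\<^sub>R v"
  proof -
    have "(w \<bullet> u) * (v \<bullet> v) - (w \<bullet> v) * (u \<bullet> v) = \<alpha> * ((u \<bullet> u) * (v \<bullet> v) - (u \<bullet> v)\<^sup>2)"
      unfolding w by (simp add: inner_add_left inner_commute algebra_simps power2_eq_square)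
    then show ?thesis using G by simp
  qed
  show "\<beta> = ((w \<bullet> v) * (u \<bullet> u) - (w \<bullet> u) * (u \<bullet> v)) / ((u \<bullet> u) * (v \<bullet> v) - (u \<bullet> v)\<^sup>2)" if w: "w = \<alpha> *\<^sub>R u + \<beta> *\<^sub>R v"
  proof -
    have "(w \<bullet> v) * (u \<bullet> u) - (w \<bullet> u) * (u \<bullet> v) = \<beta> * ((u \<bullet> u) * (v \<bullet> v) - (u \<bullet> v)\<^sup>2)"
      unfolding w by (simp add: inner_add_left inner_commute algebra_simps power2_eq_square)
    then show ?thesis using G by simp
  qed
qed

context affine_chart begin

text \<open>If the combination vanished at \<open>q\<close>, the constant curve would be an integral
  curve, so every multiple t (x, y) would fix \<open>q\<close>. The stabilizer lies in a lattice,
  which contains no line.\<close>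

lemma ham_a_independent:
  assumes q: "q \<in> X0" and c: "c \<in> atlas S" "q \<in> fst c" and z: "x *\<^sub>R ham_vec S a1 c q + y *\<^sub>R ham_vec S a2 c q = 0"
  shows "x = 0 \<and> y = 0"
proof -
  have all: "x *\<^sub>R ham_vec S a1 d q + y *\<^sub>R ham_vec S a2 d q = 0" if d: "d \<in> atlas S" "q \<in> fst d" for d
  proof -
    interpret T: bounded_linear "chart_deriv c (snd d) q"
      by (rule has_derivative_bounded_linear[OF transition_has_derivative[OF c(1) d(1) c(2) d(2)]])
    have "x *\<^sub>R ham_vec S a1 d q + y *\<^sub>R ham_vec S a2 d q = chart_deriv c (snd d) q (x *\<^sub>R ham_vec S a1 c q + y *\<^sub>R ham_vec S a2 c q)"
      unfolding T.add T.scaleR ham_vec_change_chart[OF smooth_a1 c(1) d(1) c(2) d(2) q] ham_vec_change_chart[OF smooth_a2 c(1) d(1) c(2) d(2) q] ..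
    then show ?thesis unfolding z T.zero .
  qed
  have "q = act (t *\<^sub>R (x, y)) q" for t
  proof (rule act_line_unique[OF q])
    show "icurve (closed_segment 0 t) (\<lambda>_ c p. x *\<^sub>R ham_vec S a1 c p + y *\<^sub>R ham_vec S a2 c p) (\<lambda>_. q)"
      unfolding icurve_def using all by (auto simp: o_def)
  qed simp
  then have per: "\<exists>i j::int. t * x = 2 * pi * of_int i \<and> t * y = 2 * pi * of_int j" for t
    using act_free[OF q, of "t *\<^sub>R (x, y)"] by (metis Pair_inject real_scaleR_def scaleR_Pair)
  have "w = 0" if h: "\<forall>t. \<exists>i::int. t * w = 2 * pi * of_int i" for w :: real
  proof (rule ccontr)
    assume "w \<noteq> 0"
    \<comment> \<open>At the time pi / w the product is pi, which is not an integer multiple of 2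
      pi.\<close>
    obtain i :: int where "(pi / w) * w = 2 * pi * of_int i" using h by blast
    then have "pi = 2 * pi * of_int i" using \<open>w \<noteq> 0\<close> by simp
    then have "of_int (2 * i) = (1::real)" by simp
    then have "2 * i = 1" by (simp only: of_int_eq_1_iff)
    then show False by presburger
  qed
  then show ?thesis using per by blast
qed

text \<open>The fields of \<open>a1\<close> and \<open>a2\<close> are combinations of X_L and X_H
  with a coefficient matrix of determinant \<delta>. Their independence forces \<delta> \<noteq> 0,
  so the relation can be inverted and \<open>kernel_dF\<close> applies.\<close>

lemma ham_a_span_kernel:
  assumes q: "q \<in> X0" "q \<in> WC" and c: "c \<in> atlas S" "q \<in> fst c" and v: "dL c q v = 0" "dH c q v = 0"
  shows "\<exists>x y. v = x *\<^sub>R ham_vec S a1 c q + y *\<^sub>R ham_vec S a2 c q"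
proof -
  obtain r1 s1 where 1: "ham_vec S a1 c q = r1 *\<^sub>R XL c q + s1 *\<^sub>R XH c q" using ham_a_span(1)[OF q(1) c] by blast
  obtain r2 s2 where 2: "ham_vec S a2 c q = r2 *\<^sub>R XL c q + s2 *\<^sub>R XH c q" using ham_a_span(2)[OF q(1) c] by blast
  define \<delta> where "\<delta> = r1 * s2 - r2 * s1"
  have e1: "s2 *\<^sub>R ham_vec S a1 c q + (- s1) *\<^sub>R ham_vec S a2 c q = \<delta> *\<^sub>R XL c q"
    and e2: "(- r2) *\<^sub>R ham_vec S a1 c q + r1 *\<^sub>R ham_vec S a2 c q = \<delta> *\<^sub>R XH c q"
    unfolding 1 2 \<delta>_def by (simp_all add: algebra_simps)
  have "\<delta> \<noteq> 0"
  proof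
    assume "\<delta> = 0"
    then have "s2 = 0 \<and> - s1 = 0" "- r2 = 0 \<and> r1 = 0"
      using ham_a_independent[OF q(1) c] e1 e2 by (metis scaleR_zero_left)+
    then show False using ham_a_independent[OF q(1) c, of 1 0] 1 by simp
  qed
  then have XL: "XL c q = (1 / \<delta>) *\<^sub>R (s2 *\<^sub>R ham_vec S a1 c q + (- s1) *\<^sub>R ham_vec S a2 c q)"
    and XH: "XH c q = (1 / \<delta>) *\<^sub>R ((- r2) *\<^sub>R ham_vec S a1 c q + r1 *\<^sub>R ham_vec S a2 c q)"
    unfolding e1 e2 by simp_all
  obtain a b where "v = a *\<^sub>R XL c q + b *\<^sub>R XH c q" using kernel_dF[OF q(2) c v] by blast
  then have "v = (a * s2 / \<delta> - b * r2 / \<delta>) *\<^sub>R ham_vec S a1 c q + (b * r1 / \<delta> - a * s1 / \<delta>) *\<^sub>R ham_vec S a2 c q"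
    unfolding XL XH by (simp add: algebra_simps)
  then show ?thesis by blast
qed

text \<open>The velocity is tangent to the fiber because \<open>F\<close> is constant along the
  curve, and the coefficients do not depend on the chart because both sides transform alike. Their
  continuity is needed since they are integrated to lift the curve.\<close>

lemma fiber_curve_velocity:
  assumes g: "C1_curve (X0 \<inter> WC) \<gamma> \<gamma>'" and F: "\<And>t. F (\<gamma> t) = k"
  obtains \<alpha> \<beta> where "continuous_on UNIV \<alpha>" "continuous_on UNIV \<beta>"
    "\<And>t c. c \<in> atlas S \<Longrightarrow> \<gamma> t \<in> fst c \<Longrightarrow> \<gamma>' t c = \<alpha> t *\<^sub>R ham_vec S a1 c (\<gamma> t) + \<beta> t *\<^sub>R ham_vec S a2 c (\<gamma> t)"
proof -
  have ic: "icurve UNIV (\<lambda>t c p. \<gamma>' t c) \<gamma>" and gX: "\<gamma> t \<in> X0" "\<gamma> t \<in> WC" for t using g by (auto simp: C1_curve_def)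
  have "\<exists>x y. \<forall>c\<in>atlas S. \<gamma> t \<in> fst c \<longrightarrow> \<gamma>' t c = x *\<^sub>R ham_vec S a1 c (\<gamma> t) + y *\<^sub>R ham_vec S a2 c (\<gamma> t)" for t
  proof -
    obtain c where c: "c \<in> atlas S" "\<gamma> t \<in> fst c" using charts_cover by blast
    have "((\<lambda>t. F (\<gamma> t)) has_vector_derivative chart_deriv c F (\<gamma> t) (\<gamma>' t c)) (at t)"
      using icurve_smooth_map[OF smooth_F ic UNIV_I UNIV_I c] by simp
    then have "chart_deriv c F (\<gamma> t) (\<gamma>' t c) = 0"
      unfolding F using has_vector_derivative_const vector_derivative_unique_at by blast
    then have "dL c (\<gamma> t) (\<gamma>' t c) = 0" "dH c (\<gamma> t) (\<gamma>' t c) = 0"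
      unfolding chart_deriv_eq[OF c F_has_derivative[OF c]] by (simp_all add: zero_prod_def)
    then obtain x y where xy: "\<gamma>' t c = x *\<^sub>R ham_vec S a1 c (\<gamma> t) + y *\<^sub>R ham_vec S a2 c (\<gamma> t)"
      using ham_a_span_kernel[OF gX c] by blast
    have "\<gamma>' t d = x *\<^sub>R ham_vec S a1 d (\<gamma> t) + y *\<^sub>R ham_vec S a2 d (\<gamma> t)" if d: "d \<in> atlas S" "\<gamma> t \<in> fst d" for d
    proof -
      interpret T: bounded_linear "chart_deriv c (snd d) (\<gamma> t)"
        by (rule has_derivative_bounded_linear[OF transition_has_derivative[OF c(1) d(1) c(2) d(2)]])
      have "((snd d \<circ> \<gamma>) has_vector_derivative chart_deriv c (snd d) (\<gamma> t) (\<gamma>' t c)) (at t)"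
        by (rule curve_change_chart[OF c(1) d(1) c(2) d(2) icurve_continuous[OF ic] UNIV_I C1_curve_has_vector_derivative[OF g c]])
      then have "\<gamma>' t d = chart_deriv c (snd d) (\<gamma> t) (\<gamma>' t c)"
        using C1_curve_has_vector_derivative[OF g d] vector_derivative_unique_at by blast
      then show ?thesis
        unfolding xy T.add T.scaleR ham_vec_change_chart[OF smooth_a1 c(1) d(1) c(2) d(2) gX(1)] ham_vec_change_chart[OF smooth_a2 c(1) d(1) c(2) d(2) gX(1)] .
    qed
    then show ?thesis by blast
  qed
  then obtain \<alpha> \<beta> where ab: "\<And>t c. c \<in> atlas S \<Longrightarrow> \<gamma> t \<in> fst c \<Longrightarrow> \<gamma>' t c = \<alpha> t *\<^sub>R ham_vec S a1 c (\<gamma> t) + \<beta> t *\<^sub>R ham_vec S a2 c (\<gamma> t)"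
    by metis
  have "isCont \<alpha> t0 \<and> isCont \<beta> t0" for t0
  proof -
    obtain c where c: "c \<in> atlas S" "\<gamma> t0 \<in> fst c" using charts_cover by blast
    define T where "T = {t. \<gamma> t \<in> fst c}"
    have T: "open T" "t0 \<in> T" using C1_curve_open[OF g c(1)] c by (simp_all add: T_def)
    have ham: "continuous_on T (\<lambda>t. ham_vec S h c (\<gamma> t))" if h: "smooth_map X0 h" for h
    proof -
      have "continuous_on (snd c ` (fst c \<inter> X0)) (in_chart c (ham_vec S h c))"
        using ham_vec_Ck_on[OF h c(1), of 0] by simp
      moreover have "continuous_on T (\<lambda>t. snd c (\<gamma> t))"
        by (rule continuous_on_compose2[OF continuous_on_chart[OF c(1)] continuous_on_subset[OF icurve_continuous[OF ic]]]) (auto simp: T_def)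
      ultimately have "continuous_on T (\<lambda>t. in_chart c (ham_vec S h c) (snd c (\<gamma> t)))"
        by (rule continuous_on_compose2) (use gX in \<open>auto simp: T_def\<close>)
      then show ?thesis by (rule continuous_on_eq) (simp add: T_def in_chart_chart c)
    qed
    define u where "u = (\<lambda>t. ham_vec S a1 c (\<gamma> t))"
    define v where "v = (\<lambda>t. ham_vec S a2 c (\<gamma> t))"
    define w where "w = (\<lambda>t. \<gamma>' t c)"
    have uv: "continuous_on T u" "continuous_on T v" "continuous_on T w"
      using ham[OF smooth_a1] ham[OF smooth_a2] g c by (auto simp: u_def v_def w_def T_def C1_curve_def)
    have ind: "x = 0 \<and> y = 0" if "t \<in> T" "x *\<^sub>R u t + y *\<^sub>R v t = 0" for t x y
      using ham_a_independent[OF gX(1) c(1)] that by (simp add: T_def u_def v_def)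
    have wt: "w t = \<alpha> t *\<^sub>R u t + \<beta> t *\<^sub>R v t" if "t \<in> T" for t
      using ab[OF c(1)] that by (simp add: T_def u_def v_def w_def)
    \<comment> \<open>The Gram determinant: solving for the coefficients by inner products exhibits
      them as quotients of continuous functions.\<close>
    define G where "G = (\<lambda>t. (u t \<bullet> u t) * (v t \<bullet> v t) - (u t \<bullet> v t)\<^sup>2)"
    have G: "G t \<noteq> 0" if "t \<in> T" for t unfolding G_def by (rule gram_coefficients(1)[OF ind[OF that]])
    have num: "continuous_on T (\<lambda>t. ((w t \<bullet> u t) * (v t \<bullet> v t) - (w t \<bullet> v t) * (u t \<bullet> v t)) / G t)"
      "continuous_on T (\<lambda>t. ((w t \<bullet> v t) * (u t \<bullet> u t) - (w t \<bullet> u t) * (u t \<bullet> v t)) / G t)"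
      unfolding G_def by (intro continuous_intros uv ballI; use G in \<open>simp add: G_def\<close>)+
    have "continuous_on T \<alpha>"
      by (rule continuous_on_eq[OF num(1)]) (unfold G_def, rule gram_coefficients(2)[OF ind wt, symmetric])
    moreover have "continuous_on T \<beta>"
      by (rule continuous_on_eq[OF num(2)]) (unfold G_def, rule gram_coefficients(3)[OF ind wt, symmetric])
    ultimately show ?thesis using continuous_on_eq_continuous_at[OF T(1)] T(2) by blast
  qed
  then have "continuous_on UNIV \<alpha>" "continuous_on UNIV \<beta>" by (simp_all add: continuous_at_imp_continuous_on)
  then show ?thesis using ab that by blast
qed

end

section \<open>Smooth families of cycles\<close>

locale cycle_family = twisting_setting S m \<Delta> \<epsilon> f E \<tau>2 \<tau>1 \<xi> \<kappa>
  for S :: "('m::{t2_space,second_countable_topology}) int_sys" and m \<Delta> \<epsilon> f E \<tau>2 \<tau>1 \<xi> \<kappa> +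
  fixes \<theta> :: "'m one_form" and c :: "complex \<Rightarrow> real \<Rightarrow> 'm"
  assumes primitive: "primitive_on S W \<theta>"
    and c_fiber: "\<And>z t. z \<in> D \<Longrightarrow> c z t \<in> fiber S E z"
    and c_period: "\<And>z t. z \<in> D \<Longrightarrow> c z (t + 1) = c z t"
    and c_continuous: "continuous_on (D \<times> UNIV) (\<lambda>(z, t). c z t)"
    and c_smooth: "\<And>d. d \<in> atlas S \<Longrightarrow> smooth_on (\<lambda>(z, t). snd d (c z t)) {(z, t). z \<in> D \<and> c z t \<in> fst d}"
begin

definition dom :: "'m chart \<Rightarrow> (complex \<times> real) set" where
  "dom d = {(z, t). z \<in> D \<and> c z t \<in> fst d}"

definition coord :: "'m chart \<Rightarrow> complex \<times> real \<Rightarrow> real^4" where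
  "coord d = (\<lambda>(z, t). snd d (c z t))"

definition vel :: "complex \<Rightarrow> real \<Rightarrow> 'm chart \<Rightarrow> real^4" where
  "vel z t d = frechet_derivative (coord d) (at (z, t)) (0, 1)"

lemma open_dom: assumes d: "d \<in> atlas S" shows "open (dom d)"
proof -
  have "open ((D \<times> UNIV) \<inter> (\<lambda>(z, t). c z t) -` fst d)"
    by (rule continuous_open_preimage[OF c_continuous open_Times[OF open_D open_UNIV] open_chart[OF d]])
  moreover have "(D \<times> UNIV) \<inter> (\<lambda>(z, t). c z t) -` fst d = dom d" by (auto simp: dom_def)
  ultimately show ?thesis by simp
qed

lemma coord_Ck_on: "d \<in> atlas S \<Longrightarrow> Ck_on n (coord d) (dom d)"
  using smooth_on_open_imp_Ck_on[OF c_smooth] open_dom unfolding coord_def dom_def by blast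

lemma coord_has_vector_derivative:
  assumes d: "d \<in> atlas S" and z: "z \<in> D" "c z t \<in> fst d"
  shows "((snd d \<circ> c z) has_vector_derivative vel z t d) (at t)"
proof -
  have x: "(z, t) \<in> dom d" using z by (simp add: dom_def)
  have D: "(coord d has_derivative frechet_derivative (coord d) (at (z, t))) (at (z, t))"
    by (rule Ck_on_has_derivative[OF coord_Ck_on[OF d, of "Suc 0"] x])
  have "((\<lambda>t. (z, t)) has_derivative (\<lambda>h. (0, h))) (at t)"
    by (intro has_derivative_Pair has_derivative_const has_derivative_ident)
  from diff_chain_at[OF this D]
  have "((\<lambda>t. snd d (c z t)) has_derivative (\<lambda>h. frechet_derivative (coord d) (at (z, t)) (0, h))) (at t)"
    by (simp add: o_def coord_def)
  moreover have "frechet_derivative (coord d) (at (z, t)) (0, h) = h *\<^sub>R vel z t d" for h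
    using linear_scale[OF has_derivative_linear[OF D], of h "(0, 1)"] by (simp add: vel_def)
  ultimately show ?thesis unfolding has_vector_derivative_def o_def by simp
qed

lemma loop_continuous: "z \<in> D \<Longrightarrow> continuous_on UNIV (c z)"
proof -
  assume z: "z \<in> D"
  have "continuous_on UNIV (\<lambda>t. (\<lambda>(z, t). c z t) (z, t))"
    by (rule continuous_on_compose2[OF c_continuous]) (use z in \<open>auto intro!: continuous_intros\<close>)
  then show ?thesis by simp
qed

lemma loop_C1_curve:
  assumes z: "z \<in> D" and X: "range (c z) \<subseteq> X"
  shows "C1_curve X (c z) (vel z)"
  unfolding C1_curve_def icurve_def
proof (intro conjI ballI impI)
  fix d assume d: "d \<in> atlas S"
  have "continuous_on (dom d) (\<lambda>x. frechet_derivative (coord d) (at x) (0, 1))"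
    using Ck_on_deriv[OF coord_Ck_on[OF d, of "Suc 0"]] by simp
  then show "continuous_on {t. c z t \<in> fst d} (\<lambda>t. vel z t d)"
    unfolding vel_def by (rule continuous_on_compose2) (use z in \<open>auto simp: dom_def intro!: continuous_intros\<close>)
qed (use loop_continuous[OF z] X coord_has_vector_derivative z in auto)

lemma loop_F: assumes z: "z \<in> D" shows "F (c z t) = F (c z 0)"
proof -
  have "c z 0 \<in> W" "\<Phi> (c z 0) = z" using fiber_WC[OF z c_fiber[OF z]] WC_iff by blast+
  then show ?thesis using c_fiber[OF z, of t] fiber_eq[of "c z 0"] by simp
qed

lemma loop_WC: "z \<in> D \<Longrightarrow> c z t \<in> WC" and loop_Phi: "z \<in> D \<Longrightarrow> \<Phi> (c z t) = z"
  using fiber_WC[OF _ c_fiber] by blast+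

lemma loop_closed: "z \<in> D \<Longrightarrow> c z 1 = c z 0" using c_period[of z 0] by simp

text \<open>Joint smoothness in (z, t) makes position and velocity Lipschitz on a compact ball of
  the parameter space; comparing two points with the same \<open>t\<close> leaves only the distance
  in \<open>z\<close>.\<close>

lemma family_lip:
  assumes z0: "z0 \<in> D"
  shows "\<exists>d\<in>atlas S. c z0 t0 \<in> fst d \<and> (\<exists>\<delta>>0. \<exists>K\<ge>0. \<forall>\<^sub>F z in at z0. \<forall>t\<in>{0..1}. \<bar>t - t0\<bar> < \<delta> \<longrightarrow>
       c z t \<in> fst d \<and> norm (snd d (c z t) - snd d (c z0 t)) \<le> K * norm (z - z0) \<and> norm (vel z t d - vel z0 t d) \<le> K * norm (z - z0))"
proof -
  obtain d where d: "d \<in> atlas S" "c z0 t0 \<in> fst d" using charts_cover by blast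
  have "(z0, t0) \<in> dom d" using z0 d by (simp add: dom_def)
  then obtain r where r: "r > 0" "cball (z0, t0) r \<subseteq> dom d" using open_contains_cball open_dom[OF d(1)] by blast
  obtain B1 where B1: "B1 \<ge> 0" "\<And>x y. x \<in> cball (z0, t0) r \<Longrightarrow> y \<in> cball (z0, t0) r \<Longrightarrow> norm (coord d x - coord d y) \<le> B1 * norm (x - y)"
    using C1_Lipschitz[OF coord_Ck_on[OF d(1)] compact_cball convex_cball r(2)] by metis
  have "Ck_on (Suc 0) (\<lambda>x. frechet_derivative (coord d) (at x) (0, 1)) (dom d)"
    by (rule Ck_on_deriv[OF coord_Ck_on[OF d(1)]])
  from C1_Lipschitz[OF this compact_cball convex_cball r(2)]
  obtain B2 where B2: "B2 \<ge> 0" "\<And>x y. x \<in> cball (z0, t0) r \<Longrightarrow> y \<in> cball (z0, t0) r \<Longrightarrow>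
      norm (frechet_derivative (coord d) (at x) (0, 1) - frechet_derivative (coord d) (at y) (0, 1)) \<le> B2 * norm (x - y)" by metis
  define K where "K = B1 + B2"
  have K: "K \<ge> 0" "B1 \<le> K" "B2 \<le> K" using B1(1) B2(1) by (simp_all add: K_def)
  have "\<forall>\<^sub>F z in at z0. dist z z0 < r / 2" using r(1) by (auto simp: eventually_at intro!: exI[of _ "r / 2"])
  then have "\<forall>\<^sub>F z in at z0. \<forall>t\<in>{0..1}. \<bar>t - t0\<bar> < r / 2 \<longrightarrow>
       c z t \<in> fst d \<and> norm (snd d (c z t) - snd d (c z0 t)) \<le> K * norm (z - z0) \<and> norm (vel z t d - vel z0 t d) \<le> K * norm (z - z0)"
  proof (eventually_elim, intro ballI impI)
    fix z t assume z: "dist z z0 < r / 2" and t: "\<bar>t - t0\<bar> < r / 2"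
    have "norm (z - z0, t - t0) \<le> norm (z - z0) + norm (t - t0)" by (rule norm_Pair_le)
    also have "\<dots> < r" using z t by (simp add: dist_norm)
    finally have 1: "(z, t) \<in> cball (z0, t0) r" by (subst mem_cball, subst dist_commute) (simp add: dist_norm)
    have 2: "(z0, t) \<in> cball (z0, t0) r" using t r(1) by (simp add: dist_Pair_Pair dist_real_def abs_minus_commute)
    have n: "norm ((z, t) - (z0, t)) = norm (z - z0)" by (simp add: norm_Pair)
    have "c z t \<in> fst d" using r(2) 1 by (auto simp: dom_def)
    moreover have "norm (snd d (c z t) - snd d (c z0 t)) \<le> K * norm (z - z0)"
      using order_trans[OF B1(2)[OF 1 2] mult_right_mono[OF K(2) norm_ge_zero]] unfolding n by (simp add: coord_def)
    moreover have "norm (vel z t d - vel z0 t d) \<le> K * norm (z - z0)"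
      using order_trans[OF B2(2)[OF 1 2] mult_right_mono[OF K(3) norm_ge_zero]] unfolding n by (simp add: vel_def)
    ultimately show "c z t \<in> fst d \<and> norm (snd d (c z t) - snd d (c z0 t)) \<le> K * norm (z - z0) \<and> norm (vel z t d - vel z0 t d) \<le> K * norm (z - z0)"
      by blast
  qed
  then show ?thesis using d r(1) K(1) by (intro bexI[of _ d] conjI exI[of _ "r / 2"] exI[of _ K]) auto
qed

text \<open>One lift yields both conclusions. Its endpoint is a lattice vector, which determines the
  homology class; the coordinates of the endpoint are the integrals of the velocity coefficients,
  which determine the derivative of the action. At this stage the integers may depend on
  \<open>z0\<close>.\<close>

lemma cycle_decomposition:
  assumes z0: "z0 \<in> D"
  obtains i j :: int where
    "loop_class (fiber S E z0) (c z0) = gamma_L S E z0 (c z0 0) [^]\<^bsub>H1 S E z0\<^esub> i \<otimes>\<^bsub>H1 S E z0\<^esub> gamma_poly S E \<epsilon> f z0 (c z0 0) [^]\<^bsub>H1 S E z0\<^esub> j"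
    "(action_of_loops S \<theta> c has_derivative
       (\<lambda>w. of_int i * Re w + of_int j * ((\<tau>1 z0 / (2 * pi) + of_int \<kappa>) * Re w + \<tau>2 z0 / (2 * pi) * Im w))) (at z0)"
proof -
  define p where "p = c z0 0"
  have p: "p \<in> WC" "p \<in> fiber S E z0" unfolding p_def by (rule loop_WC[OF z0] c_fiber[OF z0])+
  obtain A a a11 a12 a21 a22 c1 c2 where "affine_chart S m \<Delta> \<epsilon> f E A a a11 a12 a21 a22 c1 c2" and FA: "F p \<in> A"
    using affine_chart_exists[OF p(1)] by metis
  then interpret affine_chart S m \<Delta> \<epsilon> f E A a a11 a12 a21 a22 c1 c2 by blast
  interpret twisting_chart S m \<Delta> \<epsilon> f E A a a11 a12 a21 a22 c1 c2 \<tau>2 \<tau>1 \<xi> \<kappa> p z0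
    by unfold_locales (use FA z0 p in auto)
  have inX: "range (c z) \<subseteq> X0 \<inter> WC" if "z \<in> D" "c z 0 \<in> X0" for z
  proof
    fix q assume "q \<in> range (c z)"
    then obtain t where q: "q = c z t" by blast
    show "q \<in> X0 \<inter> WC" unfolding q using X0_F[OF loop_F[OF that(1)] that(2)] loop_WC[OF that(1)] by blast
  qed
  have X: "open (X0 \<inter> WC)" by (rule open_Int[OF open_X0 open_WC])
  have C: "C1_curve (X0 \<inter> WC) (c z) (vel z)" if "z \<in> D" "c z 0 \<in> X0" for z
    by (rule loop_C1_curve[OF that(1) inX[OF that]])
  have pX: "c z0 0 \<in> X0" using p_X0 by (simp add: p_def)
  from fiber_curve_velocity[OF C[OF z0 pX], of "F p"]
  obtain \<alpha> \<beta> where ab: "continuous_on UNIV \<alpha>" "continuous_on UNIV \<beta>"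
    and vel: "\<And>t d. d \<in> atlas S \<Longrightarrow> c z0 t \<in> fst d \<Longrightarrow> vel z0 t d = \<alpha> t *\<^sub>R ham_vec S a1 d (c z0 t) + \<beta> t *\<^sub>R ham_vec S a2 d (c z0 t)"
    using loop_F[OF z0] unfolding p_def by metis
  have ab01: "continuous_on {0..1} \<alpha>" "continuous_on {0..1} \<beta>" using ab continuous_on_subset by blast+
  define \<eta> where "\<eta> = (\<lambda>t. (integral {0..t} \<alpha>, integral {0..t} \<beta>))"
  have ic: "icurve {0..1} (\<lambda>t c p. \<alpha> t *\<^sub>R ham_vec S a1 c p + \<beta> t *\<^sub>R ham_vec S a2 c p) (c z0)"
  proof (rule icurve_cong)
    show "icurve {0..1} (\<lambda>t c p. vel z0 t c) (c z0)"
      using C[OF z0 pX] icurve_subset[OF _ subset_UNIV] unfolding C1_curve_def by blast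
  qed (rule vel)
  have lift: "c z0 t = act (\<eta> t) p" if "t \<in> {0..1}" for t
    unfolding \<eta>_def by (rule act_curve_lift[OF p_X0 ab01 ic _ that]) (simp add: p_def)
  have "act (\<eta> 1) p = p" using lift[of 1] loop_closed[OF z0] by (simp add: p_def)
  from act_free[OF p_X0 this] obtain i' j' :: int where ij': "\<eta> 1 = (2 * pi * of_int i', 2 * pi * of_int j')" by metis
  \<comment> \<open>The determinant is 1 or - 1 and thus its own inverse; Cramer's rule then gives
    integer coordinates of the endpoint in the basis \<open>vL\<close>, \<open>vM\<close>.\<close>
  define D0 where "D0 = a11 * a22 - a12 * a21"
  have D0: "D0 * D0 = 1" using unimodular unfolding D0_def[symmetric] by (metis abs_mult_self_eq mult_1)
  define i where "i = D0 * (i' * a22 - j' * a21)"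
  define j where "j = D0 * (j' * a11 - i' * a12)"
  have "i * a11 + j * a21 = (D0 * D0) * i'" "i * a12 + j * a22 = (D0 * D0) * j'"
    unfolding i_def j_def by (simp_all add: D0_def algebra_simps)
  then have ij: "i' = i * a11 + j * a21" "j' = i * a12 + j * a22" using D0 by simp_all
  have \<eta>1: "\<eta> 1 = of_int i *\<^sub>R vL + of_int j *\<^sub>R vM"
    unfolding ij' ij vL_def vM_def by (simp add: algebra_simps)
  have "loop_class (fiber S E z0) (c z0) = loop_class (fiber S E z0) (\<lambda>t. act (\<eta> t) p)" by (rule loop_class_cong) (rule lift)
  also have "\<dots> = cls (\<eta> 1)"
  proof (rule loop_class_act[OF p_X0 act_fiber])
    show "continuous_on {0..1} \<eta>"
      unfolding \<eta>_def by (intro continuous_on_Pair indefinite_integral_continuous_1 integrable_continuous_real ab01)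
  qed (simp add: \<eta>_def zero_prod_def)
  finally have cl: "loop_class (fiber S E z0) (c z0) = gamma_L S E z0 p [^]\<^bsub>H1 S E z0\<^esub> i \<otimes>\<^bsub>H1 S E z0\<^esub> gamma_poly S E \<epsilon> f z0 p [^]\<^bsub>H1 S E z0\<^esub> j"
    unfolding \<eta>1 cls_combination gamma_L_cls gamma_poly_cls H1_def .
  have ev: "\<forall>\<^sub>F z in at z0. z \<in> D \<and> c z 0 \<in> X0"
  proof -
    have "continuous_on D (\<lambda>z. (\<lambda>(z, t). c z t) (z, 0))"
      by (rule continuous_on_compose2[OF c_continuous]) (auto intro!: continuous_intros)
    then have "open (D \<inter> (\<lambda>z. c z 0) -` X0)" using continuous_open_preimage[OF _ open_D open_X0] by simp
    then have "\<forall>\<^sub>F z in at z0. z \<in> D \<inter> (\<lambda>z. c z 0) -` X0" by (rule eventually_at_in_open') (use z0 pX in simp)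
    then show ?thesis by eventually_elim simp
  qed
  have lev: "a1 (c z t) = a1 (c z 0)" "a2 (c z t) = a2 (c z 0)" if "z \<in> D" for z t
    by (simp_all only: a1_def a2_def loop_F[OF that, of t])
  have pr: "primitive_on S (X0 \<inter> WC) \<theta>" by (rule primitive_on_subset[OF primitive]) (use WC_iff in blast)
  have sm: "smooth_map (X0 \<inter> WC) a1" "smooth_map (X0 \<inter> WC) a2"
    by (rule smooth_map_subset[OF smooth_a1 X Int_lower1] smooth_map_subset[OF smooth_a2 X Int_lower1])+
  interpret curve_family S "X0 \<inter> WC" \<theta> a1 a2 "c z0" "vel z0" c vel z0 \<alpha> \<beta> "\<lambda>z. a1 (c z 0)" "\<lambda>z. a2 (c z 0)"
  proof unfold_locales
    show "\<forall>\<^sub>F z in at z0. C1_curve (X0 \<inter> WC) (c z) (vel z)" using ev by eventually_elim (rule C; simp)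
    show "\<forall>\<^sub>F z in at z0. c z 1 = c z 0" using ev by eventually_elim (rule loop_closed; simp)
    show "\<forall>\<^sub>F z in at z0. \<forall>t\<in>{0..1}. a1 (c z t) = a1 (c z 0) \<and> a2 (c z t) = a2 (c z 0)"
      using ev by eventually_elim (use lev in blast)
    show "\<And>t. t \<in> {0..1} \<Longrightarrow> a1 (c z0 t) = a1 (c z0 0) \<and> a2 (c z0 t) = a2 (c z0 0)" using lev[OF z0] by blast
    show "\<And>t d. t \<in> {0..1} \<Longrightarrow> d \<in> atlas S \<Longrightarrow> c z0 t \<in> fst d \<Longrightarrow> vel z0 t d = \<alpha> t *\<^sub>R ham_vec S a1 d (c z0 t) + \<beta> t *\<^sub>R ham_vec S a2 d (c z0 t)"
      by (rule vel)
    show "\<exists>d\<in>atlas S. c z0 t0 \<in> fst d \<and> (\<exists>\<delta>>0. \<exists>K\<ge>0. \<forall>\<^sub>F z in at z0. \<forall>t\<in>{0..1}. \<bar>t - t0\<bar> < \<delta> \<longrightarrow>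
       c z t \<in> fst d \<and> norm (snd d (c z t) - snd d (c z0 t)) \<le> K * norm (z - z0) \<and> norm (vel z t d - vel z0 t d) \<le> K * norm (z - z0))" for t0
      by (rule family_lip[OF z0])
  qed (fact X pr sm C[OF z0 pX] loop_closed[OF z0] ab01)+
  \<comment> \<open>The change of basis on the side of the functions: pairing the endpoint with (a1,
    a2) is the same as pairing (i, j) with (L, \<mu>_2), up to the constants \<open>c1\<close>,
    \<open>c2\<close> that drop out of differences.\<close>
  have coords: "of_int i' * a1 q + of_int j' * a2 q = of_int i * (Lmap S q - c1) + of_int j * (mu2 q - c2)" if "q \<in> X0" for q
  proof -
    have L: "Lmap S q - c1 = of_int a11 * a1 q + of_int a12 * a2 q" and m: "mu2 q - c2 = of_int a21 * a1 q + of_int a22 * a2 q"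
      using f_fst[of q] f_affine[of "F q"] that by (simp_all add: a1_def a2_def mu2_F)
    show ?thesis unfolding L m ij by (simp add: algebra_simps)
  qed
  define h where "h = (\<lambda>z. line_integral S \<theta> (c z) 0 1 - 2 * pi * (of_int i * Re z + of_int j * M z))"
  have int: "integral {0..1} \<alpha> = 2 * pi * of_int i'" "integral {0..1} \<beta> = 2 * pi * of_int j'" using ij' by (simp_all add: \<eta>_def)
  have lm: "Lmap S (c z 0) = Re z" "mu2 (c z 0) = M z" if "z \<in> D" for z
    using Re_Phi[of "c z 0"] mu2_M[of "c z 0"] loop_Phi[OF that, of 0] loop_WC[OF that, of 0] WC_iff by simp_all
  have eq: "integral {0..1} \<alpha> * (a1 (c z 0) - a1 (c z0 0)) + integral {0..1} \<beta> * (a2 (c z 0) - a2 (c z0 0))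
      = 2 * pi * (of_int i * Re z + of_int j * M z) - 2 * pi * (of_int i * Re z0 + of_int j * M z0)" if "z \<in> D" "c z 0 \<in> X0" for z
  proof -
    have "integral {0..1} \<alpha> * (a1 (c z 0) - a1 (c z0 0)) + integral {0..1} \<beta> * (a2 (c z 0) - a2 (c z0 0))
       = 2 * pi * (of_int i' * a1 (c z 0) + of_int j' * a2 (c z 0)) - 2 * pi * (of_int i' * a1 (c z0 0) + of_int j' * a2 (c z0 0))"
      unfolding int by (simp add: algebra_simps)
    also have "\<dots> = 2 * pi * (of_int i * Re z + of_int j * M z) - 2 * pi * (of_int i * Re z0 + of_int j * M z0)"
      unfolding coords[OF that(2)] coords[OF pX] lm[OF that(1)] lm[OF z0] by (simp add: algebra_simps)
    finally show ?thesis .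
  qed
  have h: "(h has_derivative (\<lambda>_. 0)) (at z0)"
    unfolding has_derivative_at_alt
  proof (intro conjI allI impI)
    fix e :: real assume e: "e > 0"
    have "\<forall>\<^sub>F z in at z0. norm (h z - h z0 - 0) \<le> e * norm (z - z0)"
      using first_variation[OF e] ev
    proof eventually_elim
      case (elim z)
      then show ?case using eq[of z] by (simp add: h_def algebra_simps)
    qed
    then obtain d where d: "d > 0" "\<And>x. x \<noteq> z0 \<Longrightarrow> dist x z0 < d \<Longrightarrow> norm (h x - h z0 - 0) \<le> e * norm (x - z0)"
      unfolding eventually_at by auto
    have "norm (h x - h z0 - 0) \<le> e * norm (x - z0)" if "norm (x - z0) < d" for x
      using d(2)[of x] that by (cases "x = z0") (simp_all add: dist_norm)
    then show "\<exists>d>0. \<forall>y. norm (y - z0) < d \<longrightarrow> norm (h y - h z0 - 0) \<le> e * norm (y - z0)" using d(1) by blast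
  qed simp
  define M' where "M' = (\<lambda>w. (\<tau>1 z0 / (2 * pi) + of_int \<kappa>) * Re w + \<tau>2 z0 / (2 * pi) * Im w)"
  have M': "(M has_derivative M') (at z0)" using M_has_derivative[OF z0] by (simp add: M'_def)
  have "((\<lambda>z. 1 / (2 * pi) * h z + (of_int i * Re z + of_int j * M z)) has_derivative
      (\<lambda>w. 1 / (2 * pi) * 0 + (of_int i * Re w + of_int j * M' w))) (at z0)"
    by (intro has_derivative_add has_derivative_mult_right h M' bounded_linear_imp_has_derivative bounded_linear_Re)
  moreover have "(\<lambda>z. 1 / (2 * pi) * h z + (of_int i * Re z + of_int j * M z)) = action_of_loops S \<theta> c"
    by (simp add: fun_eq_iff action_of_loops_def h_def field_simps)
  ultimately have "(action_of_loops S \<theta> c has_derivative (\<lambda>w. of_int i * Re w + of_int j * M' w)) (at z0)" by simp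
  then show ?thesis using that[of i j] cl by (simp add: p_def M'_def)
qed

end

lemma ex1_unique: "\<exists>!x. P x \<Longrightarrow> P a \<Longrightarrow> P b \<Longrightarrow> a = b" by blast

section \<open>Admissible families of cycles\<close>

locale admissible_family = cycle_family +
  assumes admissible: "admissible_cycle S E \<epsilon> \<theta> c"
begin

lemma basis:
  "z \<in> D \<Longrightarrow> x \<in> carrier (H1 S E z) \<Longrightarrow> \<exists>!(a::int, b::int).
        x = gamma_L S E z (c z 0) [^]\<^bsub>H1 S E z\<^esub> a \<otimes>\<^bsub>H1 S E z\<^esub> loop_class (fiber S E z) (c z) [^]\<^bsub>H1 S E z\<^esub> b"
  by (rule bspec[OF bspec[OF admissible[unfolded admissible_cycle_def, THEN conjunct2, THEN conjunct2, THEN conjunct2, THEN conjunct1]]])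

lemma basis_unique:
  fixes a b a' b' :: int
  assumes z: "z \<in> D" and x: "x \<in> carrier (H1 S E z)"
    and 1: "x = gamma_L S E z (c z 0) [^]\<^bsub>H1 S E z\<^esub> a \<otimes>\<^bsub>H1 S E z\<^esub> loop_class (fiber S E z) (c z) [^]\<^bsub>H1 S E z\<^esub> b"
    and 2: "x = gamma_L S E z (c z 0) [^]\<^bsub>H1 S E z\<^esub> a' \<otimes>\<^bsub>H1 S E z\<^esub> loop_class (fiber S E z) (c z) [^]\<^bsub>H1 S E z\<^esub> b'"
  shows "a = a' \<and> b = b'"
proof -
  have "(a, b) = (a', b')"
    by (rule ex1_unique[OF basis[OF z x]]) (simp_all only: prod.case 1[symmetric] 2[symmetric])
  then show ?thesis by simp
qed

lemma cycles_in:
  assumes z: "z \<in> D" and p: "p \<in> fiber S E z"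
  shows "gamma_L S E z p \<in> carrier (H1 S E z)" "gamma_poly S E \<epsilon> f z p \<in> carrier (H1 S E z)"
proof -
  have pW: "p \<in> WC" using fiber_WC[OF z p] by blast
  obtain A a a11 a12 a21 a22 c1 c2 where "affine_chart S m \<Delta> \<epsilon> f E A a a11 a12 a21 a22 c1 c2" and FA: "F p \<in> A"
    using affine_chart_exists[OF pW] by metis
  then interpret affine_chart S m \<Delta> \<epsilon> f E A a a11 a12 a21 a22 c1 c2 by blast
  interpret twisting_chart S m \<Delta> \<epsilon> f E A a a11 a12 a21 a22 c1 c2 \<tau>2 \<tau>1 \<xi> \<kappa> p z
    by unfold_locales (use FA z p in auto)
  show "gamma_L S E z p \<in> carrier (H1 S E z)" "gamma_poly S E \<epsilon> f z p \<in> carrier (H1 S E z)"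
    unfolding gamma_L_cls gamma_poly_cls H1_def by (rule cls_in)+
qed

lemma comm_group_H1: "comm_group (H1 S E z)"
  unfolding H1_def by (rule abelian_homology_group)

text \<open>Powers of \<open>gamma_L\<close> have second coordinate 0 in the basis, so uniqueness of
  coordinates separates them.\<close>

lemma gamma_L_infinite_order:
  assumes z: "z \<in> D" and eq: "gamma_L S E z (c z 0) [^]\<^bsub>H1 S E z\<^esub> (k::int) = gamma_L S E z (c z 0) [^]\<^bsub>H1 S E z\<^esub> l"
  shows "k = l"
proof -
  interpret H: comm_group "H1 S E z" by (rule comm_group_H1)
  have g: "gamma_L S E z (c z 0) \<in> carrier (H1 S E z)" by (rule cycles_in(1)[OF z c_fiber[OF z]])
  define gc where "gc = loop_class (fiber S E z) (c z)"
  have "gc [^]\<^bsub>H1 S E z\<^esub> (0::int) = \<one>\<^bsub>H1 S E z\<^esub>" by simp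
  then have *: "x = x \<otimes>\<^bsub>H1 S E z\<^esub> gc [^]\<^bsub>H1 S E z\<^esub> (0::int)" if "x \<in> carrier (H1 S E z)" for x
    using that by simp
  note gk = H.int_pow_closed[OF g, of k] and gl = H.int_pow_closed[OF g, of l]
  have "k = l \<and> 0 = (0::int)"
    by (rule basis_unique[OF z gk *[OF gk, unfolded gc_def] eq[THEN trans, OF *[OF gl, unfolded gc_def]]])
  then show ?thesis ..
qed

lemma admissible_action:
  assumes z: "z \<in> D"
  obtains i :: int where "(action_of_loops S \<theta> c has_derivative
     (\<lambda>w. of_int i * Re w + ((\<tau>1 z / (2 * pi) + of_int \<kappa>) * Re w + \<tau>2 z / (2 * pi) * Im w))) (at z)"
proof -
  interpret H: comm_group "H1 S E z" by (rule comm_group_H1)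
  note g = cycles_in[OF z c_fiber[OF z, of 0]]
  obtain i j :: int where
    ij: "loop_class (fiber S E z) (c z) = gamma_L S E z (c z 0) [^]\<^bsub>H1 S E z\<^esub> i \<otimes>\<^bsub>H1 S E z\<^esub> gamma_poly S E \<epsilon> f z (c z 0) [^]\<^bsub>H1 S E z\<^esub> j"
    and d: "(action_of_loops S \<theta> c has_derivative
       (\<lambda>w. of_int i * Re w + of_int j * ((\<tau>1 z / (2 * pi) + of_int \<kappa>) * Re w + \<tau>2 z / (2 * pi) * Im w))) (at z)"
    by (rule cycle_decomposition[OF z])
  define gL gP gc where "gL = gamma_L S E z (c z 0)" and "gP = gamma_poly S E \<epsilon> f z (c z 0)" and "gc = loop_class (fiber S E z) (c z)"
  have cc: "gL \<in> carrier (H1 S E z)" "gP \<in> carrier (H1 S E z)" "gc \<in> carrier (H1 S E z)"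
    using g unfolding gL_def gP_def gc_def ij by (simp_all add: H.int_pow_closed)
  obtain a b :: int where ab: "gP = gL [^]\<^bsub>H1 S E z\<^esub> a \<otimes>\<^bsub>H1 S E z\<^esub> gc [^]\<^bsub>H1 S E z\<^esub> b"
    using basis[OF z cc(2)] unfolding gL_def gc_def by auto
  \<comment> \<open>The expansion of the \<mu>_2 class in the admissible basis is substituted into
    the expansion of the cycle; comparing coordinates gives b j = 1, so \<open>j\<close> is a
    unit.\<close>
  have "gc = gL [^]\<^bsub>H1 S E z\<^esub> i \<otimes>\<^bsub>H1 S E z\<^esub> (gL [^]\<^bsub>H1 S E z\<^esub> a \<otimes>\<^bsub>H1 S E z\<^esub> gc [^]\<^bsub>H1 S E z\<^esub> b) [^]\<^bsub>H1 S E z\<^esub> j"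
    using ij unfolding ab[symmetric] by (simp add: gL_def gP_def gc_def)
  also have "\<dots> = gL [^]\<^bsub>H1 S E z\<^esub> (i + a * j) \<otimes>\<^bsub>H1 S E z\<^esub> gc [^]\<^bsub>H1 S E z\<^esub> (b * j)"
    using cc by (simp add: H.int_pow_distrib H.int_pow_closed H.int_pow_pow H.int_pow_mult H.m_assoc)
  finally have 1: "gc = gL [^]\<^bsub>H1 S E z\<^esub> (i + a * j) \<otimes>\<^bsub>H1 S E z\<^esub> gc [^]\<^bsub>H1 S E z\<^esub> (b * j)" .
  have 2: "gc = gL [^]\<^bsub>H1 S E z\<^esub> (0::int) \<otimes>\<^bsub>H1 S E z\<^esub> gc [^]\<^bsub>H1 S E z\<^esub> (1::int)"
    using cc by (simp add: H.int_pow_1)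
  have "b * j = 1" using basis_unique[OF z cc(3)[unfolded gc_def] 1[unfolded gL_def gc_def] 2[unfolded gL_def gc_def]] by simp
  \<comment> \<open>The orientation condition on admissible cycles excludes \<open>j = -1\<close>.\<close>
  then have j: "j = 1 \<or> j = - 1" by (metis mult.commute zmult_eq_1_iff)
  have "frechet_derivative (action_of_loops S \<theta> c) (at z) \<i> > 0"
    using bspec[OF admissible[unfolded admissible_cycle_def, THEN conjunct2, THEN conjunct2, THEN conjunct2, THEN conjunct2] z] ..
  then have "of_int j * (\<tau>2 z / (2 * pi)) > 0" unfolding frechet_derivative_at[OF d, symmetric] by simp
  then have "j = 1" using j divide_pos_pos[OF tau2_pos[OF z], of "2 * pi"] by auto
  then show ?thesis using d that[of i] by simp
qed

end

section \<open>Taylor series of the actions\<close>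

text \<open>Iterated directional derivatives, the last vector of the list being applied first. The
  list records the order of differentiation used in \<open>taylor2\<close>, with the j-derivatives
  innermost.\<close>

primrec partial :: "'a::real_normed_vector list \<Rightarrow> ('a \<Rightarrow> real) \<Rightarrow> 'a \<Rightarrow> real" where
  "partial [] g = g"
| "partial (v # vs) g = (\<lambda>z. frechet_derivative (partial vs g) (at z) v)"

lemma partial_append: "partial (us @ vs) g = partial us (partial vs g)"
  by (induction us) auto

lemma partial_replicate: "partial (replicate n v) g = ((\<lambda>h z. frechet_derivative h (at z) v) ^^ n) g"
  by (induction n) auto

lemma taylor2_partial: "taylor2 g a b = partial (replicate a 1 @ replicate b \<i>) g 0 / (fact a * fact b)"
  by (simp add: taylor2_def partial_append partial_replicate)

lemma Ck_on_partial: "(\<And>n. Ck_on n g N) \<Longrightarrow> Ck_on n (partial vs g) N"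
proof (induction vs arbitrary: n)
  case (Cons v vs)
  have "Ck_on (Suc n) (partial vs g) N" by (rule Cons.IH) (rule Cons.prems)
  then show ?case by simp
qed simp

lemma partial_add:
  assumes N: "open N" and g: "\<And>n. Ck_on n g1 N" "\<And>n. Ck_on n g2 N"
    and eq: "\<And>z. z \<in> N \<Longrightarrow> h z = g1 z + g2 z" and z: "z \<in> N"
  shows "partial vs h z = partial vs g1 z + partial vs g2 z"
  using z
proof (induction vs arbitrary: z)
  case (Cons v vs)
  have d: "(partial vs g has_derivative frechet_derivative (partial vs g) (at z)) (at z)" if "\<And>n. Ck_on n g N" for g
    using Ck_on_has_derivative[OF Ck_on_partial[of g N "Suc 0"] Cons.prems] that by blast
  have "((\<lambda>z. partial vs g1 z + partial vs g2 z) has_derivative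
      (\<lambda>w. frechet_derivative (partial vs g1) (at z) w + frechet_derivative (partial vs g2) (at z) w)) (at z)"
    by (intro has_derivative_add d g)
  then have "(partial vs h has_derivative
      (\<lambda>w. frechet_derivative (partial vs g1) (at z) w + frechet_derivative (partial vs g2) (at z) w)) (at z)"
    by (rule has_derivative_transform_within_open[OF _ N Cons.prems]) (simp add: Cons.IH)
  from fun_cong[OF frechet_derivative_at[OF this], of v] show ?case by simp
qed (use eq in simp)

text \<open>The relation between the three functions is known on \<open>U\<close> only, and 0 need
  not belong to \<open>U\<close>. It is inherited by the partial derivatives on the open set
  \<open>U\<close> and passes to the limit at 0 by their continuity on \<open>B\<close>.\<close>

lemma taylor2_add_at_limit_point:
  assumes B: "open B" "0 \<in> B" and g: "\<And>n. Ck_on n g1 B" "\<And>n. Ck_on n g2 B" "\<And>n. Ck_on n g3 B"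
    and U: "open U" "U \<subseteq> B" "0 islimpt U" and eq: "\<And>z. z \<in> U \<Longrightarrow> g1 z = g2 z + g3 z"
  shows "taylor2 g1 a b = taylor2 g2 a b + taylor2 g3 a b"
proof -
  let ?p = "partial (replicate a 1 @ replicate b \<i>)"
  have c: "(?p g \<longlongrightarrow> ?p g 0) (at 0 within U)" if "\<And>n. Ck_on n g B" for g
  proof -
    have "continuous_on B (?p g)" using Ck_on_partial[of g B 0, OF that] by simp
    then have "(?p g \<longlongrightarrow> ?p g 0) (at 0 within B)" using B(2) by (simp add: continuous_on_def)
    then show ?thesis by (rule tendsto_within_subset[OF _ U(2)])
  qed
  have "?p g1 z = ?p g2 z + ?p g3 z" if "z \<in> U" for z
    by (rule partial_add[OF U(1) Ck_on_subset[OF g(2) U(2)] Ck_on_subset[OF g(3) U(2)] eq that])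
  then have "\<forall>\<^sub>F z in at 0 within U. ?p g2 z + ?p g3 z = ?p g1 z" by (simp add: eventually_at_topological) blast
  from Lim_transform_eventually[OF tendsto_add[OF c[OF g(2)] c[OF g(3)]] this]
  have "?p g1 0 = ?p g2 0 + ?p g3 0"
    by (rule tendsto_unique[OF _ c[OF g(1)], rotated]) (use U(3) in \<open>simp add: trivial_limit_within\<close>)
  then show ?thesis by (simp add: taylor2_partial add_divide_distrib)
qed

lemma partial_zero: "partial vs (\<lambda>_. 0) = (\<lambda>_. 0)"
  by (induction vs) auto

lemma partial_const: "vs \<noteq> [] \<Longrightarrow> partial vs (\<lambda>_. k) = (\<lambda>_. 0)"
  by (cases vs rule: rev_cases) (simp_all add: partial_append partial_zero)

lemma partial_linear:
  assumes "bounded_linear g" shows "partial (vs @ [v]) g = (if vs = [] then (\<lambda>_. g v) else (\<lambda>_. 0))"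
  using frechet_derivative_at[OF bounded_linear_imp_has_derivative[OF assms]]
  by (simp add: partial_append partial_const flip: fun_eq_iff)

lemma taylor2_linear: "taylor2 (\<lambda>z. x * Re z) a b = l_series x a b"
proof -
  have l: "bounded_linear (\<lambda>z. x * Re z)" by (intro bounded_linear_const_mult bounded_linear_Re)
  show ?thesis
  proof (cases b)
    case 0
    show ?thesis
    proof (cases a)
      case (Suc n)
      have "replicate a (1::complex) = replicate n 1 @ [1]" unfolding Suc by (simp add: replicate_append_same)
      then show ?thesis using 0 Suc by (simp add: taylor2_partial partial_linear[OF l] l_series_def)
    qed (simp add: 0 taylor2_partial l_series_def)
  next
    case (Suc n)
    have "replicate a (1::complex) @ replicate b \<i> = (replicate a 1 @ replicate n \<i>) @ [\<i>]" unfolding Suc by (simp add: replicate_append_same)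
    then show ?thesis using Suc by (simp add: taylor2_partial partial_linear[OF l] l_series_def del: append_assoc)
  qed
qed

lemma Ck_on_bounded_linear_self: "bounded_linear l \<Longrightarrow> Ck_on n l N"
proof (induction n)
  case 0
  then show ?case by (simp add: linear_continuous_on)
next
  case (Suc n)
  have d: "(l has_derivative l) (at x)" for x by (rule bounded_linear_imp_has_derivative[OF Suc.prems])
  have "frechet_derivative l (at x) = l" for x by (rule frechet_derivative_at[OF d, symmetric])
  then show ?case using d Ck_on_const by (auto simp: differentiable_def)
qed

text \<open>z log z - z is a primitive of log z, so this term adds Im log to the l-derivative and Re
  log to the j-derivative. Off the slit the argument of \<open>Ln\<close> avoids the nonpositive
  real axis.\<close>

lemma log_cut_action_has_derivative:
  assumes s: "s = 1 \<or> s = - 1" and z: "z \<notin> slit s"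
  shows "((\<lambda>z. Im (z * log_cut s z - z)) has_derivative (\<lambda>w. Im (log_cut s z * w))) (at z)"
proof -
  have nz: "z \<noteq> 0" using z by (auto simp: slit_def)
  have "of_real s * \<i> * z \<notin> \<real>\<^sub>\<le>\<^sub>0"
    using s z by (auto simp: complex_nonpos_Reals_iff slit_def)
  then have "((\<lambda>z. z * log_cut s z - z) has_field_derivative log_cut s z) (at z)"
    unfolding log_cut_def using nz s by (auto intro!: derivative_eq_intros simp: field_simps)
  then have "((\<lambda>z. z * log_cut s z - z) has_derivative (\<lambda>w. log_cut s z * w)) (at z)"
    by (simp add: has_field_derivative_def)
  then show ?thesis by (rule bounded_linear.has_derivative[OF bounded_linear_Im])
qed

section \<open>Comparison of the action integrals and of their Taylor series\<close>

locale action_setting = twisting_setting S m \<Delta> \<epsilon> f E \<tau>2 \<tau>1 \<xi> \<kappa>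
  for S :: "('m::{t2_space,second_countable_topology}) int_sys" and m \<Delta> \<epsilon> f E \<tau>2 \<tau>1 \<xi> \<kappa> +
  fixes \<theta> :: "'m one_form"
  assumes normalized: "normalized_primitive S E \<epsilon> f \<theta>"
begin

lemma primitive_W: "primitive_on S W \<theta>" using normalized unfolding normalized_primitive_def by blast

lemma D_nontrivial: "at 0 within D \<noteq> bot"
  using zero_islimpt[of 1] islimpt_subset[of 0 "D \<inter> ball 0 1" D] trivial_limit_within by fastforce

lemma I_poly_tendsto: "(I_poly S E \<epsilon> f \<theta> \<longlongrightarrow> 0) (at 0 within D)"
  using normalized unfolding normalized_primitive_def by blast

text \<open>By \<open>action_poly_constant\<close> the difference is a constant whatever starting
  points are chosen; both functions tend to 0 at 0, so it vanishes.\<close>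

lemma I_poly_eq: assumes z: "z \<in> D" shows "I_poly S E \<epsilon> f \<theta> z = M z"
proof -
  define P where "P z = (SOME p. p \<in> fiber S E z)" for z
  have P: "P z \<in> WC" "mu2 (P z) = M z" if "z \<in> D" for z
  proof -
    have "P z \<in> fiber S E z" unfolding P_def using fiber_nonempty[OF that] by (rule someI_ex)
    then show "P z \<in> WC" "mu2 (P z) = M z" using fiber_WC[OF that] mu2_M[of "P z"] WC_iff by metis+
  qed
  define k where "k = I_poly S E \<epsilon> f \<theta> z - M z"
  have "line_integral S \<theta> (PL (P w)) 0 1 - 2 * pi * M w = line_integral S \<theta> (PL (P z)) 0 1 - 2 * pi * M z" if "w \<in> D" for w
    using action_poly_constant[OF primitive_W P(1)[OF that] P(1)[OF z]] P(2)[OF that] P(2)[OF z] by simp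
  then have I: "I_poly S E \<epsilon> f \<theta> w = M w + k" if "w \<in> D" for w
    using that by (simp add: k_def I_poly_def action_of_loops_def P_def field_simps)
  have "((\<lambda>w. M w + k) \<longlongrightarrow> 0 + k) (at 0 within D)" by (intro tendsto_intros M_tendsto)
  then have "(I_poly S E \<epsilon> f \<theta> \<longlongrightarrow> 0 + k) (at 0 within D)"
    by (rule Lim_transform_eventually) (auto simp: eventually_at_topological I)
  then have "k = 0" using tendsto_unique[OF D_nontrivial _ I_poly_tendsto] by simp
  then show ?thesis by (simp add: k_def)
qed

lemma regularized_poly: "z \<in> D \<Longrightarrow> regularized (\<epsilon> m) D (I_poly S E \<epsilon> f \<theta>) z = 2 * pi * M z + Im (z * log_cut (\<epsilon> m) z - z)"
  using tendsto_Lim[OF D_nontrivial I_poly_tendsto] by (simp add: regularized_def I_poly_eq)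

lemma regularized_poly_has_derivative:
  assumes z: "z \<in> D"
  shows "((\<lambda>z. 2 * pi * M z + Im (z * log_cut (\<epsilon> m) z - z)) has_derivative
    (\<lambda>w. 2 * pi * ((\<tau>1 z / (2 * pi) + of_int \<kappa>) * Re w + \<tau>2 z / (2 * pi) * Im w) + Im (log_cut (\<epsilon> m) z * w))) (at z)"
proof -
  have "z \<notin> slit (\<epsilon> m)" using z D_eq by blast
  then show ?thesis
    by (intro has_derivative_add has_derivative_mult_right M_has_derivative[OF z] log_cut_action_has_derivative[OF eps])
qed

text \<open>The l-derivative of the smooth extension at 0 is the limit of its values in
  \<open>D\<close>, where differentiating \<open>M\<close> and the logarithmic term gives \<tau>_1 +
  Im log + 2 pi \<kappa>.\<close>

lemma taylor_poly_linear_coefficient: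
  assumes T: "taylor_poly S m E \<epsilon> f \<theta> T"
  shows "((\<lambda>z. \<tau>1 z + Im (log_cut (\<epsilon> m) z)) \<longlongrightarrow> T 1 0 - 2 * pi * of_int \<kappa>) (at 0 within D)"
proof -
  obtain r g where r: "r > 0" and g: "smooth_on g (ball 0 r)" "\<forall>z\<in>D \<inter> ball 0 r. g z = regularized (\<epsilon> m) D (I_poly S E \<epsilon> f \<theta>) z"
    and T: "T = taylor2 g"
    using T unfolding taylor_poly_def taylor_of_extension_def by blast
  have C: "Ck_on n g (ball 0 r)" for n by (rule smooth_on_open_imp_Ck_on[OF g(1) open_ball])
  have T10: "T 1 0 = frechet_derivative g (at 0) 1" by (simp add: T taylor2_def)
  have der: "frechet_derivative g (at z) 1 = \<tau>1 z + Im (log_cut (\<epsilon> m) z) + 2 * pi * of_int \<kappa>" if z: "z \<in> D \<inter> ball 0 r" for z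
  proof -
    have zD: "z \<in> D" using z by blast
    have "(g has_derivative (\<lambda>w. 2 * pi * ((\<tau>1 z / (2 * pi) + of_int \<kappa>) * Re w + \<tau>2 z / (2 * pi) * Im w) + Im (log_cut (\<epsilon> m) z * w))) (at z)"
      by (rule has_derivative_transform_within_open[OF regularized_poly_has_derivative[OF zD] open_Int[OF open_D open_ball] z])
        (use g(2) regularized_poly in auto)
    from frechet_derivative_at[OF this, symmetric] show ?thesis by (simp add: field_simps)
  qed
  have "continuous_on (ball 0 r) (\<lambda>z. frechet_derivative g (at z) 1)" using Ck_on_deriv[OF C[of "Suc 0"]] by simp
  then have "((\<lambda>z. frechet_derivative g (at z) 1) \<longlongrightarrow> T 1 0) (at 0 within ball 0 r)"
    unfolding T10 using r by (simp add: continuous_on_def)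
  then have "((\<lambda>z. frechet_derivative g (at z) 1) \<longlongrightarrow> T 1 0) (at 0)" using r by (simp add: at_within_open[of 0 "ball 0 r"])
  then have "((\<lambda>z. frechet_derivative g (at z) 1 - 2 * pi * of_int \<kappa>) \<longlongrightarrow> T 1 0 - 2 * pi * of_int \<kappa>) (at 0 within D)"
    by (intro tendsto_intros) (rule tendsto_within_subset[OF _ subset_UNIV])
  moreover have "\<forall>\<^sub>F z in at 0 within D. frechet_derivative g (at z) 1 - 2 * pi * of_int \<kappa> = \<tau>1 z + Im (log_cut (\<epsilon> m) z)"
    unfolding eventually_at_topological
    by (rule exI[of _ "ball 0 r"]) (use r der in auto)
  ultimately show ?thesis by (rule Lim_transform_eventually)
qed

lemma cycle_family_admissible:
  assumes "admissible_cycle S E \<epsilon> \<theta> c"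
  shows "admissible_family S m \<Delta> \<epsilon> f E \<tau>2 \<tau>1 \<xi> \<kappa> \<theta> c"
proof unfold_locales
  have 1: "\<forall>z\<in>D. \<forall>t. c z t \<in> fiber S E z \<and> c z (t + 1) = c z t"
    and 2: "continuous_on (D \<times> UNIV) (\<lambda>(z, t). c z t)"
    and 3: "\<forall>d\<in>atlas S. smooth_on (\<lambda>(z, t). snd d (c z t)) {(z, t). z \<in> D \<and> c z t \<in> fst d}"
    using assms[unfolded admissible_cycle_def, THEN conjunct1]
      assms[unfolded admissible_cycle_def, THEN conjunct2, THEN conjunct1]
      assms[unfolded admissible_cycle_def, THEN conjunct2, THEN conjunct2, THEN conjunct1] .
  show "primitive_on S W \<theta>" by (rule primitive_W)
  show "c z t \<in> fiber S E z" "c z (t + 1) = c z t" if "z \<in> D" for z t using 1 that by simp_all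
  show "continuous_on (D \<times> UNIV) (\<lambda>(z, t). c z t)" by (rule 2)
  show "smooth_on (\<lambda>(z, t). snd d (c z t)) {(z, t). z \<in> D \<and> c z t \<in> fst d}" if "d \<in> atlas S" for d
    using 3 that by (rule bspec)
  show "admissible_cycle S E \<epsilon> \<theta> c" by (rule assms)
qed

lemma taylor_difference:
  assumes c: "admissible_cycle S E \<epsilon> \<theta> c" and T: "taylor_poly S m E \<epsilon> f \<theta> T"
    and T': "taylor_of_extension D (regularized (\<epsilon> m) D (action_of_loops S \<theta> c)) T'"
  shows "\<exists>n::int. \<forall>a b. T a b = T' a b + l_series (2 * pi * of_int n) a b"
proof -
  interpret admissible_family S m \<Delta> \<epsilon> f E \<tau>2 \<tau>1 \<xi> \<kappa> \<theta> c by (rule cycle_family_admissible[OF c])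
  let ?I = "action_of_loops S \<theta> c"
  obtain r1 g1 where 1: "r1 > 0" "smooth_on g1 (ball 0 r1)" "\<And>z. z \<in> D \<inter> ball 0 r1 \<Longrightarrow> g1 z = regularized (\<epsilon> m) D (I_poly S E \<epsilon> f \<theta>) z" "T = taylor2 g1"
    using T unfolding taylor_poly_def taylor_of_extension_def by blast
  obtain r2 g2 where 2: "r2 > 0" "smooth_on g2 (ball 0 r2)" "\<And>z. z \<in> D \<inter> ball 0 r2 \<Longrightarrow> g2 z = regularized (\<epsilon> m) D ?I z" "T' = taylor2 g2"
    using T' unfolding taylor_of_extension_def by blast
  define r where "r = min r1 r2"
  have r: "r > 0" "ball 0 r \<subseteq> ball (0::complex) r1" "ball 0 r \<subseteq> ball (0::complex) r2" using 1(1) 2(1) by (auto simp: r_def)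
  define U where "U = D \<inter> ball 0 r"
  have U: "open U" "connected U" "0 islimpt U" "U \<subseteq> ball 0 r" "U \<subseteq> D"
    using open_D connected_D_ball[OF r(1)] zero_islimpt[OF r(1)] by (auto simp: U_def)
  have C: "Ck_on n g1 (ball 0 r)" "Ck_on n g2 (ball 0 r)" for n
    using smooth_on_open_imp_Ck_on[OF 1(2) open_ball] smooth_on_open_imp_Ck_on[OF 2(2) open_ball] Ck_on_subset r(2,3) by blast+
  \<comment> \<open>The limit of the admissible action at 0 is not yet known to exist;
    \<open>K\<close> names the term that \<open>regularized\<close> subtracts.\<close>
  define K where "K = 2 * pi * Lim (at 0 within D) ?I"
  have diff: "g1 z - g2 z = 2 * pi * M z - 2 * pi * ?I z + K" if "z \<in> U" for z
  proof -
    have z: "z \<in> D" "z \<in> D \<inter> ball 0 r1" "z \<in> D \<inter> ball 0 r2" using that r by (auto simp: U_def)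
    show ?thesis using 1(3)[OF z(2)] 2(3)[OF z(3)] regularized_poly[OF z(1)] by (simp add: regularized_def K_def)
  qed
  have "\<exists>i::int. (?I has_derivative (\<lambda>w. of_int i * Re w + ((\<tau>1 z / (2 * pi) + of_int \<kappa>) * Re w + \<tau>2 z / (2 * pi) * Im w))) (at z)" if "z \<in> D" for z
    using admissible_action[OF that] by metis
  then obtain i :: "complex \<Rightarrow> int" where i: "\<And>z. z \<in> D \<Longrightarrow> (?I has_derivative (\<lambda>w. of_int (i z) * Re w + ((\<tau>1 z / (2 * pi) + of_int \<kappa>) * Re w + \<tau>2 z / (2 * pi) * Im w))) (at z)"
    by metis
  have dd: "((\<lambda>z. g1 z - g2 z) has_derivative (\<lambda>w. - (2 * pi * of_int (i z)) * Re w)) (at z)" if z: "z \<in> U" for z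
  proof -
    have zD: "z \<in> D" using z U by blast
    have "((\<lambda>z. 2 * pi * M z - 2 * pi * ?I z + K) has_derivative
        (\<lambda>w. 2 * pi * ((\<tau>1 z / (2 * pi) + of_int \<kappa>) * Re w + \<tau>2 z / (2 * pi) * Im w)
          - 2 * pi * (of_int (i z) * Re w + ((\<tau>1 z / (2 * pi) + of_int \<kappa>) * Re w + \<tau>2 z / (2 * pi) * Im w)) + 0)) (at z)"
      by (intro has_derivative_add has_derivative_diff has_derivative_mult_right M_has_derivative[OF zD] i[OF zD] has_derivative_const)
    then have "((\<lambda>z. 2 * pi * M z - 2 * pi * ?I z + K) has_derivative (\<lambda>w. - (2 * pi * of_int (i z)) * Re w)) (at z)"
      by (simp add: algebra_simps)
    then show ?thesis by (rule has_derivative_transform_within_open[OF _ U(1) z]) (simp add: diff)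
  qed
  \<comment> \<open>This identifies the integers, up to a factor, with a continuous function on the
    connected set \<open>U\<close>; they are therefore constant there.\<close>
  have i_eq: "- 2 * pi * of_int (i z) = frechet_derivative g1 (at z) 1 - frechet_derivative g2 (at z) 1" if z: "z \<in> U" for z
  proof -
    have zb: "z \<in> ball 0 r" using z U by blast
    have "((\<lambda>z. g1 z - g2 z) has_derivative (\<lambda>w. frechet_derivative g1 (at z) w - frechet_derivative g2 (at z) w)) (at z)"
      by (intro has_derivative_diff Ck_on_has_derivative[OF C(1)[of "Suc 0"] zb] Ck_on_has_derivative[OF C(2)[of "Suc 0"] zb])
    from fun_cong[OF has_derivative_unique[OF dd[OF z] this], of 1] show ?thesis by simp
  qed
  have "(\<lambda>z. real_of_int (i z)) constant_on U"
  proof (rule continuous_discrete_range_constant[OF U(2)])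
    have "continuous_on (ball 0 r) (\<lambda>z. frechet_derivative g1 (at z) 1)" "continuous_on (ball 0 r) (\<lambda>z. frechet_derivative g2 (at z) 1)"
      using Ck_on_deriv[OF C(1)[of "Suc 0"]] Ck_on_deriv[OF C(2)[of "Suc 0"]] by simp_all
    then have "continuous_on U (\<lambda>z. frechet_derivative g1 (at z) 1)" "continuous_on U (\<lambda>z. frechet_derivative g2 (at z) 1)"
      using continuous_on_subset U(4) by blast+
    then have "continuous_on U (\<lambda>z. (frechet_derivative g1 (at z) 1 - frechet_derivative g2 (at z) 1) / (- 2 * pi))"
      by (intro continuous_intros) auto
    then show "continuous_on U (\<lambda>z. real_of_int (i z))" by (rule continuous_on_eq) (simp flip: i_eq)
    show "\<exists>e>0. \<forall>y. y \<in> U \<and> real_of_int (i y) \<noteq> real_of_int (i x) \<longrightarrow> e \<le> norm (real_of_int (i y) - real_of_int (i x))" for x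
    proof (intro exI[of _ 1] conjI allI impI)
      fix y assume "y \<in> U \<and> real_of_int (i y) \<noteq> real_of_int (i x)"
      then have "1 \<le> \<bar>i y - i x\<bar>" by auto
      then show "1 \<le> norm (real_of_int (i y) - real_of_int (i x))" by (metis of_int_1_le_iff of_int_abs of_int_diff real_norm_def)
    qed simp
  qed
  then obtain x where x: "\<And>z. z \<in> U \<Longrightarrow> real_of_int (i z) = x" unfolding constant_on_def by blast
  obtain z1 where z1: "z1 \<in> U" using U(3) islimpt_EMPTY[of 0] by (metis ex_in_conv)
  define n where "n = i z1"
  have n: "i z = n" if "z \<in> U" for z using x[OF that] x[OF z1] by (simp add: n_def)
  define k where "k = g1 z1 - g2 z1 + 2 * pi * of_int n * Re z1"
  have k: "g1 z - g2 z + 2 * pi * of_int n * Re z = k" if z: "z \<in> U" for z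
    unfolding k_def
  proof (rule has_derivative_zero_unique_connected[OF U(1,2) _ z z1])
    fix z assume z: "z \<in> U"
    have "((\<lambda>z. g1 z - g2 z + 2 * pi * of_int n * Re z) has_derivative (\<lambda>w. - (2 * pi * of_int (i z)) * Re w + 2 * pi * of_int n * Re w)) (at z)"
      by (intro has_derivative_add dd[OF z] has_derivative_mult_right bounded_linear_imp_has_derivative bounded_linear_Re)
    then show "((\<lambda>z. g1 z - g2 z + 2 * pi * of_int n * Re z) has_derivative (\<lambda>w. 0)) (at z)" unfolding n[OF z] by simp
  qed
  \<comment> \<open>For the action itself the identity shows that its limit at 0 exists and equals
    (K - k) / (2 pi); by the definition of \<open>K\<close> this is also K / (2 pi).\<close>
  have "k = 0"
  proof -
    have I: "?I z = M z + of_int n * Re z + (K - k) / (2 * pi)" if "z \<in> U" for z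
      using diff[OF that] k[OF that] by (simp add: field_simps)
    have "((\<lambda>z. M z + of_int n * Re z + (K - k) / (2 * pi)) \<longlongrightarrow> 0 + of_int n * Re 0 + (K - k) / (2 * pi)) (at 0 within D)"
      by (intro tendsto_intros M_tendsto)
    moreover have "\<forall>\<^sub>F z in at 0 within D. M z + of_int n * Re z + (K - k) / (2 * pi) = ?I z"
      unfolding eventually_at_topological by (rule exI[of _ "ball 0 r"]) (use r I in \<open>auto simp: U_def\<close>)
    ultimately have "(?I \<longlongrightarrow> 0 + of_int n * Re 0 + (K - k) / (2 * pi)) (at 0 within D)" by (rule Lim_transform_eventually)
    from tendsto_Lim[OF D_nontrivial this] have "2 * pi * Lim (at 0 within D) ?I = K - k" by simp
    then have "K = K - k" by (simp add: K_def)
    then show ?thesis by simp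
  qed
  define l where "l = (\<lambda>z. - (2 * pi * of_int n) * Re z)"
  have l: "Ck_on q l (ball 0 r)" for q
  proof -
    have "bounded_linear l" unfolding l_def by (intro bounded_linear_const_mult bounded_linear_Re)
    then show ?thesis by (rule Ck_on_bounded_linear_self)
  qed
  have "T a b = T' a b + l_series (2 * pi * of_int (- n)) a b" for a b
  proof -
    have "taylor2 g1 a b = taylor2 g2 a b + taylor2 l a b"
    proof (rule taylor2_add_at_limit_point[OF open_ball _ C l U(1,4,3)])
      show "g1 z = g2 z + l z" if "z \<in> U" for z using k[OF that] unfolding l_def \<open>k = 0\<close> mult_minus_left by linarith
    qed (use r in simp)
    then show ?thesis unfolding 1(4) 2(4) l_def taylor2_linear by simp
  qed
  then show ?thesis by blast
qed

lemma taylor_twisting: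
  assumes T: "taylor_poly S m E \<epsilon> f \<theta> Spoly" and P: "taylor_pref S m E \<epsilon> \<theta> Spref"
  shows "Spoly a b - Spref a b = l_series (of_int \<kappa> * (2 * pi)) a b"
proof -
  obtain c T' n' where c: "admissible_cycle S E \<epsilon> \<theta> c"
    and T': "taylor_of_extension D (regularized (\<epsilon> m) D (action_of_loops S \<theta> c)) T'"
    and n': "\<forall>a b. Spref a b = T' a b + l_series (2 * pi * of_int n') a b" and pref: "Spref 1 0 \<in> {- pi / 2..<3 * pi / 2}"
    using P unfolding taylor_pref_def by blast
  obtain n where n: "\<forall>a b. Spoly a b = T' a b + l_series (2 * pi * of_int n) a b"
    using taylor_difference[OF c T T'] by blast
  define N where "N = n - n'"
  have N: "Spoly a b - Spref a b = l_series (of_int N * (2 * pi)) a b" for a b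
    using n n' by (simp add: N_def l_series_def algebra_simps)
  obtain s where s: "s \<in> {- pi / 2..<3 * pi / 2}" "((\<lambda>z. \<tau>1 z + Im (log_cut (\<epsilon> m) z)) \<longlongrightarrow> s) (at 0 within D)"
    using tau1 unfolding preferred_tau1_def by blast
  have "Spoly 1 0 = s + 2 * pi * of_int \<kappa>"
    using tendsto_unique[OF D_nontrivial s(2) taylor_poly_linear_coefficient[OF T]] by simp
  then have e: "(of_int N - of_int \<kappa>) * (2 * pi) = s - Spref 1 0" using N[of 1 0] by (simp add: l_series_def algebra_simps)
  \<comment> \<open>Two elements of a half-open interval of length 2 pi differ by less than 2 pi, so
    the integer N - \<kappa> is 0.\<close>
  have "\<bar>(of_int N - of_int \<kappa>) * (2 * pi)\<bar> < 1 * (2 * pi)" unfolding e using s(1) pref by auto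
  then have "\<bar>of_int (N - \<kappa>)\<bar> < (1::real)" by (simp add: abs_mult)
  then have "\<bar>N - \<kappa>\<bar> < 1" by (metis of_int_abs of_int_less_1_iff)
  then have "N = \<kappa>" by simp
  then show ?thesis using N by simp
qed

end

context action_setting begin

text \<open>The admissible cycle contained in \<open>taylor_pref\<close> provides the basis in which
  the order of \<open>gamma_L\<close> is read off; one fiber is enough to determine the integer in
  the cycle statement.\<close>

lemma preferred_cycle_infinite_order:
  assumes P: "taylor_pref S m E \<epsilon> \<theta> Spref"
  obtains z p where "z \<in> D" "p \<in> fiber S E z"
    "\<And>k l :: int. gamma_L S E z p [^]\<^bsub>H1 S E z\<^esub> k = gamma_L S E z p [^]\<^bsub>H1 S E z\<^esub> l \<Longrightarrow> k = l"
proof -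
  obtain c where c: "admissible_cycle S E \<epsilon> \<theta> c" using P unfolding taylor_pref_def by blast
  interpret admissible_family S m \<Delta> \<epsilon> f E \<tau>2 \<tau>1 \<xi> \<kappa> \<theta> c by (rule cycle_family_admissible[OF c])
  obtain z where z: "z \<in> D" using zero_islimpt[of 1] islimpt_EMPTY[of 0] by (metis IntD1 ex_in_conv zero_less_one)
  show ?thesis by (rule that[OF z c_fiber[OF z] gamma_L_infinite_order[OF z]])
qed

lemma fiber_cycle_difference:
  assumes z: "z \<in> D" and p: "p \<in> fiber S E z"
  shows "gamma_L S E z p [^]\<^bsub>H1 S E z\<^esub> \<kappa>
     = gamma_poly S E \<epsilon> f z p \<otimes>\<^bsub>H1 S E z\<^esub> inv\<^bsub>H1 S E z\<^esub> gamma_pref S E \<tau>2 \<tau>1 z p"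
proof -
  have pW: "p \<in> WC" using fiber_WC[OF z p] by blast
  obtain A a a11 a12 a21 a22 c1 c2 where "affine_chart S m \<Delta> \<epsilon> f E A a a11 a12 a21 a22 c1 c2" and FA: "F p \<in> A"
    using affine_chart_exists[OF pW] by metis
  then interpret affine_chart S m \<Delta> \<epsilon> f E A a a11 a12 a21 a22 c1 c2 by blast
  interpret twisting_chart S m \<Delta> \<epsilon> f E A a a11 a12 a21 a22 c1 c2 \<tau>2 \<tau>1 \<xi> \<kappa> p z
    by unfold_locales (use FA z p in auto)
  show ?thesis by (rule cycle_difference)
qed

text \<open>Where L = 0 the shear acts trivially and the integer is invisible; a point off this line
  lets the statements on momentum maps and on actions determine it.\<close>

lemma nonvertical_point: obtains p where "p \<in> W" "\<Phi> p \<in> D" "Lmap S p \<noteq> 0"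
proof -
  obtain d where d: "d > 0" "\<And>x. 0 < x \<Longrightarrow> x < d \<Longrightarrow> complex_of_real x \<in> D" using D_contains_right by metis
  then have D: "complex_of_real (d / 2) \<in> D" by (intro d(2)) simp_all
  then obtain p where p: "p \<in> fiber S E (of_real (d / 2))" using fiber_nonempty by blast
  then have P: "p \<in> W" "\<Phi> p = of_real (d / 2)" by (simp_all add: fiber_def)
  have "Lmap S p = d / 2" unfolding Re_Phi[symmetric] P(2) by simp
  then show ?thesis using that[of p] D d(1) P by simp
qed

end

theorem theorem1p1:
  fixes S :: "('m::{t2_space,second_countable_topology}) int_sys"
    and m :: 'm
    and \<Delta> :: "(real \<times> real) set" and \<epsilon> :: "'m \<Rightarrow> real" and f :: "real \<times> real \<Rightarrow> real \<times> real"
    and E :: "'m normal_form"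
    and \<tau>2 \<tau>1 \<xi> :: "complex \<Rightarrow> real"
    and \<theta> :: "'m one_form"
    and Spoly Spref :: "nat \<Rightarrow> nat \<Rightarrow> real"
    and \<kappa> k :: int
  assumes "simple_semitoric S"
    and "focus_focus S m"
    and "polygon_representative S \<Delta> \<epsilon> f"
    and "Lmap S m = 0"
    and "mu_poly S f m = (0, 0)"
    and "preferred_normal_form S m E"
    and "small_normal_form S m E"
    and "return_time S E \<tau>2"
    and "preferred_tau1 S m E \<epsilon> \<tau>2 \<tau>1"
    and "preferred_action S E \<epsilon> \<tau>2 \<tau>1 \<xi>"
    and "normalized_primitive S E \<epsilon> f \<theta>"
    and "taylor_poly S m E \<epsilon> f \<theta> Spoly"
    and "taylor_pref S m E \<epsilon> \<theta> Spref"
    and "twisting_index S E f \<xi> \<kappa>"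
  shows "(k = \<kappa> \<longleftrightarrow> (\<forall>p\<in>Wset S E. mu_poly S f p = Tpow k (nu S E \<xi> p))) \<and>
    (k = \<kappa> \<longleftrightarrow> (\<forall>z\<in>Dcut S E \<epsilon>. of_int k * Re z = I_poly S E \<epsilon> f \<theta> z - \<xi> z)) \<and>
    (k = \<kappa> \<longleftrightarrow> (\<forall>a b. l_series (of_int k * (2 * pi)) a b = Spoly a b - Spref a b)) \<and>
    (k = \<kappa> \<longleftrightarrow> (\<forall>z\<in>Dcut S E \<epsilon>. \<forall>p\<in>fiber S E z.
       gamma_L S E z p [^]\<^bsub>H1 S E z\<^esub> k
         = gamma_poly S E \<epsilon> f z p \<otimes>\<^bsub>H1 S E z\<^esub> inv\<^bsub>H1 S E z\<^esub> gamma_pref S E \<tau>2 \<tau>1 z p))"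
proof -
  interpret action_setting S m \<Delta> \<epsilon> f E \<tau>2 \<tau>1 \<xi> \<kappa> \<theta>
    by unfold_locales (use assms in \<open>auto simp: simple_semitoric_def semitoric_def symplectic_manifold_def\<close>)
  \<comment> \<open>That \<kappa> satisfies all four conditions is established above or follows at
    once; each converse needs a witness: a point with L \<noteq> 0 for momentum maps and actions,
    the coefficient (1, 0) for the series, and a class of infinite order for the cycles.\<close>
  obtain p0 where p0: "p0 \<in> W" "\<Phi> p0 \<in> D" "Lmap S p0 \<noteq> 0" by (rule nonvertical_point)
  have tw: "mu_poly S f p = Tpow \<kappa> (nu S E \<xi> p)" if "p \<in> W" for p
    using twisting that unfolding twisting_index_def by blast
  have 1: "k = \<kappa>" if "\<forall>p\<in>W. mu_poly S f p = Tpow k (nu S E \<xi> p)"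
  proof -
    have "Tpow k (nu S E \<xi> p0) = Tpow \<kappa> (nu S E \<xi> p0)" using that tw p0(1) by simp
    then show ?thesis using p0(3) by (simp add: Tpow_eq nu_def)
  qed
  have act: "of_int \<kappa> * Re z = I_poly S E \<epsilon> f \<theta> z - \<xi> z" if "z \<in> D" for z
    using I_poly_eq[OF that] by (simp add: M_def)
  have 2: "k = \<kappa>" if "\<forall>z\<in>D. of_int k * Re z = I_poly S E \<epsilon> f \<theta> z - \<xi> z"
  proof -
    have "of_int k * Re (\<Phi> p0) = of_int \<kappa> * Re (\<Phi> p0)" using that act p0(2) by simp
    then show ?thesis using p0(3) by (simp add: Re_Phi)
  qed
  have tay: "Spoly a b - Spref a b = l_series (of_int \<kappa> * (2 * pi)) a b" for a b
    by (rule taylor_twisting) (fact assms)+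
  have 3: "k = \<kappa>" if "\<forall>a b. l_series (of_int k * (2 * pi)) a b = Spoly a b - Spref a b"
    using that[rule_format, of 1 0] unfolding tay by (simp add: l_series_def)
  obtain z p where z: "z \<in> D" "p \<in> fiber S E z"
    and inf: "\<And>k l :: int. gamma_L S E z p [^]\<^bsub>H1 S E z\<^esub> k = gamma_L S E z p [^]\<^bsub>H1 S E z\<^esub> l \<Longrightarrow> k = l"
    using preferred_cycle_infinite_order[OF assms(13)] by metis
  have 4: "k = \<kappa>" if "\<forall>z\<in>D. \<forall>p\<in>fiber S E z. gamma_L S E z p [^]\<^bsub>H1 S E z\<^esub> k
         = gamma_poly S E \<epsilon> f z p \<otimes>\<^bsub>H1 S E z\<^esub> inv\<^bsub>H1 S E z\<^esub> gamma_pref S E \<tau>2 \<tau>1 z p"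
    by (rule inf) (use that z fiber_cycle_difference[OF z] in simp)
  show ?thesis
  proof (intro conjI iffI ballI allI)
    show "mu_poly S f p = Tpow k (nu S E \<xi> p)" if "k = \<kappa>" "p \<in> W" for p unfolding that(1) by (rule tw[OF that(2)])
    show "of_int k * Re z = I_poly S E \<epsilon> f \<theta> z - \<xi> z" if "k = \<kappa>" "z \<in> D" for z unfolding that(1) by (rule act[OF that(2)])
    show "l_series (of_int k * (2 * pi)) a b = Spoly a b - Spref a b" if "k = \<kappa>" for a b unfolding that tay ..
    show "gamma_L S E z p [^]\<^bsub>H1 S E z\<^esub> k
         = gamma_poly S E \<epsilon> f z p \<otimes>\<^bsub>H1 S E z\<^esub> inv\<^bsub>H1 S E z\<^esub> gamma_pref S E \<tau>2 \<tau>1 z p"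
      if "k = \<kappa>" "z \<in> D" "p \<in> fiber S E z" for z p unfolding that(1) by (rule fiber_cycle_difference[OF that(2,3)])
  qed (fact 1 2 3 4)+
qed

end
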